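(* Let $(V,\eta)$ be a cyclic arrangement of $n$ hyperplanes in $k$-space. For any $\xi$ such that $(V,\eta,\xi)$ is a left cyclic polarized arrangement, the mutually inverse isomorphisms $\Phi:\mathcal B_l(n,k)\to\tilde B(V,\eta,\xi)$ and $\Psi=\Phi^{-1}$ defined in the context restrict to mutually inverse isomorphisms between $\mathcal B'(n,k)$ and $\tilde B'(V,\eta)$. These restricted isomorphisms are independent of the choice of $\xi$.
   Context: **Arrangements.** An arrangement of $n$ hyperplanes in $k$-space is a pair $(V,\eta)$ with $V\subset\mathbb R^n$ a linear subspace of dimension $k$ and $\eta\in\mathbb R^n/V$ such that every representative of $\eta$ has at least $n-k$ nonzero entries. View $V+\eta$ as an affine subspace of $\mathbb R^n$; $H_i=\{x\in V+\eta: x_i=0\}$, $H_S=\bigcap_{i\in S}H_i$, and for $\alpha\in\{+,-\}^n$, $\Delta_\alpha=\{x\in V+\eta:\alpha(i)x_i\ge0\ \forall i\}$. A polarized arrangement is $(V,\eta,\xi)$ with also $\xi\in V^*=(\mathbb R^n)^*/V^\perp$, every representative of $\xi$ having at least $k$ nonzero entries. $\alpha$ is feasible if $\Delta_\alpha\ne\emptyset$, bounded if an affine function on $V+\eta$ with linear part $\xi$ is bounded above on $\Delta_\alpha$; $\mathcal P$ is the set of bounded feasible $\alpha$, and $\mathcal K\subset\mathcal P$ is the set of feasible $\alpha$ with $\Delta_\alpha$ compact. **Cyclicity.** $\mathrm{Gr}^{>0}_{k,n}$: $k$-dimensional subspaces of $\mathbb R^n$ with all Plücker coordinates nonzero and of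 the same sign. $\eta$ is positively oriented with respect to $V$ if the first coordinate of the orthogonal projection of a representative of $\eta$ onto $V^\perp\subset\mathbb R^n$ is positive. $(V,\eta)$ is cyclic if $V\in\mathrm{Gr}^{>0}_{k,n}$, $V+\langle\eta\rangle\in\mathrm{Gr}^{>0}_{k+1,n}$ and $\eta$ is positively oriented with respect to $V$. $(V,\eta,\xi)$ is left cyclic if $V+\langle\eta\rangle\in\mathrm{Gr}^{>0}_{k+1,n}$, $\{(\xi(v),v):v\in V\}\in\mathrm{Gr}^{>0}_{k,n+1}$, and $\eta$ is positively oriented with respect to $V$. **Hypertoric algebras.** For $\alpha,\beta\in\mathcal P$, $\tilde R_{\alpha\beta}=\mathbb Z[u_1,\dots,u_n]/(u_S:\Delta_\alpha\cap\Delta_\beta\cap H_S=\emptyset)$, $u_S=\prod_{i\in S}u_i$, and $f_{\alpha,\beta}$ is the class of $1$. $\tilde B(V,\eta,\xi)=\bigoplus_{\alpha,\beta\in\mathcal P}\tilde R_{\alpha\beta}$ with $\mathbb Z[u_1,\dots,u_n]$-bilinear product $f_{\alpha,\beta}f_{\beta,\gamma}=u_{S(\alpha\beta\gamma)}f_{\alpha,\gamma}$, $S(\alpha\beta\gamma)=\{i:\alpha(i)=\gamma(i)\ne\beta(i)\}$ (other products $0$). $\tilde B'(V,\eta)=e\,\tilde B(V,\eta,\xi)\,e=\bigoplus_{\alpha,\beta\in\mathcal K}\tilde R_{\alpha\beta}$, $e=\sum_{\alpha\in\mathcal K}f_{\alpha,\alpha}$; this does not depend on $\xi$. **Ozsváth–Szabó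 algebras.** $V(n,k)$ is the set of $k$-element subsets of $\{0,\dots,n\}$. $\mathcal B(n,k)$ is the path algebra over $\mathbb Z$ (paths composed left to right) of the quiver with vertex set $V(n,k)$ and arrows: for $1\le i\le n$, $R_i:\mathbf x\to\mathbf y$ and $L_i:\mathbf y\to\mathbf x$ whenever $\mathbf x\cap\{i-1,i\}=\{i-1\}$ and $\mathbf y=(\mathbf x\setminus\{i-1\})\cup\{i\}$; $U_i:\mathbf x\to\mathbf x$ for all $\mathbf x$; modulo (whenever the paths make sense) $R_iU_j=U_jR_i$, $L_iU_j=U_jL_i$, $U_iU_j=U_jU_i$; $R_iL_i=U_i$, $L_iR_i=U_i$; $R_iR_j=R_jR_i$, $L_iL_j=L_jL_i$, $L_iR_j=R_jL_i$ for $|i-j|>1$; $R_{i-1}R_i=0$, $L_iL_{i-1}=0$; $U_i\mathbf I_{\mathbf x}=0$ if $\mathbf x\cap\{i-1,i\}=\emptyset$ ($\mathbf I_{\mathbf x}$ = trivial path). $V_l(n,k)$, $V'(n,k)$ are the sets of $k$-element subsets of $\{0,\dots,n-1\}$, $\{1,\dots,n-1\}$, and $\mathcal B_l(n,k)$, $\mathcal B'(n,k)$ are $\bigoplus\mathbf I_{\mathbf x}\mathcal B(n,k)\mathbf I_{\mathbf x'}$ over $\mathbf x,\mathbf x'$ in $V_l(n,k)$, $V'(n,k)$ respectively. **The map $\Phi$.** For left cyclic $(V,\eta,\xi)$, $\mathcal P=\{\alpha:\text{the sequence }+\alpha\text{ has exactly }k\text{ sign changes}\}$, and $\alpha\mapsto\mathbf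 x_\alpha=\{i\in\{0,\dots,n-1\}:\alpha(i)\neq\alpha(i+1)\}$ (convention $\alpha(0)=+$) is a bijection $\mathcal P\to V_l(n,k)$ with inverse $\mathbf x\mapsto\alpha_{\mathbf x}$. $\Phi$ is the algebra isomorphism $\mathcal B_l(n,k)\to\tilde B(V,\eta,\xi)$ with $\mathbf I_{\mathbf x}\mapsto f_{\alpha_{\mathbf x},\alpha_{\mathbf x}}$, each arrow $R_i$ or $L_i$ from $\mathbf x$ to $\mathbf y$ sent to $f_{\alpha_{\mathbf x},\alpha_{\mathbf y}}$, and $U_i:\mathbf x\to\mathbf x$ sent to $u_if_{\alpha_{\mathbf x},\alpha_{\mathbf x}}$. *)

theory Defs
  imports
    "HOL-Analysis.Function_Topology"
    "HOL-Library.Function_Algebras"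
    "HOL-Library.Poly_Mapping"
    "HOL-Algebra.QuotRing"
    "Jordan_Normal_Form.Determinant"
begin

section \<open>Linear algebra in coordinate spaces\<close>

text \<open>
  For a finite \<open>I \<subseteq> \<nat>\<close>, the space \<open>\<real>\<^sup>I\<close> is realised as the set of real sequences supported in \<open>I\<close>;
  \<open>\<real>\<^sup>n\<close> is the case \<open>I = {1..n}\<close>. The product topology on \<open>nat \<Rightarrow> real\<close> induces the Euclidean
  topology on it.
\<close>

interpretation rfun: vector_space "\<lambda>(c::real) (x::nat \<Rightarrow> real) i. c * x i"
  by unfold_locales (auto simp: fun_eq_iff algebra_simps)

definition coord_space :: "nat set \<Rightarrow> (nat \<Rightarrow> real) set" where
  "coord_space I = {x. \<forall>i. i \<notin> I \<longrightarrow> x i = 0}"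

definition dot :: "nat \<Rightarrow> (nat \<Rightarrow> real) \<Rightarrow> (nat \<Rightarrow> real) \<Rightarrow> real" where
  "dot n x y = (\<Sum>i=1..n. x i * y i)"

definition orth_compl :: "nat \<Rightarrow> (nat \<Rightarrow> real) set \<Rightarrow> (nat \<Rightarrow> real) set" where
  "orth_compl n V = {y \<in> coord_space {1..n}. \<forall>v\<in>V. dot n y v = 0}"

definition linear_subspace :: "nat set \<Rightarrow> nat \<Rightarrow> (nat \<Rightarrow> real) set \<Rightarrow> bool" where
  "linear_subspace I k V \<longleftrightarrow> V \<subseteq> coord_space I \<and> rfun.subspace V \<and> rfun.dim V = k"

definition ordered_basis :: "nat \<Rightarrow> (nat \<Rightarrow> nat \<Rightarrow> real) \<Rightarrow> (nat \<Rightarrow> real) set \<Rightarrow> bool" where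
  "ordered_basis k b V \<longleftrightarrow>
     inj_on b {0..<k} \<and> rfun.independent (b ` {0..<k}) \<and> rfun.span (b ` {0..<k}) = V"

definition pluecker :: "nat \<Rightarrow> (nat \<Rightarrow> nat \<Rightarrow> real) \<Rightarrow> nat set \<Rightarrow> real" where
  "pluecker k b S = det (mat k k (\<lambda>(r, c). b r (sorted_list_of_set S ! c)))"

text \<open>The positive Grassmannian \<open>Gr\<^sup>>\<^sup>0\<close> of \<open>k\<close>-dimensional subspaces of \<open>\<real>\<^sup>I\<close>. Changing the basis
  rescales all Pluecker coordinates by a common nonzero factor, so it does not matter which basis
  is used.\<close>

definition Gr_pos :: "nat \<Rightarrow> nat set \<Rightarrow> (nat \<Rightarrow> real) set set" where
  "Gr_pos k I = {V. linear_subspace I k V \<and>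
     (\<exists>b. ordered_basis k b V \<and>
       ((\<forall>S. S \<subseteq> I \<and> card S = k \<longrightarrow> pluecker k b S > 0) \<or>
        (\<forall>S. S \<subseteq> I \<and> card S = k \<longrightarrow> pluecker k b S < 0)))}"


section \<open>Arrangements\<close>

text \<open>
  The classes \<open>\<eta> \<in> \<real>\<^sup>n / V\<close> and \<open>\<xi> \<in> V\<^sup>* = (\<real>\<^sup>n)\<^sup>* / V\<^sup>\<bottom>\<close> are given by representatives in \<open>\<real>\<^sup>n\<close>,
  a covector acting through \<^const>\<open>dot\<close>. All notions below depend on the classes only.
\<close>

definition affine_space :: "(nat \<Rightarrow> real) set \<Rightarrow> (nat \<Rightarrow> real) \<Rightarrow> (nat \<Rightarrow> real) set" where
  "affine_space V \<eta> = (\<lambda>v. v + \<eta>) ` V"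

definition arrangement :: "nat \<Rightarrow> nat \<Rightarrow> (nat \<Rightarrow> real) set \<Rightarrow> (nat \<Rightarrow> real) \<Rightarrow> bool" where
  "arrangement n k V \<eta> \<longleftrightarrow>
     linear_subspace {1..n} k V \<and> \<eta> \<in> coord_space {1..n} \<and>
     (\<forall>x \<in> affine_space V \<eta>. card {i \<in> {1..n}. x i \<noteq> 0} \<ge> n - k)"

definition polarized_arrangement ::
    "nat \<Rightarrow> nat \<Rightarrow> (nat \<Rightarrow> real) set \<Rightarrow> (nat \<Rightarrow> real) \<Rightarrow> (nat \<Rightarrow> real) \<Rightarrow> bool" where
  "polarized_arrangement n k V \<eta> \<xi> \<longleftrightarrow>
     arrangement n k V \<eta> \<and> \<xi> \<in> coord_space {1..n} \<and>
     (\<forall>\<zeta> \<in> affine_space (orth_compl n V) \<xi>. card {i \<in> {1..n}. \<zeta> i \<noteq> 0} \<ge> k)"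

definition flat :: "(nat \<Rightarrow> real) set \<Rightarrow> (nat \<Rightarrow> real) \<Rightarrow> nat set \<Rightarrow> (nat \<Rightarrow> real) set" where
  "flat V \<eta> S = {x \<in> affine_space V \<eta>. \<forall>i\<in>S. x i = 0}"

text \<open>Sign vectors \<open>{+,-}\<^sup>n\<close>, with the signs encoded as \<open>\<plusminus>1\<close>.\<close>

type_synonym signs = "nat \<Rightarrow> real"

definition sign_vectors :: "nat \<Rightarrow> signs set" where
  "sign_vectors n = {1..n} \<rightarrow>\<^sub>E {1, -1}"

definition region :: "nat \<Rightarrow> (nat \<Rightarrow> real) set \<Rightarrow> (nat \<Rightarrow> real) \<Rightarrow> signs \<Rightarrow> (nat \<Rightarrow> real) set" where
  "region n V \<eta> \<alpha> = {x \<in> affine_space V \<eta>. \<forall>i\<in>{1..n}. \<alpha> i * x i \<ge> 0}"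

definition feasible :: "nat \<Rightarrow> (nat \<Rightarrow> real) set \<Rightarrow> (nat \<Rightarrow> real) \<Rightarrow> signs \<Rightarrow> bool" where
  "feasible n V \<eta> \<alpha> \<longleftrightarrow> region n V \<eta> \<alpha> \<noteq> {}"

text \<open>Affine functions on \<open>V + \<eta>\<close> with the same linear part differ by a constant, so it suffices to
  test the one given by the representative \<open>\<xi>\<close>.\<close>

definition bounded_signs ::
    "nat \<Rightarrow> (nat \<Rightarrow> real) set \<Rightarrow> (nat \<Rightarrow> real) \<Rightarrow> (nat \<Rightarrow> real) \<Rightarrow> signs \<Rightarrow> bool" where
  "bounded_signs n V \<eta> \<xi> \<alpha> \<longleftrightarrow> bdd_above (dot n \<xi> ` region n V \<eta> \<alpha>)"

definition bounded_feasible ::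
    "nat \<Rightarrow> (nat \<Rightarrow> real) set \<Rightarrow> (nat \<Rightarrow> real) \<Rightarrow> (nat \<Rightarrow> real) \<Rightarrow> signs set" where
  "bounded_feasible n V \<eta> \<xi> =
     {\<alpha> \<in> sign_vectors n. feasible n V \<eta> \<alpha> \<and> bounded_signs n V \<eta> \<xi> \<alpha>}"

definition compact_feasible :: "nat \<Rightarrow> (nat \<Rightarrow> real) set \<Rightarrow> (nat \<Rightarrow> real) \<Rightarrow> signs set" where
  "compact_feasible n V \<eta> =
     {\<alpha> \<in> sign_vectors n. feasible n V \<eta> \<alpha> \<and> compact (region n V \<eta> \<alpha>)}"


section \<open>Cyclicity\<close>

definition positively_oriented :: "nat \<Rightarrow> (nat \<Rightarrow> real) set \<Rightarrow> (nat \<Rightarrow> real) \<Rightarrow> bool" where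
  "positively_oriented n V \<eta> \<longleftrightarrow> (\<exists>w \<in> orth_compl n V. \<eta> - w \<in> V \<and> w 1 > 0)"

definition cyclic_arrangement :: "nat \<Rightarrow> nat \<Rightarrow> (nat \<Rightarrow> real) set \<Rightarrow> (nat \<Rightarrow> real) \<Rightarrow> bool" where
  "cyclic_arrangement n k V \<eta> \<longleftrightarrow>
     arrangement n k V \<eta> \<and>
     V \<in> Gr_pos k {1..n} \<and>
     rfun.span (insert \<eta> V) \<in> Gr_pos (k + 1) {1..n} \<and>
     positively_oriented n V \<eta>"

text \<open>In the graph \<open>{(\<xi>(v), v)}\<close> the value \<open>\<xi>(v)\<close> is the first of the \<open>n + 1\<close> coordinates; it is put
  at index \<open>0\<close>.\<close>

definition left_cyclic ::
    "nat \<Rightarrow> nat \<Rightarrow> (nat \<Rightarrow> real) set \<Rightarrow> (nat \<Rightarrow> real) \<Rightarrow> (nat \<Rightarrow> real) \<Rightarrow> bool" where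
  "left_cyclic n k V \<eta> \<xi> \<longleftrightarrow>
     polarized_arrangement n k V \<eta> \<xi> \<and>
     rfun.span (insert \<eta> V) \<in> Gr_pos (k + 1) {1..n} \<and>
     (\<lambda>v. v(0 := dot n \<xi> v)) ` V \<in> Gr_pos k {0..n} \<and>
     positively_oriented n V \<eta>"


section \<open>Hypertoric algebras\<close>

type_synonym mpoly_int = "(nat \<Rightarrow>\<^sub>0 nat) \<Rightarrow>\<^sub>0 int"

definition poly_ring :: "nat \<Rightarrow> mpoly_int ring" where
  "poly_ring n =
     \<lparr> carrier = {p. \<forall>m \<in> Poly_Mapping.keys p. Poly_Mapping.keys m \<subseteq> {1..n}},
       monoid.mult = (*), one = 1, zero = 0, add = (+) \<rparr>"

definition u_var :: "nat \<Rightarrow> mpoly_int" where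
  "u_var i = Poly_Mapping.single (Poly_Mapping.single i 1) 1"

definition u_set :: "nat set \<Rightarrow> mpoly_int" where
  "u_set S = (\<Prod>i\<in>S. u_var i)"

definition R_ideal ::
    "nat \<Rightarrow> (nat \<Rightarrow> real) set \<Rightarrow> (nat \<Rightarrow> real) \<Rightarrow> signs \<Rightarrow> signs \<Rightarrow> mpoly_int set" where
  "R_ideal n V \<eta> \<alpha> \<beta> =
     Idl\<^bsub>poly_ring n\<^esub>
       {u_set S | S. S \<subseteq> {1..n} \<and> region n V \<eta> \<alpha> \<inter> region n V \<eta> \<beta> \<inter> flat V \<eta> S = {}}"

definition R_tilde ::
    "nat \<Rightarrow> (nat \<Rightarrow> real) set \<Rightarrow> (nat \<Rightarrow> real) \<Rightarrow> signs \<Rightarrow> signs \<Rightarrow> mpoly_int set ring" where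
  "R_tilde n V \<eta> \<alpha> \<beta> = poly_ring n Quot R_ideal n V \<eta> \<alpha> \<beta>"

definition R_class ::
    "nat \<Rightarrow> (nat \<Rightarrow> real) set \<Rightarrow> (nat \<Rightarrow> real) \<Rightarrow> signs \<Rightarrow> signs \<Rightarrow> mpoly_int \<Rightarrow> mpoly_int set" where
  "R_class n V \<eta> \<alpha> \<beta> p = R_ideal n V \<eta> \<alpha> \<beta> +>\<^bsub>poly_ring n\<^esub> p"

definition switch_set :: "nat \<Rightarrow> signs \<Rightarrow> signs \<Rightarrow> signs \<Rightarrow> nat set" where
  "switch_set n \<alpha> \<beta> \<gamma> = {i \<in> {1..n}. \<alpha> i = \<gamma> i \<and> \<alpha> i \<noteq> \<beta> i}"

text \<open>The component \<open>R\<^sub>\<alpha>\<^sub>\<beta> \<times> R\<^sub>\<beta>\<^sub>\<gamma> \<rightarrow> R\<^sub>\<alpha>\<^sub>\<gamma>\<close> of the product: \<open>[p] [q] = [u\<^sub>S p q]\<close> with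
  \<open>S = S(\<alpha>\<beta>\<gamma>)\<close>. As for the product in \<^const>\<open>FactRing\<close>, the union runs over
  representatives; all members of the union coincide.\<close>

definition R_prod ::
    "nat \<Rightarrow> (nat \<Rightarrow> real) set \<Rightarrow> (nat \<Rightarrow> real) \<Rightarrow> signs \<Rightarrow> signs \<Rightarrow> signs \<Rightarrow>
     mpoly_int set \<Rightarrow> mpoly_int set \<Rightarrow> mpoly_int set" where
  "R_prod n V \<eta> \<alpha> \<beta> \<gamma> A B =
     (\<Union>p\<in>A. \<Union>q\<in>B. R_class n V \<eta> \<alpha> \<gamma> (u_set (switch_set n \<alpha> \<beta> \<gamma>) * p * q))"

text \<open>
  The ring on the direct sum of the \<open>R\<^sub>\<alpha>\<^sub>\<beta>\<close> over \<open>\<alpha>, \<beta> \<in> Q\<close>, for a set \<open>Q\<close> of sign vectors. Its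
  elements are families indexed by all pairs \<open>(\<alpha>, \<beta>)\<close> which vanish outside \<open>Q \<times> Q\<close>, so that for
  \<open>Q' \<subseteq> Q\<close> the sum over \<open>Q'\<close> is literally a subset of the sum over \<open>Q\<close>.
\<close>

type_synonym family = "signs \<Rightarrow> signs \<Rightarrow> mpoly_int set"

definition hypertoric_ring ::
    "nat \<Rightarrow> (nat \<Rightarrow> real) set \<Rightarrow> (nat \<Rightarrow> real) \<Rightarrow> signs set \<Rightarrow> family ring" where
  "hypertoric_ring n V \<eta> Q =
     \<lparr> carrier = {M. \<forall>\<alpha> \<beta>. if \<alpha> \<in> Q \<and> \<beta> \<in> Q then M \<alpha> \<beta> \<in> carrier (R_tilde n V \<eta> \<alpha> \<beta>)
                           else M \<alpha> \<beta> = \<zero>\<^bsub>R_tilde n V \<eta> \<alpha> \<beta>\<^esub>},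
       monoid.mult = (\<lambda>M N \<alpha> \<gamma>. if \<alpha> \<in> Q \<and> \<gamma> \<in> Q
                then finsum (R_tilde n V \<eta> \<alpha> \<gamma>) (\<lambda>\<beta>. R_prod n V \<eta> \<alpha> \<beta> \<gamma> (M \<alpha> \<beta>) (N \<beta> \<gamma>)) Q
                else \<zero>\<^bsub>R_tilde n V \<eta> \<alpha> \<gamma>\<^esub>),
       one = (\<lambda>\<alpha> \<beta>. if \<alpha> \<in> Q \<and> \<alpha> = \<beta> then \<one>\<^bsub>R_tilde n V \<eta> \<alpha> \<beta>\<^esub> else \<zero>\<^bsub>R_tilde n V \<eta> \<alpha> \<beta>\<^esub>),
       zero = (\<lambda>\<alpha> \<beta>. \<zero>\<^bsub>R_tilde n V \<eta> \<alpha> \<beta>\<^esub>),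
       add = (\<lambda>M N \<alpha> \<beta>. M \<alpha> \<beta> \<oplus>\<^bsub>R_tilde n V \<eta> \<alpha> \<beta>\<^esub> N \<alpha> \<beta>) \<rparr>"

definition B_tilde ::
    "nat \<Rightarrow> (nat \<Rightarrow> real) set \<Rightarrow> (nat \<Rightarrow> real) \<Rightarrow> (nat \<Rightarrow> real) \<Rightarrow> family ring" where
  "B_tilde n V \<eta> \<xi> = hypertoric_ring n V \<eta> (bounded_feasible n V \<eta> \<xi>)"

definition B_tilde' :: "nat \<Rightarrow> (nat \<Rightarrow> real) set \<Rightarrow> (nat \<Rightarrow> real) \<Rightarrow> family ring" where
  "B_tilde' n V \<eta> = hypertoric_ring n V \<eta> (compact_feasible n V \<eta>)"

text \<open>The element \<open>p f\<^sub>\<alpha>\<^sub>\<beta>\<close> for a polynomial \<open>p\<close>.\<close>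

definition poly_f ::
    "nat \<Rightarrow> (nat \<Rightarrow> real) set \<Rightarrow> (nat \<Rightarrow> real) \<Rightarrow> mpoly_int \<Rightarrow> signs \<Rightarrow> signs \<Rightarrow> family" where
  "poly_f n V \<eta> p \<alpha> \<beta> =
     (\<lambda>\<alpha>' \<beta>'. if \<alpha>' = \<alpha> \<and> \<beta>' = \<beta> then R_class n V \<eta> \<alpha> \<beta> p else \<zero>\<^bsub>R_tilde n V \<eta> \<alpha>' \<beta>'\<^esub>)"

abbreviation f_elem ::
    "nat \<Rightarrow> (nat \<Rightarrow> real) set \<Rightarrow> (nat \<Rightarrow> real) \<Rightarrow> signs \<Rightarrow> signs \<Rightarrow> family" where
  "f_elem n V \<eta> \<equiv> poly_f n V \<eta> 1"


section \<open>Ozsvath--Szabo algebras\<close>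

datatype label = ArrR nat | ArrL nat | ArrU nat

type_synonym vertex = "nat set"

definition verts :: "nat \<Rightarrow> nat \<Rightarrow> vertex set" where
  "verts n k = {x. x \<subseteq> {0..n} \<and> card x = k}"

definition verts_l :: "nat \<Rightarrow> nat \<Rightarrow> vertex set" where
  "verts_l n k = {x. x \<subseteq> {0..<n} \<and> card x = k}"

definition verts' :: "nat \<Rightarrow> nat \<Rightarrow> vertex set" where
  "verts' n k = {x. x \<subseteq> {1..<n} \<and> card x = k}"

definition moves_right :: "nat \<Rightarrow> vertex \<Rightarrow> vertex \<Rightarrow> bool" where
  "moves_right i x y \<longleftrightarrow> x \<inter> {i - 1, i} = {i - 1} \<and> y = (x - {i - 1}) \<union> {i}"

fun arrow :: "nat \<Rightarrow> nat \<Rightarrow> vertex \<Rightarrow> label \<Rightarrow> vertex \<Rightarrow> bool" where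
  "arrow n k x (ArrR i) y \<longleftrightarrow> x \<in> verts n k \<and> y \<in> verts n k \<and> i \<in> {1..n} \<and> moves_right i x y"
| "arrow n k x (ArrL i) y \<longleftrightarrow> x \<in> verts n k \<and> y \<in> verts n k \<and> i \<in> {1..n} \<and> moves_right i y x"
| "arrow n k x (ArrU i) y \<longleftrightarrow> x \<in> verts n k \<and> i \<in> {1..n} \<and> x = y"

text \<open>A path is a triple of its source, its list of labels (from left to right) and its target.\<close>

type_synonym qpath = "vertex \<times> label list \<times> vertex"

fun is_path :: "nat \<Rightarrow> nat \<Rightarrow> qpath \<Rightarrow> bool" where
  "is_path n k (x, [], y) \<longleftrightarrow> x \<in> verts n k \<and> x = y"
| "is_path n k (x, a # w, y) \<longleftrightarrow> (\<exists>z. arrow n k x a z \<and> is_path n k (z, w, y))"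

type_synonym path_sum = "qpath \<Rightarrow>\<^sub>0 int"

definition path_sum_mult :: "path_sum \<Rightarrow> path_sum \<Rightarrow> path_sum" where
  "path_sum_mult a b =
     (\<Sum>(x, v, y) \<in> Poly_Mapping.keys a. \<Sum>(y', w, z) \<in> Poly_Mapping.keys b.
        if y = y'
        then Poly_Mapping.single (x, v @ w, z)
               (Poly_Mapping.lookup a (x, v, y) * Poly_Mapping.lookup b (y', w, z))
        else 0)"

definition idem_sum :: "vertex set \<Rightarrow> path_sum" where
  "idem_sum X = (\<Sum>x\<in>X. Poly_Mapping.single (x, [], x) 1)"

definition path_algebra :: "nat \<Rightarrow> nat \<Rightarrow> path_sum ring" where
  "path_algebra n k =
     \<lparr> carrier = {a. \<forall>p \<in> Poly_Mapping.keys a. is_path n k p},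
       monoid.mult = path_sum_mult, one = idem_sum (verts n k), zero = 0, add = (+) \<rparr>"

inductive equal_words :: "label list \<Rightarrow> label list \<Rightarrow> bool" where
  RU: "equal_words [ArrR i, ArrU j] [ArrU j, ArrR i]"
| LU: "equal_words [ArrL i, ArrU j] [ArrU j, ArrL i]"
| UU: "equal_words [ArrU i, ArrU j] [ArrU j, ArrU i]"
| RL: "equal_words [ArrR i, ArrL i] [ArrU i]"
| LR: "equal_words [ArrL i, ArrR i] [ArrU i]"
| RR_far: "i + 1 < j \<or> j + 1 < i \<Longrightarrow> equal_words [ArrR i, ArrR j] [ArrR j, ArrR i]"
| LL_far: "i + 1 < j \<or> j + 1 < i \<Longrightarrow> equal_words [ArrL i, ArrL j] [ArrL j, ArrL i]"
| LR_far: "i + 1 < j \<or> j + 1 < i \<Longrightarrow> equal_words [ArrL i, ArrR j] [ArrR j, ArrL i]"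

inductive zero_word :: "vertex \<Rightarrow> label list \<Rightarrow> bool" where
  RR: "zero_word x [ArrR i, ArrR (Suc i)]"
| LL: "zero_word x [ArrL (Suc i), ArrL i]"
| U: "x \<inter> {i - 1, i} = {} \<Longrightarrow> zero_word x [ArrU i]"

definition OSz_relations :: "nat \<Rightarrow> nat \<Rightarrow> path_sum set" where
  "OSz_relations n k =
     {Poly_Mapping.single (x, v, y) 1 - Poly_Mapping.single (x, w, y) 1 | x y v w.
        equal_words v w \<and> is_path n k (x, v, y) \<and> is_path n k (x, w, y)} \<union>
     {Poly_Mapping.single (x, w, y) 1 | x y w. zero_word x w \<and> is_path n k (x, w, y)}"

definition OSz_ideal :: "nat \<Rightarrow> nat \<Rightarrow> path_sum set" where
  "OSz_ideal n k = Idl\<^bsub>path_algebra n k\<^esub> (OSz_relations n k)"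

definition OSz :: "nat \<Rightarrow> nat \<Rightarrow> path_sum set ring" where
  "OSz n k = path_algebra n k Quot OSz_ideal n k"

definition OSz_class :: "nat \<Rightarrow> nat \<Rightarrow> path_sum \<Rightarrow> path_sum set" where
  "OSz_class n k a = OSz_ideal n k +>\<^bsub>path_algebra n k\<^esub> a"

abbreviation path_class :: "nat \<Rightarrow> nat \<Rightarrow> qpath \<Rightarrow> path_sum set" where
  "path_class n k p \<equiv> OSz_class n k (Poly_Mapping.single p 1)"

text \<open>For \<open>e = \<Sum>\<^sub>x\<^sub>\<in>\<^sub>X I\<^sub>x\<close>, the direct sum of the \<open>I\<^sub>x B I\<^sub>x\<^sub>'\<close> over \<open>x, x' \<in> X\<close> is the corner \<open>e B e\<close>,
  a ring with unit \<open>e\<close>.\<close>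

definition corner :: "('a, 'b) ring_scheme \<Rightarrow> 'a \<Rightarrow> ('a, 'b) ring_scheme" where
  "corner R e = R\<lparr>carrier := {e \<otimes>\<^bsub>R\<^esub> a \<otimes>\<^bsub>R\<^esub> e | a. a \<in> carrier R}, one := e\<rparr>"

definition OSz_l :: "nat \<Rightarrow> nat \<Rightarrow> path_sum set ring" where
  "OSz_l n k = corner (OSz n k) (OSz_class n k (idem_sum (verts_l n k)))"

definition OSz' :: "nat \<Rightarrow> nat \<Rightarrow> path_sum set ring" where
  "OSz' n k = corner (OSz n k) (OSz_class n k (idem_sum (verts' n k)))"


section \<open>The isomorphism\<close>

definition sign_changes :: "nat \<Rightarrow> signs \<Rightarrow> vertex" where
  "sign_changes n \<alpha> = {i \<in> {0..<n}. (\<alpha>(0 := 1)) i \<noteq> (\<alpha>(0 := 1)) (i + 1)}"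

definition signs_of ::
    "nat \<Rightarrow> (nat \<Rightarrow> real) set \<Rightarrow> (nat \<Rightarrow> real) \<Rightarrow> (nat \<Rightarrow> real) \<Rightarrow> vertex \<Rightarrow> signs" where
  "signs_of n V \<eta> \<xi> = inv_into (bounded_feasible n V \<eta> \<xi>) (sign_changes n)"

definition is_Phi ::
    "nat \<Rightarrow> nat \<Rightarrow> (nat \<Rightarrow> real) set \<Rightarrow> (nat \<Rightarrow> real) \<Rightarrow> (nat \<Rightarrow> real) \<Rightarrow>
     (path_sum set \<Rightarrow> family) \<Rightarrow> bool" where
  "is_Phi n k V \<eta> \<xi> \<phi> \<longleftrightarrow>
     \<phi> \<in> ring_iso (OSz_l n k) (B_tilde n V \<eta> \<xi>) \<and>
     (\<forall>x \<in> verts_l n k.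
        \<phi> (path_class n k (x, [], x)) = f_elem n V \<eta> (signs_of n V \<eta> \<xi> x) (signs_of n V \<eta> \<xi> x)) \<and>
     (\<forall>x \<in> verts_l n k. \<forall>y \<in> verts_l n k. \<forall>i. \<forall>a \<in> {ArrR i, ArrL i}. arrow n k x a y \<longrightarrow>
        \<phi> (path_class n k (x, [a], y)) = f_elem n V \<eta> (signs_of n V \<eta> \<xi> x) (signs_of n V \<eta> \<xi> y)) \<and>
     (\<forall>x \<in> verts_l n k. \<forall>i \<in> {1..n}.
        \<phi> (path_class n k (x, [ArrU i], x)) =
          poly_f n V \<eta> (u_var i) (signs_of n V \<eta> \<xi> x) (signs_of n V \<eta> \<xi> x))"

text \<open>\<^term>\<open>extensional\<close> fixes the irrelevant values of \<open>\<Phi>\<close> outside its domain.\<close>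

definition Phi ::
    "nat \<Rightarrow> nat \<Rightarrow> (nat \<Rightarrow> real) set \<Rightarrow> (nat \<Rightarrow> real) \<Rightarrow> (nat \<Rightarrow> real) \<Rightarrow> path_sum set \<Rightarrow> family" where
  "Phi n k V \<eta> \<xi> = (THE \<phi>. \<phi> \<in> extensional (carrier (OSz_l n k)) \<and> is_Phi n k V \<eta> \<xi> \<phi>)"

definition Psi ::
    "nat \<Rightarrow> nat \<Rightarrow> (nat \<Rightarrow> real) set \<Rightarrow> (nat \<Rightarrow> real) \<Rightarrow> (nat \<Rightarrow> real) \<Rightarrow> family \<Rightarrow> path_sum set" where
  "Psi n k V \<eta> \<xi> = inv_into (carrier (OSz_l n k)) (Phi n k V \<eta> \<xi>)"

end

theory Submission
  imports Defs
begin

text \<open>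
  Modulo the relations, a path starting at \<open>x\<close> is determined by its weight, the number of times it
  crosses each edge, where \<open>U\<^sub>i\<close> counts as two crossings. It is nonzero exactly if the set \<open>T\<close> of the
  edges it meets satisfies Hall's condition, that is, if distinct elements of \<open>x\<close> adjacent to the
  edges in \<open>T\<close> can be chosen. The nonzero weights therefore index a basis of
  \<open>I\<^sub>x \<B> I\<^sub>y\<close>, and the edges of odd weight are those where the sign vectors of \<open>x\<close> and \<open>y\<close> differ.

  On the other side, total positivity gives explicit circuits and cocircuits of \<open>V\<close>, of \<open>V + \<langle>\<eta>\<rangle>\<close> and
  of the graph of \<open>\<xi>\<close>. They show that \<open>\<P>\<close> consists of the sign vectors with \<open>k\<close>
  sign changes after a leading \<open>+\<close> and \<open>\<K>\<close> of those among them that start with \<open>+\<close>,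
  and that \<open>\<Delta>\<^sub>\<alpha> \<inter> \<Delta>\<^sub>\<beta> \<inter> H\<^sub>S\<close> is
  nonempty exactly if \<open>S\<close> together with the coordinates where \<open>\<alpha>\<close> and \<open>\<beta>\<close> differ satisfies the
  same Hall condition for \<open>x\<^sub>\<alpha>\<close>. Halving weights thus matches paths with monomials, for the
  sum over any set of sign vectors in \<open>\<P>\<close>. Taking \<open>\<P>\<close> and \<open>\<K>\<close> for this set gives \<open>\<Phi>\<close> and its
  restriction, and neither set involves \<open>\<xi>\<close>.
\<close>

section \<open>The path algebra\<close>

text \<open>Rewriting paths bounds the algebra from above. For the bound from below no
  representation is built: the sums of paths whose coefficients cancel within every type of
  supported weight are shown to form a two-sided ideal containing the relations. This works because
  crossing an edge of \<open>T\<close> does not affect whether \<open>T\<close> satisfies Hall's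
  condition. The endpoints fix the parity of each weight, so halving loses nothing. Adding two odd
  weights produces a carry, and these carries are the factor \<open>u_S\<close> in the hypertoric
  product. On the geometric side, the cocircuits of \<open>V + \<langle>\<eta>\<rangle>\<close> give
  the vertex of the arrangement on \<open>k\<close> coordinate hyperplanes only up to a sign. Total
  positivity of \<open>V\<close> makes this sign the same for all choices of hyperplanes, and the
  orientation of \<eta> fixes it. Since \<Phi> is introduced by a definite description, its
  uniqueness needs proof as well. The difficulty there is that a path between vertices of
  \<open>B_l\<close> may pass through vertices containing \<open>n\<close>.\<close>

definition path_comp :: "qpath \<Rightarrow> qpath \<Rightarrow> int \<Rightarrow> path_sum" where
  "path_comp p q c =
     (if snd (snd p) = fst q then Poly_Mapping.single (fst p, fst (snd p) @ fst (snd q), snd (snd q)) c else 0)"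

lemma path_comp_0 [simp]: "path_comp p q 0 = 0"
  by (simp add: path_comp_def)

lemma path_comp_add: "path_comp p q (c + d) = path_comp p q c + path_comp p q d"
  by (simp add: path_comp_def single_add)

text \<open>Summing over fixed finite sets instead of the supports makes bilinearity a termwise
  matter, as the supports of \<open>a\<close>, \<open>a'\<close> and \<open>a + a'\<close>
  differ.\<close>

lemma path_sum_mult_superset:
  assumes "finite A" "finite B" "Poly_Mapping.keys a \<subseteq> A" "Poly_Mapping.keys b \<subseteq> B"
  shows "path_sum_mult a b =
    (\<Sum>p\<in>A. \<Sum>q\<in>B. path_comp p q (Poly_Mapping.lookup a p * Poly_Mapping.lookup b q))"
proof -
  have "path_sum_mult a b = (\<Sum>p\<in>Poly_Mapping.keys a. \<Sum>q\<in>Poly_Mapping.keys b.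
      path_comp p q (Poly_Mapping.lookup a p * Poly_Mapping.lookup b q))"
    unfolding path_sum_mult_def path_comp_def
    by (intro sum.cong refl) (simp add: case_prod_beta, intro sum.cong refl, simp add: case_prod_beta, metis prod.collapse)
  also have "\<dots> = (\<Sum>p\<in>Poly_Mapping.keys a. \<Sum>q\<in>B.
      path_comp p q (Poly_Mapping.lookup a p * Poly_Mapping.lookup b q))"
    using assms by (intro sum.cong sum.mono_neutral_left refl) (auto simp: in_keys_iff)
  also have "\<dots> = (\<Sum>p\<in>A. \<Sum>q\<in>B. path_comp p q (Poly_Mapping.lookup a p * Poly_Mapping.lookup b q))"
    using assms by (intro sum.mono_neutral_left) (auto simp: in_keys_iff)
  finally show ?thesis .
qed

lemma path_sum_mult_add_left: "path_sum_mult (a + a') b = path_sum_mult a b + path_sum_mult a' b"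
proof -
  let ?A = "Poly_Mapping.keys a \<union> Poly_Mapping.keys a'"
  have "Poly_Mapping.keys (a + a') \<subseteq> ?A" by (rule Poly_Mapping.keys_add)
  then show ?thesis
    by (simp add: path_sum_mult_superset[of ?A "Poly_Mapping.keys b"] lookup_add distrib_right
        path_comp_add sum.distrib)
qed

lemma path_sum_mult_add_right: "path_sum_mult a (b + b') = path_sum_mult a b + path_sum_mult a b'"
proof -
  let ?B = "Poly_Mapping.keys b \<union> Poly_Mapping.keys b'"
  have "Poly_Mapping.keys (b + b') \<subseteq> ?B" by (rule Poly_Mapping.keys_add)
  then show ?thesis
    by (simp add: path_sum_mult_superset[of "Poly_Mapping.keys a" ?B] lookup_add distrib_left
        path_comp_add sum.distrib)
qed

lemma path_sum_mult_0 [simp]: "path_sum_mult 0 b = 0" "path_sum_mult a 0 = 0"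
  by (simp_all add: path_sum_mult_def)

lemma path_sum_mult_sum_left: "path_sum_mult (sum f A) b = (\<Sum>i\<in>A. path_sum_mult (f i) b)"
  by (induction A rule: infinite_finite_induct) (auto simp: path_sum_mult_add_left)

lemma path_sum_mult_sum_right: "path_sum_mult a (sum f A) = (\<Sum>i\<in>A. path_sum_mult a (f i))"
  by (induction A rule: infinite_finite_induct) (auto simp: path_sum_mult_add_right)

lemma path_sum_mult_single:
  "path_sum_mult (Poly_Mapping.single p c) (Poly_Mapping.single q d) = path_comp p q (c * d)"
  by (simp add: path_sum_mult_superset[of "{p}" "{q}"])

lemma poly_mapping_expand: "a = (\<Sum>p\<in>Poly_Mapping.keys a. Poly_Mapping.single p (Poly_Mapping.lookup a p))"
  for a :: "'a \<Rightarrow>\<^sub>0 'b::comm_monoid_add"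
proof (rule poly_mapping_eqI)
  fix q
  have "Poly_Mapping.lookup (\<Sum>p\<in>Poly_Mapping.keys a. Poly_Mapping.single p (Poly_Mapping.lookup a p)) q
    = (\<Sum>p\<in>Poly_Mapping.keys a. if p = q then Poly_Mapping.lookup a q else 0)"
    unfolding lookup_sum by (intro sum.cong refl) (auto simp: lookup_single when_def)
  then show "Poly_Mapping.lookup a q =
      Poly_Mapping.lookup (\<Sum>p\<in>Poly_Mapping.keys a. Poly_Mapping.single p (Poly_Mapping.lookup a p)) q"
    by (auto simp: in_keys_iff)
qed

lemma poly_mapping_additive_induct [case_names zero single add]:
  fixes a :: "'a \<Rightarrow>\<^sub>0 'b::comm_monoid_add"
  assumes "P 0" "\<And>p c. P (Poly_Mapping.single p c)" "\<And>a b. P a \<Longrightarrow> P b \<Longrightarrow> P (a + b)"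
  shows "P a"
proof -
  have "P (\<Sum>p\<in>A. Poly_Mapping.single p (Poly_Mapping.lookup a p))" for A
    by (induction A rule: infinite_finite_induct) (auto intro: assms)
  then show ?thesis by (subst poly_mapping_expand)
qed

lemma path_sum_mult_assoc:
  "path_sum_mult (path_sum_mult a b) c = path_sum_mult a (path_sum_mult b c)"
proof (induction a rule: poly_mapping_additive_induct)
  case (single p r)
  show ?case
  proof (induction b rule: poly_mapping_additive_induct)
    case (single q s)
    show ?case
      by (induction c rule: poly_mapping_additive_induct)
        (auto simp: path_sum_mult_single path_comp_def path_sum_mult_add_right mult.assoc)
  qed (auto simp: path_sum_mult_add_left path_sum_mult_add_right)
qed (auto simp: path_sum_mult_add_left)

text \<open>The effect of multiplying by \<open>idem_sum X\<close> on the left and by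
  \<open>idem_sum Y\<close> on the right, for finite \<open>X\<close> and \<open>Y\<close>. It turns
  corners into sums of paths with prescribed endpoints.\<close>

definition restrict_paths :: "vertex set \<Rightarrow> vertex set \<Rightarrow> path_sum \<Rightarrow> path_sum" where
  "restrict_paths X Y a =
     (\<Sum>p\<in>Poly_Mapping.keys a. if fst p \<in> X \<and> snd (snd p) \<in> Y
        then Poly_Mapping.single p (Poly_Mapping.lookup a p) else 0)"

lemma idem_sum_mult_left:
  assumes "finite X"
  shows "path_sum_mult (idem_sum X) a = restrict_paths X UNIV a"
proof -
  have *: "path_sum_mult (idem_sum X) (Poly_Mapping.single p c)
      = (if fst p \<in> X then Poly_Mapping.single p c else 0)" for p c
    using assms
    by (cases p) (auto simp: idem_sum_def path_sum_mult_sum_left path_sum_mult_single path_comp_def)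
  show ?thesis
    unfolding restrict_paths_def
    by (subst poly_mapping_expand[of a]) (simp add: path_sum_mult_sum_right *)
qed

lemma idem_sum_mult_right:
  assumes "finite X"
  shows "path_sum_mult a (idem_sum X) = restrict_paths UNIV X a"
proof -
  have *: "path_sum_mult (Poly_Mapping.single p c) (idem_sum X)
      = (if snd (snd p) \<in> X then Poly_Mapping.single p c else 0)" for p c
    using assms
    by (cases p) (auto simp: idem_sum_def path_sum_mult_sum_right path_sum_mult_single path_comp_def)
  show ?thesis
    unfolding restrict_paths_def
    by (subst poly_mapping_expand[of a]) (simp add: path_sum_mult_sum_left *)
qed

lemma lookup_restrict_paths:
  "Poly_Mapping.lookup (restrict_paths X Y a) p =
     (if fst p \<in> X \<and> snd (snd p) \<in> Y then Poly_Mapping.lookup a p else 0)"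
proof -
  have "Poly_Mapping.lookup (restrict_paths X Y a) p =
    (\<Sum>q\<in>Poly_Mapping.keys a. if q = p then (if fst p \<in> X \<and> snd (snd p) \<in> Y then Poly_Mapping.lookup a p else 0) else 0)"
    unfolding restrict_paths_def lookup_sum
    by (intro sum.cong refl) (auto simp: lookup_single when_def)
  then show ?thesis by (auto simp: in_keys_iff)
qed

lemma keys_restrict_paths:
  "Poly_Mapping.keys (restrict_paths X Y a) = {p \<in> Poly_Mapping.keys a. fst p \<in> X \<and> snd (snd p) \<in> Y}"
  by (auto simp: in_keys_iff lookup_restrict_paths split: if_splits)

lemma restrict_paths_id:
  assumes "\<And>p. p \<in> Poly_Mapping.keys a \<Longrightarrow> fst p \<in> X \<and> snd (snd p) \<in> Y"
  shows "restrict_paths X Y a = a"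
  using assms by (intro poly_mapping_eqI) (auto simp: lookup_restrict_paths in_keys_iff)

lemma restrict_paths_restrict_paths:
  "restrict_paths X Y (restrict_paths X' Y' a) = restrict_paths (X \<inter> X') (Y \<inter> Y') a"
  by (intro poly_mapping_eqI) (auto simp: lookup_restrict_paths)

lemma finite_verts [simp]: "finite (verts n k)"
  unfolding verts_def by (rule finite_subset[of _ "Pow {0..n}"]) auto

primrec is_U :: "label \<Rightarrow> bool" where
  "is_U (ArrR i) = False" | "is_U (ArrL i) = False" | "is_U (ArrU i) = True"

primrec edge :: "label \<Rightarrow> nat" where
  "edge (ArrR i) = i" | "edge (ArrL i) = i" | "edge (ArrU i) = i"

text \<open>For \<open>ArrU\<close> the values of \<open>src\<close> and \<open>tgt\<close> are
  placeholders: \<open>applicable\<close> and \<open>act\<close> test \<open>is_U\<close> before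
  consulting them.\<close>

primrec src :: "label \<Rightarrow> nat" where
  "src (ArrR i) = i - 1" | "src (ArrL i) = i" | "src (ArrU i) = i"

primrec tgt :: "label \<Rightarrow> nat" where
  "tgt (ArrR i) = i" | "tgt (ArrL i) = i - 1" | "tgt (ArrU i) = i"

locale osz = fixes n k :: nat
begin

text \<open>The quiver becomes a partial action of letters on vertices. The target is then a
  function of source and letter, so that a path is a vertex together with a word, and membership in
  \<open>verts n k\<close> has to be checked only at the source.\<close>

definition applicable :: "vertex \<Rightarrow> label \<Rightarrow> bool" where
  "applicable x a \<longleftrightarrow> edge a \<in> {1..n} \<and> (is_U a \<or> src a \<in> x \<and> tgt a \<notin> x)"

definition act :: "vertex \<Rightarrow> label \<Rightarrow> vertex" where
  "act x a = (if is_U a then x else insert (tgt a) (x - {src a}))"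

primrec pathw :: "vertex \<Rightarrow> label list \<Rightarrow> bool" where
  "pathw x [] = True"
| "pathw x (a # w) = (applicable x a \<and> pathw (act x a) w)"

abbreviation run :: "vertex \<Rightarrow> label list \<Rightarrow> vertex" where
  "run \<equiv> foldl act"

lemma arrow_iff: "arrow n k x a y \<longleftrightarrow> x \<in> verts n k \<and> applicable x a \<and> y = act x a"
proof -
  have card: "card (insert q (x - {p})) = card x" if "p \<in> x" "q \<notin> x" "finite x" for p q :: nat and x
    using that by (simp add: card_Diff_singleton Suc_diff_1 card_gt_0_iff)
      (metis Suc_pred card_gt_0_iff empty_iff)
  have fin: "finite x" if "x \<in> verts n k" for x
    using that by (auto simp: verts_def intro: finite_subset)
  have inv: "insert q (x - {p}) \<in> verts n k" if "x \<in> verts n k" "p \<in> x" "q \<notin> x" "q \<le> n" for x p q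
  proof -
    have "insert q (x - {p}) \<subseteq> {0..n}" "card x = k" using that by (auto simp: verts_def)
    then show ?thesis using card[OF that(2,3) fin[OF that(1)]] unfolding verts_def by simp
  qed
  have int: "z \<inter> {i-1, i} = {i-1} \<longleftrightarrow> i - 1 \<in> z \<and> i \<notin> z" if "1 \<le> i" for z and i :: nat
  proof -
    have "i \<noteq> i - 1" using that by auto
    then show ?thesis by blast
  qed
  show ?thesis
  proof (cases a)
    case (ArrR i)
    then show ?thesis using ArrR int inv[where x=x and p="i-1" and q=i]
      by (auto simp: moves_right_def applicable_def act_def)
  next
    case (ArrL i)
    show ?thesis
    proof
      assume "arrow n k x a y"
      then have *: "x \<in> verts n k" "y \<in> verts n k" "1 \<le> i" "i \<le> n" "y \<inter> {i-1,i} = {i-1}" "x = y - {i-1} \<union> {i}"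
        using ArrL by (auto simp: moves_right_def)
      then have "i \<notin> y" "i - 1 \<in> y" using int[of i y] by auto
      then have "y = insert (i-1) (x - {i})" "i \<in> x" "i - 1 \<notin> x" using * by auto
      then show "x \<in> verts n k \<and> applicable x a \<and> y = act x a"
        using * ArrL by (auto simp: applicable_def act_def)
    next
      assume "x \<in> verts n k \<and> applicable x a \<and> y = act x a"
      then have *: "x \<in> verts n k" "1 \<le> i" "i \<le> n" "i \<in> x" "i - 1 \<notin> x" "y = insert (i-1) (x - {i})"
        using ArrL by (auto simp: applicable_def act_def)
      have "y \<in> verts n k" using inv[where x=x and p=i and q="i-1"] * by auto
      moreover have "moves_right i y x" using * by (auto simp: moves_right_def)
      ultimately show "arrow n k x a y" using * ArrL by auto
    qed
  next
    case (ArrU i)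
    then show ?thesis by (auto simp: applicable_def act_def)
  qed
qed

lemma act_verts: "x \<in> verts n k \<Longrightarrow> applicable x a \<Longrightarrow> act x a \<in> verts n k"
  using arrow_iff[of x a "act x a"] by (cases a) (auto simp: act_def)

lemma is_path_iff: "is_path n k (x, w, y) \<longleftrightarrow> x \<in> verts n k \<and> pathw x w \<and> y = run x w"
  by (induction w arbitrary: x) (auto simp: arrow_iff act_verts)

lemma pathw_append [simp]: "pathw x (u @ w) \<longleftrightarrow> pathw x u \<and> pathw (run x u) w"
  by (induction u arbitrary: x) auto

lemma run_verts: "x \<in> verts n k \<Longrightarrow> pathw x w \<Longrightarrow> run x w \<in> verts n k"
  by (induction w arbitrary: x) (auto simp: act_verts)

lemma ring_path_algebra: "ring (path_algebra n k)"
proof -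
  have closed: "path_sum_mult a b \<in> carrier (path_algebra n k)"
    if a: "a \<in> carrier (path_algebra n k)" and b: "b \<in> carrier (path_algebra n k)" for a b
  proof -
    have "Poly_Mapping.keys (path_sum_mult a b) \<subseteq> {p. is_path n k p}"
    proof
      fix r assume "r \<in> Poly_Mapping.keys (path_sum_mult a b)"
      also have "path_sum_mult a b = (\<Sum>p\<in>Poly_Mapping.keys a. \<Sum>q\<in>Poly_Mapping.keys b.
          path_comp p q (Poly_Mapping.lookup a p * Poly_Mapping.lookup b q))"
        by (rule path_sum_mult_superset) auto
      finally obtain p q where pq: "p \<in> Poly_Mapping.keys a" "q \<in> Poly_Mapping.keys b"
        and r: "r \<in> Poly_Mapping.keys (path_comp p q (Poly_Mapping.lookup a p * Poly_Mapping.lookup b q))"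
        using keys_sum by (smt (verit) UN_E subsetD)
      obtain x v y y' w z where p: "p = (x, v, y)" and q: "q = (y', w, z)" by (metis prod.exhaust)
      have "y = y'" "r = (x, v @ w, z)"
        using r by (auto simp: path_comp_def p q split: if_splits)
      moreover have "is_path n k p" "is_path n k q" using a b pq by (auto simp: path_algebra_def)
      ultimately show "r \<in> {p. is_path n k p}" by (auto simp: p q is_path_iff)
    qed
    then show ?thesis by (auto simp: path_algebra_def)
  qed
  have idem: "idem_sum (verts n k) \<in> carrier (path_algebra n k)"
  proof -
    have "Poly_Mapping.keys (idem_sum (verts n k)) \<subseteq> (\<Union>x\<in>verts n k. {(x, [], x)})"
      unfolding idem_sum_def by (rule order_trans[OF keys_sum]) auto
    then show ?thesis by (fastforce simp: path_algebra_def)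
  qed
  have add: "a + b \<in> carrier (path_algebra n k)"
    if "a \<in> carrier (path_algebra n k)" "b \<in> carrier (path_algebra n k)" for a b
    using that Poly_Mapping.keys_add[of a b] unfolding path_algebra_def by fastforce
  have neg: "- a \<in> carrier (path_algebra n k)" if "a \<in> carrier (path_algebra n k)" for a
    using that by (simp add: path_algebra_def)
  have zero: "0 \<in> carrier (path_algebra n k)" by (simp add: path_algebra_def)
  have unit: "path_sum_mult (idem_sum (verts n k)) a = a" "path_sum_mult a (idem_sum (verts n k)) = a"
    if a: "a \<in> carrier (path_algebra n k)" for a
  proof -
    have "fst p \<in> verts n k \<and> snd (snd p) \<in> verts n k" if "p \<in> Poly_Mapping.keys a" for p
    proof -
      obtain x w y where p: "p = (x, w, y)" by (metis prod.exhaust)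
      then have "is_path n k (x, w, y)" using a that by (simp add: path_algebra_def)
      then show ?thesis by (simp add: p is_path_iff run_verts)
    qed
    then have "restrict_paths (verts n k) UNIV a = a" "restrict_paths UNIV (verts n k) a = a"
      by (blast intro: restrict_paths_id)+
    then show "path_sum_mult (idem_sum (verts n k)) a = a" "path_sum_mult a (idem_sum (verts n k)) = a"
      by (simp_all add: idem_sum_mult_left idem_sum_mult_right)
  qed
  have ops: "monoid.mult (path_algebra n k) = path_sum_mult" "monoid.one (path_algebra n k) = idem_sum (verts n k)"
    "ring.zero (path_algebra n k) = 0" "ring.add (path_algebra n k) = (+)"
    by (simp_all add: path_algebra_def)
  show ?thesis
  proof (intro ringI abelian_groupI monoidI, unfold ops)
    fix a assume "a \<in> carrier (path_algebra n k)"
    then show "\<exists>b\<in>carrier (path_algebra n k). b + a = 0"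
      by (intro bexI[of _ "- a"] neg) auto
  qed (simp_all add: closed idem add zero unit path_sum_mult_assoc path_sum_mult_add_left
      path_sum_mult_add_right add_ac)
qed

lemma OSz_relations_carrier: "OSz_relations n k \<subseteq> carrier (path_algebra n k)"
proof -
  have "Poly_Mapping.keys (Poly_Mapping.single p (1::int) - Poly_Mapping.single q 1) \<subseteq> {p, q}" for p q :: qpath
    using keys_diff[of "Poly_Mapping.single p (1::int)" "Poly_Mapping.single q 1"] by auto
  then show ?thesis by (fastforce simp: OSz_relations_def path_algebra_def)
qed

lemma ideal_OSz_ideal: "ideal (OSz_ideal n k) (path_algebra n k)"
  unfolding OSz_ideal_def by (rule ring.genideal_ideal[OF ring_path_algebra OSz_relations_carrier])

end

section \<open>Crossing weights and reduction of words\<close>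

primrec label_weight :: "label \<Rightarrow> nat \<Rightarrow> nat" where
  "label_weight (ArrR i) j = (if i = j then 1 else 0)"
| "label_weight (ArrL i) j = (if i = j then 1 else 0)"
| "label_weight (ArrU i) j = (if i = j then 2 else 0)"

definition weight :: "label list \<Rightarrow> nat \<Rightarrow> nat" where
  "weight w i = (\<Sum>a\<leftarrow>w. label_weight a i)"

lemma weight_simps [simp]:
  "weight [] i = 0" "weight (a # w) i = label_weight a i + weight w i"
  "weight (u @ w) i = weight u i + weight w i"
  by (simp_all add: weight_def)

lemma label_weight_pos_iff: "label_weight a i > 0 \<longleftrightarrow> edge a = i"
  by (cases a) auto

lemma weight_pos_iff: "weight w i > 0 \<longleftrightarrow> i \<in> edge ` set w"
  by (induction w) (auto simp: label_weight_pos_iff)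

definition commutes :: "label \<Rightarrow> label \<Rightarrow> bool" where
  "commutes a b \<longleftrightarrow> is_U a \<or> is_U b \<or> edge a + 1 < edge b \<or> edge b + 1 < edge a"

lemma commutes_sym: "commutes a b \<longleftrightarrow> commutes b a"
  by (auto simp: commutes_def)

text \<open>Edge \<open>i\<close> joins the positions \<open>i - 1\<close> and \<open>i\<close>, so
  position \<open>p\<close> is an endpoint of the edges \<open>p\<close> and \<open>Suc p\<close>
  only.\<close>

definition touches :: "label \<Rightarrow> nat \<Rightarrow> bool" where
  "touches a p \<longleftrightarrow> \<not> is_U a \<and> (edge a = p \<or> edge a = Suc p)"

definition moves_distinct :: "label list \<Rightarrow> bool" where
  "moves_distinct w \<longleftrightarrow> (\<forall>a\<in>set w. \<not> is_U a) \<and> distinct (map edge w)"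

lemma moves_distinct_append:
  "moves_distinct (u @ w) \<longleftrightarrow> moves_distinct u \<and> moves_distinct w \<and> edge ` set u \<inter> edge ` set w = {}"
  by (auto simp: moves_distinct_def)

lemma moves_distinct_Cons:
  "moves_distinct (a # w) \<longleftrightarrow> \<not> is_U a \<and> moves_distinct w \<and> edge a \<notin> edge ` set w"
  by (auto simp: moves_distinct_def)

lemma commutes_if_not_touches:
  assumes "\<not> touches b (src a)" "\<not> touches b (tgt a)" "edge b \<noteq> edge a" "edge a \<ge> 1"
  shows "commutes b a"
  using assms by (cases a; cases b) (auto simp: touches_def commutes_def)

context osz
begin

abbreviation "\<I> \<equiv> OSz_ideal n k"

lemma ideal_add: "a \<in> \<I> \<Longrightarrow> b \<in> \<I> \<Longrightarrow> a + b \<in> \<I>"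
  using additive_subgroup.a_closed[OF ideal.axioms(1)[OF ideal_OSz_ideal]] by (auto simp: path_algebra_def)

lemma ideal_mult_left: "a \<in> \<I> \<Longrightarrow> r \<in> carrier (path_algebra n k) \<Longrightarrow> path_sum_mult r a \<in> \<I>"
  using ideal.I_l_closed[OF ideal_OSz_ideal] by (auto simp: path_algebra_def)

lemma ideal_mult_right: "a \<in> \<I> \<Longrightarrow> r \<in> carrier (path_algebra n k) \<Longrightarrow> path_sum_mult a r \<in> \<I>"
  using ideal.I_r_closed[OF ideal_OSz_ideal] by (auto simp: path_algebra_def)

lemma ideal_zero: "0 \<in> \<I>"
  using additive_subgroup.zero_closed[OF ideal.axioms(1)[OF ideal_OSz_ideal]] by (auto simp: path_algebra_def)

lemma ideal_uminus:
  assumes "a \<in> \<I>"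
  shows "- a \<in> \<I>"
proof -
  interpret I: ideal "\<I>" "path_algebra n k" by (rule ideal_OSz_ideal)
  have a: "a \<in> carrier (path_algebra n k)" using assms by (rule I.a_Hcarr)
  then have "- a \<in> carrier (path_algebra n k)" by (simp add: path_algebra_def)
  moreover have "- a \<oplus>\<^bsub>path_algebra n k\<^esub> a = \<zero>\<^bsub>path_algebra n k\<^esub>" by (simp add: path_algebra_def)
  ultimately have "\<ominus>\<^bsub>path_algebra n k\<^esub> a = - a" using a I.minus_equality by blast
  then show ?thesis using additive_subgroup.a_inv_closed[OF ideal.axioms(1)[OF ideal_OSz_ideal] assms] by simp
qed

lemma ideal_diff: "a \<in> \<I> \<Longrightarrow> b \<in> \<I> \<Longrightarrow> a - b \<in> \<I>"
  using ideal_add[OF _ ideal_uminus, of a b] by simp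

definition path1 :: "vertex \<Rightarrow> label list \<Rightarrow> path_sum" where
  "path1 x w = Poly_Mapping.single (x, w, run x w) 1"

lemma path1_carrier: "x \<in> verts n k \<Longrightarrow> pathw x w \<Longrightarrow> path1 x w \<in> carrier (path_algebra n k)"
  by (simp add: path1_def path_algebra_def is_path_iff)

lemma path1_append: "path1 x (u @ w) = path_sum_mult (path1 x u) (path1 (run x u) w)"
  by (simp add: path1_def path_sum_mult_single path_comp_def)

text \<open>Both notions hold vacuously for words that are not paths starting at \<open>x\<close>, so that
  impossible words need not be separated from those in the ideal.\<close>

definition zeroes :: "vertex \<Rightarrow> label list \<Rightarrow> bool" where
  "zeroes x w \<longleftrightarrow> (x \<in> verts n k \<longrightarrow> pathw x w \<longrightarrow> path1 x w \<in> \<I>)"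

definition reduces :: "vertex \<Rightarrow> label list \<Rightarrow> label list \<Rightarrow> bool" where
  "reduces x w w' \<longleftrightarrow> (x \<in> verts n k \<longrightarrow> pathw x w \<longrightarrow>
     pathw x w' \<and> run x w' = run x w \<and> path1 x w - path1 x w' \<in> \<I>)"

lemma zeroesI: "(x \<in> verts n k \<Longrightarrow> pathw x w \<Longrightarrow> zeroes x w) \<Longrightarrow> zeroes x w"
  by (auto simp: zeroes_def)

lemma reduces_refl: "reduces x w w"
  by (auto simp: reduces_def ideal_zero)

lemma reduces_trans [trans]: "reduces x u v \<Longrightarrow> reduces x v w \<Longrightarrow> reduces x u w"
  unfolding reduces_def using ideal_add[of "path1 x u - path1 x v" "path1 x v - path1 x w"] by auto

lemma zeroes_reduces: "reduces x u v \<Longrightarrow> zeroes x v \<Longrightarrow> zeroes x u"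
  unfolding reduces_def zeroes_def using ideal_add[of "path1 x u - path1 x v" "path1 x v"] by auto

lemma zeroes_context:
  assumes "zeroes (run x u) w"
  shows "zeroes x (u @ w @ v)"
  unfolding zeroes_def
proof (intro impI)
  assume x: "x \<in> verts n k" and p: "pathw x (u @ w @ v)"
  have y: "run x u \<in> verts n k" "run (run x u) w \<in> verts n k" using x p by (auto intro!: run_verts)
  have pw: "pathw x u" "pathw (run x u) w" "pathw (run (run x u) w) v" using p by simp_all
  have "path1 (run x u) w \<in> \<I>" using assms pw(2) y(1) by (simp add: zeroes_def)
  then show "path1 x (u @ w @ v) \<in> \<I>"
    unfolding path1_append
    by (rule ideal_mult_left[OF ideal_mult_right, OF _ path1_carrier[OF y(2) pw(3)] path1_carrier[OF x pw(1)]])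
qed

lemma reduces_context:
  assumes "reduces (run x u) w w'"
  shows "reduces x (u @ w @ v) (u @ w' @ v)"
  unfolding reduces_def
proof (intro impI)
  assume x: "x \<in> verts n k" and p: "pathw x (u @ w @ v)"
  have y: "run x u \<in> verts n k" "run (run x u) w \<in> verts n k" using x p by (auto intro!: run_verts)
  have pw: "pathw x u" "pathw (run x u) w" "pathw (run (run x u) w) v" using p by simp_all
  have *: "pathw (run x u) w'" "run (run x u) w' = run (run x u) w" "path1 (run x u) w - path1 (run x u) w' \<in> \<I>"
    using assms pw(2) y(1) by (simp_all add: reduces_def)
  let ?r = "path1 (run (run x u) w) v"
  have "path1 x (u @ w @ v) - path1 x (u @ w' @ v) =
      path_sum_mult (path1 x u) (path_sum_mult (path1 (run x u) w - path1 (run x u) w') ?r)"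
    unfolding path1_append *(2)
    using path_sum_mult_add_right[of "path1 x u" "path_sum_mult (path1 (run x u) w - path1 (run x u) w') ?r"
        "path_sum_mult (path1 (run x u) w') ?r"]
      path_sum_mult_add_left[of "path1 (run x u) w - path1 (run x u) w'" "path1 (run x u) w'" ?r]
    by simp
  also have "\<dots> \<in> \<I>"
    by (rule ideal_mult_left[OF ideal_mult_right, OF *(3) path1_carrier[OF y(2) pw(3)] path1_carrier[OF x pw(1)]])
  finally show "pathw x (u @ w' @ v) \<and> run x (u @ w' @ v) = run x (u @ w @ v) \<and>
      path1 x (u @ w @ v) - path1 x (u @ w' @ v) \<in> \<I>"
    using pw * by simp
qed

lemma zeroes_prefix: "zeroes x w \<Longrightarrow> zeroes x (w @ v)"
  using zeroes_context[of x "[]" w v] by simp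

lemma reduces_prefix: "reduces x w w' \<Longrightarrow> reduces x (w @ v) (w' @ v)"
  using reduces_context[of x "[]" w w' v] by simp

lemma zeroes_Cons: "zeroes (act x a) w \<Longrightarrow> zeroes x (a # w)"
  using zeroes_context[of x "[a]" w "[]"] by simp

lemma reduces_Cons: "reduces (act x a) w w' \<Longrightarrow> reduces x (a # w) (a # w')"
  using reduces_context[of x "[a]" w w' "[]"] by simp

text \<open>A relation may be read in either direction, but the side conditions are one-sided: a
  loop is a path at every vertex, whereas crossing its edge forth and back is a path only where the
  occupation permits it.\<close>

lemma reduces_relation:
  assumes "equal_words w w' \<or> equal_words w' w"
    and "pathw x w \<Longrightarrow> pathw x w' \<and> run x w' = run x w"
  shows "reduces x w w'"
  unfolding reduces_def
proof (intro impI)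
  assume x: "x \<in> verts n k" and p: "pathw x w"
  have rel: "path1 x u - path1 x v \<in> \<I>"
    if "equal_words u v" "pathw x u" "pathw x v" "run x u = run x v" for u v
  proof -
    have "path1 x u - path1 x v \<in> OSz_relations n k"
      using that x unfolding OSz_relations_def path1_def is_path_iff
      by (intro UnI1 CollectI exI[of _ x] exI[of _ "run x u"] exI[of _ u] exI[of _ v]) simp
    then show ?thesis
      unfolding OSz_ideal_def using ring.genideal_self[OF ring_path_algebra OSz_relations_carrier] by auto
  qed
  have "path1 x w - path1 x w' \<in> \<I>"
    using assms p rel[of w w'] rel[of w' w] ideal_uminus[of "path1 x w' - path1 x w"] by auto
  then show "pathw x w' \<and> run x w' = run x w \<and> path1 x w - path1 x w' \<in> \<I>"
    using assms p by auto
qed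

lemma zeroes_relation: "zero_word x w \<Longrightarrow> zeroes x w"
proof -
  assume "zero_word x w"
  then have "path1 x w \<in> OSz_relations n k" if "x \<in> verts n k" "pathw x w"
    using that unfolding OSz_relations_def path1_def is_path_iff
    by (intro UnI2 CollectI exI[of _ x] exI[of _ "run x w"] exI[of _ w]) simp
  then show ?thesis
    unfolding zeroes_def OSz_ideal_def
    using ring.genideal_self[OF ring_path_algebra OSz_relations_carrier] by auto
qed

lemma reduces_swap:
  assumes "commutes a b"
  shows "reduces x [a, b] [b, a]"
proof (rule reduces_relation)
  show "equal_words [a, b] [b, a] \<or> equal_words [b, a] [a, b]"
    using assms by (cases a; cases b) (auto simp: commutes_def intro: equal_words.intros)
  show "pathw x [b, a] \<and> run x [b, a] = run x [a, b]" if p: "pathw x [a, b]"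
  proof (cases "is_U a \<or> is_U b")
    case True
    then show ?thesis using p by (auto simp: applicable_def act_def)
  next
    case False
    then have "tgt a \<noteq> src b" "tgt a \<noteq> tgt b" "src a \<noteq> src b" "src a \<noteq> tgt b"
      using assms p by (cases a; cases b; auto simp: commutes_def applicable_def)+
    then show ?thesis using p False by (auto simp: applicable_def act_def)
  qed
qed

lemma reduces_move_front:
  assumes "\<forall>b\<in>set u. commutes b a"
  shows "reduces x (u @ [a]) (a # u)"
  using assms
proof (induction u arbitrary: x)
  case (Cons b u)
  have "reduces x (b # u @ [a]) (b # a # u)"
    using Cons by (intro reduces_Cons) auto
  also have "reduces x (b # a # u) (a # b # u)"
    using reduces_prefix[OF reduces_swap[of b a x], of u] Cons by simp
  finally show ?case by simp
qed (simp add: reduces_refl)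

lemma reduces_move_back:
  assumes "\<forall>b\<in>set u. commutes b a"
  shows "reduces x (a # u) (u @ [a])"
  using assms
proof (induction u arbitrary: x)
  case (Cons b u)
  have "reduces x (a # b # u) (b # a # u)"
    using reduces_prefix[OF reduces_swap[of a b x], of u] Cons by (simp add: commutes_sym)
  also have "reduces x (b # a # u) (b # u @ [a])"
    using Cons by (intro reduces_Cons) auto
  finally show ?case by simp
qed (simp add: reduces_refl)

lemma reduces_return:
  assumes "\<not> is_U a" "\<not> is_U b" "edge b = edge a" "src b = tgt a"
  shows "reduces x [a, b] [ArrU (edge a)]"
proof (cases "edge a \<ge> 1")
  case True
  show ?thesis
  proof (rule reduces_relation)
    show "equal_words [a, b] [ArrU (edge a)] \<or> equal_words [ArrU (edge a)] [a, b]"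
      using assms True by (cases a; cases b) (auto intro: equal_words.intros)
    have "tgt b = src a" "src a \<noteq> tgt a" using assms True by (cases a; cases b; simp)+
    then show "pathw x [ArrU (edge a)] \<and> run x [ArrU (edge a)] = run x [a, b]" if "pathw x [a, b]"
      using that assms by (auto simp: applicable_def act_def)
  qed
qed (auto simp: reduces_def applicable_def)

lemma reduces_loop:
  assumes "\<not> is_U a" "\<not> is_U b" "edge b = edge a" "src b = tgt a" "src a \<in> x" "tgt a \<notin> x"
  shows "reduces x [ArrU (edge a)] [a, b]"
proof (cases "edge a \<ge> 1")
  case True
  show ?thesis
  proof (rule reduces_relation)
    show "equal_words [ArrU (edge a)] [a, b] \<or> equal_words [a, b] [ArrU (edge a)]"
      using assms True by (cases a; cases b) (auto intro: equal_words.intros)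
    have "tgt b = src a" "src a \<noteq> tgt a" using assms True by (cases a; cases b; simp)+
    then show "pathw x [a, b] \<and> run x [a, b] = run x [ArrU (edge a)]" if "pathw x [ArrU (edge a)]"
      using that assms by (auto simp: applicable_def act_def)
  qed
qed (auto simp: reduces_def applicable_def)

text \<open>The letter \<open>b\<close> picks up the element that \<open>a\<close> has just moved
  and does not take it back. So one element moves two steps in the same direction, which is one of
  the two vanishing words of moves.\<close>

lemma zeroes_advance:
  assumes "\<not> is_U a" "\<not> is_U b" "src b = tgt a" "tgt b \<noteq> src a"
  shows "zeroes x [a, b]"
proof (rule zeroesI)
  assume "pathw x [a, b]"
  then have e: "edge a \<ge> 1" "edge b \<ge> 1" by (auto simp: applicable_def)
  have "zero_word x [a, b]"
  proof (cases a)
    case (ArrR i)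
    then have "b = ArrR (Suc i)" using assms e by (cases b) auto
    then show ?thesis using ArrR by (auto intro: zero_word.intros)
  next
    case (ArrL i)
    then obtain j where "b = ArrL j" "i = Suc j" using assms e by (cases b) auto
    then show ?thesis using ArrL by (auto intro: zero_word.intros)
  qed (use assms in auto)
  then show "zeroes x [a, b]" by (rule zeroes_relation)
qed

text \<open>Two moves in the same direction across adjacent edges: the letters in between commute
  past either the first or the second of them, depending on the side on which their edge lies.\<close>

lemma zeroes_advance_between:
  assumes ab: "\<not> is_U a" "\<not> is_U b" "src b = tgt a" "tgt b \<noteq> src a"
    and ge1: "edge a \<ge> 1" "edge b \<ge> 1"
    and v: "edge a \<notin> edge ` set v" "edge b \<notin> edge ` set v"
  shows "zeroes x (a # v @ [b])"
proof -
  \<comment> \<open>The near letters lie on the side of \<open>a\<close> away from \<open>b\<close>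
    and hence commute with \<open>b\<close>. All other letters between \<open>a\<close> and
    \<open>b\<close> commute with \<open>a\<close> and with every near letter. The word
    \<open>u\<close> below collects the near letters already passed.\<close>
  define near where "near c \<longleftrightarrow> \<not> is_U c \<and>
    (edge a < edge b \<and> edge c < edge a \<or> edge b < edge a \<and> edge a < edge c)" for c
  have adj: "edge b = Suc (edge a) \<or> edge a = Suc (edge b)"
    using ab ge1 by (cases a; cases b) auto
  have "zeroes x (a # u @ v @ [b])" if "\<forall>c\<in>set u. near c" for u
    using that v
  proof (induction v arbitrary: x u)
    case Nil
    have "\<forall>c\<in>set u. commutes c b" using Nil adj by (auto simp: near_def commutes_def)
    then have "reduces x (a # u @ [b]) (a # b # u)"
      by (intro reduces_Cons reduces_move_front)
    moreover have "zeroes x (a # b # u)"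
      using zeroes_prefix[OF zeroes_advance[OF ab]] by simp
    ultimately show ?case using zeroes_reduces by simp
  next
    case (Cons c v)
    show ?case
    proof (cases "near c")
      case True
      then show ?thesis using Cons.IH[where u="u @ [c]" and x=x] Cons.prems by auto
    next
      case False
      have "\<forall>d\<in>set (a # u). commutes d c"
        using False Cons.prems adj ab by (auto simp: near_def commutes_def)
      then have "reduces x ((a # u) @ [c]) (c # a # u)" by (rule reduces_move_front)
      then have "reduces x (((a # u) @ [c]) @ v @ [b]) ((c # a # u) @ v @ [b])"
        by (rule reduces_prefix)
      moreover have "zeroes (act x c) (a # u @ v @ [b])"
        by (rule Cons.IH) (use Cons.prems in auto)
      then have "zeroes x (c # a # u @ v @ [b])" by (rule zeroes_Cons)
      ultimately show ?thesis using zeroes_reduces by simp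
    qed
  qed
  from this[of "[]"] show ?thesis by simp
qed

lemma mem_act_iff:
  assumes "applicable x a"
  shows "p \<in> act x a \<longleftrightarrow> (if touches a p then p \<notin> x else p \<in> x)"
  using assms by (cases a) (auto simp: applicable_def act_def touches_def)

lemma mem_run_untouched:
  assumes "pathw x w" "\<forall>a\<in>set w. \<not> touches a p"
  shows "p \<in> run x w \<longleftrightarrow> p \<in> x"
  using assms by (induction w arbitrary: x) (auto simp: mem_act_iff)

text \<open>A position is an endpoint of only two edges; if one of these is not crossed and the other
  at most once, then the position is touched exactly if its occupation changes.\<close>

lemma untouched_before:
  assumes "moves_distinct (u @ a # v)" "e \<notin> edge ` set (u @ a # v)" "e = p \<or> e = Suc p" "touches a p"
  shows "\<forall>b\<in>set u. \<not> touches b p" "\<forall>b\<in>set v. \<not> touches b p"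
proof -
  have "edge b \<noteq> edge a \<and> edge b \<noteq> e" if "b \<in> set u \<union> set v" for b
  proof -
    have "edge b \<in> edge ` set u \<union> edge ` set v" using that by auto
    then show ?thesis using assms(1,2) by (auto simp: moves_distinct_append moves_distinct_Cons)
  qed
  moreover have "edge a \<noteq> e" using assms(2) by auto
  ultimately show "\<forall>b\<in>set u. \<not> touches b p" "\<forall>b\<in>set v. \<not> touches b p"
    using assms(3,4) unfolding touches_def by (metis Un_iff)+
qed

lemma untouched_if_unchanged:
  assumes "pathw x w" "moves_distinct w" "e \<notin> edge ` set w" "e = p \<or> e = Suc p"
    and "p \<in> run x w \<longleftrightarrow> p \<in> x"
  shows "\<forall>a\<in>set w. \<not> touches a p"
proof (rule ccontr)
  assume "\<not> ?thesis"
  then obtain a where a: "a \<in> set w" "touches a p" by auto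
  then obtain u v where w: "w = u @ a # v" by (metis split_list)
  note unt = untouched_before[of u a v e p]
  have "p \<in> run x u \<longleftrightarrow> p \<in> x"
    using assms w unt a by (intro mem_run_untouched) auto
  moreover have "p \<in> act (run x u) a \<longleftrightarrow> p \<notin> run x u"
    using assms(1) w a by (auto simp: mem_act_iff)
  moreover have "p \<in> run (act (run x u) a) v \<longleftrightarrow> p \<in> act (run x u) a"
    using assms w unt a by (intro mem_run_untouched) auto
  ultimately show False using assms(5) w by auto
qed

lemma applicable_src_tgt:
  assumes "applicable x a" "\<not> is_U a"
  shows "src a \<in> x" "tgt a \<notin> x" "edge a \<ge> 1" "src a \<notin> act x a" "tgt a \<in> act x a"
    "edge a = src a \<or> edge a = Suc (src a)" "edge a = tgt a \<or> edge a = Suc (tgt a)" "src a \<noteq> tgt a"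
  using assms by (cases a; auto simp: applicable_def act_def)+

lemma same_edge_cases:
  assumes "\<not> is_U a" "\<not> is_U b" "edge a = edge b"
  shows "src b = src a \<and> tgt b = tgt a \<or> src b = tgt a \<and> tgt b = src a"
  using assms by (cases a; cases b) auto

lemma touches_cases:
  assumes "touches a p" "edge a \<ge> 1"
  shows "src a = p \<or> tgt a = p"
  using assms by (cases a) (auto simp: touches_def)

lemma same_edge_if:
  assumes "\<not> is_U a" "\<not> is_U b" "edge a \<ge> 1" "edge b \<ge> 1" "src b = tgt a" "tgt b = src a"
  shows "edge b = edge a"
  using assms by (cases a; cases b) auto

section \<open>Normal forms of paths\<close>

lemma zeroes_U_at_empty:
  assumes "x \<inter> {i - 1, i} = {}"
  shows "zeroes x [ArrU i]"
  using assms by (intro zeroes_relation zero_word.U)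

text \<open>A letter \<open>a\<close> is put in front of a normal form. Loops move to the back. If
  the move part crosses the edge of \<open>a\<close> again, there are two cases. If some letter
  before that crossing touches the target of \<open>a\<close>, the first such letter carries the
  element onwards, and the word is zero. Otherwise the crossing brings the element back; the source
  of \<open>a\<close> is vacant throughout, so every letter in between commutes with
  \<open>a\<close>, and the two crossings merge into a loop.\<close>

lemma normal_form:
  "zeroes x w \<or> (\<exists>w' us. reduces x w (w' @ us) \<and> moves_distinct w' \<and> (\<forall>a\<in>set us. is_U a) \<and>
     (\<forall>i. weight (w' @ us) i = weight w i))"
proof (induction w arbitrary: x)
  case Nil
  have "reduces x [] ([] @ [])" by (simp add: reduces_refl)
  then show ?case by (intro disjI2 exI[of _ "[]"]) (simp add: moves_distinct_def)
next
  case (Cons a w)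
  show ?case
  proof (cases "x \<in> verts n k \<and> pathw x (a # w) \<and> \<not> zeroes (act x a) w")
    case False
    then show ?thesis using zeroes_Cons[of x a w] by (auto simp: zeroes_def)
  next
    case True
    then have x: "x \<in> verts n k" and app: "applicable x a" and pw: "pathw (act x a) w"
      and nz: "\<not> zeroes (act x a) w" by auto
    define z where "z = act x a"
    have z: "z \<in> verts n k" using x app by (simp add: z_def act_verts)
    from Cons.IH[of z] nz obtain w' us where w': "reduces z w (w' @ us)" "moves_distinct w'"
      "\<forall>a\<in>set us. is_U a" "\<And>i. weight (w' @ us) i = weight w i" by (auto simp: z_def)
    have pw': "pathw z w'" using w'(1) z pw by (auto simp: reduces_def z_def)
    have red: "reduces x (a # w) (a # w' @ us)" using w'(1) by (intro reduces_Cons) (simp add: z_def)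
    show ?thesis
    proof (cases "is_U a")
      case U: True
      then have "\<forall>b\<in>set w'. commutes b a" by (auto simp: commutes_def)
      then have "reduces x ((a # w') @ us) ((w' @ [a]) @ us)" by (intro reduces_prefix reduces_move_back)
      then have "reduces x (a # w) (w' @ (a # us))" using reduces_trans[OF red] by simp
      moreover have "\<forall>i. weight (w' @ (a # us)) i = weight (a # w) i" using w'(4) by simp
      ultimately show ?thesis using w' U by (intro disjI2 exI[of _ w'] exI[of _ "a # us"]) simp
    next
      case RL: False
      note ap = applicable_src_tgt[OF app RL]
      show ?thesis
      proof (cases "edge a \<in> edge ` set w'")
        case False
        then have "moves_distinct (a # w')" using w'(2) RL by (simp add: moves_distinct_Cons)
        then show ?thesis using red w' by (intro disjI2 exI[of _ "a # w'"] exI[of _ us]) simp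
      next
        case True
        then obtain b v v' where b: "edge b = edge a" and w'_eq: "w' = v @ b # v'"
          by (metis (no_types, opaque_lifting) imageE split_list)
        have dv: "moves_distinct v" and b_RL: "\<not> is_U b" and av: "edge a \<notin> edge ` set v"
          and dvv: "moves_distinct (v @ v')"
          using w'(2) b by (auto simp: w'_eq moves_distinct_append moves_distinct_Cons)
        have pv: "pathw z v" and appb: "applicable (run z v) b" using pw' by (auto simp: w'_eq)
        have tz: "tgt a \<in> z" "src a \<notin> z" using ap by (simp_all add: z_def)
        show ?thesis
        proof (cases "\<exists>d\<in>set v. touches d (tgt a)")
          case True
          then obtain d v1 v2 where d: "touches d (tgt a)" and v_eq: "v = v1 @ d # v2"
            by (metis split_list)
          have d_RL: "\<not> is_U d" using d by (simp add: touches_def)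
          have "\<forall>c\<in>set v1. \<not> touches c (tgt a)"
            using untouched_before[of v1 d v2 "edge a" "tgt a"] dv av ap(7) d by (auto simp: v_eq)
          then have in1: "tgt a \<in> run z v1"
            using mem_run_untouched[of z v1 "tgt a"] pv tz by (simp add: v_eq)
          have appd: "applicable (run z v1) d" using pv by (simp add: v_eq)
          note apd = applicable_src_tgt[OF appd d_RL]
          have sd: "src d = tgt a" using touches_cases[OF d apd(3)] in1 apd(2) by auto
          have "edge d \<noteq> edge a" using av by (auto simp: v_eq)
          then have td: "tgt d \<noteq> src a" using same_edge_if[OF RL d_RL ap(3) apd(3) sd] by auto
          have "edge a \<notin> edge ` set v1" "edge d \<notin> edge ` set v1"
            using av dv by (auto simp: v_eq moves_distinct_append moves_distinct_Cons)
          then have "zeroes x (a # v1 @ [d])"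
            by (rule zeroes_advance_between[OF RL d_RL sd td ap(3) apd(3)])
          from zeroes_prefix[OF this, of "v2 @ b # v' @ us"]
          have "zeroes x (a # w' @ us)" by (simp add: w'_eq v_eq)
          then show ?thesis using zeroes_reduces[OF red] by simp
        next
          case no_tgt: False
          have tgt_in: "tgt a \<in> run z v"
            using mem_run_untouched[OF pv, of "tgt a"] no_tgt tz by auto
          note apb = applicable_src_tgt[OF appb b_RL]
          have sb: "src b = tgt a" "tgt b = src a"
            using same_edge_cases[OF RL b_RL] b apb(2) tgt_in by auto
          then have "src a \<notin> run z v" using apb(2) by simp
          then have "\<forall>c\<in>set v. \<not> touches c (src a)"
            using untouched_if_unchanged[OF pv dv av ap(6)] tz by simp
          then have "\<forall>c\<in>set v. commutes c a"
            using no_tgt av ap(3) by (metis commutes_if_not_touches image_eqI)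
          then have "reduces x ((a # v) @ (b # v' @ us)) ((v @ [a]) @ (b # v' @ us))"
            by (intro reduces_prefix reduces_move_back)
          also have "reduces x ((v @ [a]) @ (b # v' @ us)) (v @ [ArrU (edge a)] @ v' @ us)"
            using reduces_context[OF reduces_return[OF RL b_RL b sb(1)], of x v "v' @ us"] by simp
          also have "reduces x (v @ [ArrU (edge a)] @ v' @ us) (v @ (v' @ [ArrU (edge a)]) @ us)"
            using reduces_context[OF reduces_move_back[of v' "ArrU (edge a)"], of x v us]
            by (simp add: commutes_def)
          finally have "reduces x (a # w) ((v @ v') @ (ArrU (edge a) # us))"
            using reduces_trans[OF red] by (simp add: w'_eq)
          moreover have "weight ((v @ v') @ (ArrU (edge a) # us)) i = weight (a # w) i" for i
          proof -
            have "label_weight a i + label_weight b i = label_weight (ArrU (edge a)) i"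
              using RL b_RL b by (cases a; cases b) auto
            then show ?thesis using w'(4)[of i] by (simp add: w'_eq)
          qed
          ultimately show ?thesis
            using dvv w'(3) by (intro disjI2 exI[of _ "v @ v'"] exI[of _ "ArrU (edge a) # us"]) simp
        qed
      qed
    qed
  qed
qed

section \<open>Levels, and the uniqueness of paths that cross no edge twice\<close>

definition level :: "vertex \<Rightarrow> nat \<Rightarrow> nat" where
  "level x i = card (x \<inter> {..<i})"

lemma level_Suc: "level x (Suc i) = level x i + (if i \<in> x then 1 else 0)"
proof -
  have "x \<inter> {..<Suc i} = (if i \<in> x then insert i (x \<inter> {..<i}) else x \<inter> {..<i})"
    by (auto simp: less_Suc_eq)
  then show ?thesis by (simp add: level_def)
qed

text \<open>\<open>level x i\<close> counts the elements to the left of edge \<open>i\<close>. A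
  move across another edge stays on one side of edge \<open>i\<close> and cannot change that
  number.\<close>

lemma level_act:
  assumes "applicable x a"
  shows "a = ArrR i \<Longrightarrow> level x i = Suc (level (act x a) i)"
    and "a = ArrL i \<Longrightarrow> level (act x a) i = Suc (level x i)"
    and "is_U a \<or> edge a \<noteq> i \<Longrightarrow> level (act x a) i = level x i"
proof -
  have fin: "finite (x \<inter> {..<i})" by simp
  show "level x i = Suc (level (act x a) i)" if "a = ArrR i"
  proof -
    have *: "i - 1 \<in> x" "i \<notin> x" "i \<ge> 1" using assms that by (auto simp: applicable_def)
    then have "x \<inter> {..<i} = insert (i - 1) (act x a \<inter> {..<i})" "i - 1 \<notin> act x a \<inter> {..<i}"
      using that by (auto simp: act_def)
    then show ?thesis by (simp add: level_def)
  qed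
  show "level (act x a) i = Suc (level x i)" if "a = ArrL i"
  proof -
    have *: "i - 1 \<notin> x" "i \<in> x" "i \<ge> 1" using assms that by (auto simp: applicable_def)
    then have "act x a \<inter> {..<i} = insert (i - 1) (x \<inter> {..<i})" "i - 1 \<notin> x \<inter> {..<i}"
      using that by (auto simp: act_def)
    then show ?thesis by (simp add: level_def)
  qed
  show "level (act x a) i = level x i" if "is_U a \<or> edge a \<noteq> i"
  proof (cases "is_U a")
    case True
    then show ?thesis by (simp add: act_def)
  next
    case False
    note ap = applicable_src_tgt[OF assms False]
    have e: "edge a \<noteq> i" using that False by simp
    show ?thesis
    proof (cases "edge a < i")
      case True
      then have "src a < i" "tgt a < i" using ap(6,7) by auto
      then have "act x a \<inter> {..<i} = insert (tgt a) (x \<inter> {..<i} - {src a})"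
        using False by (auto simp: act_def)
      moreover have "card (insert (tgt a) (x \<inter> {..<i} - {src a})) = Suc (card (x \<inter> {..<i} - {src a}))"
        using ap(2) by (intro card_insert_disjoint) auto
      moreover have "\<dots> = card (x \<inter> {..<i})"
        using ap(1) \<open>src a < i\<close> by (intro card_Suc_Diff1) auto
      ultimately show ?thesis by (simp add: level_def)
    next
      case False': False
      then have "i \<le> src a" "i \<le> tgt a" using ap(6,7) e by auto
      then have "act x a \<inter> {..<i} = x \<inter> {..<i}" using False by (auto simp: act_def)
      then show ?thesis by (simp add: level_def)
    qed
  qed
qed

lemma level_run_untouched:
  assumes "pathw x w" "\<forall>a\<in>set w. is_U a \<or> edge a \<noteq> i"
  shows "level (run x w) i = level x i"
  using assms by (induction w arbitrary: x) (auto simp: level_act(3))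

lemma level_run_distinct:
  assumes "pathw x w" "moves_distinct w" "a \<in> set w"
  shows "a = ArrR i \<Longrightarrow> level x i = Suc (level (run x w) i)"
    and "a = ArrL i \<Longrightarrow> level (run x w) i = Suc (level x i)"
proof -
  obtain u v where w: "w = u @ a # v" using assms(3) by (metis split_list)
  have d: "\<forall>b\<in>set u. edge b \<noteq> edge a" "\<forall>b\<in>set v. edge b \<noteq> edge a"
    using assms(2) by (auto simp: w moves_distinct_append moves_distinct_Cons) (metis image_eqI)+
  have *: "level (run x u) i = level x i" "level (run (act (run x u) a) v) i = level (act (run x u) a) i"
    if "edge a = i"
    using assms(1) d that by (auto simp: w intro!: level_run_untouched)
  have app: "applicable (run x u) a" using assms(1) by (simp add: w)
  show "a = ArrR i \<Longrightarrow> level x i = Suc (level (run x w) i)"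
    using * level_act(1)[OF app] by (simp add: w)
  show "a = ArrL i \<Longrightarrow> level (run x w) i = Suc (level x i)"
    using * level_act(2)[OF app] by (simp add: w)
qed

text \<open>A crossing changes the level at its edge by one, and no later letter undoes this. The
  endpoints therefore determine which edges are crossed and in which direction, that is, the letters
  up to their order.\<close>

lemma distinct_path_labels:
  assumes "pathw x w" "moves_distinct w"
  shows "set w = {a. (\<exists>i. a = ArrR i \<and> level x i = Suc (level (run x w) i)) \<or>
    (\<exists>i. a = ArrL i \<and> level (run x w) i = Suc (level x i))}"
proof -
  have "a \<in> set w" if e: "edge a = i" "\<not> is_U a" and l: "level x i \<noteq> level (run x w) i"
    "a = ArrR i \<Longrightarrow> level x i = Suc (level (run x w) i)"
    "a = ArrL i \<Longrightarrow> level (run x w) i = Suc (level x i)" for a i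
  proof (rule ccontr)
    assume a: "a \<notin> set w"
    have "\<not> (\<forall>b\<in>set w. is_U b \<or> edge b \<noteq> i)"
      using level_run_untouched[OF assms(1), of i] l(1) by auto
    then obtain b where b: "b \<in> set w" "edge b = i" by blast
    have "\<not> is_U b" using assms(2) b by (auto simp: moves_distinct_def)
    then consider "b = a" | "a = ArrR i" "b = ArrL i" | "a = ArrL i" "b = ArrR i"
      using e b(2) by (cases a; cases b) simp_all
    then show False
    proof cases
      case 1
      then show False using a b by simp
    next
      case 2
      then show False using l(2) level_run_distinct(2)[OF assms b(1), of i] by linarith
    next
      case 3
      then show False using l(3) level_run_distinct(1)[OF assms b(1), of i] by linarith
    qed
  qed
  note converse = this
  show ?thesis
  proof (intro Set.set_eqI iffI)
    fix a assume a: "a \<in> set w"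
    then have "\<not> is_U a" using assms(2) by (simp add: moves_distinct_def)
    then obtain i where "a = ArrR i \<or> a = ArrL i" by (cases a) auto
    then show "a \<in> {a. (\<exists>i. a = ArrR i \<and> level x i = Suc (level (run x w) i)) \<or>
        (\<exists>i. a = ArrL i \<and> level (run x w) i = Suc (level x i))}"
      using level_run_distinct[OF assms a, of i] by blast
  next
    fix a assume "a \<in> {a. (\<exists>i. a = ArrR i \<and> level x i = Suc (level (run x w) i)) \<or>
        (\<exists>i. a = ArrL i \<and> level (run x w) i = Suc (level x i))}"
    then consider i where "a = ArrR i" "level x i = Suc (level (run x w) i)"
      | i where "a = ArrL i" "level (run x w) i = Suc (level x i)" by blast
    then show "a \<in> set w"
    proof cases
      case 1
      then show ?thesis by (intro converse[of a]) simp_all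
    next
      case 2
      then show ?thesis by (intro converse[of a]) simp_all
    qed
  qed
qed

text \<open>The first letter of one word also occurs in the other. Where it is applied there, its
  source is still occupied and its target still vacant, so no earlier letter has touched either, and
  it can be pulled to the front.\<close>

lemma distinct_paths_reduce:
  assumes "pathw x w" "pathw x w'" "moves_distinct w" "moves_distinct w'" "run x w = run x w'" "x \<in> verts n k"
  shows "reduces x w w'"
  using assms
proof (induction w arbitrary: x w')
  case Nil
  have "set w' = {}"
    using distinct_path_labels[OF Nil(1,3)] distinct_path_labels[OF Nil(2,4)] Nil(5) by simp
  then show ?case by (simp add: reduces_refl)
next
  case (Cons a w)
  have "set (a # w) = set w'"
    using distinct_path_labels[OF Cons.prems(1,3)] distinct_path_labels[OF Cons.prems(2,4)] Cons.prems(5) by simp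
  then obtain v v' where w': "w' = v @ a # v'" by (metis list.set_intros(1) split_list)
  have RL: "\<not> is_U a" and app: "applicable x a" using Cons.prems by (auto simp: moves_distinct_Cons)
  have dv: "moves_distinct v" "edge a \<notin> edge ` set v" "moves_distinct (v @ v')"
    using Cons.prems(4) by (auto simp: w' moves_distinct_append moves_distinct_Cons)
  have pv: "pathw x v" "applicable (run x v) a" using Cons.prems(2) by (simp_all add: w')
  note ap = applicable_src_tgt[OF app RL] and ap' = applicable_src_tgt[OF pv(2) RL]
  have "\<forall>b\<in>set v. \<not> touches b (src a)" "\<forall>b\<in>set v. \<not> touches b (tgt a)"
    using untouched_if_unchanged[OF pv(1) dv(1,2)] ap ap' by blast+
  then have comm: "\<forall>b\<in>set v. commutes b a" using dv(2) ap(3) by (metis commutes_if_not_touches image_eqI)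
  have "reduces x ((v @ [a]) @ v') ((a # v) @ v')" by (intro reduces_prefix reduces_move_front comm)
  then have *: "pathw x (a # v @ v')" "run x (a # v @ v') = run x w'"
    using Cons.prems by (auto simp: reduces_def w')
  have "reduces (act x a) w (v @ v')"
    using Cons.prems * dv(3) by (intro Cons.IH) (auto simp: moves_distinct_Cons act_verts)
  then have "reduces x (a # w) (a # v @ v')" by (rule reduces_Cons)
  also have "reduces x (a # v @ v') ((v @ [a]) @ v')"
    using reduces_prefix[OF reduces_move_back[OF comm], of x v'] by simp
  finally show ?case by (simp add: w')
qed

lemma reduces_permute_U:
  assumes "\<forall>a\<in>set us. is_U a" "mset us = mset us'"
  shows "reduces x us us'"
  using assms
proof (induction us arbitrary: x us')
  case (Cons a us)
  have "a \<in> set us'" using Cons.prems(2) by (metis list.set_intros(1) mset_eq_setD)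
  then obtain v v' where us': "us' = v @ a # v'" by (metis split_list)
  have "reduces x (a # us) (a # v @ v')"
    using Cons.prems us' by (intro reduces_Cons Cons.IH) auto
  also have "reduces x (a # v @ v') ((v @ [a]) @ v')"
    using reduces_prefix[OF reduces_move_back[of v a], of x v'] Cons.prems(1) by (simp add: commutes_def)
  finally show ?case by (simp add: us')
qed (simp add: reduces_refl)

lemma run_U: "\<forall>a\<in>set us. is_U a \<Longrightarrow> run x us = x"
  by (induction us) (auto simp: act_def)

lemma weight_U:
  assumes "\<forall>a\<in>set us. is_U a"
  shows "weight us i = 2 * count (mset us) (ArrU i)"
  using assms
proof (induction us)
  case (Cons a us)
  then show ?case by (cases a) auto
qed simp

lemma weight_distinct_moves:
  assumes "moves_distinct w"
  shows "weight w i = (if i \<in> edge ` set w then 1 else 0)"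
  using assms
proof (induction w)
  case (Cons a w)
  then show ?case by (cases a) (auto simp: moves_distinct_Cons)
qed simp

lemma parity_level: "pathw x w \<Longrightarrow> even (weight w i) \<longleftrightarrow> (even (level x i) \<longleftrightarrow> even (level (run x w) i))"
proof (induction w arbitrary: x)
  case (Cons a w)
  have "even (label_weight a i) \<longleftrightarrow> (even (level x i) \<longleftrightarrow> even (level (act x a) i))"
    using Cons.prems level_act[of x a i] by (cases a) auto
  then show ?case using Cons by auto
qed simp

text \<open>Hall's condition for assigning to every edge in \<open>T\<close> one of its endpoints in \<open>x\<close>, in the form
  in which it applies to paths.\<close>

definition supported :: "vertex \<Rightarrow> nat set \<Rightarrow> bool" where
  "supported x T \<longleftrightarrow> (\<forall>i d. {i + 1..i + d} \<subseteq> T \<longrightarrow> d \<le> card (x \<inter> {i..i + d}))"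

lemma supported_mono: "supported x T \<Longrightarrow> S \<subseteq> T \<Longrightarrow> supported x S"
  unfolding supported_def by blast

lemma U_eq: "is_U a \<Longrightarrow> a = ArrU (edge a)"
  by (cases a) auto

text \<open>\<open>e\<close> is the second edge at \<open>tgt c\<close>, and the edge of
  \<open>c\<close> is not crossed again. The element brought by \<open>c\<close> therefore rests at
  \<open>tgt c\<close> until the letter crossing \<open>e\<close>, which must move it onwards in the
  same direction.\<close>

lemma zeroes_cross_after:
  assumes c: "applicable x c" "\<not> is_U c" and w: "moves_distinct (c # w)"
    and e: "e \<in> edge ` set w" "e = tgt c \<or> e = Suc (tgt c)"
  shows "zeroes x (c # w @ v)"
proof (rule zeroesI)
  assume x: "x \<in> verts n k" and p: "pathw x (c # w @ v)"
  obtain b w1 w2 where b: "edge b = e" and w_eq: "w = w1 @ b # w2"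
    using e(1) by (metis (no_types, opaque_lifting) imageE split_list)
  note ap = applicable_src_tgt[OF c]
  have RL: "\<not> is_U b" and ne: "edge b \<noteq> edge c" and d: "moves_distinct w" "edge c \<notin> edge ` set w"
    using w by (auto simp: w_eq moves_distinct_append moves_distinct_Cons)
  have tb: "touches b (tgt c)" using e(2) b RL by (auto simp: touches_def)
  have "\<forall>a\<in>set w1. \<not> touches a (tgt c)"
    using untouched_before[of w1 b w2 "edge c" "tgt c"] d ap(7) tb by (auto simp: w_eq)
  then have "tgt c \<in> run (act x c) w1"
    using mem_run_untouched[of "act x c" w1] p ap(5) by (auto simp: w_eq)
  moreover have appb: "applicable (run (act x c) w1) b" using p by (simp add: w_eq)
  note apb = applicable_src_tgt[OF appb RL]
  ultimately have sb: "src b = tgt c" using touches_cases[OF tb apb(3)] apb(2) by auto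
  have "tgt b \<noteq> src c" using same_edge_if[OF c(2) RL ap(3) apb(3) sb] ne by auto
  moreover have "edge c \<notin> edge ` set w1" "edge b \<notin> edge ` set w1"
    using d by (auto simp: w_eq moves_distinct_append moves_distinct_Cons)
  ultimately have "zeroes x (c # w1 @ [b])"
    by (intro zeroes_advance_between c(2) RL sb ap(3) apb(3))
  from zeroes_prefix[OF this, of "w2 @ v"] show "zeroes x (c # w @ v)" by (simp add: w_eq)
qed

text \<open>The loop is opened into a move and its return. The return is prepended to
  \<open>v\<close> and only enlarges the set of edges met, so the last hypothesis applies to it
  after the first move.\<close>

lemma zeroes_loop_then:
  assumes "\<not> is_U a" "\<not> is_U b" "edge b = edge a" "src b = tgt a" "src a \<in> x" "tgt a \<notin> x"
    and "\<And>w. edge ` set v \<subseteq> edge ` set w \<Longrightarrow> zeroes (act x a) w"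
  shows "zeroes x (ArrU (edge a) # v)"
proof -
  have "reduces x ([ArrU (edge a)] @ v) ([a, b] @ v)"
    by (intro reduces_prefix reduces_loop assms)
  moreover have "zeroes (act x a) (b # v)" by (rule assms(7)) auto
  then have "zeroes x (a # b # v)" by (rule zeroes_Cons)
  ultimately show ?thesis using zeroes_reduces by simp
qed

text \<open>In a shortest violation of Hall's condition the interval is empty at both ends and full in
  between. The first letter acting there shortens the interval, unless it moves
  an outer element onto an end of the interval; then the adjacent edge, which occurs in the word,
  is crossed afterwards in the same direction, or else a loop across it can be moved to the front.\<close>

lemma zeroes_unsupported_aux:
  assumes "{i + 1..i + d} \<subseteq> edge ` set w" "card (x \<inter> {i..i + d}) < d"
  shows "zeroes x w"
  using assms
proof (induction d arbitrary: i w x rule: less_induct)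
  case (less d)
  have dpos: "d \<ge> 1" using less.prems by simp
  have "{i + 1 + 1..i + 1 + (d - 1)} \<subseteq> {i + 1..i + d}" "{i + 1..i + (d - 1)} \<subseteq> {i + 1..i + d}"
    using dpos by auto
  then have s1: "{i + 1 + 1..i + 1 + (d - 1)} \<subseteq> edge ` set w" and s2: "{i + 1..i + (d - 1)} \<subseteq> edge ` set w"
    using less.prems(1) by blast+
  have shorter: "zeroes y v" if "d \<ge> 2" "{j + 1..j + (d - 1)} \<subseteq> edge ` set v"
    "card (y \<inter> {j..j + (d - 1)}) < d - 1" for j v y
    using that by (intro less.IH[of "d - 1" j v y]) auto
  show ?case
  proof (cases "x \<inter> {i..i + d} = {i + 1..<i + d}")
    case False
    \<comment> \<open>Any other occupation yields a shorter violation: dropping an occupied end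
      loses one element along with one edge, and if the ends are vacant and an inner position is
      vacant as well, fewer than \<open>d - 1\<close> elements are left.\<close>
    have "i \<in> x \<or> i + d \<in> x \<or> x \<inter> {i..i + d} \<subset> {i + 1..<i + d}"
    proof (rule ccontr)
      assume neg: "\<not> ?thesis"
      have "x \<inter> {i..i + d} \<subseteq> {i + 1..<i + d}"
      proof
        fix p assume p: "p \<in> x \<inter> {i..i + d}"
        then have "p \<noteq> i" "p \<noteq> i + d" using neg by blast+
        then show "p \<in> {i + 1..<i + d}" using p by simp
      qed
      then show False using False neg by blast
    qed
    moreover have "zeroes x w" if "i \<in> x"
    proof (rule shorter[of "i + 1"])
      have "x \<inter> {i..i + d} = insert i (x \<inter> {i + 1..i + 1 + (d - 1)})" using that dpos by auto
      then have "card (x \<inter> {i..i + d}) = Suc (card (x \<inter> {i + 1..i + 1 + (d - 1)}))" by simp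
      then show "card (x \<inter> {i + 1..i + 1 + (d - 1)}) < d - 1" "d \<ge> 2" using less.prems(2) by auto
    qed (use s1 s2 in simp)
    moreover have "zeroes x w" if "i + d \<in> x"
    proof (rule shorter[of i])
      have "x \<inter> {i..i + d} = insert (i + d) (x \<inter> {i..i + (d - 1)})" using that dpos by auto
      moreover have "i + d \<notin> x \<inter> {i..i + (d - 1)}" using dpos by auto
      ultimately have "card (x \<inter> {i..i + d}) = Suc (card (x \<inter> {i..i + (d - 1)}))" by simp
      then show "card (x \<inter> {i..i + (d - 1)}) < d - 1" "d \<ge> 2" using less.prems(2) by auto
    qed (use s1 s2 in simp)
    moreover have "zeroes x w" if s: "x \<inter> {i..i + d} \<subset> {i + 1..<i + d}"
    proof (rule shorter[of i])
      have c: "card (x \<inter> {i..i + d}) < d - 1" using psubset_card_mono[OF _ s] by simp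
      then show "d \<ge> 2" by simp
      have "card (x \<inter> {i..i + (d - 1)}) \<le> card (x \<inter> {i..i + d})" by (intro card_mono) auto
      then show "card (x \<inter> {i..i + (d - 1)}) < d - 1" using c by simp
    qed (use s1 s2 in simp)
    ultimately show ?thesis by blast
  next
    case True
    \<comment> \<open>The loop at the left end is opened as \<open>L\<close> followed by
      \<open>R\<close>. The letter \<open>L\<close> takes the element at \<open>i + 1\<close> out to
      \<open>i\<close> and leaves \<open>d - 2\<close> elements for the remaining
      \<open>d - 1\<close> edges. For \<open>d = 1\<close> both ends of the edge are vacant, and the
      loop itself is a relation.\<close>
    have loop_left: "zeroes y (ArrU (i + 1) # v)"
      if y: "y \<inter> {i..i + d} = {i + 1..<i + d}" and sub: "d \<ge> 2 \<Longrightarrow> {i + 2..i + d} \<subseteq> edge ` set v" for y v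
    proof (cases "d = 1")
      case True
      then have "y \<inter> {i + 1 - 1, i + 1} = {}" using y by auto
      then have "zeroes y [ArrU (i + 1)]" by (rule zeroes_U_at_empty)
      then show ?thesis using zeroes_prefix[of y "[ArrU (i + 1)]" v] by simp
    next
      case False
      then have d2: "d \<ge> 2" using dpos by simp
      have "p \<in> y \<longleftrightarrow> p \<in> {i + 1..<i + d}" if "p \<in> {i..i + d}" for p using y that by blast
      from this[of i] this[of "i + 1"] this[of "i + d"]
      have mem: "i \<notin> y" "i + 1 \<in> y" "i + d \<notin> y" using d2 by auto
      have "zeroes y (ArrU (edge (ArrL (i + 1))) # v)"
      proof (rule zeroes_loop_then[of _ "ArrR (i + 1)"])
        fix w' assume w': "edge ` set v \<subseteq> edge ` set w'"
        show "zeroes (act y (ArrL (i + 1))) w'"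
        proof (rule shorter[of "i + 1"])
          have "act y (ArrL (i + 1)) \<inter> {i + 1..i + 1 + (d - 1)} \<subseteq> {i + 2..<i + d}"
          proof
            fix p assume p: "p \<in> act y (ArrL (i + 1)) \<inter> {i + 1..i + 1 + (d - 1)}"
            then have "p \<in> y \<inter> {i..i + d}" "p \<noteq> i + 1" using d2 by (auto simp: act_def)
            then show "p \<in> {i + 2..<i + d}" unfolding y by auto
          qed
          then have "card (act y (ArrL (i + 1)) \<inter> {i + 1..i + 1 + (d - 1)}) \<le> card {i + 2..<i + d}"
            by (intro card_mono) auto
          then show "card (act y (ArrL (i + 1)) \<inter> {i + 1..i + 1 + (d - 1)}) < d - 1" using d2 by simp
          show "{i + 1 + 1..i + 1 + (d - 1)} \<subseteq> edge ` set w'" using sub[OF d2] w' d2 by auto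
        qed (rule d2)
      qed (use mem in auto)
      then show ?thesis by simp
    qed
    have loop_right: "zeroes y (ArrU (i + d) # v)"
      if y: "y \<inter> {i..i + d} = {i + 1..<i + d}" and sub: "d \<ge> 2 \<Longrightarrow> {i + 1..i + (d - 1)} \<subseteq> edge ` set v" for y v
    proof (cases "d = 1")
      case True
      then show ?thesis using loop_left[OF y, of v] by simp
    next
      case False
      then have d2: "d \<ge> 2" using dpos by simp
      have "p \<in> y \<longleftrightarrow> p \<in> {i + 1..<i + d}" if "p \<in> {i..i + d}" for p using y that by blast
      from this[of i] this[of "i + d - 1"] this[of "i + d"]
      have mem: "i \<notin> y" "i + d - 1 \<in> y" "i + d \<notin> y" using d2 by auto
      have "zeroes y (ArrU (edge (ArrR (i + d))) # v)"
      proof (rule zeroes_loop_then[of _ "ArrL (i + d)"])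
        fix w' assume w': "edge ` set v \<subseteq> edge ` set w'"
        show "zeroes (act y (ArrR (i + d))) w'"
        proof (rule shorter[of i])
          have "act y (ArrR (i + d)) \<inter> {i..i + (d - 1)} \<subseteq> {i + 1..<i + d - 1}"
          proof
            fix p assume p: "p \<in> act y (ArrR (i + d)) \<inter> {i..i + (d - 1)}"
            then have "p \<in> y \<inter> {i..i + d}" "p \<noteq> i + d - 1" using d2 by (auto simp: act_def)
            then show "p \<in> {i + 1..<i + d - 1}" unfolding y by auto
          qed
          then have "card (act y (ArrR (i + d)) \<inter> {i..i + (d - 1)}) \<le> card {i + 1..<i + d - 1}"
            by (intro card_mono) auto
          then show "card (act y (ArrR (i + d)) \<inter> {i..i + (d - 1)}) < d - 1" using d2 by simp
          show "{i + 1..i + (d - 1)} \<subseteq> edge ` set w'" using sub[OF d2] w' by auto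
        qed (rule d2)
      qed (use mem d2 in auto)
      then show ?thesis by simp
    qed
    \<comment> \<open>Loops commute with all letters, so the induction runs over the moves only. A
      move that avoids the positions of the interval leaves its occupation as it is.\<close>
    have normal: "zeroes y (w' @ us)"
      if "y \<inter> {i..i + d} = {i + 1..<i + d}" "moves_distinct w'" "\<forall>a\<in>set us. is_U a"
        "{i + 1..i + d} \<subseteq> edge ` set (w' @ us)" for y w' us
      using that
    proof (induction w' arbitrary: y)
      case Nil
      have "i + 1 \<in> {i + 1..i + d}" using dpos by simp
      then have "i + 1 \<in> edge ` set us" using Nil(4) by (simp add: subset_iff)
      then obtain a where "a \<in> set us" "edge a = i + 1" by (metis imageE)
      then have "ArrU (i + 1) \<in> set us" using Nil(3) U_eq[of a] by simp
      then obtain u v where us: "us = u @ ArrU (i + 1) # v" by (metis split_list)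
      have "reduces y (u @ [ArrU (i + 1)]) (ArrU (i + 1) # u)"
        by (intro reduces_move_front) (simp add: commutes_def)
      then have "reduces y ((u @ [ArrU (i + 1)]) @ v) ((ArrU (i + 1) # u) @ v)" by (rule reduces_prefix)
      moreover have "zeroes y (ArrU (i + 1) # u @ v)"
      proof (rule loop_left[OF Nil(1)])
        show "{i + 2..i + d} \<subseteq> edge ` set (u @ v)"
        proof
          fix e assume "e \<in> {i + 2..i + d}"
          then have "e \<in> edge ` set us" "e \<noteq> i + 1" using Nil(4) by auto
          then show "e \<in> edge ` set (u @ v)" by (auto simp: us)
        qed
      qed
      ultimately show ?case using zeroes_reduces by (simp add: us)
    next
      case (Cons c w')
      have RL: "\<not> is_U c" using Cons.prems(2) by (simp add: moves_distinct_Cons)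
      show ?case
      proof (rule zeroesI)
        assume y_vert: "y \<in> verts n k" and p: "pathw y ((c # w') @ us)"
        then have app: "applicable y c" by simp
        note ap = applicable_src_tgt[OF app RL]
        have y: "y \<inter> {i..i + d} = {i + 1..<i + d}" by (rule Cons.prems(1))
        then have mem: "p \<in> y \<longleftrightarrow> p \<in> {i + 1..<i + d}" if "p \<in> {i..i + d}" for p using that by blast
        have sup: "e \<in> edge ` set w' \<or> ArrU e \<in> set us" if "e \<in> {i + 1..i + d}" "e \<noteq> edge c" for e
        proof -
          have "e \<in> edge ` set w' \<or> (\<exists>a\<in>set us. edge a = e)" using Cons.prems(4) that by auto
          moreover have "a = ArrU e" if "a \<in> set us" "edge a = e" for a
            using Cons.prems(3) that U_eq[of a] by simp
          ultimately show ?thesis by metis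
        qed
        have after: "{i + 1..i + d} - {edge c} \<subseteq> edge ` set (w' @ us)" using Cons.prems(4) by auto
        consider (inside) "edge c \<in> {i + 1..i + d}" | (left) "edge c \<notin> {i + 1..i + d}" "tgt c = i"
          | (right) "edge c \<notin> {i + 1..i + d}" "tgt c = i + d"
          | (out) "edge c \<notin> {i + 1..i + d}" "tgt c \<noteq> i" "tgt c \<noteq> i + d" by blast
        then show "zeroes y ((c # w') @ us)"
        proof cases
          \<comment> \<open>Only the two end positions of the interval are vacant, so a move across
            one of its edges goes outward onto an end. What remains is a shorter violation.\<close>
          case inside
          show ?thesis
          proof (cases c)
            case (ArrR e)
            have e: "e - 1 \<in> y" "e \<notin> y" "e \<ge> 1" "e \<in> {i + 1..i + d}" using ap inside ArrR by auto
            have "e \<notin> {i + 1..<i + d}" "e - 1 \<in> {i + 1..<i + d}" using mem[of e] mem[of "e - 1"] e by auto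
            then have e_eq: "e = i + d" and d2: "d \<ge> 2" using e by auto
            have "zeroes (act y c) (w' @ us)"
            proof (rule shorter[of i])
              have "act y c \<inter> {i..i + (d - 1)} \<subseteq> {i + 1..<i + d - 1}"
              proof
                fix q assume q: "q \<in> act y c \<inter> {i..i + (d - 1)}"
                then have "q \<in> y \<inter> {i..i + d}" "q \<noteq> i + d - 1" using d2 by (auto simp: act_def ArrR e_eq)
                then show "q \<in> {i + 1..<i + d - 1}" unfolding y by auto
              qed
              then have "card (act y c \<inter> {i..i + (d - 1)}) \<le> card {i + 1..<i + d - 1}"
                by (intro card_mono) auto
              then show "card (act y c \<inter> {i..i + (d - 1)}) < d - 1" using d2 by simp
              show "{i + 1..i + (d - 1)} \<subseteq> edge ` set (w' @ us)"
              proof -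
                have "{i + 1..i + (d - 1)} \<subseteq> {i + 1..i + d} - {edge c}" using d2 by (auto simp: ArrR e_eq)
                then show ?thesis using after by blast
              qed
            qed (rule d2)
            then show ?thesis using zeroes_Cons by simp
          next
            case (ArrL e)
            have e: "e - 1 \<notin> y" "e \<in> y" "e \<ge> 1" "e \<in> {i + 1..i + d}" using ap inside ArrL by auto
            have "e - 1 \<notin> {i + 1..<i + d}" "e \<in> {i + 1..<i + d}" using mem[of e] mem[of "e - 1"] e by auto
            then have e_eq: "e = i + 1" and d2: "d \<ge> 2" using e by auto
            have "zeroes (act y c) (w' @ us)"
            proof (rule shorter[of "i + 1"])
              have "act y c \<inter> {i + 1..i + 1 + (d - 1)} \<subseteq> {i + 2..<i + d}"
              proof
                fix q assume q: "q \<in> act y c \<inter> {i + 1..i + 1 + (d - 1)}"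
                then have "q \<in> y \<inter> {i..i + d}" "q \<noteq> i + 1" using d2 by (auto simp: act_def ArrL e_eq)
                then show "q \<in> {i + 2..<i + d}" unfolding y by auto
              qed
              then have "card (act y c \<inter> {i + 1..i + 1 + (d - 1)}) \<le> card {i + 2..<i + d}"
                by (intro card_mono) auto
              then show "card (act y c \<inter> {i + 1..i + 1 + (d - 1)}) < d - 1" using d2 by simp
              show "{i + 1 + 1..i + 1 + (d - 1)} \<subseteq> edge ` set (w' @ us)"
              proof -
                have "{i + 1 + 1..i + 1 + (d - 1)} \<subseteq> {i + 1..i + d} - {edge c}" using d2 by (auto simp: ArrL e_eq)
                then show ?thesis using after by blast
              qed
            qed (rule d2)
            then show ?thesis using zeroes_Cons by simp
          qed (use RL in simp)
        next
          case left
          have "i + 1 \<in> edge ` set w' \<or> ArrU (i + 1) \<in> set us" using sup[of "i + 1"] left dpos by auto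
          then show ?thesis
          proof
            assume "i + 1 \<in> edge ` set w'"
            then have "zeroes y (c # w' @ us)"
              using left Cons.prems(2) by (intro zeroes_cross_after[OF app RL, where e="i + 1"]) auto
            then show ?thesis by simp
          next
            assume "ArrU (i + 1) \<in> set us"
            then obtain u v where us: "us = u @ ArrU (i + 1) # v" by (metis split_list)
            have "reduces y (((c # w') @ u) @ [ArrU (i + 1)]) (ArrU (i + 1) # (c # w') @ u)"
              by (intro reduces_move_front) (simp add: commutes_def)
            then have "reduces y ((((c # w') @ u) @ [ArrU (i + 1)]) @ v) ((ArrU (i + 1) # (c # w') @ u) @ v)"
              by (rule reduces_prefix)
            moreover have "zeroes y (ArrU (i + 1) # ((c # w') @ u @ v))"
            proof (rule loop_left[OF y])
              show "{i + 2..i + d} \<subseteq> edge ` set ((c # w') @ u @ v)"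
              proof
                fix e assume "e \<in> {i + 2..i + d}"
                then have "e \<in> {i + 1..i + d}" "e \<noteq> i + 1" by auto
                then have "e \<in> edge ` set ((c # w') @ us)" "e \<noteq> i + 1" using Cons.prems(4) by blast+
                then show "e \<in> edge ` set ((c # w') @ u @ v)" by (auto simp: us)
              qed
            qed
            ultimately show ?thesis using zeroes_reduces by (simp add: us)
          qed
        next
          case right
          have "i + d \<in> edge ` set w' \<or> ArrU (i + d) \<in> set us" using sup[of "i + d"] right dpos by auto
          then show ?thesis
          proof
            assume "i + d \<in> edge ` set w'"
            then have "zeroes y (c # w' @ us)"
              using right Cons.prems(2) by (intro zeroes_cross_after[OF app RL, where e="i + d"]) auto
            then show ?thesis by simp
          next
            assume "ArrU (i + d) \<in> set us"
            then obtain u v where us: "us = u @ ArrU (i + d) # v" by (metis split_list)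
            have "reduces y (((c # w') @ u) @ [ArrU (i + d)]) (ArrU (i + d) # (c # w') @ u)"
              by (intro reduces_move_front) (simp add: commutes_def)
            then have "reduces y ((((c # w') @ u) @ [ArrU (i + d)]) @ v) ((ArrU (i + d) # (c # w') @ u) @ v)"
              by (rule reduces_prefix)
            moreover have "zeroes y (ArrU (i + d) # ((c # w') @ u @ v))"
            proof (rule loop_right[OF y])
              show "{i + 1..i + (d - 1)} \<subseteq> edge ` set ((c # w') @ u @ v)" if "d \<ge> 2"
              proof
                fix e assume "e \<in> {i + 1..i + (d - 1)}"
                then have "e \<in> {i + 1..i + d}" "e \<noteq> i + d" using that by auto
                then have "e \<in> edge ` set ((c # w') @ us)" "e \<noteq> i + d" using Cons.prems(4) by blast+
                then show "e \<in> edge ` set ((c # w') @ u @ v)" by (auto simp: us)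
              qed
            qed
            ultimately show ?thesis using zeroes_reduces by (simp add: us)
          qed
        next
          case out
          have "src c \<notin> {i..i + d}"
          proof
            assume s: "src c \<in> {i..i + d}"
            then have "src c \<in> {i + 1..<i + d}" using mem ap(1) by blast
            then show False using out ap(6) by auto
          qed
          moreover have "tgt c \<notin> {i..i + d}"
          proof
            assume "tgt c \<in> {i..i + d}"
            then have "tgt c \<in> {i + 1..<i + d}" using out by auto
            then show False using out(1) ap(7) by auto
          qed
          ultimately have "act y c \<inter> {i..i + d} = {i + 1..<i + d}"
            using y RL by (auto simp: act_def)
          then have "zeroes (act y c) (w' @ us)"
            using Cons.prems out by (intro Cons.IH) (auto simp: moves_distinct_Cons)
          then show ?thesis using zeroes_Cons by simp
        qed
      qed
    qed
    from normal_form[of x w] show ?thesis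
    proof
      assume "\<exists>w' us. reduces x w (w' @ us) \<and> moves_distinct w' \<and> (\<forall>a\<in>set us. is_U a) \<and>
        (\<forall>i. weight (w' @ us) i = weight w i)"
      then obtain w' us where w': "reduces x w (w' @ us)" "moves_distinct w'" "\<forall>a\<in>set us. is_U a"
        "\<And>i. weight (w' @ us) i = weight w i" by blast
      have "edge ` set (w' @ us) = edge ` set w"
        using w'(4) weight_pos_iff[of "w' @ us"] weight_pos_iff[of w] by (intro Set.set_eqI) metis
      then show ?thesis using normal[OF True w'(2,3)] less.prems(1) zeroes_reduces[OF w'(1)] by metis
    qed
  qed
qed

lemma zeroes_unsupported:
  assumes "\<not> supported x (edge ` set w)"
  shows "zeroes x w"
proof -
  obtain i d where "{i + 1..i + d} \<subseteq> edge ` set w" "card (x \<inter> {i..i + d}) < d"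
    using assms unfolding supported_def by (auto simp: not_le)
  then show ?thesis by (rule zeroes_unsupported_aux)
qed

text \<open>An interval loses an element only if the moved element crosses its boundary, that is, if
  the crossed edge \<open>e\<close> is adjacent to the interval. As \<open>e\<close> lies in
  \<open>T\<close>, the condition before the move also holds for the interval extended by
  \<open>e\<close>, and it leaves one element to spare. The move back gives the other
  implication.\<close>

lemma supported_act:
  assumes "applicable x a" "finite x" "edge a \<in> T"
  shows "supported (act x a) T \<longleftrightarrow> supported x T"
proof (cases "is_U a")
  case True
  then show ?thesis by (simp add: act_def)
next
  case False
  note ap = applicable_src_tgt[OF assms(1) False]
  define e where "e = edge a"
  have e: "e \<ge> 1" "{src a, tgt a} = {e - 1, e}" "e \<in> T"
    using ap assms(3) by (auto simp: e_def)
  have swap: "supported z T"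
    if y: "supported y T" and z: "z = insert q (y - {p})" and pq: "p \<in> y" "q \<notin> y" "{p, q} = {e - 1, e}" "finite y"
    for y z p q
    unfolding supported_def
  proof (intro allI impI)
    fix i d assume sub: "{i + 1..i + d} \<subseteq> T"
    let ?J = "{i..i + d}"
    show "d \<le> card (z \<inter> ?J)"
    proof (cases "p \<in> ?J \<and> q \<notin> ?J")
      case True
      have ge: "i + d + 1 = e \<or> i = e"
        using True pq(3) e(1) by (auto simp: doubleton_eq_iff)
      obtain i' where sub': "{i' + 1..i' + (d + 1)} \<subseteq> T" and J': "{i'..i' + (d + 1)} = insert q ?J"
      proof (cases "i = e")
        case True
        have "q = e - 1" using True \<open>p \<in> ?J \<and> q \<notin> ?J\<close> pq(3) e(1) by (auto simp: doubleton_eq_iff)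
        moreover have "{e - 1 + 1..e - 1 + (d + 1)} = insert e {i + 1..i + d}" using True e(1) by auto
        moreover have "{e - 1..e - 1 + (d + 1)} = insert (e - 1) ?J" using True e(1) by auto
        ultimately show ?thesis using that[of "e - 1"] sub e(3) by auto
      next
        case False
        then have i: "i + d + 1 = e" using ge by simp
        then have "q = e" using \<open>p \<in> ?J \<and> q \<notin> ?J\<close> pq(3) e(1) by (auto simp: doubleton_eq_iff)
        moreover have "{i + 1..i + (d + 1)} = insert e {i + 1..i + d}" using i by auto
        moreover have "{i..i + (d + 1)} = insert e ?J" using i by auto
        ultimately show ?thesis using that[of i] sub e(3) by auto
      qed
      have "d + 1 \<le> card (y \<inter> insert q ?J)" using y sub' unfolding supported_def J'[symmetric] by blast
      also have "y \<inter> insert q ?J = insert p (z \<inter> ?J)" using True pq z by auto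
      also have "card \<dots> \<le> card (z \<inter> ?J) + 1" by (simp add: card_insert_if)
      finally show ?thesis by simp
    next
      case False
      have "d \<le> card (y \<inter> ?J)" using y sub by (auto simp: supported_def)
      also have "\<dots> \<le> card (z \<inter> ?J)"
      proof (cases "p \<in> ?J")
        case True
        then have "z \<inter> ?J = insert q (y \<inter> ?J - {p})" using False z by auto
        moreover have "card (insert q (y \<inter> ?J - {p})) = Suc (card (y \<inter> ?J - {p}))"
          using pq by (intro card_insert_disjoint) auto
        moreover have "\<dots> = card (y \<inter> ?J)"
          using pq True by (intro card_Suc_Diff1) auto
        ultimately show ?thesis by simp
      next
        case False
        then have "y \<inter> ?J \<subseteq> z \<inter> ?J" using z by auto
        then show ?thesis by (intro card_mono) auto
      qed
      finally show ?thesis .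
    qed
  qed
  have a1: "act x a = insert (tgt a) (x - {src a})" using False by (simp add: act_def)
  then have a2: "x = insert (src a) (act x a - {tgt a})" using ap by auto
  have "finite (act x a)" using a1 assms(2) by simp
  then show ?thesis
    using swap[OF _ a1 ap(1,2) e(2) assms(2)] swap[OF _ a2 ap(5,4)] e(2) by (auto simp: insert_commute)
qed

lemma finite_vertex: "x \<in> verts n k \<Longrightarrow> finite x"
  by (auto simp: verts_def intro: finite_subset)

lemma supported_run:
  assumes "x \<in> verts n k" "pathw x w" "edge ` set w \<subseteq> T"
  shows "supported (run x w) T \<longleftrightarrow> supported x T"
  using assms by (induction w arbitrary: x) (auto simp: supported_act finite_vertex act_verts)

text \<open>Each vanishing word violates Hall's condition: two consecutive moves meet two edges with
  a single element at their three endpoints, and a vanishing loop meets one edge with no element at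
  all.\<close>

lemma unsupported_zero_word:
  assumes "zero_word x w" "pathw x w"
  shows "\<not> supported x (edge ` set w)"
  using assms
proof cases
  case (RR i)
  then have a: "i - 1 \<in> x" "i \<notin> x" "Suc i \<notin> x" "i \<ge> 1" using assms(2) by (auto simp: applicable_def act_def)
  have J: "{i - 1..i - 1 + 2} = {i - 1, i, Suc i}" using a(4) by auto
  have "x \<inter> {i - 1..i - 1 + 2} \<subseteq> {i - 1}" unfolding J using a by blast
  then have "card (x \<inter> {i - 1..i - 1 + 2}) \<le> card {i - 1}" by (intro card_mono) auto
  moreover have "{i - 1 + 1..i - 1 + 2} \<subseteq> edge ` set w" using a RR by auto
  ultimately show ?thesis unfolding supported_def
    by (intro notI) (drule spec[of _ "i - 1"], drule spec[of _ 2], simp)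
next
  case (LL i)
  then have a: "i - 1 \<notin> x" "i \<notin> x" "Suc i \<in> x" "i \<ge> 1" using assms(2) by (auto simp: applicable_def act_def)
  have J: "{i - 1..i - 1 + 2} = {i - 1, i, Suc i}" using a(4) by auto
  have "x \<inter> {i - 1..i - 1 + 2} \<subseteq> {Suc i}" unfolding J using a by blast
  then have "card (x \<inter> {i - 1..i - 1 + 2}) \<le> card {Suc i}" by (intro card_mono) auto
  moreover have "{i - 1 + 1..i - 1 + 2} \<subseteq> edge ` set w" using a LL by auto
  ultimately show ?thesis unfolding supported_def
    by (intro notI) (drule spec[of _ "i - 1"], drule spec[of _ 2], simp)
next
  case (U i)
  have "i \<ge> 1" using assms(2) U by (auto simp: applicable_def)
  then have "{i - 1..i - 1 + 1} = {i - 1, i}" "{i - 1 + 1..i - 1 + 1} = {i}" by auto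
  then show ?thesis unfolding supported_def using U
    by (intro notI) (drule spec[of _ "i - 1"], drule spec[of _ 1], simp)
qed

end

section \<open>The ideal of relations\<close>

definition path_type :: "qpath \<Rightarrow> vertex \<times> (nat \<Rightarrow> nat) \<times> vertex" where
  "path_type p = (fst p, weight (fst (snd p)), snd (snd p))"

text \<open>Paths of equal type turn out to be congruent modulo the relations, so for supported
  weights these sums are the coordinates of the class of \<open>a\<close>.\<close>

definition type_coeff :: "path_sum \<Rightarrow> vertex \<times> (nat \<Rightarrow> nat) \<times> vertex \<Rightarrow> int" where
  "type_coeff a t = (\<Sum>p\<in>Poly_Mapping.keys a. if path_type p = t then Poly_Mapping.lookup a p else 0)"

lemma type_coeff_superset:
  assumes "finite A" "Poly_Mapping.keys a \<subseteq> A"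
  shows "type_coeff a t = (\<Sum>p\<in>A. if path_type p = t then Poly_Mapping.lookup a p else 0)"
  unfolding type_coeff_def using assms by (intro sum.mono_neutral_left) (auto simp: in_keys_iff)

lemma type_coeff_0 [simp]: "type_coeff 0 t = 0"
  by (simp add: type_coeff_def)

lemma type_coeff_add: "type_coeff (a + b) t = type_coeff a t + type_coeff b t"
proof -
  let ?A = "Poly_Mapping.keys a \<union> Poly_Mapping.keys b"
  have "Poly_Mapping.keys (a + b) \<subseteq> ?A" by (rule Poly_Mapping.keys_add)
  then show ?thesis
    by (simp only: type_coeff_superset[of ?A] finite_UnI finite_keys Un_upper1 Un_upper2 sum.distrib[symmetric])
      (intro sum.cong refl, simp add: lookup_add)
qed

lemma type_coeff_uminus: "type_coeff (- a) t = - type_coeff a t"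
  using type_coeff_add[of a "- a" t] by simp

lemma type_coeff_diff: "type_coeff (a - b) t = type_coeff a t - type_coeff b t"
  using type_coeff_add[of a "- b" t] by (simp add: type_coeff_uminus)

lemma type_coeff_single: "type_coeff (Poly_Mapping.single p c) t = (if path_type p = t then c else 0)"
  by (simp add: type_coeff_superset[of "{p}"])

lemma type_coeff_sum: "type_coeff (sum f A) t = (\<Sum>i\<in>A. type_coeff (f i) t)"
  by (induction A rule: infinite_finite_induct) (simp_all add: type_coeff_add)

lemma weight_append: "weight (u @ w) = (\<lambda>i. weight u i + weight w i)"
  by (rule ext) simp

lemma single_sum: "Poly_Mapping.single p (sum f A) = (\<Sum>i\<in>A. Poly_Mapping.single p (f i))"
  by (induction A rule: infinite_finite_induct) (simp_all add: single_add)

lemma nat_weight_diff: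
  fixes m u w :: "'a \<Rightarrow> nat"
  shows "(\<forall>i. u i + w i = m i) \<longleftrightarrow> (\<forall>i. u i \<le> m i) \<and> (\<forall>i. w i = m i - u i)"
proof -
  have "u i + w i = m i \<longleftrightarrow> u i \<le> m i \<and> w i = m i - u i" for i by linarith
  then show ?thesis by blast
qed

lemma type_coeff_mult_single_left:
  "type_coeff (path_sum_mult (Poly_Mapping.single (x', u, y') c) b) (x, m, z) =
    (if x' = x \<and> (\<forall>i. weight u i \<le> m i) then c * type_coeff b (y', \<lambda>i. m i - weight u i, z) else 0)"
proof (induction b rule: poly_mapping_additive_induct)
  case (single q d)
  obtain y'' w z' where q: "q = (y'', w, z')" by (metis prod.exhaust)
  have "weight (u @ w) = m \<longleftrightarrow> (\<forall>i. weight u i \<le> m i) \<and> weight w = (\<lambda>i. m i - weight u i)"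
    using nat_weight_diff[of "weight u" "weight w" m] by (simp add: weight_append fun_eq_iff)
  then show ?case
    by (cases "y' = y''")
      (simp_all add: q path_sum_mult_single path_comp_def type_coeff_single path_type_def)
qed (auto simp: path_sum_mult_add_right type_coeff_add distrib_left)

lemma type_coeff_mult_single_right:
  "type_coeff (path_sum_mult b (Poly_Mapping.single (y', u, z') c)) (x, m, z) =
    (if z' = z \<and> (\<forall>i. weight u i \<le> m i) then c * type_coeff b (x, \<lambda>i. m i - weight u i, y') else 0)"
proof (induction b rule: poly_mapping_additive_induct)
  case (single q d)
  obtain x' w y'' where q: "q = (x', w, y'')" by (metis prod.exhaust)
  have "weight (w @ u) = m \<longleftrightarrow> (\<forall>i. weight u i \<le> m i) \<and> weight w = (\<lambda>i. m i - weight u i)"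
    using nat_weight_diff[of "weight u" "weight w" m] by (simp add: weight_append fun_eq_iff add.commute)
  then show ?case
    by (cases "y'' = y'")
      (simp_all add: q path_sum_mult_single path_comp_def type_coeff_single path_type_def mult.commute)
qed (auto simp: path_sum_mult_add_left type_coeff_add distrib_left)

lemma equal_words_weight: "equal_words v w \<Longrightarrow> weight v = weight w"
  by (induction rule: equal_words.induct) (auto simp: fun_eq_iff)

lemma idealI_uminus:
  assumes "J \<subseteq> carrier R" "ring R" "\<zero>\<^bsub>R\<^esub> \<in> J"
    and "\<And>a b. a \<in> J \<Longrightarrow> b \<in> J \<Longrightarrow> a \<oplus>\<^bsub>R\<^esub> b \<in> J"
    and "\<And>a. a \<in> J \<Longrightarrow> \<ominus>\<^bsub>R\<^esub> a \<in> J"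
    and "\<And>a r. a \<in> J \<Longrightarrow> r \<in> carrier R \<Longrightarrow> r \<otimes>\<^bsub>R\<^esub> a \<in> J"
    and "\<And>a r. a \<in> J \<Longrightarrow> r \<in> carrier R \<Longrightarrow> a \<otimes>\<^bsub>R\<^esub> r \<in> J"
  shows "ideal J R"
proof (rule idealI)
  show "subgroup J (add_monoid R)"
    using assms by (intro subgroup.intro) (auto simp: a_inv_def)
qed (use assms in auto)

context osz
begin

lemma a_inv_path_algebra:
  assumes a: "a \<in> carrier (path_algebra n k)"
  shows "\<ominus>\<^bsub>path_algebra n k\<^esub> a = - a"
proof -
  interpret P: ring "path_algebra n k" by (rule ring_path_algebra)
  have "- a \<in> carrier (path_algebra n k)" using a by (simp add: path_algebra_def)
  moreover have "- a \<oplus>\<^bsub>path_algebra n k\<^esub> a = \<zero>\<^bsub>path_algebra n k\<^esub>" by (simp add: path_algebra_def)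
  ultimately show ?thesis using a P.minus_equality by blast
qed

lemma path_algebra_ops:
  "monoid.mult (path_algebra n k) = path_sum_mult" "monoid.one (path_algebra n k) = idem_sum (verts n k)"
  "ring.zero (path_algebra n k) = 0" "ring.add (path_algebra n k) = (+)"
  by (simp_all add: path_algebra_def)

definition vanishing :: "path_sum set" where
  "vanishing = {a \<in> carrier (path_algebra n k).
     \<forall>x m y. supported x {i. 0 < m i} \<longrightarrow> type_coeff a (x, m, y) = 0}"

lemma vanishing_sum:
  assumes "\<And>i. i \<in> A \<Longrightarrow> f i \<in> vanishing"
  shows "sum f A \<in> vanishing"
proof -
  interpret P: ring "path_algebra n k" by (rule ring_path_algebra)
  have "0 \<in> carrier (path_algebra n k)" using P.zero_closed by (simp only: path_algebra_ops)
  moreover have "a + b \<in> carrier (path_algebra n k)"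
    if "a \<in> carrier (path_algebra n k)" "b \<in> carrier (path_algebra n k)" for a b
    using P.a_closed[OF that] by (simp only: path_algebra_ops)
  ultimately have "sum f A \<in> carrier (path_algebra n k)"
    using assms by (induction A rule: infinite_finite_induct) (auto simp: vanishing_def)
  moreover have "type_coeff (sum f A) (x, m, y) = 0" if "supported x {i. 0 < m i}" for x m y
    unfolding type_coeff_sum using assms that by (intro sum.neutral) (auto simp: vanishing_def)
  ultimately show ?thesis by (simp add: vanishing_def)
qed

text \<open>Multiplying by a path shifts weights by the weight of that path. On the left the source
  changes too, but the edges crossed belong to the support of the total weight, so
  \<open>supported_run\<close> carries Hall's condition along the path. On the right the source
  stays and the support can only shrink.\<close>

lemma ideal_vanishing: "ideal vanishing (path_algebra n k)"
proof -
  interpret P: ring "path_algebra n k" by (rule ring_path_algebra)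
  have single_path: "is_path n k p" if "a \<in> carrier (path_algebra n k)" "p \<in> Poly_Mapping.keys a" for a p
    using that by (simp add: path_algebra_def)
  have single_carrier: "Poly_Mapping.single p c \<in> carrier (path_algebra n k)" if "is_path n k p" for p c
    using that by (simp add: path_algebra_def)
  have left: "path_sum_mult (Poly_Mapping.single p c) a \<in> vanishing" if a: "a \<in> vanishing" and p: "is_path n k p" for a p c
  proof -
    obtain x' u y' where p_eq: "p = (x', u, y')" by (metis prod.exhaust)
    have pu: "x' \<in> verts n k" "pathw x' u" "y' = run x' u" using p by (auto simp: p_eq is_path_iff)
    have "type_coeff (path_sum_mult (Poly_Mapping.single p c) a) (x, m, z) = 0"
      if sup: "supported x {i. 0 < m i}" for x m z
    proof (cases "x' = x \<and> (\<forall>i. weight u i \<le> m i)")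
      case True
      then have "edge ` set u \<subseteq> {i. 0 < m i}"
        using weight_pos_iff[of u] by (metis gr_zeroI leD mem_Collect_eq subsetI)
      then have "supported y' {i. 0 < m i}" using supported_run[of x' u] pu True sup by auto
      then have "supported y' {i. 0 < m i - weight u i}" by (rule supported_mono) auto
      then show ?thesis using a by (auto simp: p_eq type_coeff_mult_single_left vanishing_def)
    qed (auto simp: p_eq type_coeff_mult_single_left)
    moreover have "path_sum_mult (Poly_Mapping.single p c) a \<in> carrier (path_algebra n k)"
      using P.m_closed[OF single_carrier[OF p], of a c] a by (simp add: path_algebra_ops vanishing_def)
    ultimately show ?thesis by (simp add: vanishing_def)
  qed
  have right: "path_sum_mult a (Poly_Mapping.single p c) \<in> vanishing" if a: "a \<in> vanishing" and p: "is_path n k p" for a p c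
  proof -
    obtain x' u y' where p_eq: "p = (x', u, y')" by (metis prod.exhaust)
    have "type_coeff (path_sum_mult a (Poly_Mapping.single p c)) (x, m, z) = 0"
      if sup: "supported x {i. 0 < m i}" for x m z
    proof -
      have "supported x {i. 0 < m i - weight u i}" using sup by (rule supported_mono) auto
      then show ?thesis using a by (auto simp: p_eq type_coeff_mult_single_right vanishing_def)
    qed
    moreover have "path_sum_mult a (Poly_Mapping.single p c) \<in> carrier (path_algebra n k)"
      using P.m_closed[OF _ single_carrier[OF p], of a c] a by (simp add: path_algebra_ops vanishing_def)
    ultimately show ?thesis by (simp add: vanishing_def)
  qed
  show ?thesis
  proof (rule idealI_uminus[OF _ ring_path_algebra])
    fix a r assume a: "a \<in> vanishing" and r: "r \<in> carrier (path_algebra n k)"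
    have "path_sum_mult r a = (\<Sum>p\<in>Poly_Mapping.keys r. path_sum_mult (Poly_Mapping.single p (Poly_Mapping.lookup r p)) a)"
      by (subst poly_mapping_expand[of r]) (simp add: path_sum_mult_sum_left)
    also have "\<dots> \<in> vanishing" by (intro vanishing_sum left a single_path[OF r])
    finally show "r \<otimes>\<^bsub>path_algebra n k\<^esub> a \<in> vanishing" by (simp add: path_algebra_ops)
    have "path_sum_mult a r = (\<Sum>p\<in>Poly_Mapping.keys r. path_sum_mult a (Poly_Mapping.single p (Poly_Mapping.lookup r p)))"
      by (subst poly_mapping_expand[of r]) (simp add: path_sum_mult_sum_right)
    also have "\<dots> \<in> vanishing" by (intro vanishing_sum right a single_path[OF r])
    finally show "a \<otimes>\<^bsub>path_algebra n k\<^esub> r \<in> vanishing" by (simp add: path_algebra_ops)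
  next
    fix a assume a: "a \<in> vanishing"
    then have "a \<in> carrier (path_algebra n k)" by (simp add: vanishing_def)
    then have "- a \<in> carrier (path_algebra n k)" using a_inv_path_algebra P.a_inv_closed by metis
    then show "\<ominus>\<^bsub>path_algebra n k\<^esub> a \<in> vanishing"
      using a by (simp add: a_inv_path_algebra vanishing_def type_coeff_uminus)
  next
    fix a b assume "a \<in> vanishing" "b \<in> vanishing"
    then show "a \<oplus>\<^bsub>path_algebra n k\<^esub> b \<in> vanishing"
      using vanishing_sum[of "{0, 1}" "\<lambda>i. if i = (0::nat) then a else b"] by (auto simp: path_algebra_ops)
  next
    show "\<zero>\<^bsub>path_algebra n k\<^esub> \<in> vanishing"
      using vanishing_sum[of "{}"] by (simp add: path_algebra_ops)
  qed (auto simp: vanishing_def)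
qed

lemma OSz_ideal_subset_vanishing: "OSz_ideal n k \<subseteq> vanishing"
proof -
  have "OSz_relations n k \<subseteq> vanishing"
  proof
    fix a assume a: "a \<in> OSz_relations n k"
    then have carr: "a \<in> carrier (path_algebra n k)" using OSz_relations_carrier by auto
    from a consider x y v w where "a = Poly_Mapping.single (x, v, y) 1 - Poly_Mapping.single (x, w, y) 1"
        "equal_words v w"
      | x y w where "a = Poly_Mapping.single (x, w, y) 1" "zero_word x w" "is_path n k (x, w, y)"
      unfolding OSz_relations_def by blast
    then have "type_coeff a (x', m, y') = 0" if sup: "supported x' {i. 0 < m i}" for x' m y'
    proof cases
      case 1
      then show ?thesis
        using equal_words_weight[OF 1(2)] by (simp add: type_coeff_diff type_coeff_single path_type_def)
    next
      case 2
      have "\<not> supported x (edge ` set w)" using 2 by (intro unsupported_zero_word) (auto simp: is_path_iff)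
      moreover have "edge ` set w = {i. 0 < weight w i}" by (auto simp: weight_pos_iff)
      ultimately show ?thesis using sup 2 by (auto simp: type_coeff_single path_type_def)
    qed
    then show "a \<in> vanishing" using carr by (simp add: vanishing_def)
  qed
  then show ?thesis
    unfolding OSz_ideal_def by (intro ring.genideal_minimal ring_path_algebra ideal_vanishing)
qed

lemma path_not_in_ideal:
  assumes "is_path n k (x, w, y)" "supported x (edge ` set w)"
  shows "Poly_Mapping.single (x, w, y) 1 \<notin> OSz_ideal n k"
proof
  assume "Poly_Mapping.single (x, w, y) 1 \<in> OSz_ideal n k"
  then have "Poly_Mapping.single (x, w, y) 1 \<in> vanishing" using OSz_ideal_subset_vanishing by auto
  moreover have "edge ` set w = {i. 0 < weight w i}" by (auto simp: weight_pos_iff)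
  ultimately have "type_coeff (Poly_Mapping.single (x, w, y) 1) (x, weight w, y) = 0"
    using assms(2) by (simp add: vanishing_def)
  then show False by (simp add: type_coeff_single path_type_def)
qed

lemma normal_form_supported:
  assumes "x \<in> verts n k" "pathw x w" "supported x (edge ` set w)"
  obtains w' us where "reduces x w (w' @ us)" "moves_distinct w'" "\<forall>a\<in>set us. is_U a"
    "\<And>i. weight (w' @ us) i = weight w i"
proof -
  have "\<not> zeroes x w"
    using path_not_in_ideal[of x w "run x w"] assms by (auto simp: zeroes_def path1_def is_path_iff)
  then show ?thesis using normal_form[of x w] that by blast
qed

text \<open>Equal types give equal classes. In normal form the moves agree up to order, as levels
  determine them. The equality of weights then forces the loops to agree with multiplicity.\<close>

lemma path1_diff_in_ideal:
  assumes x: "x \<in> verts n k" and w: "pathw x w" "pathw x v" "run x w = run x v" "\<And>i. weight w i = weight v i"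
  shows "path1 x w - path1 x v \<in> OSz_ideal n k"
proof -
  have same: "edge ` set w = edge ` set v"
  proof -
    have "i \<in> edge ` set w \<longleftrightarrow> i \<in> edge ` set v" for i
      using weight_pos_iff[of w i] weight_pos_iff[of v i] w(4)[of i] by simp
    then show ?thesis by blast
  qed
  show ?thesis
  proof (cases "supported x (edge ` set w)")
    case False
    then have "path1 x w \<in> OSz_ideal n k" "path1 x v \<in> OSz_ideal n k"
      using zeroes_unsupported[of x w] zeroes_unsupported[of x v] same x w by (auto simp: zeroes_def)
    then show ?thesis by (rule ideal_diff)
  next
    case True
    obtain w' us where w': "reduces x w (w' @ us)" "moves_distinct w'" "\<forall>a\<in>set us. is_U a"
      "\<And>i. weight (w' @ us) i = weight w i" using normal_form_supported[OF x w(1) True] by blast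
    obtain v' vs where v': "reduces x v (v' @ vs)" "moves_distinct v'" "\<forall>a\<in>set vs. is_U a"
      "\<And>i. weight (v' @ vs) i = weight v i" using normal_form_supported[OF x w(2)] True same by auto
    have pw: "pathw x w'" "run x w' = run x w" "path1 x w - path1 x (w' @ us) \<in> OSz_ideal n k"
      using w'(1,3) x w by (auto simp: reduces_def run_U)
    have pv: "pathw x v'" "run x v' = run x v" "path1 x v - path1 x (v' @ vs) \<in> OSz_ideal n k"
      using v'(1,3) x w by (auto simp: reduces_def run_U)
    have w'v': "reduces x w' v'" using pw pv w' v' x w(3) by (intro distinct_paths_reduce) auto
    have "set w' = set v'"
      using distinct_path_labels[OF pw(1) w'(2)] distinct_path_labels[OF pv(1) v'(2)] pw pv w(3) by simp
    then have "weight w' i = weight v' i" for i using w'(2) v'(2) by (simp add: weight_distinct_moves)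
    then have eq: "weight us i = weight vs i" for i using w'(4)[of i] v'(4)[of i] w(4)[of i] by simp
    have "count (mset us) a = count (mset vs) a" for a
    proof (cases "is_U a")
      case True
      then show ?thesis
        using eq[of "edge a"] weight_U[OF w'(3), of "edge a"] weight_U[OF v'(3), of "edge a"] U_eq[of a] by simp
    next
      case False
      then have "a \<notin># mset us" "a \<notin># mset vs" using w'(3) v'(3) by auto
      then show ?thesis by (metis not_in_iff)
    qed
    then have "mset us = mset vs" by (rule multiset_eqI)
    then have "reduces x (w' @ us) (v' @ vs)"
      using reduces_trans[OF reduces_prefix[OF w'v'] reduces_context[OF reduces_permute_U, of us vs x v' "[]"]] w'(3)
      by simp
    then have "path1 x (w' @ us) - path1 x (v' @ vs) \<in> OSz_ideal n k"
      using w'(1) x w by (auto simp: reduces_def)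
    from ideal_add[OF pw(3) ideal_diff[OF this pv(3)]] show ?thesis by simp
  qed
qed

lemma ideal_scale:
  assumes "Poly_Mapping.single p 1 - Poly_Mapping.single q 1 \<in> OSz_ideal n k" "fst p = fst q" "fst p \<in> verts n k"
  shows "Poly_Mapping.single p c - Poly_Mapping.single q c \<in> OSz_ideal n k"
proof -
  let ?s = "Poly_Mapping.single (fst p, [], fst p) c"
  have "?s \<in> carrier (path_algebra n k)" using assms(3) by (simp add: path_algebra_def)
  then have "path_sum_mult ?s (Poly_Mapping.single p 1 - Poly_Mapping.single q 1) \<in> OSz_ideal n k"
    using assms(1) by (intro ideal_mult_left)
  moreover have "path_sum_mult ?s (Poly_Mapping.single p 1 - Poly_Mapping.single q 1)
      = Poly_Mapping.single p c - Poly_Mapping.single q c"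
    using path_sum_mult_add_right[of ?s "Poly_Mapping.single p 1 - Poly_Mapping.single q 1" "Poly_Mapping.single q 1"]
      assms(2) by (cases p; cases q) (simp add: path_sum_mult_single path_comp_def)
  ultimately show ?thesis by simp
qed

lemma ideal_scale_single:
  assumes "Poly_Mapping.single p 1 \<in> OSz_ideal n k" "fst p \<in> verts n k"
  shows "Poly_Mapping.single p c \<in> OSz_ideal n k"
proof -
  let ?s = "Poly_Mapping.single (fst p, [], fst p) c"
  have "?s \<in> carrier (path_algebra n k)" using assms(2) by (simp add: path_algebra_def)
  then have "path_sum_mult ?s (Poly_Mapping.single p 1) \<in> OSz_ideal n k"
    using assms(1) by (intro ideal_mult_left)
  moreover have "path_sum_mult ?s (Poly_Mapping.single p 1) = Poly_Mapping.single p c"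
    by (cases p) (simp add: path_sum_mult_single path_comp_def)
  ultimately show ?thesis by simp
qed

lemma ideal_sum: "(\<And>i. i \<in> A \<Longrightarrow> f i \<in> OSz_ideal n k) \<Longrightarrow> sum f A \<in> OSz_ideal n k"
  by (induction A rule: infinite_finite_induct) (auto simp: ideal_zero ideal_add)

text \<open>For the inclusion from right to left, every path is replaced by one chosen
  representative of its type. What remains is a combination of representatives with coefficients
  \<open>type_coeff a t\<close>. The supported ones drop out, and the unsupported ones lie in the
  ideal.\<close>

theorem OSz_ideal_eq_vanishing: "OSz_ideal n k = vanishing"
proof
  show "vanishing \<subseteq> OSz_ideal n k"
  proof
    fix a assume a: "a \<in> vanishing"
    let ?K = "Poly_Mapping.keys a"
    let ?l = "Poly_Mapping.lookup a"
    have path: "is_path n k p" if "p \<in> ?K" for p using a that by (auto simp: vanishing_def path_algebra_def)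
    define r where "r t = (SOME p. is_path n k p \<and> path_type p = t)" for t
    have r: "is_path n k (r (path_type p))" "path_type (r (path_type p)) = path_type p" if "is_path n k p" for p
      using someI[of "\<lambda>q. is_path n k q \<and> path_type q = path_type p" p] that unfolding r_def by auto
    have "(\<Sum>p\<in>?K. Poly_Mapping.single p (?l p) - Poly_Mapping.single (r (path_type p)) (?l p)) \<in> OSz_ideal n k"
    proof (rule ideal_sum)
      fix p assume p: "p \<in> ?K"
      obtain x w y where p_eq: "p = (x, w, y)" by (metis prod.exhaust)
      obtain x' v y' where q_eq: "r (path_type p) = (x', v, y')" by (metis prod.exhaust)
      have "x' = x" "y' = y" "weight v = weight w" using r(2)[OF path[OF p]] unfolding q_eq by (simp_all add: p_eq path_type_def)
      moreover have "is_path n k (x, w, y)" "is_path n k (x', v, y')"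
        using path[OF p] r(1)[OF path[OF p]] unfolding q_eq by (simp_all add: p_eq)
      ultimately have d: "Poly_Mapping.single p 1 - Poly_Mapping.single (r (path_type p)) 1 \<in> OSz_ideal n k"
        and x: "x \<in> verts n k"
        using path1_diff_in_ideal[of x w v] unfolding q_eq by (simp_all add: p_eq is_path_iff path1_def)
      have f: "fst p = fst (r (path_type p))" "fst p \<in> verts n k"
        unfolding q_eq using \<open>x' = x\<close> x by (simp_all add: p_eq)
      show "Poly_Mapping.single p (?l p) - Poly_Mapping.single (r (path_type p)) (?l p) \<in> OSz_ideal n k"
        by (rule ideal_scale[OF d f])
    qed
    moreover have "(\<Sum>p\<in>?K. Poly_Mapping.single (r (path_type p)) (?l p)) \<in> OSz_ideal n k"
    proof -
      have "(\<Sum>p\<in>?K. Poly_Mapping.single (r (path_type p)) (?l p)) =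
          (\<Sum>t\<in>path_type ` ?K. \<Sum>p\<in>{p \<in> ?K. path_type p = t}. Poly_Mapping.single (r (path_type p)) (?l p))"
        by (rule sum.image_gen) simp
      also have "\<dots> = (\<Sum>t\<in>path_type ` ?K. Poly_Mapping.single (r t) (type_coeff a t))"
      proof (intro sum.cong refl)
        fix t
        have "(\<Sum>p\<in>{p \<in> ?K. path_type p = t}. Poly_Mapping.single (r (path_type p)) (?l p)) =
            (\<Sum>p\<in>{p \<in> ?K. path_type p = t}. Poly_Mapping.single (r t) (?l p))"
          by (intro sum.cong) auto
        also have "\<dots> = Poly_Mapping.single (r t) (\<Sum>p\<in>{p \<in> ?K. path_type p = t}. ?l p)"
          by (rule single_sum[symmetric])
        also have "(\<Sum>p\<in>{p \<in> ?K. path_type p = t}. ?l p) = type_coeff a t"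
          unfolding type_coeff_def by (subst sum.inter_filter) auto
        finally show "(\<Sum>p\<in>{p \<in> ?K. path_type p = t}. Poly_Mapping.single (r (path_type p)) (?l p)) =
          Poly_Mapping.single (r t) (type_coeff a t)" .
      qed
      also have "\<dots> \<in> OSz_ideal n k"
      proof (rule ideal_sum)
        fix t assume "t \<in> path_type ` ?K"
        then obtain p where p: "p \<in> ?K" "t = path_type p" by auto
        obtain x w y where rt: "r t = (x, w, y)" by (metis prod.exhaust)
        have path_r: "is_path n k (x, w, y)" and t: "t = (x, weight w, y)"
          using r[OF path[OF p(1)]] unfolding p(2)[symmetric] rt by (simp_all add: path_type_def)
        have eq: "edge ` set w = {i. 0 < weight w i}" by (auto simp: weight_pos_iff)
        show "Poly_Mapping.single (r t) (type_coeff a t) \<in> OSz_ideal n k"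
        proof (cases "supported x (edge ` set w)")
          case True
          then have "type_coeff a t = 0" using a t eq by (simp add: vanishing_def)
          then show ?thesis by (simp add: ideal_zero)
        next
          case False
          then have "Poly_Mapping.single (r t) 1 \<in> OSz_ideal n k"
            using zeroes_unsupported[of x w] path_r unfolding zeroes_def path1_def rt is_path_iff by simp
          moreover have "fst (r t) \<in> verts n k" using path_r unfolding rt is_path_iff by simp
          ultimately show ?thesis by (rule ideal_scale_single)
        qed
      qed
      finally show ?thesis .
    qed
    ultimately have "(\<Sum>p\<in>?K. Poly_Mapping.single p (?l p) - Poly_Mapping.single (r (path_type p)) (?l p))
        + (\<Sum>p\<in>?K. Poly_Mapping.single (r (path_type p)) (?l p)) \<in> OSz_ideal n k"
      by (rule ideal_add)
    then have "(\<Sum>p\<in>?K. Poly_Mapping.single p (?l p)) \<in> OSz_ideal n k"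
      by (simp only: sum_subtractf diff_add_cancel)
    then show "a \<in> OSz_ideal n k" by (subst poly_mapping_expand)
  qed
qed (rule OSz_ideal_subset_vanishing)

section \<open>Paths crossing no edge twice\<close>

text \<open>The edges that every path from \<open>x\<close> to \<open>y\<close> crosses an odd
  number of times; for vertices coming from sign vectors, the coordinates at which the signs
  disagree.\<close>

definition odd_edges :: "vertex \<Rightarrow> vertex \<Rightarrow> nat set" where
  "odd_edges x y = {i \<in> {1..n}. even (level x i) \<noteq> even (level y i)}"

lemma level_0 [simp]: "level x 0 = 0"
  by (simp add: level_def)

lemma level_top:
  assumes "x \<in> verts n k"
  shows "level x (Suc n) = k"
proof -
  have "x \<inter> {..<Suc n} = x" using assms by (auto simp: verts_def)
  then show ?thesis using assms by (simp add: level_def verts_def)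
qed

lemma level_parity_eq:
  assumes "x \<in> verts n k" "y \<in> verts n k" "i \<le> Suc n" "i \<notin> odd_edges x y"
  shows "even (level x i) \<longleftrightarrow> even (level y i)"
proof (cases "i = 0 \<or> i = Suc n")
  case True
  then show ?thesis using level_top[OF assms(1)] level_top[OF assms(2)] by auto
next
  case False
  then show ?thesis using assms(3,4) by (auto simp: odd_edges_def)
qed

lemma odd_edges_empty:
  assumes "x \<in> verts n k" "y \<in> verts n k" "odd_edges x y = {}"
  shows "x = y"
proof -
  have par: "even (level x i) \<longleftrightarrow> even (level y i)" if "i \<le> Suc n" for i
    using level_parity_eq[OF assms(1,2) that] assms(3) by simp
  have "i \<in> x \<longleftrightarrow> i \<in> y" if "i \<le> n" for i
    using par[of i] par[of "Suc i"] that by (simp add: level_Suc split: if_splits)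
  then show ?thesis using assms(1,2) by (auto simp: verts_def subset_iff)
qed

text \<open>If no edge of \<open>D\<close> could be crossed, its endpoints would have equal
  occupation in \<open>x\<close>, and Hall's condition for \<open>x\<close> would make both
  occupied. Take the first block of consecutive edges of \<open>D\<close>. The parities of the
  levels of \<open>x\<close> and \<open>y\<close> begin to differ at its left end and cease to
  differ after its right end, so \<open>y\<close> is vacant at both extreme positions. It then has
  too few elements for the block.\<close>

lemma exists_applicable_move:
  assumes x: "x \<in> verts n k" and y: "y \<in> verts n k" and ne: "odd_edges x y \<noteq> {}"
    and sup: "supported x (odd_edges x y)" "supported y (odd_edges x y)"
  obtains a where "\<not> is_U a" "edge a \<in> odd_edges x y" "applicable x a"
proof -
  define D where "D = odd_edges x y"
  have D: "D \<subseteq> {1..n}" "finite D" by (auto simp: D_def odd_edges_def)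
  have "\<exists>i\<in>D. (i - 1 \<in> x) \<noteq> (i \<in> x)"
  proof (rule ccontr)
    assume "\<not> ?thesis"
    then have same: "i - 1 \<in> x \<longleftrightarrow> i \<in> x" if "i \<in> D" for i using that by auto
    have full: "i - 1 \<in> x" "i \<in> x" if i: "i \<in> D" for i
    proof -
      have i1: "i \<ge> 1" using D i by auto
      have "{i - 1 + 1..i - 1 + 1} \<subseteq> D" using i i1 by simp
      then have c: "1 \<le> card (x \<inter> {i - 1..i - 1 + 1})"
        using sup(1) unfolding supported_def D_def by blast
      have "{i - 1..i - 1 + 1} = {i - 1, i}" using i1 by auto
      then have "x \<inter> {i - 1, i} \<noteq> {}" using c by (metis card.empty not_one_le_zero)
      then show "i - 1 \<in> x" "i \<in> x" using same[OF i] by auto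
    qed
    define i where "i = Min D"
    have i: "i \<in> D" "\<And>j. j \<in> D \<Longrightarrow> i \<le> j" using D ne by (auto simp: i_def D_def[symmetric])
    have i1: "i \<ge> 1" "i \<le> n" using D i(1) by auto
    have "i - 1 \<notin> D" using i(2)[of "i - 1"] i1 by auto
    then have "even (level x (i - 1)) \<longleftrightarrow> even (level y (i - 1))"
      using i1 by (intro level_parity_eq x y) (auto simp: D_def)
    moreover have "even (level x i) \<noteq> even (level y i)" using i(1) by (simp add: D_def odd_edges_def)
    ultimately have iy: "i - 1 \<notin> y"
      using full(1)[OF i(1)] level_Suc[of x "i - 1"] level_Suc[of y "i - 1"] i1 by auto
    define j where "j = Max {j \<in> D. {i..j} \<subseteq> D}"
    have J: "finite {j \<in> D. {i..j} \<subseteq> D}" "{j \<in> D. {i..j} \<subseteq> D} \<noteq> {}" using D i by auto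
    have j: "j \<in> D" "{i..j} \<subseteq> D" using Max_in[OF J] by (auto simp: j_def)
    have jmax: "j' \<le> j" if "j' \<in> D" "{i..j'} \<subseteq> D" for j' unfolding j_def using that J by (intro Max_ge) auto
    have jn: "i \<le> j" "j \<le> n" using i(2)[OF j(1)] j(1) D by auto
    have "Suc j \<notin> D"
    proof
      assume "Suc j \<in> D"
      moreover then have "{i..Suc j} \<subseteq> D" using j(2) by (auto simp: le_Suc_eq)
      ultimately show False using jmax[of "Suc j"] by simp
    qed
    then have "even (level x (Suc j)) \<longleftrightarrow> even (level y (Suc j))"
      using jn by (intro level_parity_eq x y) (auto simp: D_def)
    moreover have "even (level x j) \<noteq> even (level y j)" using j(1) by (simp add: D_def odd_edges_def)
    ultimately have jy: "j \<notin> y" using full(2)[OF j(1)] by (auto simp: level_Suc)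
    have "{i - 1 + 1..i - 1 + (j - i + 1)} = {i..j}" using i1 jn by auto
    then have "{i - 1 + 1..i - 1 + (j - i + 1)} \<subseteq> D" using j(2) by simp
    then have "j - i + 1 \<le> card (y \<inter> {i - 1..i - 1 + (j - i + 1)})"
      using sup(2) unfolding supported_def D_def by blast
    also have "\<dots> \<le> card {i..<j}"
    proof (rule card_mono)
      show "y \<inter> {i - 1..i - 1 + (j - i + 1)} \<subseteq> {i..<j}"
      proof
        fix p assume p: "p \<in> y \<inter> {i - 1..i - 1 + (j - i + 1)}"
        then have "p \<noteq> i - 1" "p \<noteq> j" using iy jy by auto
        then show "p \<in> {i..<j}" using p jn i1 by auto
      qed
    qed simp
    finally show False by simp
  qed
  then obtain i where i: "i \<in> D" "(i - 1 \<in> x) \<noteq> (i \<in> x)" by auto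
  have "applicable x (if i \<in> x then ArrL i else ArrR i)" using i D by (auto simp: applicable_def)
  then show ?thesis using that[of "if i \<in> x then ArrL i else ArrR i"] i by (auto simp: D_def)
qed

lemma odd_edges_act:
  assumes "applicable x a" "\<not> is_U a" "edge a \<in> odd_edges x y"
  shows "odd_edges (act x a) y = odd_edges x y - {edge a}"
proof -
  have "even (level (act x a) i) \<longleftrightarrow> (if i = edge a then odd (level x i) else even (level x i))" for i
    using level_act[OF assms(1), of i] assms(2) by (cases a) auto
  then show ?thesis using assms(3) by (auto simp: odd_edges_def)
qed

lemma exists_distinct_path:
  assumes "x \<in> verts n k" "y \<in> verts n k" "supported x (odd_edges x y)" "supported y (odd_edges x y)"
  shows "\<exists>w. pathw x w \<and> moves_distinct w \<and> run x w = y \<and> edge ` set w = odd_edges x y"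
  using assms
proof (induction "card (odd_edges x y)" arbitrary: x rule: less_induct)
  case less
  show ?case
  proof (cases "odd_edges x y = {}")
    case True
    then have "x = y" using less.prems odd_edges_empty by blast
    then show ?thesis using True by (intro exI[of _ "[]"]) (simp add: moves_distinct_def)
  next
    case False
    obtain a where a: "\<not> is_U a" "edge a \<in> odd_edges x y" "applicable x a"
      using exists_applicable_move[OF less.prems(1,2) False less.prems(3,4)] by blast
    note D = odd_edges_act[OF a(3,1,2)]
    have "finite (odd_edges x y)" by (simp add: odd_edges_def)
    then have c: "card (odd_edges (act x a) y) < card (odd_edges x y)"
      unfolding D using a(2) by (rule card_Diff1_less)
    have "supported (act x a) (odd_edges x y)"
      using supported_act[OF a(3) finite_vertex a(2)] less.prems by simp
    then have "supported (act x a) (odd_edges (act x a) y)" unfolding D by (rule supported_mono) auto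
    moreover have "supported y (odd_edges (act x a) y)"
      unfolding D using less.prems(4) by (rule supported_mono) auto
    ultimately obtain w where w: "pathw (act x a) w" "moves_distinct w" "run (act x a) w = y"
      "edge ` set w = odd_edges (act x a) y"
      using less.hyps[OF c] less.prems(1,2) act_verts[OF _ a(3)] by blast
    then show ?thesis
      using a D by (intro exI[of _ "a # w"]) (auto simp: moves_distinct_Cons)
  qed
qed

lemma verts_l_subset: "verts_l n k \<subseteq> verts n k"
  by (auto simp: verts_l_def verts_def)

lemma level_verts_l:
  assumes "x \<in> verts_l n k"
  shows "level x n = k"
proof -
  have "x \<inter> {..<n} = x" using assms by (auto simp: verts_l_def)
  then show ?thesis using assms by (simp add: level_def verts_l_def)
qed

text \<open>At both ends all \<open>k\<close> elements lie to the left of edge \<open>n\<close>,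
  while a single crossing of it would change that number.\<close>

lemma distinct_path_last_edge:
  assumes "x \<in> verts_l n k" "run x w \<in> verts_l n k" "pathw x w" "moves_distinct w"
  shows "n \<notin> edge ` set w"
proof
  assume "n \<in> edge ` set w"
  then obtain a where a: "a \<in> set w" "edge a = n" by auto
  have "\<not> is_U a" using assms(4) a(1) by (simp add: moves_distinct_def)
  then have "a = ArrR n \<or> a = ArrL n" using a(2) by (cases a) simp_all
  then show False
    using level_run_distinct[OF assms(3,4) a(1), of n] level_verts_l[OF assms(1)] level_verts_l[OF assms(2)] by auto
qed

lemma act_verts_l:
  assumes "x \<in> verts_l n k" "applicable x a" "is_U a \<or> edge a \<noteq> n"
  shows "act x a \<in> verts_l n k"
proof (cases "is_U a")
  case True
  then show ?thesis using assms(1) by (simp add: act_def)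
next
  case False
  note ap = applicable_src_tgt[OF assms(2) False]
  have "act x a \<in> verts n k" using assms verts_l_subset by (auto intro: act_verts)
  moreover have "tgt a < n" using assms(2,3) False by (cases a) (auto simp: applicable_def)
  ultimately show ?thesis
    using assms(1) False by (auto simp: verts_l_def verts_def act_def)
qed

section \<open>Totally positive subspaces\<close>

text \<open>Translates column numbers of minors into levels, so that cofactor signs become
  \<open>(- 1) ^ level J t\<close> without reference to an enumeration of \<open>J\<close>.\<close>

lemma level_nth_sorted:
  assumes "finite J" "c < card J"
  shows "level J (sorted_list_of_set J ! c) = c"
proof -
  let ?xs = "sorted_list_of_set J"
  have len: "length ?xs = card J" by simp
  have less: "?xs ! i < ?xs ! j" if "i < j" "j < card J" for i j
    using sorted_wrt_nth_less[OF strict_sorted_list_of_set[of J] that(1)] that(2) len by simp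
  have iff: "?xs ! i < ?xs ! c \<longleftrightarrow> i < c" if "i < card J" for i
    using less[of i c] less[of c i] that assms(2) by (metis linorder_neqE_nat order_less_asym order_less_irrefl)
  have "J = (!) ?xs ` {..<card J}"
    using assms(1) by (metis len nth_image set_sorted_list_of_set lessThan_atLeast0 order_refl take_all)
  moreover have "f ` A \<inter> {..<a} = f ` {i \<in> A. f i < a}" for f :: "nat \<Rightarrow> nat" and A a by auto
  ultimately have "J \<inter> {..<?xs ! c} = (!) ?xs ` {i \<in> {..<card J}. ?xs ! i < ?xs ! c}" by metis
  also have "{i \<in> {..<card J}. ?xs ! i < ?xs ! c} = {..<c}" using iff assms(2) by auto
  finally have "J \<inter> {..<?xs ! c} = (!) ?xs ` {..<c}" .
  moreover have "inj_on ((!) ?xs) {..<c}"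
    using assms(2) by (intro inj_on_nth) auto
  ultimately show ?thesis by (simp add: level_def card_image)
qed

lemma sorted_list_remove_nth:
  assumes "finite J" "c < card J" "i < card J - 1"
  shows "sorted_list_of_set (J - {sorted_list_of_set J ! c}) ! i =
    sorted_list_of_set J ! (if i < c then i else Suc i)"
proof -
  let ?xs = "sorted_list_of_set J"
  have len: "length ?xs = card J" by simp
  have split: "?xs = take c ?xs @ ?xs ! c # drop (Suc c) ?xs"
    using id_take_nth_drop[of c ?xs] assms(2) by simp
  have "distinct ?xs" by simp
  then have "?xs ! c \<notin> set (take c ?xs)" by (subst (asm) split) auto
  then have "remove1 (?xs ! c) ?xs = take c ?xs @ drop (Suc c) ?xs"
    by (subst (2) split) (simp add: remove1_append)
  then have "sorted_list_of_set (J - {?xs ! c}) = take c ?xs @ drop (Suc c) ?xs"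
    using sorted_list_of_set_remove[OF assms(1)] by simp
  then show ?thesis using assms len by (auto simp: nth_append)
qed

lemma det_repeated_row:
  assumes r: "r < m" and J: "finite J" "card J = Suc m"
  shows "(\<Sum>t\<in>J. (- 1) ^ level J t * pluecker m b (J - {t}) * b r t) = 0"
proof -
  let ?xs = "sorted_list_of_set J"
  \<comment> \<open>The row \<open>b r\<close> appears once more on top, so the cofactors along the
    top row are, up to sign, the Pluecker coordinates of \<open>J\<close> with one point
    removed.\<close>
  define A where "A = mat (Suc m) (Suc m) (\<lambda>(i, c). (case i of 0 \<Rightarrow> b r | Suc i' \<Rightarrow> b i') (?xs ! c))"
  have A: "A \<in> carrier_mat (Suc m) (Suc m)" by (simp add: A_def)
  have "row A 0 = row A (Suc r)" using r by (intro eq_vecI) (auto simp: A_def)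
  then have "det A = 0" using r by (intro det_identical_rows[OF A, of 0 "Suc r"]) auto
  moreover have "det A = (\<Sum>c<Suc m. A $$ (0, c) * cofactor A 0 c)"
    by (rule laplace_expansion_row[OF A]) simp
  moreover have "A $$ (0, c) * cofactor A 0 c =
      (- 1) ^ level J (?xs ! c) * pluecker m b (J - {?xs ! c}) * b r (?xs ! c)" if c: "c < Suc m" for c
  proof -
    have "mat_delete A 0 c = mat m m (\<lambda>(r, i). b r (sorted_list_of_set (J - {?xs ! c}) ! i))"
      using c J by (intro eq_matI) (auto simp: A_def mat_delete_def sorted_list_remove_nth)
    then have "cofactor A 0 c = (- 1) ^ c * pluecker m b (J - {?xs ! c})"
      by (simp add: cofactor_def pluecker_def)
    then show ?thesis using c J by (simp add: A_def level_nth_sorted)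
  qed
  ultimately have "(\<Sum>c<Suc m. (- 1) ^ level J (?xs ! c) * pluecker m b (J - {?xs ! c}) * b r (?xs ! c)) = 0"
    by simp
  moreover have "bij_betw ((!) ?xs) {..<Suc m} J"
    using bij_betw_nth[of ?xs "{..<Suc m}" J] J by simp
  ultimately show ?thesis
    using sum.reindex_bij_betw[of "(!) ?xs" "{..<Suc m}" J "\<lambda>t. (- 1) ^ level J t * pluecker m b (J - {t}) * b r t"]
    by simp
qed

lemma Gr_pos_subspace:
  assumes "W \<in> Gr_pos m I"
  shows "rfun.subspace W" "W \<subseteq> coord_space I"
  using assms by (auto simp: Gr_pos_def linear_subspace_def)

lemma Gr_pos_closed:
  assumes "W \<in> Gr_pos m I"
  shows "x \<in> W \<Longrightarrow> y \<in> W \<Longrightarrow> (\<lambda>i. x i + y i) \<in> W" "x \<in> W \<Longrightarrow> (\<lambda>i. c * x i) \<in> W"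
    "x \<in> W \<Longrightarrow> y \<in> W \<Longrightarrow> (\<lambda>i. x i - y i) \<in> W" "(\<lambda>i. 0) \<in> W"
  using Gr_pos_subspace(1)[OF assms] rfun.subspace_add[of W x y] rfun.subspace_scale[of W x c]
    rfun.subspace_diff[of W x y] rfun.subspace_0[of W]
  by (simp_all add: plus_fun_def fun_diff_def zero_fun_def)

text \<open>Expanding the determinant with a repeated row: on \<open>W\<close> the coordinates in \<open>J\<close> satisfy a linear
  relation with alternating coefficients. Everything below about positive subspaces follows
  from these relations.\<close>

lemma Gr_pos_circuit:
  assumes W: "W \<in> Gr_pos m I" and J: "J \<subseteq> I" "finite J" "card J = Suc m"
  obtains c where "\<And>t. t \<in> J \<Longrightarrow> c t > 0" "\<And>x. x \<in> W \<Longrightarrow> (\<Sum>t\<in>J. (- 1) ^ level J t * c t * x t) = 0"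
proof -
  obtain b where b: "ordered_basis m b W" and
    sign: "(\<forall>S. S \<subseteq> I \<and> card S = m \<longrightarrow> pluecker m b S > 0) \<or> (\<forall>S. S \<subseteq> I \<and> card S = m \<longrightarrow> pluecker m b S < 0)"
    using W unfolding Gr_pos_def by auto
  have rel: "(\<Sum>t\<in>J. (- 1) ^ level J t * pluecker m b (J - {t}) * x t) = 0" if "x \<in> W" for x
  proof -
    have "x \<in> rfun.span (b ` {0..<m})" using that b by (simp add: ordered_basis_def)
    then show ?thesis
    proof (induction rule: rfun.span_induct_alt)
      case base
      show ?case by (simp add: zero_fun_def)
    next
      case (step c x y)
      then obtain r where "r < m" "x = b r" by auto
      then have "(\<Sum>t\<in>J. (- 1) ^ level J t * pluecker m b (J - {t}) * x t) = 0"
        using det_repeated_row[of r m J b] J by simp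
      then show ?case using step
        by (simp add: plus_fun_def distrib_left sum.distrib mult.left_commute[of _ c] flip: sum_distrib_left)
    qed
  qed
  have S: "J - {t} \<subseteq> I \<and> card (J - {t}) = m" if "t \<in> J" for t using that J by auto
  from sign show ?thesis
  proof
    assume "\<forall>S. S \<subseteq> I \<and> card S = m \<longrightarrow> pluecker m b S > 0"
    then show ?thesis using that[of "\<lambda>t. pluecker m b (J - {t})"] S rel by blast
  next
    assume neg: "\<forall>S. S \<subseteq> I \<and> card S = m \<longrightarrow> pluecker m b S < 0"
    show ?thesis
    proof (rule that[of "\<lambda>t. - pluecker m b (J - {t})"])
      show "- pluecker m b (J - {t}) > 0" if "t \<in> J" for t using neg S[OF that] by simp
      show "(\<Sum>t\<in>J. (- 1) ^ level J t * - pluecker m b (J - {t}) * x t) = 0" if "x \<in> W" for x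
        using rel[OF that] by (simp add: sum_negf)
    qed
  qed
qed

text \<open>The square submatrix of a basis on the columns \<open>S\<close> has nonzero determinant,
  so the coefficients of \<open>x\<close> can be solved for.\<close>

lemma Gr_pos_interpolate:
  assumes W: "W \<in> Gr_pos m I" and S: "S \<subseteq> I" "finite S" "card S = m"
  obtains x where "x \<in> W" "\<And>s. s \<in> S \<Longrightarrow> x s = f s"
proof -
  obtain b where b: "ordered_basis m b W" and nz: "pluecker m b S \<noteq> 0"
  proof -
    obtain b where "ordered_basis m b W" and
      "(\<forall>S. S \<subseteq> I \<and> card S = m \<longrightarrow> pluecker m b S > 0) \<or> (\<forall>S. S \<subseteq> I \<and> card S = m \<longrightarrow> pluecker m b S < 0)"
      using W unfolding Gr_pos_def by auto
    then show ?thesis using that[of b] S by (metis order_less_irrefl)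
  qed
  let ?xs = "sorted_list_of_set S"
  define A where "A = mat m m (\<lambda>(r, c). b r (?xs ! c))"
  have A: "A \<in> carrier_mat m m" by (simp add: A_def)
  have "det A \<noteq> 0" using nz by (simp add: pluecker_def A_def)
  then have "A \<in> Units (ring_mat TYPE(real) m ())" by (rule det_non_zero_imp_unit[OF A])
  then obtain B where B: "B \<in> carrier_mat m m" "B * A = 1\<^sub>m m" by (auto simp: Units_def ring_mat_def)
  define v where "v = vec m (\<lambda>c. f (?xs ! c))"
  define a where "a = B\<^sup>T *\<^sub>v v"
  have a: "a \<in> carrier_vec m" using B by (simp add: a_def v_def)
  have "A\<^sup>T * B\<^sup>T = 1\<^sub>m m" using transpose_mult[OF B(1) A] B(2) by simp
  then have "A\<^sup>T *\<^sub>v a = v"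
    using A B(1) assoc_mult_mat_vec[of "A\<^sup>T" m m "B\<^sup>T" m v] by (simp add: a_def v_def)
  define x where "x = (\<Sum>r<m. (\<lambda>i. a $ r * b r i))"
  have x_app: "x i = (\<Sum>r<m. a $ r * b r i)" for i
    by (simp add: x_def) (induction m, simp_all add: zero_fun_def plus_fun_def)
  have "x \<in> rfun.span (b ` {0..<m})"
    unfolding x_def by (intro rfun.span_sum rfun.span_scale rfun.span_base) auto
  then have "x \<in> W" using b by (simp add: ordered_basis_def)
  moreover have "x s = f s" if s: "s \<in> S" for s
  proof -
    obtain c where c: "c < m" "s = ?xs ! c"
      using s S by (metis in_set_conv_nth length_sorted_list_of_set set_sorted_list_of_set)
    have "v $ c = (A\<^sup>T *\<^sub>v a) $ c" using \<open>A\<^sup>T *\<^sub>v a = v\<close> by simp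
    also have "\<dots> = (\<Sum>r<m. b r s * a $ r)"
      using A a c by (simp add: scalar_prod_def A_def lessThan_atLeast0)
    finally show ?thesis using c by (simp add: x_app v_def mult.commute)
  qed
  ultimately show ?thesis using that by blast
qed

lemma level_insert:
  assumes "finite Z" "t \<notin> Z"
  shows "level (insert t Z) s = level Z s + (if t < s then 1 else 0)"
proof -
  have "insert t Z \<inter> {..<s} = (if t < s then insert t (Z \<inter> {..<s}) else Z \<inter> {..<s})" by auto
  then show ?thesis using assms by (simp add: level_def)
qed

lemma Gr_pos_vanish:
  assumes W: "W \<in> Gr_pos m I" and S: "S \<subseteq> I" "finite S" "card S = m"
    and x: "x \<in> W" "\<And>s. s \<in> S \<Longrightarrow> x s = 0"
  shows "x t = 0"
proof (cases "t \<in> I - S")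
  case True
  obtain c where c: "\<And>s. s \<in> insert t S \<Longrightarrow> c s > 0"
    and rel: "\<And>x. x \<in> W \<Longrightarrow> (\<Sum>s\<in>insert t S. (- 1) ^ level (insert t S) s * c s * x s) = 0"
    using Gr_pos_circuit[OF W, of "insert t S"] S True by auto
  have "(\<Sum>s\<in>S. (- 1) ^ level (insert t S) s * c s * x s) = 0" using x(2) by simp
  then have "(- 1) ^ level (insert t S) t * c t * x t = 0" using rel[OF x(1)] True S by simp
  then show ?thesis using c[of t] by auto
next
  case False
  then show ?thesis using x Gr_pos_subspace(2)[OF W] by (auto simp: coord_space_def)
qed

text \<open>Under the sign hypothesis all terms of the circuit relation on \<open>J\<close> are
  nonnegative with sum zero. So \<open>x\<close> vanishes on \<open>J\<close>, which contains
  \<open>m\<close> coordinates that determine \<open>x\<close>.\<close>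

lemma Gr_pos_alternating:
  assumes W: "W \<in> Gr_pos m I" and J: "J \<subseteq> I" "finite J" "card J = Suc m"
    and x: "x \<in> W" "\<And>t. t \<in> J \<Longrightarrow> (- 1) ^ level J t * x t \<ge> 0"
  shows "x i = 0"
proof -
  obtain c where c: "\<And>s. s \<in> J \<Longrightarrow> c s > 0"
    and rel: "\<And>x. x \<in> W \<Longrightarrow> (\<Sum>s\<in>J. (- 1) ^ level J s * c s * x s) = 0"
    using Gr_pos_circuit[OF W J] by blast
  have "(\<Sum>s\<in>J. c s * ((- 1) ^ level J s * x s)) = 0"
    using rel[OF x(1)] by (simp add: mult.left_commute mult.assoc)
  then have zero: "c s * ((- 1) ^ level J s * x s) = 0" if "s \<in> J" for s
    using sum_nonneg_eq_0_iff[OF J(2), of "\<lambda>s. c s * ((- 1) ^ level J s * x s)"] c x(2) that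
    by (simp add: less_imp_le)
  have z: "x s = 0" if "s \<in> J" for s using zero[OF that] c[OF that] by auto
  obtain t where "t \<in> J" using J(3) by fastforce
  then have S: "J - {t} \<subseteq> I" "finite (J - {t})" "card (J - {t}) = m" using J by auto
  show ?thesis by (rule Gr_pos_vanish[OF W S x(1)]) (use z in blast)
qed

text \<open>Interpolation produces an \<open>x\<close> that vanishes on \<open>Z\<close> and has the
  right sign at one further index \<open>t0\<close>. For any other \<open>t\<close> the circuit on
  \<open>Z\<close> with \<open>t0\<close> and \<open>t\<close> added has only two nonzero terms and
  so transfers the sign from \<open>t0\<close> to \<open>t\<close>.\<close>

lemma Gr_pos_cocircuit:
  assumes W: "W \<in> Gr_pos (Suc q) I" and I: "finite I" and Z: "Z \<subseteq> I" "card Z = q" "Z \<noteq> I"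
  obtains x where "x \<in> W" "\<And>z. z \<in> Z \<Longrightarrow> x z = 0" "\<And>t. t \<in> I - Z \<Longrightarrow> (- 1) ^ level Z t * x t > 0"
proof -
  have fin: "finite Z" using Z I finite_subset by auto
  obtain t0 where t0: "t0 \<in> I - Z" using Z by auto
  obtain x where x: "x \<in> W" "\<And>s. s \<in> insert t0 Z \<Longrightarrow> x s = (if s = t0 then (- 1) ^ level Z t0 else 0)"
    using Gr_pos_interpolate[OF W, of "insert t0 Z" "\<lambda>s. if s = t0 then (- 1) ^ level Z t0 else 0"] t0 Z fin by auto
  have xZ: "x z = 0" if "z \<in> Z" for z using x(2)[of z] that t0 by auto
  have xt0: "(- 1) ^ level Z t0 * x t0 > 0" using x(2)[of t0] by (simp flip: power_mult_distrib)
  have "(- 1) ^ level Z t * x t > 0" if t: "t \<in> I - Z" for t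
  proof (cases "t = t0")
    case False
    define J where "J = insert t (insert t0 Z)"
    have J: "J \<subseteq> I" "finite J" "card J = Suc (Suc q)" using t t0 Z fin False by (auto simp: J_def)
    obtain c where c: "\<And>s. s \<in> J \<Longrightarrow> c s > 0"
      and rel: "\<And>x. x \<in> W \<Longrightarrow> (\<Sum>s\<in>J. (- 1) ^ level J s * c s * x s) = 0"
      using Gr_pos_circuit[OF W J] by blast
    have "(\<Sum>s\<in>J. (- 1) ^ level J s * c s * x s) =
        (- 1) ^ level J t * c t * x t + (- 1) ^ level J t0 * c t0 * x t0"
      using t t0 fin False xZ by (simp add: J_def)
    then have eq: "(- 1) ^ level J t * c t * x t = - ((- 1) ^ level J t0 * c t0 * x t0)"
      using rel[OF x(1)] by simp
    \<comment> \<open>Of \<open>t\<close> and \<open>t0\<close> exactly the larger one has the other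
      to its left. This extra sign cancels the minus sign in \<open>eq\<close>.\<close>
    have "level J t = level Z t + (if t0 < t then 1 else 0)" "level J t0 = level Z t0 + (if t < t0 then 1 else 0)"
      using t t0 fin False by (auto simp: J_def level_insert)
    then have "(- 1) ^ level Z t * c t * x t = (- 1) ^ level Z t0 * c t0 * x t0"
      using eq False by (auto split: if_splits)
    moreover have "(- 1) ^ level Z t0 * c t0 * x t0 > 0"
      using xt0 c[of t0] by (simp add: J_def mult.left_commute[of _ "c t0"] mult.assoc)
    ultimately have "c t * ((- 1) ^ level Z t * x t) > 0" by (simp add: mult.left_commute mult.assoc)
    then show ?thesis using c[of t] by (simp add: J_def zero_less_mult_iff)
  qed (use xt0 in simp)
  then show ?thesis using that x(1) xZ by blast
qed

end

section \<open>Sign changes in cyclic arrangements\<close>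

text \<open>In contrast to \<open>sign_vectors\<close>, the values outside \<open>{1..n}\<close> are
  free, so that auxiliary sign functions can be given by a formula.\<close>

definition is_sign :: "nat \<Rightarrow> signs \<Rightarrow> bool" where
  "is_sign n \<alpha> \<longleftrightarrow> (\<forall>t\<in>{1..n}. \<alpha> t = 1 \<or> \<alpha> t = -1)"

lemma sign_vectors_is_sign: "\<alpha> \<in> sign_vectors n \<Longrightarrow> is_sign n \<alpha>"
  by (auto simp: sign_vectors_def is_sign_def PiE_def Pi_def)

lemma finite_sign_changes [simp]: "finite (sign_changes n \<alpha>)"
  by (auto simp: sign_changes_def)

lemma sign_changes_less: "a \<in> sign_changes n \<alpha> \<Longrightarrow> a < n"
  by (auto simp: sign_changes_def)

context osz
begin

lemma sign_eq_level:
  assumes "is_sign n \<alpha>" "t \<le> n"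
  shows "(\<alpha>(0 := 1)) t = (- 1) ^ level (sign_changes n \<alpha>) t"
  using assms(2)
proof (induction t)
  case (Suc t)
  have s: "(\<alpha>(0 := 1)) i = 1 \<or> (\<alpha>(0 := 1)) i = -1" if "i \<le> n" for i
    using assms(1) that by (auto simp: is_sign_def)
  have IH: "(\<alpha>(0 := 1)) t = (- 1) ^ level (sign_changes n \<alpha>) t" using Suc by simp
  have mem: "t \<in> sign_changes n \<alpha> \<longleftrightarrow> (\<alpha>(0 := 1)) t \<noteq> (\<alpha>(0 := 1)) (Suc t)"
    using Suc.prems by (simp add: sign_changes_def)
  show ?case
  proof (cases "t \<in> sign_changes n \<alpha>")
    case True
    then have "(\<alpha>(0 := 1)) (Suc t) = - (\<alpha>(0 := 1)) t"
      using mem s[of t] s[of "Suc t"] Suc.prems by force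
    then show ?thesis using True IH by (simp add: level_Suc del: fun_upd_apply)
  next
    case False
    then show ?thesis using mem IH by (simp add: level_Suc del: fun_upd_apply)
  qed
qed simp

lemma sign_at:
  assumes "is_sign n \<alpha>" "t \<in> {1..n}"
  shows "\<alpha> t = (- 1) ^ level (sign_changes n \<alpha>) t"
  using sign_eq_level[OF assms(1), of t] assms(2) by simp

text \<open>\<open>Z\<close> is meant as the zero set of a cocircuit. The condition says that
  \<open>f\<close> is nowhere of sign opposite to the cocircuit, whose signs off \<open>Z\<close>
  are \<open>(- 1) ^ level Z t\<close>.\<close>

definition conformal :: "nat set \<Rightarrow> nat set \<Rightarrow> (nat \<Rightarrow> real) \<Rightarrow> bool" where
  "conformal I Z f \<longleftrightarrow> (\<forall>t\<in>I - Z. (- 1) ^ level Z t * f t \<ge> 0)"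

text \<open>The largest index outside \<open>Z\<close> is added. It lies to the right of all other
  indices outside \<open>Z\<close>, so no relevant level changes.\<close>

lemma conformal_extend:
  assumes "finite I" "Z \<subseteq> I" "conformal I Z f" "card Z \<le> q" "q \<le> card I"
  shows "\<exists>Z'. Z \<subseteq> Z' \<and> Z' \<subseteq> I \<and> card Z' = q \<and> conformal I Z' f"
  using assms(2-5)
proof (induction "q - card Z" arbitrary: Z)
  case 0
  then show ?case by (intro exI[of _ Z]) auto
next
  case (Suc d)
  have fin: "finite (I - Z)" "finite Z" using assms(1) Suc.prems(1) finite_subset by auto
  have "card Z < card I" using Suc by simp
  then have "I - Z \<noteq> {}" using Suc.prems(1) by auto
  then have m: "Max (I - Z) \<in> I - Z" by (rule Max_in[OF fin(1)])
  have m_max: "\<And>t. t \<in> I - Z \<Longrightarrow> t \<le> Max (I - Z)" using fin(1) by (rule Max_ge)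
  let ?Z = "insert (Max (I - Z)) Z"
  have "conformal I ?Z f"
    unfolding conformal_def
  proof
    fix t assume t: "t \<in> I - ?Z"
    then have "level ?Z t = level Z t" using m fin m_max[of t] by (simp add: level_insert leD)
    then show "0 \<le> (- 1) ^ level ?Z t * f t" using Suc.prems(2) t by (auto simp: conformal_def)
  qed
  moreover have "card ?Z = Suc (card Z)" using fin m by simp
  moreover have "?Z \<subseteq> I" using Suc.prems(1) m by blast
  moreover have "d = q - card ?Z" "card ?Z \<le> q" using Suc.hyps(2) \<open>card ?Z = Suc (card Z)\<close> by linarith+
  ultimately obtain Z' where "?Z \<subseteq> Z'" "Z' \<subseteq> I" "card Z' = q" "conformal I Z' f"
    using Suc.hyps(1)[of ?Z] Suc.prems(4) by blast
  then show ?case by blast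
qed

lemma level_Suc_image: "level (Suc ` C) (Suc t) = level C t"
proof -
  have "Suc ` C \<inter> {..<Suc t} = Suc ` (C \<inter> {..<t})" by auto
  then show ?thesis by (simp add: level_def card_image)
qed

lemma level_minus_zero:
  assumes "1 \<le> t"
  shows "level x t = level (x - {0}) t + (if 0 \<in> x then 1 else 0)"
proof -
  have "x \<inter> {..<t} = (if 0 \<in> x then insert 0 ((x - {0}) \<inter> {..<t}) else (x - {0}) \<inter> {..<t})"
    using assms by auto
  then show ?thesis by (cases "0 \<in> x") (simp_all add: level_def)
qed

text \<open>Each change \<open>a\<close> is placed at the coordinate \<open>Suc a\<close> just after
  it. At any other coordinate \<open>t\<close> there is no change immediately before, so placed and
  original changes to the left of \<open>t\<close> are equally many. In the second statement the
  factor \<open>\<alpha> 1\<close> makes the first sign positive, and the change at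
  \<open>0\<close>, which compares with the leading \<open>+\<close>, is dropped.\<close>

lemma conformal_sign_changes:
  assumes "is_sign n \<alpha>"
  shows "conformal {1..n} (Suc ` sign_changes n \<alpha>) \<alpha>"
    and "conformal {1..n} (Suc ` (sign_changes n \<alpha> - {0})) (\<lambda>t. \<alpha> 1 * \<alpha> t)"
proof -
  have eq: "level (Suc ` C) t = level C t" if "t \<notin> Suc ` C" "t \<in> {1..n}" for C t
  proof -
    obtain s where s: "t = Suc s" using \<open>t \<in> {1..n}\<close> by (cases t) auto
    then have "s \<notin> C" using that by auto
    then show ?thesis by (simp add: s level_Suc_image level_Suc[of C])
  qed
  have sq: "(- 1 :: real) ^ l * (- 1) ^ l = 1" for l :: nat by (simp flip: power_mult_distrib)
  show "conformal {1..n} (Suc ` sign_changes n \<alpha>) \<alpha>"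
    unfolding conformal_def
  proof
    fix t assume "t \<in> {1..n} - Suc ` sign_changes n \<alpha>"
    then have "level (Suc ` sign_changes n \<alpha>) t = level (sign_changes n \<alpha>) t" "t \<in> {1..n}"
      using eq[of t "sign_changes n \<alpha>"] by blast+
    then show "0 \<le> (- 1) ^ level (Suc ` sign_changes n \<alpha>) t * \<alpha> t"
      using sign_at[OF assms, of t] sq by simp
  qed
  show "conformal {1..n} (Suc ` (sign_changes n \<alpha> - {0})) (\<lambda>t. \<alpha> 1 * \<alpha> t)"
    unfolding conformal_def
  proof
    fix t assume "t \<in> {1..n} - Suc ` (sign_changes n \<alpha> - {0})"
    then have *: "level (Suc ` (sign_changes n \<alpha> - {0})) t = level (sign_changes n \<alpha> - {0}) t" "t \<in> {1..n}"
      using eq[of t "sign_changes n \<alpha> - {0}"] by blast+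
    define e l :: nat where "e = (if 0 \<in> sign_changes n \<alpha> then 1 else 0)"
      and "l = level (sign_changes n \<alpha> - {0}) t"
    have "level (sign_changes n \<alpha>) 1 = e" "level (sign_changes n \<alpha>) t = l + e"
      using level_Suc[of "sign_changes n \<alpha>" 0] level_minus_zero[of t "sign_changes n \<alpha>"] *(2)
      by (simp_all only: e_def l_def level_0 One_nat_def add_0 atLeastAtMost_iff)
    then have "\<alpha> 1 = (- 1) ^ e" "\<alpha> t = (- 1) ^ (l + e)"
      using sign_at[OF assms, of 1] sign_at[OF assms *(2)] *(2) by auto
    then have "\<alpha> 1 * \<alpha> t = (- 1) ^ l * ((- 1) ^ e * (- 1) ^ e)"
      by (simp only: power_add mult.left_commute mult.commute)
    then have "\<alpha> 1 * \<alpha> t = (- 1) ^ level (sign_changes n \<alpha> - {0}) t"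
      by (simp only: sq mult_1_right l_def)
    then show "0 \<le> (- 1) ^ level (Suc ` (sign_changes n \<alpha> - {0})) t * (\<alpha> 1 * \<alpha> t)"
      using * sq by simp
  qed
qed

lemma exists_level:
  assumes "finite C" "q \<le> card C"
  shows "\<exists>b. level C b = q"
proof -
  obtain N where "C \<subseteq> {..<N}" using assms(1) finite_nat_bounded by auto
  then have "C \<inter> {..<N} = C" by auto
  then have N: "q \<le> level C N" using assms(2) by (simp add: level_def)
  define b where "b = (LEAST b. q \<le> level C b)"
  have b: "q \<le> level C b" unfolding b_def using N by (rule LeastI)
  show ?thesis
  proof (cases b)
    case 0
    then show ?thesis using b by (intro exI[of _ 0]) simp
  next
    case (Suc b')
    then have "\<not> q \<le> level C b'" using not_less_Least[of b' "\<lambda>b. q \<le> level C b"] by (simp add: b_def)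
    then show ?thesis using b Suc by (intro exI[of _ b]) (auto simp: level_Suc split: if_splits)
  qed
qed

text \<open>\<open>C\<close> consists of the first \<open>q\<close> changes other than
  \<open>0\<close>. Coordinate \<open>1\<close> and the coordinates just after these changes
  alternate in sign.\<close>

lemma alternating_indices:
  assumes \<alpha>: "is_sign n \<alpha>" and q: "q \<le> card (sign_changes n \<alpha> - {0})" and n: "n \<ge> 1"
  obtains C where "finite C" "0 \<notin> C" "card C = q" "Suc ` C \<subseteq> {1..n}"
    "\<And>t. t \<in> insert 1 (Suc ` C) \<Longrightarrow> \<alpha> t = \<alpha> 1 * (- 1) ^ level (insert 1 (Suc ` C)) t"
proof -
  define x where "x = sign_changes n \<alpha>"
  obtain b where b: "level (x - {0}) b = q" using exists_level[of "x - {0}" q] q by (auto simp: x_def)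
  define C where "C = (x - {0}) \<inter> {..<b}"
  have C: "finite C" "0 \<notin> C" "card C = q" using b by (auto simp: C_def level_def)
  have sub: "Suc ` C \<subseteq> {1..n}" by (auto simp: C_def x_def dest: sign_changes_less)
  have "\<alpha> t = \<alpha> 1 * (- 1) ^ level (insert 1 (Suc ` C)) t" if t: "t \<in> insert 1 (Suc ` C)" for t
  proof (cases "t = 1")
    case True
    have "insert 1 (Suc ` C) \<inter> {..<1} = {}" by auto
    then show ?thesis using True by (simp add: level_def)
  next
    case False
    then obtain a where a: "a \<in> C" "t = Suc a" using t by auto
    have a1: "a \<ge> 1" "a \<in> x" "a < n" using a C by (auto simp: C_def x_def dest: sign_changes_less intro: Suc_leI gr0I)
    have "1 \<notin> Suc ` C" using C by auto
    then have "level (insert 1 (Suc ` C)) t = Suc (level C a)"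
      using a1 C(1) a by (simp add: level_insert level_Suc_image)
    moreover have "C \<inter> {..<a} = (x - {0}) \<inter> {..<a}" using a by (auto simp: C_def)
    then have "level C a = level (x - {0}) a" by (simp add: level_def)
    moreover have "\<alpha> t = (- 1) ^ Suc (level x a)"
      using sign_at[OF \<alpha>, of t] a a1 by (simp add: level_Suc flip: x_def)
    moreover have "\<alpha> 1 = (- 1) ^ (if 0 \<in> x then 1 else 0 :: nat)"
      using sign_at[OF \<alpha>, of 1] level_Suc[of x 0] n by (simp add: x_def)
    ultimately show ?thesis using level_minus_zero[of a x] a1 by (simp add: power_add)
  qed
  then show ?thesis using that C sub by blast
qed

lemma sign_cases:
  assumes "is_sign n \<alpha>" "n \<ge> 1"
  shows "\<alpha> 1 = 1 \<and> 0 \<notin> sign_changes n \<alpha> \<or> \<alpha> 1 = -1 \<and> 0 \<in> sign_changes n \<alpha>"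
  using assms by (auto simp: is_sign_def sign_changes_def)

text \<open>\<open>m\<close> changes would give \<open>m + 1\<close> coordinates on which
  \<open>x\<close> weakly alternates, forcing \<open>x = 0\<close>. The change at \<open>0\<close>
  does not count, because the leading \<open>+\<close> is not a coordinate of
  \<open>W\<close>.\<close>

lemma sign_changes_bound:
  assumes W: "W \<in> Gr_pos m {1..n}" and n: "n \<ge> 1" and x: "x \<in> W" "x i \<noteq> 0"
    and \<alpha>: "is_sign n \<alpha>" "\<And>t. t \<in> {1..n} \<Longrightarrow> \<alpha> t * x t \<ge> 0"
  shows "card (sign_changes n \<alpha> - {0}) < m"
proof (rule ccontr)
  assume "\<not> ?thesis"
  then obtain C where C: "finite C" "0 \<notin> C" "card C = m" "Suc ` C \<subseteq> {1..n}"
    "\<And>t. t \<in> insert 1 (Suc ` C) \<Longrightarrow> \<alpha> t = \<alpha> 1 * (- 1) ^ level (insert 1 (Suc ` C)) t"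
    using alternating_indices[OF \<alpha>(1), of m] n by (metis not_less)
  let ?J = "insert 1 (Suc ` C)"
  have "1 \<notin> Suc ` C" using C(2) by auto
  then have J: "?J \<subseteq> {1..n}" "finite ?J" "card ?J = Suc m" using C n by (auto simp: card_image)
  have s: "\<alpha> 1 = 1 \<or> \<alpha> 1 = -1" using \<alpha>(1) n by (auto simp: is_sign_def)
  have "(\<lambda>i. \<alpha> 1 * x i) \<in> W" by (rule Gr_pos_closed[OF W]) (rule x(1))
  moreover have "(- 1) ^ level ?J t * (\<alpha> 1 * x t) \<ge> 0" if "t \<in> ?J" for t
  proof -
    have "(- 1) ^ level ?J t * \<alpha> 1 = \<alpha> t" using C(5)[OF that] by simp
    then show ?thesis using \<alpha>(2)[of t] that J(1) by (metis mult.assoc subsetD)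
  qed
  ultimately have "\<alpha> 1 * x i = 0" by (rule Gr_pos_alternating[OF W J])
  then show False using s x(2) by auto
qed

end

section \<open>Vertices of a cyclic arrangement\<close>

locale cyclic = osz n k for n k +
  fixes V :: "(nat \<Rightarrow> real) set" and \<eta> :: "nat \<Rightarrow> real"
  assumes cyclic: "cyclic_arrangement n k V \<eta>"
begin

definition W :: "(nat \<Rightarrow> real) set" where
  "W = rfun.span (insert \<eta> V)"

lemma V_pos: "V \<in> Gr_pos k {1..n}" and W_pos: "W \<in> Gr_pos (Suc k) {1..n}"
  and eta_coord: "\<eta> \<in> coord_space {1..n}"
  using cyclic by (auto simp: cyclic_arrangement_def arrangement_def W_def)

lemma W_iff: "x \<in> W \<longleftrightarrow> (\<exists>t. (\<lambda>i. x i - t * \<eta> i) \<in> V)"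
  unfolding W_def rfun.span_breakdown_eq rfun.span_eq_iff[THEN iffD2, OF Gr_pos_subspace(1)[OF V_pos]]
  by (simp add: fun_diff_def)

lemma affine_iff: "x \<in> affine_space V \<eta> \<longleftrightarrow> (\<lambda>i. x i - \<eta> i) \<in> V"
proof
  assume "x \<in> affine_space V \<eta>"
  then obtain v where "v \<in> V" "x = v + \<eta>" by (auto simp: affine_space_def)
  then show "(\<lambda>i. x i - \<eta> i) \<in> V" by simp
next
  assume "(\<lambda>i. x i - \<eta> i) \<in> V"
  then show "x \<in> affine_space V \<eta>"
    unfolding affine_space_def by (intro image_eqI[of _ _ "\<lambda>i. x i - \<eta> i"]) (auto simp: fun_eq_iff)
qed

lemma affine_subset_W: "x \<in> affine_space V \<eta> \<Longrightarrow> x \<in> W"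
  unfolding W_iff affine_iff by (intro exI[of _ 1]) simp

lemma affine_diff: "x \<in> affine_space V \<eta> \<Longrightarrow> y \<in> affine_space V \<eta> \<Longrightarrow> (\<lambda>i. x i - y i) \<in> V"
  using Gr_pos_closed(3)[OF V_pos, of "\<lambda>i. x i - \<eta> i" "\<lambda>i. y i - \<eta> i"] by (simp add: affine_iff)

lemma affine_add: "x \<in> affine_space V \<eta> \<Longrightarrow> v \<in> V \<Longrightarrow> (\<lambda>i. x i + s * v i) \<in> affine_space V \<eta>"
  using Gr_pos_closed(1)[OF V_pos, of "\<lambda>i. x i - \<eta> i" "\<lambda>i. s * v i"] Gr_pos_closed(2)[OF V_pos, of v s]
  by (simp add: affine_iff algebra_simps)

lemma k_less_n: "k < n"
proof -
  define e :: "nat \<Rightarrow> nat \<Rightarrow> real" where "e i = (\<lambda>j. if i = j then 1 else 0)" for i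
  obtain b where b: "ordered_basis (Suc k) b W" using W_pos by (auto simp: Gr_pos_def)
  have "x \<in> rfun.span (e ` {1..n})" if "x \<in> coord_space {1..n}" for x
  proof -
    have "x = (\<Sum>i\<in>{1..n}. (\<lambda>j. x i * e i j))"
    proof
      fix j
      have app: "(\<Sum>i\<in>A. (\<lambda>j. x i * e i j)) j = (\<Sum>i\<in>A. x i * e i j)" for A
        by (induction A rule: infinite_finite_induct) (simp_all add: zero_fun_def plus_fun_def)
      have "(\<Sum>i\<in>{1..n}. x i * e i j) = (\<Sum>i\<in>{1..n}. if i = j then x j else 0)"
        by (intro sum.cong) (auto simp: e_def)
      also have "\<dots> = x j" using that by (auto simp: coord_space_def)
      finally show "x j = (\<Sum>i\<in>{1..n}. (\<lambda>j. x i * e i j)) j" by (simp only: app)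
    qed
    also have "\<dots> \<in> rfun.span (e ` {1..n})"
      by (intro rfun.span_sum rfun.span_scale rfun.span_base) auto
    finally show ?thesis .
  qed
  moreover have "b ` {0..<Suc k} \<subseteq> W"
    using rfun.span_superset[of "b ` {0..<Suc k}"] b unfolding ordered_basis_def by simp
  ultimately have "b ` {0..<Suc k} \<subseteq> rfun.span (e ` {1..n})" using Gr_pos_subspace(2)[OF W_pos] by blast
  then have "card (b ` {0..<Suc k}) \<le> card (e ` {1..n})"
    using rfun.independent_span_bound[of "e ` {1..n}" "b ` {0..<Suc k}"] b by (auto simp: ordered_basis_def)
  also have "\<dots> \<le> n" using card_image_le[of "{1..n}" e] by simp
  also have "card (b ` {0..<Suc k}) = Suc k" using b by (simp add: ordered_basis_def card_image)
  finally show ?thesis by simp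
qed

text \<open>The two possibilities for the vertex of the arrangement on the hyperplanes in \<open>Z\<close>, which is
  determined up to the sign \<open>s\<close> by the cocircuits of \<open>W\<close>.\<close>

definition vertex_at :: "real \<Rightarrow> nat set \<Rightarrow> (nat \<Rightarrow> real) \<Rightarrow> bool" where
  "vertex_at s Z p \<longleftrightarrow> p \<in> affine_space V \<eta> \<and> (\<forall>z\<in>Z. p z = 0) \<and>
     (\<forall>t\<in>{1..n} - Z. s * ((- 1) ^ level Z t * p t) > 0)"

lemma vertex_at_pos: "vertex_at s Z p \<Longrightarrow> t \<in> {1..n} \<Longrightarrow> t \<notin> Z \<Longrightarrow> s * ((- 1) ^ level Z t * p t) > 0"
  unfolding vertex_at_def by blast

text \<open>A cocircuit of \<open>W\<close> with zero set \<open>Z\<close> is rescaled to have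
  \<eta>-coefficient one. The coefficient is nonzero because otherwise the cocircuit would lie in
  \<open>V\<close> and vanish on \<open>k\<close> coordinates. Its sign is the sign
  \<open>s\<close>.\<close>

lemma vertex_dichotomy:
  assumes Z: "Z \<subseteq> {1..n}" "card Z = k"
  shows "\<exists>p. vertex_at 1 Z p \<or> vertex_at (- 1) Z p"
proof -
  have "card Z \<noteq> card {1..n}" using Z k_less_n by simp
  then have ne: "Z \<noteq> {1..n}" by blast
  obtain x where x: "x \<in> W" "\<And>z. z \<in> Z \<Longrightarrow> x z = 0" "\<And>t. t \<in> {1..n} - Z \<Longrightarrow> (- 1) ^ level Z t * x t > 0"
    using Gr_pos_cocircuit[OF W_pos _ Z ne] by auto
  obtain t where t: "(\<lambda>i. x i - t * \<eta> i) \<in> V" using x(1) W_iff by auto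
  have fin: "finite Z" using Z finite_subset by auto
  have "{1..n} - Z \<noteq> {}" using ne Z(1) by blast
  then obtain j where j: "j \<in> {1..n} - Z" by blast
  have "t \<noteq> 0"
  proof
    assume "t = 0"
    then have "x j = 0" using Gr_pos_vanish[OF V_pos Z(1) fin Z(2), of x j] t x(2) by simp
    then show False using x(3)[OF j] by simp
  qed
  define p where "p = (\<lambda>i. (1 / t) * x i)"
  have "(\<lambda>i. (1 / t) * (x i - t * \<eta> i)) \<in> V" by (rule Gr_pos_closed(2)[OF V_pos t])
  moreover have "(\<lambda>i. (1 / t) * (x i - t * \<eta> i)) = (\<lambda>i. p i - \<eta> i)"
    using \<open>t \<noteq> 0\<close> by (simp add: p_def right_diff_distrib)
  ultimately have p: "p \<in> affine_space V \<eta>" by (simp add: affine_iff)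
  have eq: "(- 1) ^ level Z i * p i = (1 / t) * ((- 1) ^ level Z i * x i)" for i by (simp add: p_def)
  show ?thesis
  proof (cases "t > 0")
    case True
    have "1 * ((1 / t) * ((- 1) ^ level Z i * x i)) > 0" if "i \<in> {1..n} - Z" for i
      using mult_pos_pos[OF _ x(3)[OF that], of "1 / t"] True by simp
    then have "vertex_at 1 Z p" unfolding vertex_at_def eq using p x(2) by (simp add: p_def)
    then show ?thesis by blast
  next
    case False
    then have "t < 0" using \<open>t \<noteq> 0\<close> by simp
    have "- 1 * ((1 / t) * ((- 1) ^ level Z i * x i)) > 0" if "i \<in> {1..n} - Z" for i
      using mult_neg_pos[OF _ x(3)[OF that], of "1 / t"] \<open>t < 0\<close> by simp
    then have "vertex_at (- 1) Z p" unfolding vertex_at_def eq using p x(2) by (simp add: p_def)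
    then show ?thesis by blast
  qed
qed

text \<open>The difference of the two vertices lies in \<open>V\<close> and vanishes on the common
  hyperplanes. If their signs differed, it would, up to the factor \<open>s\<close>, alternate on
  the \<open>k + 1\<close> coordinates of \<open>Z\<close> and \<open>Suc a\<close>, which is
  impossible for a nonzero element of \<open>V\<close>.\<close>

lemma vertex_adjacent:
  assumes Z: "Z \<subseteq> {1..n}" "card Z = k" and a: "a \<in> Z" "Suc a \<notin> Z" "Suc a \<le> n"
    and s: "s = 1 \<or> s = - 1" and p: "vertex_at s Z p" and p': "vertex_at (- s) (insert (Suc a) (Z - {a})) p'"
  shows False
proof -
  let ?Z' = "insert (Suc a) (Z - {a})" and ?J = "insert (Suc a) Z"
  have fin: "finite Z" using Z finite_subset by auto
  have J: "?J \<subseteq> {1..n}" "finite ?J" "card ?J = Suc k" using Z a fin by auto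
  have "a \<in> {1..n}" using a Z by auto
  define v where "v = (\<lambda>i. s * (p i - p' i))"
  have "(\<lambda>i. p i - p' i) \<in> V" using p p' affine_diff by (simp add: vertex_at_def)
  then have v: "v \<in> V" unfolding v_def by (rule Gr_pos_closed(2)[OF V_pos])
  have lJ: "level ?J a = level Z a" "level ?J (Suc a) = Suc (level Z a)"
    using fin a by (simp_all add: level_insert level_Suc)
  have "?Z' \<inter> {..<a} = Z \<inter> {..<a}" by auto
  then have lZ': "level ?Z' a = level Z a" by (simp add: level_def)
  have "a \<in> {1..n} - ?Z'" using \<open>a \<in> {1..n}\<close> by simp
  then have "- s * ((- 1) ^ level ?Z' a * p' a) > 0" using p' unfolding vertex_at_def by blast
  then have "- s * ((- 1) ^ level Z a * p' a) > 0" unfolding lZ' .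
  moreover have "p a = 0" using p a by (simp add: vertex_at_def)
  ultimately have va: "(- 1) ^ level ?J a * v a > 0" using lJ by (simp add: v_def mult.left_commute)
  have "s * ((- 1) ^ Suc (level Z a) * p (Suc a)) > 0"
    using vertex_at_pos[OF p, of "Suc a"] a level_Suc[of Z a] by simp
  moreover have "p' (Suc a) = 0" using p' by (simp add: vertex_at_def)
  ultimately have vSa: "(- 1) ^ level ?J (Suc a) * v (Suc a) > 0" using lJ by (simp add: v_def mult.left_commute)
  have "(- 1) ^ level ?J t * v t \<ge> 0" if "t \<in> ?J" for t
  proof -
    consider "t = a" | "t = Suc a" | "t \<in> Z - {a}" using \<open>t \<in> ?J\<close> by blast
    then show ?thesis
    proof cases
      case 3
      then have "v t = 0" using p p' by (simp add: v_def vertex_at_def)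
      then show ?thesis by simp
    qed (use va vSa in simp_all)
  qed
  then have "v a = 0" by (rule Gr_pos_alternating[OF V_pos J v])
  then show False using va by simp
qed

text \<open>Any \<open>Z\<close> can be pushed to the right, one element by one step at a time,
  until it is the last segment of \<open>{1..n}\<close>; by \<open>vertex_adjacent\<close> and the
  dichotomy no step changes the sign. The sum of the distances to \<open>n\<close>
  decreases.\<close>

lemma vertex_sign_invariant:
  assumes Z: "Z \<subseteq> {1..n}" "card Z = k" and s: "s = 1 \<or> s = - 1"
  shows "(\<exists>p. vertex_at s Z p) \<longleftrightarrow> (\<exists>p. vertex_at s {n - k + 1..n} p)"
  using Z
proof (induction "\<Sum>z\<in>Z. n - z" arbitrary: Z rule: less_induct)
  case less
  have fin: "finite Z" using less.prems finite_subset by auto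
  show ?case
  proof (cases "\<exists>a\<in>Z. Suc a \<notin> Z \<and> Suc a \<le> n")
    case True
    then obtain a where a: "a \<in> Z" "Suc a \<notin> Z" "Suc a \<le> n" by auto
    let ?Z' = "insert (Suc a) (Z - {a})"
    have "card ?Z' = Suc (card (Z - {a}))" using a fin by (intro card_insert_disjoint) auto
    also have "\<dots> = card Z" using a fin by (intro card_Suc_Diff1)
    finally have Z': "?Z' \<subseteq> {1..n}" "card ?Z' = k" using less.prems a by auto
    have "(\<Sum>z\<in>?Z'. n - z) = (n - Suc a) + (\<Sum>z\<in>Z - {a}. n - z)" using a fin by simp
    also have "\<dots> < (n - a) + (\<Sum>z\<in>Z - {a}. n - z)" using a by simp
    also have "\<dots> = (\<Sum>z\<in>Z. n - z)" using a fin by (simp add: sum.remove)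
    finally have IH: "(\<exists>p. vertex_at s ?Z' p) \<longleftrightarrow> (\<exists>p. vertex_at s {n - k + 1..n} p)"
      using less.hyps[of ?Z'] Z' by blast
    have "(\<exists>p. vertex_at s Z p) \<longleftrightarrow> (\<exists>p. vertex_at s ?Z' p)"
    proof
      assume "\<exists>p. vertex_at s Z p"
      then show "\<exists>p. vertex_at s ?Z' p"
        using vertex_adjacent[OF less.prems a s] vertex_dichotomy[OF Z'] s by (metis minus_minus)
    next
      assume "\<exists>p. vertex_at s ?Z' p"
      then show "\<exists>p. vertex_at s Z p"
        using vertex_adjacent[OF less.prems a, of "- s"] vertex_dichotomy[OF less.prems] s by (metis minus_minus)
    qed
    then show ?thesis using IH by simp
  next
    case False
    have "Z = {n - k + 1..n}"
    proof (cases "Z = {}")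
      case True
      then show ?thesis using less.prems by simp
    next
      case nonempty: False
      define m where "m = Min Z"
      have m: "m \<in> Z" "\<And>z. z \<in> Z \<Longrightarrow> m \<le> z" using fin nonempty by (auto simp: m_def)
      have up: "m + d \<in> Z" if "m + d \<le> n" for d
        using that
      proof (induction d)
        case (Suc d)
        then have "m + d \<in> Z" by simp
        then show ?case using False Suc.prems by auto
      qed (simp add: m)
      have "Z = {m..n}"
      proof
        show "Z \<subseteq> {m..n}" using m less.prems by auto
        show "{m..n} \<subseteq> Z" using up by (auto dest!: le_Suc_ex)
      qed
      moreover have "m \<in> {1..n}" using m less.prems by auto
      ultimately show ?thesis using less.prems(2) by auto
    qed
    then show ?thesis by simp
  qed
qed

text \<open>One set \<open>Y\<close> suffices. Let \<open>w\<close> be the projection of \<eta> onto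
  the orthogonal complement. It lies in the affine space and has the same positive product with
  every point there. As \<open>w 1 > 0\<close>, the signs of \<open>w\<close> have at most
  \<open>k\<close> changes, even counting the leading \<open>+\<close>, and so are conformal to some
  \<open>Y\<close> of size \<open>k\<close>. A vertex on \<open>Y\<close> of the wrong sign would
  have nonpositive product with \<open>w\<close>.\<close>

lemma vertex_exists:
  assumes Z: "Z \<subseteq> {1..n}" "card Z = k"
  obtains p where "vertex_at 1 Z p"
proof -
  obtain w where w: "w \<in> orth_compl n V" "\<eta> - w \<in> V" "w 1 > 0"
    using cyclic by (auto simp: cyclic_arrangement_def positively_oriented_def)
  have n1: "n \<ge> 1" using k_less_n by simp
  have "(\<lambda>i. - 1 * (\<eta> i - w i)) \<in> V"
    using Gr_pos_closed(2)[OF V_pos, of "\<lambda>i. \<eta> i - w i" "- 1"] w(2) by (simp add: fun_diff_def)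
  then have wW: "w \<in> affine_space V \<eta>" by (simp add: affine_iff)
  define \<alpha> :: "nat \<Rightarrow> real" where "\<alpha> t = (if w t < 0 then - 1 else 1)" for t
  have sign: "is_sign n \<alpha>" by (simp add: is_sign_def \<alpha>_def)
  have "\<alpha> t * w t \<ge> 0" for t by (simp add: \<alpha>_def)
  then have "card (sign_changes n \<alpha> - {0}) < Suc k"
    using sign_changes_bound[OF W_pos n1 affine_subset_W[OF wW], of 1 \<alpha>] sign w(3) by simp
  moreover have "0 \<notin> sign_changes n \<alpha>" using w(3) by (auto simp: sign_changes_def \<alpha>_def)
  ultimately have card: "card (Suc ` sign_changes n \<alpha>) \<le> k" by (simp add: card_image)
  have "Suc ` sign_changes n \<alpha> \<subseteq> {1..n}" by (auto dest: sign_changes_less)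
  then obtain Y where Y: "Y \<subseteq> {1..n}" "card Y = k" "conformal {1..n} Y \<alpha>"
    using conformal_extend[OF _ _ conformal_sign_changes(1)[OF sign] card] k_less_n by auto
  have confw: "(- 1) ^ level Y t * w t \<ge> 0" if "t \<in> {1..n} - Y" for t
  proof -
    have "w t = \<bar>w t\<bar> * \<alpha> t" by (simp add: \<alpha>_def)
    then have eq: "(- 1) ^ level Y t * w t = \<bar>w t\<bar> * ((- 1) ^ level Y t * \<alpha> t)" by (metis mult.left_commute)
    have "(- 1) ^ level Y t * \<alpha> t \<ge> 0" using Y(3) that unfolding conformal_def by blast
    then show ?thesis unfolding eq by (rule mult_nonneg_nonneg[OF abs_ge_zero])
  qed
  have "\<not> vertex_at (- 1) Y p" for p
  proof
    assume p: "vertex_at (- 1) Y p"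
    have "(\<lambda>i. p i - w i) \<in> V" using p wW affine_diff by (simp add: vertex_at_def)
    then have "dot n w (\<lambda>i. p i - w i) = 0" using w(1) by (simp add: orth_compl_def)
    then have eq: "(\<Sum>i=1..n. w i * p i) = (\<Sum>i=1..n. w i * w i)"
      by (simp add: dot_def right_diff_distrib sum_subtractf)
    have "w i * p i \<le> 0" if i: "i \<in> {1..n}" for i
    proof (cases "i \<in> Y")
      case True
      then show ?thesis using p by (simp add: vertex_at_def)
    next
      case False
      have "(- 1) ^ level Y i * p i < 0" using p i False by (simp add: vertex_at_def)
      then have "((- 1) ^ level Y i * w i) * ((- 1) ^ level Y i * p i) \<le> 0"
        using confw[of i] i False by (intro mult_nonneg_nonpos[OF _ less_imp_le]) simp_all
      moreover have "((- 1) ^ level Y i * w i) * ((- 1) ^ level Y i * p i) = w i * p i"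
        by (cases "even (level Y i)") auto
      ultimately show ?thesis by simp
    qed
    then have "(\<Sum>i=1..n. w i * p i) \<le> 0" by (intro sum_nonpos)
    moreover have "(\<Sum>i=1..n. w i * w i) > 0"
      using w(3) n1 by (intro sum_pos2[of _ 1]) auto
    ultimately show False using eq by simp
  qed
  then have "\<exists>p. vertex_at 1 Y p" using vertex_dichotomy[OF Y(1,2)] by blast
  then have "\<exists>p. vertex_at 1 Z p"
    using vertex_sign_invariant[OF Y(1,2)] vertex_sign_invariant[OF Z] by blast
  then show ?thesis using that by blast
qed

text \<open>The bound for \<open>W\<close> leaves only the case of a negative first sign followed by
  \<open>k\<close> further changes. Then \<open>x\<close> is subtracted from the vertex that
  vanishes at the coordinates just after these changes: its first coordinate is positive, that of
  \<open>x\<close> is not, so the difference is an element of \<open>V\<close> weakly alternating on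
  \<open>k + 1\<close> coordinates.\<close>

lemma affine_sign_changes_bound:
  assumes x: "x \<in> affine_space V \<eta>" and \<alpha>: "is_sign n \<alpha>" "\<And>t. t \<in> {1..n} \<Longrightarrow> \<alpha> t * x t \<ge> 0"
  shows "card (sign_changes n \<alpha>) \<le> k"
proof (rule ccontr)
  assume neg: "\<not> ?thesis"
  have n1: "n \<ge> 1" using k_less_n by simp
  \<comment> \<open>If the origin belonged to the affine space, every vertex would lie in
    \<open>V\<close> and vanish on \<open>k\<close> coordinates, hence everywhere.\<close>
  have "\<exists>i. x i \<noteq> 0"
  proof (rule ccontr)
    assume "\<not> ?thesis"
    then have "(\<lambda>i. 0 - \<eta> i) \<in> V" using x by (simp add: affine_iff)
    then have z: "(\<lambda>i. 0) \<in> affine_space V \<eta>" by (simp add: affine_iff)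
    obtain Z where Z: "Z \<subseteq> {1..n}" "card Z = k" using obtain_subset_with_card_n[of k "{1..n}"] k_less_n by auto
    then have fin: "finite Z" and "Z \<noteq> {1..n}" using finite_subset k_less_n by auto
    then have "{1..n} - Z \<noteq> {}" using Z(1) by blast
    then obtain t where t: "t \<in> {1..n} - Z" by blast
    obtain p where p: "vertex_at 1 Z p" using vertex_exists[OF Z] .
    have "(\<lambda>i. p i - 0) \<in> V" using affine_diff[of p "\<lambda>i. 0"] p z by (simp add: vertex_at_def)
    then have "p t = 0" using Gr_pos_vanish[OF V_pos Z(1) fin Z(2), of p t] p by (simp add: vertex_at_def)
    then show False using vertex_at_pos[OF p, of t] t by simp
  qed
  then obtain i where "x i \<noteq> 0" by blast
  then have W_bound: "card (sign_changes n \<alpha> - {0}) < Suc k"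
    using sign_changes_bound[OF W_pos n1 affine_subset_W[OF x], of i \<alpha>] \<alpha> by simp
  then have zero: "0 \<in> sign_changes n \<alpha>" using neg by (cases "0 \<in> sign_changes n \<alpha>") auto
  then have "k \<le> card (sign_changes n \<alpha> - {0})" using neg by simp
  then obtain C where C: "finite C" "0 \<notin> C" "card C = k" "Suc ` C \<subseteq> {1..n}"
    "\<And>t. t \<in> insert 1 (Suc ` C) \<Longrightarrow> \<alpha> t = \<alpha> 1 * (- 1) ^ level (insert 1 (Suc ` C)) t"
    using alternating_indices[OF \<alpha>(1) _ n1] by blast
  let ?J = "insert 1 (Suc ` C)"
  have "1 \<notin> Suc ` C" using C(2) by auto
  then have J: "?J \<subseteq> {1..n}" "finite ?J" "card ?J = Suc k" using C n1 by (auto simp: card_image)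
  have \<alpha>1: "\<alpha> 1 = - 1" using sign_cases[OF \<alpha>(1) n1] zero by simp
  obtain p where p: "vertex_at 1 (Suc ` C) p" using vertex_exists[OF C(4)] C(3) by (auto simp: card_image)
  have "Suc ` C \<inter> {..<1} = {}" by auto
  then have "level (Suc ` C) 1 = 0" by (simp add: level_def)
  then have p1: "p 1 > 0" using vertex_at_pos[OF p, of 1] \<open>1 \<notin> Suc ` C\<close> n1 by simp
  have x1: "x 1 \<le> 0" using \<alpha>(2)[of 1] \<alpha>1 n1 by simp
  define v where "v = (\<lambda>i. p i - x i)"
  have "v \<in> V" using p x affine_diff by (simp add: v_def vertex_at_def)
  moreover have "(- 1) ^ level ?J t * v t \<ge> 0" if t: "t \<in> ?J" for t
  proof (cases "t = 1")
    case True
    have "?J \<inter> {..<1} = {}" by auto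
    then show ?thesis using True p1 x1 by (simp add: level_def v_def)
  next
    case False
    then have "v t = - x t" using t p by (auto simp: v_def vertex_at_def)
    moreover have "(- 1) ^ level ?J t = - \<alpha> t" using C(5)[OF t] \<alpha>1 by simp
    ultimately show ?thesis using \<alpha>(2)[of t] t J(1) by auto
  qed
  ultimately have "v 1 = 0" by (rule Gr_pos_alternating[OF V_pos J])
  then show False using p1 x1 by (simp add: v_def)
qed

end

section \<open>Bounded and compact regions\<close>

text \<open>Tychonoff: the regions live in a space of infinite sequences, where coordinatewise
  bounds still suffice.\<close>

lemma compact_box: "compact {x :: nat \<Rightarrow> real. \<forall>i. x i \<in> {l i..u i}}"
proof -
  have "compactin (product_topology (\<lambda>_. euclidean) UNIV) (PiE UNIV (\<lambda>i. {l i..u i}))"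
    by (simp add: compactin_PiE)
  moreover have "PiE UNIV (\<lambda>i. {l i..u i}) = {x. \<forall>i. x i \<in> {l i..u i}}" by auto
  ultimately show ?thesis by (simp add: euclidean_product_topology)
qed

lemma dot_linear:
  "dot n \<xi> (\<lambda>i. x i + s * v i) = dot n \<xi> x + s * dot n \<xi> v"
  "dot n \<xi> (\<lambda>i. x i - v i) = dot n \<xi> x - dot n \<xi> v"
  by (simp_all add: dot_def distrib_left right_diff_distrib sum.distrib sum_subtractf sum_distrib_left
      mult.left_commute)

lemma same_sign_product:
  fixes a v :: real
  assumes "(- 1) ^ l * v > 0" "(- 1) ^ l * a \<ge> 0"
  shows "a * v \<ge> 0"
  using assms by (cases "even l") (auto intro: mult_nonneg_nonneg mult_nonpos_nonpos)

context cyclic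
begin

lemma card_changes_image: "card (Suc ` sign_changes n \<alpha>) = card (sign_changes n \<alpha>)"
  by (simp add: card_image)

lemma changes_image_subset: "Suc ` sign_changes n \<alpha> \<subseteq> {1..n}"
  by (auto dest: sign_changes_less)

lemma vertex_in_region:
  assumes "vertex_at 1 Z p" "is_sign n \<alpha>" "conformal {1..n} Z \<alpha>"
  shows "p \<in> region n V \<eta> \<alpha>"
proof -
  have "\<alpha> t * p t \<ge> 0" if t: "t \<in> {1..n}" for t
  proof (cases "t \<in> Z")
    case True
    then show ?thesis using assms(1) by (simp add: vertex_at_def)
  next
    case False
    then have "(- 1) ^ level Z t * p t > 0" using vertex_at_pos[OF assms(1) t] by simp
    moreover have "(- 1) ^ level Z t * \<alpha> t \<ge> 0" using assms(3) t False unfolding conformal_def by blast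
    ultimately show ?thesis by (rule same_sign_product)
  qed
  then show ?thesis using assms(1) by (simp add: region_def vertex_at_def)
qed

lemma feasible_if_changes:
  assumes "is_sign n \<alpha>" "card (sign_changes n \<alpha>) = k"
  shows "feasible n V \<eta> \<alpha>"
proof -
  obtain p where "vertex_at 1 (Suc ` sign_changes n \<alpha>) p"
    using vertex_exists[OF changes_image_subset] assms(2) by (auto simp: card_changes_image)
  then have "p \<in> region n V \<eta> \<alpha>" using vertex_in_region assms(1) conformal_sign_changes(1) by blast
  then show ?thesis by (auto simp: feasible_def)
qed

lemma feasible_changes_le:
  assumes "is_sign n \<alpha>" "feasible n V \<eta> \<alpha>"
  shows "card (sign_changes n \<alpha>) \<le> k"
proof -
  obtain x where "x \<in> region n V \<eta> \<alpha>" using assms(2) by (auto simp: feasible_def)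
  then show ?thesis using affine_sign_changes_bound[of x \<alpha>] assms(1) by (simp add: region_def)
qed

lemma region_add:
  assumes "p \<in> region n V \<eta> \<alpha>" "v \<in> V" "\<And>t. t \<in> {1..n} \<Longrightarrow> \<alpha> t * v t \<ge> 0" "s \<ge> 0"
  shows "(\<lambda>i. p i + s * v i) \<in> region n V \<eta> \<alpha>"
proof -
  have "\<alpha> t * (p t + s * v t) \<ge> 0" if "t \<in> {1..n}" for t
  proof -
    have "\<alpha> t * (p t + s * v t) = \<alpha> t * p t + s * (\<alpha> t * v t)" by (simp add: algebra_simps)
    then show ?thesis using assms that by (simp add: region_def)
  qed
  then show ?thesis using affine_add[of p v s] assms by (simp add: region_def)
qed

text \<open>For \<open>k\<close> sign changes a circuit of the graph of \<open>\<xi>\<close> bounds \<open>\<xi>\<close> from above; for fewer, a cocircuit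
  of the graph gives a recession direction along which \<open>\<xi>\<close> increases.\<close>

lemma bounded_if_changes:
  assumes G: "(\<lambda>v. v(0 := dot n \<xi> v)) ` V \<in> Gr_pos k {0..n}"
    and \<alpha>: "is_sign n \<alpha>" "card (sign_changes n \<alpha>) = k"
  shows "bounded_signs n V \<eta> \<xi> \<alpha>"
proof -
  let ?x = "sign_changes n \<alpha>" and ?J = "insert 0 (Suc ` sign_changes n \<alpha>)"
  have J: "?J \<subseteq> {0..n}" "finite ?J" "card ?J = Suc k"
    using \<alpha> changes_image_subset[of \<alpha>] by (auto simp: card_changes_image)
  obtain c where c: "\<And>t. t \<in> ?J \<Longrightarrow> c t > 0" and
    rel: "\<And>g. g \<in> (\<lambda>v. v(0 := dot n \<xi> v)) ` V \<Longrightarrow> (\<Sum>t\<in>?J. (- 1) ^ level ?J t * c t * g t) = 0"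
    using Gr_pos_circuit[OF G J] by blast
  \<comment> \<open>The index \<open>0\<close> raises the level at \<open>Suc a\<close> by one, just
    as the change \<open>a\<close> itself does for \<open>sign_changes\<close>. Hence the circuit
    coefficients on these coordinates carry the signs of \<alpha>, while the one at \<open>0\<close>
    is positive.\<close>
  have lev: "(- 1) ^ level ?J t = \<alpha> t" if t: "t \<in> Suc ` ?x" for t
  proof -
    obtain a where a: "a \<in> ?x" "t = Suc a" using t by auto
    have "level ?J t = Suc (level ?x a)" using a by (simp add: level_insert level_Suc_image)
    moreover have "level ?x t = Suc (level ?x a)" using a by (simp add: level_Suc)
    ultimately show ?thesis using sign_at[OF \<alpha>(1), of t] t changes_image_subset[of \<alpha>] by auto
  qed
  have rel_V: "c 0 * dot n \<xi> v = - (\<Sum>t\<in>Suc ` ?x. c t * (\<alpha> t * v t))" if v: "v \<in> V" for v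
  proof -
    have "(\<Sum>t\<in>?J. (- 1) ^ level ?J t * c t * (v(0 := dot n \<xi> v)) t) = 0" using rel v by blast
    moreover have "(\<Sum>t\<in>?J. (- 1) ^ level ?J t * c t * (v(0 := dot n \<xi> v)) t) =
        c 0 * dot n \<xi> v + (\<Sum>t\<in>Suc ` ?x. (- 1) ^ level ?J t * c t * (v(0 := dot n \<xi> v)) t)"
      by (subst sum.insert) auto
    moreover have "(\<Sum>t\<in>Suc ` ?x. (- 1) ^ level ?J t * c t * (v(0 := dot n \<xi> v)) t) =
        (\<Sum>t\<in>Suc ` ?x. c t * (\<alpha> t * v t))"
      by (intro sum.cong refl) (use lev in auto)
    ultimately show ?thesis by linarith
  qed
  define M where "M = c 0 * dot n \<xi> \<eta> + (\<Sum>t\<in>Suc ` ?x. c t * (\<alpha> t * \<eta> t))"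
  have "dot n \<xi> p \<le> M / c 0" if p: "p \<in> region n V \<eta> \<alpha>" for p
  proof -
    have "(\<lambda>i. p i - \<eta> i) \<in> V" using p by (simp add: region_def affine_iff)
    from rel_V[OF this] have "c 0 * dot n \<xi> p = M - (\<Sum>t\<in>Suc ` ?x. c t * (\<alpha> t * p t))"
      by (simp add: dot_linear M_def right_diff_distrib sum_subtractf)
    moreover have "(\<Sum>t\<in>Suc ` ?x. c t * (\<alpha> t * p t)) \<ge> 0"
    proof (rule sum_nonneg)
      fix t assume t: "t \<in> Suc ` ?x"
      then have "\<alpha> t * p t \<ge> 0" using p changes_image_subset[of \<alpha>] by (auto simp: region_def)
      then show "c t * (\<alpha> t * p t) \<ge> 0" using mult_nonneg_nonneg[OF less_imp_le[OF c[of t]]] t by blast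
    qed
    ultimately have "c 0 * dot n \<xi> p \<le> M" by linarith
    then show ?thesis using c[of 0] by (simp add: field_simps)
  qed
  then show ?thesis unfolding bounded_signs_def by (intro bdd_aboveI[of _ "M / c 0"]) auto
qed

lemma unbounded_if_few_changes:
  assumes G: "(\<lambda>v. v(0 := dot n \<xi> v)) ` V \<in> Gr_pos k {0..n}"
    and \<alpha>: "is_sign n \<alpha>" "card (sign_changes n \<alpha>) < k" and feas: "feasible n V \<eta> \<alpha>"
  shows "\<not> bounded_signs n V \<eta> \<xi> \<alpha>"
proof
  assume bdd: "bounded_signs n V \<eta> \<xi> \<alpha>"
  obtain q where q: "k = Suc q" using \<alpha>(2) by (cases k) auto
  have "card (Suc ` sign_changes n \<alpha>) \<le> q" using \<alpha>(2) q by (simp add: card_changes_image)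
  then obtain Z where Z: "Z \<subseteq> {1..n}" "card Z = q" "conformal {1..n} Z \<alpha>"
    using conformal_extend[OF _ changes_image_subset conformal_sign_changes(1)[OF \<alpha>(1)], of q] k_less_n q by auto
  have "0 \<notin> Z" using Z(1) by auto
  then have "Z \<subseteq> {0..n}" "Z \<noteq> {0..n}" using Z(1) by auto
  then obtain g where g: "g \<in> (\<lambda>v. v(0 := dot n \<xi> v)) ` V" "\<And>z. z \<in> Z \<Longrightarrow> g z = 0"
    "\<And>t. t \<in> {0..n} - Z \<Longrightarrow> (- 1) ^ level Z t * g t > 0"
    using Gr_pos_cocircuit[OF G[unfolded q] _ _ Z(2)] by auto
  obtain v where v: "v \<in> V" "g = v(0 := dot n \<xi> v)" using g(1) by auto
  have pos: "dot n \<xi> v > 0" using g(3)[of 0] \<open>0 \<notin> Z\<close> v(2) by simp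
  have conf: "\<alpha> t * v t \<ge> 0" if t: "t \<in> {1..n}" for t
  proof (cases "t \<in> Z")
    case True
    then have "v t = 0" using g(2)[of t] v(2) t by simp
    then show ?thesis by simp
  next
    case False
    have "(- 1) ^ level Z t * v t > 0" using g(3)[of t] False t v(2) by simp
    moreover have "(- 1) ^ level Z t * \<alpha> t \<ge> 0" using Z(3) t False unfolding conformal_def by blast
    ultimately show ?thesis by (rule same_sign_product)
  qed
  obtain p where p: "p \<in> region n V \<eta> \<alpha>" using feas by (auto simp: feasible_def)
  obtain M where M: "\<And>p. p \<in> region n V \<eta> \<alpha> \<Longrightarrow> dot n \<xi> p \<le> M"
    using bdd by (auto simp: bounded_signs_def bdd_above_def)
  \<comment> \<open>Far enough along \<open>v\<close> for \<xi> to reach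
    \<open>M + 1\<close>.\<close>
  define s where "s = (M - dot n \<xi> p + 1) / dot n \<xi> v"
  have "s \<ge> 0" using M[OF p] pos by (simp add: s_def)
  then have "dot n \<xi> (\<lambda>i. p i + s * v i) \<le> M" using region_add[OF p v(1) conf] M by blast
  then have "dot n \<xi> p + s * dot n \<xi> v \<le> M" by (simp only: dot_linear)
  moreover have "s * dot n \<xi> v = M - dot n \<xi> p + 1" using pos by (simp add: s_def)
  ultimately show False by linarith
qed

theorem bounded_feasible_eq:
  assumes "left_cyclic n k V \<eta> \<xi>"
  shows "bounded_feasible n V \<eta> \<xi> = {\<alpha> \<in> sign_vectors n. card (sign_changes n \<alpha>) = k}"
proof -
  have G: "(\<lambda>v. v(0 := dot n \<xi> v)) ` V \<in> Gr_pos k {0..n}" using assms by (simp add: left_cyclic_def)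
  have "feasible n V \<eta> \<alpha> \<and> bounded_signs n V \<eta> \<xi> \<alpha> \<longleftrightarrow> card (sign_changes n \<alpha>) = k"
    if "\<alpha> \<in> sign_vectors n" for \<alpha>
    using feasible_if_changes[of \<alpha>] feasible_changes_le[of \<alpha>] bounded_if_changes[OF G, of \<alpha>]
      unbounded_if_few_changes[OF G, of \<alpha>] sign_vectors_is_sign[OF that] by linarith
  then show ?thesis by (auto simp: bounded_feasible_def)
qed

text \<open>The affine space is cut out by equations in finitely many coordinates each: fixed values
  outside \<open>{1..n}\<close>, and for every \<open>t\<close> outside a fixed \<open>S\<close> of
  size \<open>k\<close> one circuit relation, which determines the coordinate \<open>t\<close> from
  those in \<open>S\<close>.\<close>

lemma closed_affine_space: "closed (affine_space V \<eta>)"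
proof -
  obtain S where S: "S \<subseteq> {1..n}" "card S = k" using obtain_subset_with_card_n[of k "{1..n}"] k_less_n by auto
  then have fin: "finite S" using finite_subset by auto
  have "\<exists>c. (\<forall>s\<in>insert t S. c s > 0) \<and> (\<forall>x\<in>V. (\<Sum>s\<in>insert t S. (- 1) ^ level (insert t S) s * c s * x s) = 0)"
    if "t \<in> {1..n} - S" for t
  proof -
    have "insert t S \<subseteq> {1..n}" "finite (insert t S)" "card (insert t S) = Suc k" using S fin that by auto
    from Gr_pos_circuit[OF V_pos this] show ?thesis by metis
  qed
  then obtain c where c: "\<And>t s. t \<in> {1..n} - S \<Longrightarrow> s \<in> insert t S \<Longrightarrow> c t s > 0"
    "\<And>t x. t \<in> {1..n} - S \<Longrightarrow> x \<in> V \<Longrightarrow> (\<Sum>s\<in>insert t S. (- 1) ^ level (insert t S) s * c t s * x s) = 0"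
    by metis
  define h where "h t x = (\<Sum>s\<in>insert t S. (- 1) ^ level (insert t S) s * c t s * x s)" for t and x :: "nat \<Rightarrow> real"
  have "affine_space V \<eta> = (\<Inter>i\<in>- {1..n}. {x. x i = \<eta> i}) \<inter> (\<Inter>t\<in>{1..n} - S. {x. h t x = h t \<eta>})"
  proof (intro Set.set_eqI iffI)
    fix x assume "x \<in> affine_space V \<eta>"
    then have v: "(\<lambda>i. x i - \<eta> i) \<in> V" by (simp add: affine_iff)
    have "x i - \<eta> i = 0" if "i \<notin> {1..n}" for i
      using v Gr_pos_subspace(2)[OF V_pos] that by (auto simp: coord_space_def)
    moreover have "h t x = h t \<eta>" if "t \<in> {1..n} - S" for t
      using c(2)[OF that v] by (simp add: h_def right_diff_distrib sum_subtractf del: sum.insert)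
    ultimately show "x \<in> (\<Inter>i\<in>- {1..n}. {x. x i = \<eta> i}) \<inter> (\<Inter>t\<in>{1..n} - S. {x. h t x = h t \<eta>})" by auto
  next
    fix x assume x: "x \<in> (\<Inter>i\<in>- {1..n}. {x. x i = \<eta> i}) \<inter> (\<Inter>t\<in>{1..n} - S. {x. h t x = h t \<eta>})"
    obtain v where v: "v \<in> V" "\<And>s. s \<in> S \<Longrightarrow> v s = x s - \<eta> s"
      using Gr_pos_interpolate[OF V_pos S(1) fin S(2), of "\<lambda>s. x s - \<eta> s"] by auto
    have "x i - \<eta> i = v i" for i
    proof -
      consider "i \<in> S" | "i \<in> {1..n} - S" | "i \<notin> {1..n}" by blast
      then show ?thesis
      proof cases
        case 1
        then show ?thesis using v(2) by simp
      next
        case 2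
        have "h i x - h i \<eta> - h i v = 0" using x 2 c(2)[OF 2 v(1)] by (auto simp: h_def simp del: sum.insert)
        moreover have "h i x - h i \<eta> - h i v = (\<Sum>s\<in>insert i S. (- 1) ^ level (insert i S) s * c i s * (x s - \<eta> s - v s))"
          by (simp add: h_def right_diff_distrib sum_subtractf del: sum.insert)
        moreover have "\<dots> = (- 1) ^ level (insert i S) i * c i i * (x i - \<eta> i - v i)"
          using 2 fin v(2) by (simp add: sum.insert)
        ultimately show ?thesis using c(1)[OF 2, of i] by auto
      next
        case 3
        then show ?thesis using x v(1) Gr_pos_subspace(2)[OF V_pos] by (auto simp: coord_space_def)
      qed
    qed
    then have "(\<lambda>i. x i - \<eta> i) = v" by (rule ext)
    then show "x \<in> affine_space V \<eta>" using v(1) by (simp add: affine_iff)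
  qed
  moreover have "closed {x :: nat \<Rightarrow> real. x i = \<eta> i}" for i
    by (intro closed_Collect_eq continuous_intros continuous_on_product_coordinates)
  moreover have "closed {x. h t x = h t \<eta>}" for t
    unfolding h_def by (intro closed_Collect_eq continuous_intros continuous_on_product_coordinates)
  ultimately show ?thesis by (auto intro!: closed_Int closed_INT)
qed

lemma closed_region: "closed (region n V \<eta> \<alpha>)"
proof -
  have "region n V \<eta> \<alpha> = affine_space V \<eta> \<inter> (\<Inter>i\<in>{1..n}. {x. 0 \<le> \<alpha> i * x i})" by (auto simp: region_def)
  moreover have "closed {x :: nat \<Rightarrow> real. 0 \<le> \<alpha> i * x i}" for i
    by (intro closed_Collect_le continuous_intros continuous_on_product_coordinates)
  ultimately show ?thesis by (auto intro!: closed_Int closed_INT closed_affine_space)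
qed

text \<open>On the coordinates given by \<open>alternating_indices\<close> the circuit of
  \<open>V\<close> has, up to the factor \<open>\<alpha> 1\<close>, the signs of \<alpha>. So a
  positive combination of the absolute values of the coordinates is constant on the region, which
  bounds each of them. Any other coordinate in \<open>{1..n}\<close> is bounded through a second
  circuit joining it to these.\<close>

lemma coordinate_bounded:
  assumes \<alpha>: "is_sign n \<alpha>" "card (sign_changes n \<alpha> - {0}) = k"
  shows "\<exists>M. \<forall>p\<in>region n V \<eta> \<alpha>. \<bar>p i\<bar> \<le> M"
proof -
  have n1: "n \<ge> 1" using k_less_n by simp
  obtain C where C: "finite C" "0 \<notin> C" "card C = k" "Suc ` C \<subseteq> {1..n}"
    "\<And>t. t \<in> insert 1 (Suc ` C) \<Longrightarrow> \<alpha> t = \<alpha> 1 * (- 1) ^ level (insert 1 (Suc ` C)) t"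
    using alternating_indices[OF \<alpha>(1), of k] \<alpha>(2) n1 by auto
  let ?J = "insert 1 (Suc ` C)"
  have "1 \<notin> Suc ` C" using C(2) by auto
  then have J: "?J \<subseteq> {1..n}" "finite ?J" "card ?J = Suc k" using C n1 by (auto simp: card_image)
  have s: "\<alpha> t = 1 \<or> \<alpha> t = - 1" if "t \<in> {1..n}" for t using \<alpha>(1) that by (auto simp: is_sign_def)
  obtain c where c: "\<And>t. t \<in> ?J \<Longrightarrow> c t > 0" and
    rel: "\<And>v. v \<in> V \<Longrightarrow> (\<Sum>t\<in>?J. (- 1) ^ level ?J t * c t * v t) = 0"
    using Gr_pos_circuit[OF V_pos J] by blast
  define M where "M = (\<Sum>t\<in>?J. c t * (\<alpha> t * \<eta> t))"
  have sum: "(\<Sum>t\<in>?J. c t * (\<alpha> t * p t)) = M" if p: "p \<in> region n V \<eta> \<alpha>" for p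
  proof -
    have "(\<lambda>i. p i - \<eta> i) \<in> V" using p by (simp add: region_def affine_iff)
    then have "(\<Sum>t\<in>?J. (- 1) ^ level ?J t * c t * (p t - \<eta> t)) = 0" by (rule rel)
    moreover have "\<alpha> 1 * (\<Sum>t\<in>?J. (- 1) ^ level ?J t * c t * (p t - \<eta> t)) = (\<Sum>t\<in>?J. c t * (\<alpha> t * (p t - \<eta> t)))"
      unfolding sum_distrib_left
    proof (intro sum.cong refl)
      fix t assume "t \<in> ?J"
      from C(5)[OF this] show "\<alpha> 1 * ((- 1) ^ level ?J t * c t * (p t - \<eta> t)) = c t * (\<alpha> t * (p t - \<eta> t))"
        by (simp only: mult_ac)
    qed
    ultimately have "(\<Sum>t\<in>?J. c t * (\<alpha> t * (p t - \<eta> t))) = 0" by (metis mult_zero_right)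
    then show ?thesis by (simp add: M_def right_diff_distrib sum_subtractf del: sum.insert)
  qed
  have J_bound: "\<bar>p t\<bar> \<le> M / c t" if p: "p \<in> region n V \<eta> \<alpha>" and t: "t \<in> ?J" for p t
  proof -
    have nonneg: "c u * (\<alpha> u * p u) \<ge> 0" if u: "u \<in> ?J" for u
    proof -
      have "\<alpha> u * p u \<ge> 0" using p u J(1) by (auto simp: region_def)
      then show ?thesis by (rule mult_nonneg_nonneg[OF less_imp_le[OF c[OF u]]])
    qed
    have "c t * (\<alpha> t * p t) \<le> M"
      unfolding sum[OF p, symmetric] using t J(2) nonneg by (intro member_le_sum) auto
    moreover have "\<alpha> t * p t = \<bar>p t\<bar>"
    proof -
      have t': "t \<in> {1..n}" using t J(1) by blast
      then have "\<alpha> t * p t \<ge> 0" using p by (simp add: region_def)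
      then show ?thesis using s[OF t'] by auto
    qed
    ultimately show ?thesis using c[OF t] by (simp add: field_simps)
  qed
  show ?thesis
  proof (cases "i \<in> ?J")
    case True
    then show ?thesis using J_bound by blast
  next
    case i: False
    show ?thesis
    proof (cases "i \<in> {1..n}")
      case False
      have "p i = \<eta> i" if "p \<in> region n V \<eta> \<alpha>" for p
      proof -
        have "(\<lambda>i. p i - \<eta> i) \<in> V" using that by (simp add: region_def affine_iff)
        then show ?thesis using False Gr_pos_subspace(2)[OF V_pos] by (auto simp: coord_space_def)
      qed
      then show ?thesis by (intro exI[of _ "\<bar>\<eta> i\<bar>"]) simp
    next
      case True
      let ?S = "Suc ` C" and ?K = "insert i (Suc ` C)"
      have K: "?K \<subseteq> {1..n}" "finite ?K" "card ?K = Suc k" using C True i by (auto simp: card_image)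
      obtain d where d: "\<And>t. t \<in> ?K \<Longrightarrow> d t > 0" and
        rel': "\<And>v. v \<in> V \<Longrightarrow> (\<Sum>t\<in>?K. (- 1) ^ level ?K t * d t * v t) = 0"
        using Gr_pos_circuit[OF V_pos K] by blast
      define N where "N = \<bar>\<Sum>t\<in>?K. (- 1) ^ level ?K t * d t * \<eta> t\<bar> + (\<Sum>t\<in>?S. d t * (M / c t))"
      have "\<bar>p i\<bar> \<le> N / d i" if p: "p \<in> region n V \<eta> \<alpha>" for p
      proof -
        have "(\<lambda>i. p i - \<eta> i) \<in> V" using p by (simp add: region_def affine_iff)
        from rel'[OF this] have "(\<Sum>t\<in>?K. (- 1) ^ level ?K t * d t * p t) = (\<Sum>t\<in>?K. (- 1) ^ level ?K t * d t * \<eta> t)"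
          by (simp add: right_diff_distrib sum_subtractf del: sum.insert)
        moreover have "(\<Sum>t\<in>?K. (- 1) ^ level ?K t * d t * p t) =
            (- 1) ^ level ?K i * d i * p i + (\<Sum>t\<in>?S. (- 1) ^ level ?K t * d t * p t)"
          using i C(1) by (subst sum.insert) auto
        ultimately have "\<bar>(- 1) ^ level ?K i * d i * p i\<bar> \<le>
            \<bar>\<Sum>t\<in>?K. (- 1) ^ level ?K t * d t * \<eta> t\<bar> + \<bar>\<Sum>t\<in>?S. (- 1) ^ level ?K t * d t * p t\<bar>" by linarith
        also have "\<bar>\<Sum>t\<in>?S. (- 1) ^ level ?K t * d t * p t\<bar> \<le> (\<Sum>t\<in>?S. \<bar>(- 1) ^ level ?K t * d t * p t\<bar>)"
          by (rule sum_abs)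
        also have "\<dots> \<le> (\<Sum>t\<in>?S. d t * (M / c t))"
        proof (rule sum_mono)
          fix t assume t: "t \<in> ?S"
          then have "d t > 0" "\<bar>p t\<bar> \<le> M / c t" using d[of t] J_bound[OF p, of t] by auto
          then show "\<bar>(- 1) ^ level ?K t * d t * p t\<bar> \<le> d t * (M / c t)"
            by (simp add: abs_mult power_abs mult_left_mono del: times_divide_eq_right)
        qed
        finally have "\<bar>(- 1) ^ level ?K i * d i * p i\<bar> \<le> N" by (simp add: N_def)
        then show ?thesis using d[of i] by (simp add: abs_mult power_abs field_simps)
      qed
      then show ?thesis by blast
    qed
  qed
qed

lemma compact_region_if_changes:
  assumes "is_sign n \<alpha>" "card (sign_changes n \<alpha> - {0}) = k"
  shows "compact (region n V \<eta> \<alpha>)"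
proof -
  obtain M where M: "\<And>i p. p \<in> region n V \<eta> \<alpha> \<Longrightarrow> \<bar>p i\<bar> \<le> M i"
    using coordinate_bounded[OF assms] by metis
  have "- M i \<le> p i" "p i \<le> M i" if "p \<in> region n V \<eta> \<alpha>" for p i
    using M[OF that, of i] by linarith+
  then have "region n V \<eta> \<alpha> = region n V \<eta> \<alpha> \<inter> {p. \<forall>i. p i \<in> {- M i..M i}}" by auto
  moreover have "compact (region n V \<eta> \<alpha> \<inter> {p. \<forall>i. p i \<in> {- M i..M i}})"
    by (rule closed_Int_compact[OF closed_region compact_box])
  ultimately show ?thesis by simp
qed

text \<open>Some cocircuit of \<open>V\<close> is conformal to \<alpha> up to a global sign and
  spans a ray of recession of the region. As \<open>V\<close> contains \<open>v\<close> along with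
  \<open>- v\<close>, the change at \<open>0\<close> is irrelevant here, in contrast to the
  polarized case.\<close>

lemma not_compact_if_few_changes:
  assumes \<alpha>: "is_sign n \<alpha>" "card (sign_changes n \<alpha> - {0}) < k" and feas: "feasible n V \<eta> \<alpha>"
  shows "\<not> compact (region n V \<eta> \<alpha>)"
proof
  assume comp: "compact (region n V \<eta> \<alpha>)"
  have n1: "n \<ge> 1" using k_less_n by simp
  let ?C = "sign_changes n \<alpha> - {0}"
  obtain q where q: "k = Suc q" using \<alpha>(2) by (cases k) auto
  have "card (Suc ` ?C) \<le> q" using \<alpha>(2) q by (simp add: card_image)
  moreover have "Suc ` ?C \<subseteq> {1..n}" using changes_image_subset by blast
  ultimately obtain Z where Z: "Z \<subseteq> {1..n}" "card Z = q" "conformal {1..n} Z (\<lambda>t. \<alpha> 1 * \<alpha> t)"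
    using conformal_extend[OF _ _ conformal_sign_changes(2)[OF \<alpha>(1)], of q] k_less_n q by auto
  have "card Z \<noteq> card {1..n}" using Z(2) k_less_n q by simp
  then have ne: "Z \<noteq> {1..n}" by blast
  obtain v where v: "v \<in> V" "\<And>z. z \<in> Z \<Longrightarrow> v z = 0" "\<And>t. t \<in> {1..n} - Z \<Longrightarrow> (- 1) ^ level Z t * v t > 0"
    using Gr_pos_cocircuit[OF V_pos[unfolded q] _ Z(1,2) ne] by auto
  define u where "u = (\<lambda>i. \<alpha> 1 * v i)"
  have u: "u \<in> V" unfolding u_def by (rule Gr_pos_closed(2)[OF V_pos v(1)])
  have conf: "\<alpha> t * u t \<ge> 0" if t: "t \<in> {1..n}" for t
  proof (cases "t \<in> Z")
    case True
    then show ?thesis using v(2) by (simp add: u_def)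
  next
    case False
    have "(- 1) ^ level Z t * v t > 0" using v(3)[of t] False t by simp
    moreover have "(- 1) ^ level Z t * (\<alpha> 1 * \<alpha> t) \<ge> 0" using Z(3) t False unfolding conformal_def by blast
    ultimately have "(\<alpha> 1 * \<alpha> t) * v t \<ge> 0" by (rule same_sign_product)
    then show ?thesis by (simp add: u_def mult.left_commute mult.assoc)
  qed
  have "{1..n} - Z \<noteq> {}" using ne Z(1) by blast
  then obtain j where j: "j \<in> {1..n} - Z" by blast
  have "\<alpha> 1 \<noteq> 0" using sign_cases[OF \<alpha>(1) n1] by auto
  then have uj: "u j \<noteq> 0" using v(3)[OF j] by (auto simp: u_def)
  obtain p where p: "p \<in> region n V \<eta> \<alpha>" using feas by (auto simp: feasible_def)
  have "continuous_on (region n V \<eta> \<alpha>) (\<lambda>x. \<bar>x j\<bar>)"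
    by (intro continuous_intros continuous_on_subset[OF continuous_on_product_coordinates]) auto
  then obtain M where M: "\<And>x. x \<in> region n V \<eta> \<alpha> \<Longrightarrow> \<bar>x j\<bar> \<le> M"
    using continuous_attains_sup[OF comp, of "\<lambda>x. \<bar>x j\<bar>"] p by blast
  define s where "s = (\<bar>p j\<bar> + M + 1) / \<bar>u j\<bar>"
  have "M \<ge> 0" using M[OF p] by linarith
  then have "s \<ge> 0" by (simp add: s_def)
  then have "\<bar>p j + s * u j\<bar> \<le> M" using M[OF region_add[OF p u conf]] by blast
  moreover have "\<bar>s * u j\<bar> = \<bar>p j\<bar> + M + 1" using uj \<open>M \<ge> 0\<close> by (simp add: s_def abs_mult)
  ultimately show False by linarith
qed

text \<open>Feasibility allows at most \<open>k\<close> changes including the one at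
  \<open>0\<close>; compactness demands at least \<open>k\<close> changes without it.\<close>

theorem compact_feasible_eq:
  "compact_feasible n V \<eta> = {\<alpha> \<in> sign_vectors n. card (sign_changes n \<alpha>) = k \<and> 0 \<notin> sign_changes n \<alpha>}"
proof -
  have "feasible n V \<eta> \<alpha> \<and> compact (region n V \<eta> \<alpha>) \<longleftrightarrow> card (sign_changes n \<alpha>) = k \<and> 0 \<notin> sign_changes n \<alpha>"
    if a: "\<alpha> \<in> sign_vectors n" for \<alpha>
  proof
    note s = sign_vectors_is_sign[OF a]
    assume f: "feasible n V \<eta> \<alpha> \<and> compact (region n V \<eta> \<alpha>)"
    then have "card (sign_changes n \<alpha>) \<le> k" "\<not> card (sign_changes n \<alpha> - {0}) < k"
      using feasible_changes_le[OF s] not_compact_if_few_changes[OF s] by auto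
    then show "card (sign_changes n \<alpha>) = k \<and> 0 \<notin> sign_changes n \<alpha>"
      using card_Suc_Diff1[of "sign_changes n \<alpha>" 0] by (cases "0 \<in> sign_changes n \<alpha>") simp_all
  next
    note s = sign_vectors_is_sign[OF a]
    assume "card (sign_changes n \<alpha>) = k \<and> 0 \<notin> sign_changes n \<alpha>"
    then show "feasible n V \<eta> \<alpha> \<and> compact (region n V \<eta> \<alpha>)"
      using feasible_if_changes[OF s] compact_region_if_changes[OF s] by simp
  qed
  then show ?thesis by (auto simp: compact_feasible_def)
qed

end

section \<open>Intersections of regions\<close>

text \<open>The vertices of the region of \<open>\<alpha>\<close> correspond to the ways of moving every sign change
  to one of its two adjacent coordinates; \<open>stays\<close> makes this choice greedily from left to right.\<close>

primrec stays :: "nat set \<Rightarrow> nat set \<Rightarrow> nat \<Rightarrow> bool" where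
  "stays x T 0 = False"
| "stays x T (Suc a) = (Suc a \<in> T \<and> \<not> (a \<in> x \<and> \<not> stays x T a))"

context osz
begin

text \<open>A change \<open>a\<close> may go to the coordinate \<open>a\<close> or
  \<open>Suc a\<close>; it stays at \<open>a\<close> exactly if \<open>a\<close> is required by
  \<open>T\<close> and not already taken from the left. If some \<open>t\<close> in \<open>T\<close>
  were missed, then the changes to its left would all stay, back to a position that is no change.
  All coordinates from there to \<open>t\<close> are required, but the changes available number one
  less. Off \<open>Z\<close> no choice moves a change across \<open>t\<close>, so levels are
  preserved.\<close>

lemma supported_matching:
  assumes x: "x \<subseteq> {0..<n}" and T: "T \<subseteq> {1..n}" and sup: "supported x T"
  obtains Z where "T \<subseteq> Z" "Z \<subseteq> {1..n}" "card Z = card x" "\<And>t. t \<in> {1..n} - Z \<Longrightarrow> level Z t = level x t"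
proof -
  define e where "e a = (if stays x T a then a else Suc a)" for a
  define Z where "Z = e ` x"
  have fin: "finite x" using x finite_subset by auto
  have pos: "a \<ge> 1" if "stays x T a" for a using that by (cases a) auto
  have strict: "e a < e b" if "a \<in> x" "b \<in> x" "a < b" for a b
  proof (cases "b = Suc a")
    case True
    then show ?thesis using that by (auto simp: e_def)
  next
    case False
    then show ?thesis using that by (auto simp: e_def)
  qed
  then have inj: "inj_on e x" by (intro linorder_inj_onI) (auto dest: order_less_imp_not_eq)
  have cardZ: "card Z = card x" unfolding Z_def by (rule card_image[OF inj])
  have sub: "Z \<subseteq> {1..n}"
  proof
    fix z assume "z \<in> Z"
    then obtain a where a: "a \<in> x" "z = e a" by (auto simp: Z_def)
    then have "a < n" using x by auto
    then show "z \<in> {1..n}" using a pos[of a] by (auto simp: e_def)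
  qed
  have cover: "t \<in> Z" if t: "t \<in> T" for t
  proof (rule ccontr)
    assume nZ: "t \<notin> Z"
    have t1: "t \<ge> 1" using t T by auto
    have tx: "t \<notin> x"
    proof
      assume tx: "t \<in> x"
      obtain a where a: "t = Suc a" using t1 by (cases t) auto
      show False
      proof (cases "stays x T t")
        case True
        then have "e t = t" by (simp add: e_def)
        then show False using tx nZ unfolding Z_def by (metis image_eqI)
      next
        case False
        then have "a \<in> x" "\<not> stays x T a" using a t by auto
        then have "e a = t" by (simp add: e_def a)
        then show False using \<open>a \<in> x\<close> nZ unfolding Z_def by (metis image_eqI)
      qed
    qed
    have run: "a \<in> x \<Longrightarrow> stays x T a \<Longrightarrow> \<exists>i<a. i \<notin> x \<and> (\<forall>b. i < b \<and> b \<le> a \<longrightarrow> b \<in> x \<and> b \<in> T)" for a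
    proof (induction a)
      case (Suc a)
      show ?case
      proof (cases "a \<in> x")
        case True
        then have "stays x T a" using Suc.prems(2) by simp
        then obtain i where i: "i < a" "i \<notin> x" "\<forall>b. i < b \<and> b \<le> a \<longrightarrow> b \<in> x \<and> b \<in> T"
          using Suc.IH True by blast
        have "\<forall>b. i < b \<and> b \<le> Suc a \<longrightarrow> b \<in> x \<and> b \<in> T"
          using i(3) Suc.prems by (metis le_Suc_eq stays.simps(2))
        then show ?thesis using i(1,2) by (intro exI[of _ i]) simp
      next
        case False
        then show ?thesis using Suc.prems by (intro exI[of _ a]) (auto dest: le_antisym Suc_leI)
      qed
    qed simp
    have "\<exists>i<t. i \<notin> x \<and> (\<forall>b. i < b \<and> b < t \<longrightarrow> b \<in> T)"
    proof (cases "t - 1 \<in> x")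
      case False
      then show ?thesis using t1 by (intro exI[of _ "t - 1"]) auto
    next
      case True
      have "stays x T (t - 1)"
      proof (rule ccontr)
        assume "\<not> stays x T (t - 1)"
        then have "e (t - 1) = t" using t1 by (simp add: e_def)
        then show False using True nZ unfolding Z_def by (metis image_eqI)
      qed
      then obtain i where i: "i < t - 1" "i \<notin> x" "\<forall>b. i < b \<and> b \<le> t - 1 \<longrightarrow> b \<in> x \<and> b \<in> T"
        using run[OF True] by blast
      have "b \<in> T" if "i < b" "b < t" for b
      proof -
        have "b \<le> t - 1" using that by simp
        then show ?thesis using i(3) that(1) by blast
      qed
      then show ?thesis using i(1,2) by (intro exI[of _ i]) simp
    qed
    then obtain i where i: "i < t" "i \<notin> x" "\<And>b. i < b \<Longrightarrow> b < t \<Longrightarrow> b \<in> T" by blast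
    have "{i + 1..i + (t - i)} \<subseteq> T"
    proof
      fix b assume "b \<in> {i + 1..i + (t - i)}"
      then show "b \<in> T" using i t by (cases "b = t") auto
    qed
    then have "t - i \<le> card (x \<inter> {i..i + (t - i)})" using sup unfolding supported_def by blast
    also have "\<dots> \<le> card {i<..<t}"
    proof (rule card_mono)
      show "x \<inter> {i..i + (t - i)} \<subseteq> {i<..<t}"
      proof
        fix b assume b: "b \<in> x \<inter> {i..i + (t - i)}"
        then have "b \<noteq> i" "b \<noteq> t" using i(2) tx by auto
        then show "b \<in> {i<..<t}" using b i(1) by auto
      qed
    qed simp
    finally show False using i(1) by simp
  qed
  have "level Z t = level x t" if t: "t \<in> {1..n} - Z" for t
  proof -
    have "e a < t \<longleftrightarrow> a < t" if a: "a \<in> x" for a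
    proof -
      have "e a \<noteq> t" using t a by (auto simp: Z_def)
      then show ?thesis by (auto simp: e_def)
    qed
    then have "Z \<inter> {..<t} = e ` (x \<inter> {..<t})" by (auto simp: Z_def)
    then show ?thesis unfolding level_def using inj by (simp add: card_image inj_on_subset)
  qed
  then show ?thesis using that[of Z] cover cardZ sub by blast
qed

end

context cyclic
begin

text \<open>A point of the intersection vanishes on all of \<open>?T\<close>, so its signs there can
  be altered freely. Were Hall's condition violated on an interval, alternating signs would produce
  more than \<open>k\<close> changes. Conversely, \<open>supported_matching\<close> provides a
  vertex of the region of \<alpha> that vanishes on \<open>?T\<close>.\<close>

theorem region_inter_iff:
  assumes \<alpha>: "is_sign n \<alpha>" "card (sign_changes n \<alpha>) = k" and \<beta>: "is_sign n \<beta>" and S: "S \<subseteq> {1..n}"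
  shows "region n V \<eta> \<alpha> \<inter> region n V \<eta> \<beta> \<inter> flat V \<eta> S \<noteq> {} \<longleftrightarrow>
    supported (sign_changes n \<alpha>) (S \<union> {i \<in> {1..n}. \<alpha> i \<noteq> \<beta> i})"
proof
  let ?x = "sign_changes n \<alpha>" and ?T = "S \<union> {i \<in> {1..n}. \<alpha> i \<noteq> \<beta> i}"
  assume "region n V \<eta> \<alpha> \<inter> region n V \<eta> \<beta> \<inter> flat V \<eta> S \<noteq> {}"
  then obtain p where p: "p \<in> region n V \<eta> \<alpha>" "p \<in> region n V \<eta> \<beta>" "p \<in> flat V \<eta> S" by auto
  have zero: "p t = 0" if t: "t \<in> ?T" for t
  proof (cases "t \<in> S")
    case True
    then show ?thesis using p(3) by (simp add: flat_def)
  next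
    case False
    then have t: "t \<in> {1..n}" "\<alpha> t \<noteq> \<beta> t" using t by auto
    then have "\<alpha> t * p t \<ge> 0" "\<beta> t * p t \<ge> 0" using p by (auto simp: region_def)
    moreover have "\<alpha> t = 1 \<or> \<alpha> t = - 1" "\<beta> t = 1 \<or> \<beta> t = - 1" using t(1) \<alpha>(1) \<beta> by (simp_all add: is_sign_def)
    ultimately show ?thesis using t(2) by (elim disjE) auto
  qed
  show "supported ?x ?T"
    unfolding supported_def
  proof (intro allI impI)
    fix i d assume sub: "{i + 1..i + d} \<subseteq> ?T"
    show "d \<le> card (?x \<inter> {i..i + d})"
    proof (rule ccontr)
      assume "\<not> ?thesis"
      then have less: "card (?x \<inter> {i..i + d}) < d" by simp
      \<comment> \<open>The point vanishes on these coordinates, so \<gamma> is still a sign pattern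
        for it. The signs alternate starting from the one at \<open>i\<close>, which is the leading
        \<open>+\<close> if \<open>i = 0\<close>. This gives \<open>d\<close> changes in place of
        fewer than \<open>d\<close>.\<close>
      define \<gamma> where "\<gamma> t = (if t \<in> {i + 1..i + d} then (\<alpha>(0 := 1)) i * (- 1) ^ (t - i) else \<alpha> t)" for t
      have "i + d \<in> ?T" using sub less by (auto simp: subset_iff)
      then have id: "i + d \<le> n" using S by auto
      have si: "(\<alpha>(0 := 1)) i = 1 \<or> (\<alpha>(0 := 1)) i = - 1" using \<alpha>(1) id by (auto simp: is_sign_def)
      have \<gamma>: "is_sign n \<gamma>"
        unfolding is_sign_def
      proof
        fix t assume "t \<in> {1..n}"
        have pm: "(- 1 :: real) ^ (t - i) = 1 \<or> (- 1 :: real) ^ (t - i) = - 1" by (cases "even (t - i)") auto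
        show "\<gamma> t = 1 \<or> \<gamma> t = - 1"
        proof (cases "t \<in> {i + 1..i + d}")
          case True
          then have "\<gamma> t = (\<alpha>(0 := 1)) i * (- 1) ^ (t - i)" by (simp add: \<gamma>_def)
          then show ?thesis using si pm by (elim disjE) simp_all
        next
          case False
          then have "\<gamma> t = \<alpha> t" by (simp only: \<gamma>_def if_False)
          then show ?thesis using \<alpha>(1) \<open>t \<in> {1..n}\<close> by (simp add: is_sign_def)
        qed
      qed
      have conf: "\<gamma> t * p t \<ge> 0" if t: "t \<in> {1..n}" for t
      proof (cases "t \<in> {i + 1..i + d}")
        case True
        then have "p t = 0" using zero sub by blast
        then show ?thesis by simp
      next
        case False
        then show ?thesis using p(1) t by (auto simp: \<gamma>_def region_def)
      qed
      have "p \<in> affine_space V \<eta>" using p(1) by (simp add: region_def)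
      then have bound: "card (sign_changes n \<gamma>) \<le> k" using affine_sign_changes_bound[OF _ \<gamma> conf] by blast
      have inside: "{i..<i + d} \<subseteq> sign_changes n \<gamma>"
      proof
        fix a assume a: "a \<in> {i..<i + d}"
        have Suc_a: "\<gamma> (Suc a) = (\<alpha>(0 := 1)) i * (- 1) ^ (Suc a - i)" using a by (simp add: \<gamma>_def)
        have "(\<gamma>(0 := 1)) a = (\<alpha>(0 := 1)) i * (- 1) ^ (a - i)"
        proof (cases "a = i")
          case True
          then show ?thesis by (simp add: \<gamma>_def)
        next
          case False
          then have "a \<in> {i + 1..i + d}" "a \<noteq> 0" using a by auto
          then show ?thesis by (simp add: \<gamma>_def)
        qed
        moreover have "Suc a - i = Suc (a - i)" using a by auto
        ultimately have "(\<gamma>(0 := 1)) (Suc a) = - (\<gamma>(0 := 1)) a" "(\<gamma>(0 := 1)) a \<noteq> 0"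
          using Suc_a si by (simp_all del: fun_upd_apply add: fun_upd_other) (elim disjE; simp)
        then have "(\<gamma>(0 := 1)) a \<noteq> (\<gamma>(0 := 1)) (Suc a)" by linarith
        then show "a \<in> sign_changes n \<gamma>" using a id by (simp add: sign_changes_def)
      qed
      have outside: "?x - {i..i + d} \<subseteq> sign_changes n \<gamma>"
      proof
        fix a assume a: "a \<in> ?x - {i..i + d}"
        then have "a \<notin> {i + 1..i + d}" "Suc a \<notin> {i + 1..i + d}" by auto
        then have "\<gamma> a = \<alpha> a" "\<gamma> (Suc a) = \<alpha> (Suc a)"
          unfolding \<gamma>_def by (simp_all only: if_False)
        then have "(\<gamma>(0 := 1)) a = (\<alpha>(0 := 1)) a" "(\<gamma>(0 := 1)) (Suc a) = (\<alpha>(0 := 1)) (Suc a)"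
          by simp_all
        then show "a \<in> sign_changes n \<gamma>" using a by (simp add: sign_changes_def)
      qed
      have "k = card (?x \<inter> {i..i + d}) + card (?x - {i..i + d})"
        using card_Un_disjoint[of "?x \<inter> {i..i + d}" "?x - {i..i + d}"] \<alpha>(2) by (simp add: Int_Diff_Un Int_Diff_disjoint)
      also have "\<dots> < card {i..<i + d} + card (?x - {i..i + d})" using less by simp
      also have "\<dots> = card ({i..<i + d} \<union> (?x - {i..i + d}))" by (intro card_Un_disjoint[symmetric]) auto
      also have "\<dots> \<le> card (sign_changes n \<gamma>)" using inside outside by (intro card_mono) auto
      finally show False using bound by simp
    qed
  qed
next
  let ?x = "sign_changes n \<alpha>" and ?T = "S \<union> {i \<in> {1..n}. \<alpha> i \<noteq> \<beta> i}"
  assume sup: "supported ?x ?T"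
  have x: "?x \<subseteq> {0..<n}" by (auto simp: sign_changes_def)
  have T: "?T \<subseteq> {1..n}" using S by blast
  obtain Z where Z: "?T \<subseteq> Z" "Z \<subseteq> {1..n}" "card Z = card ?x" "\<And>t. t \<in> {1..n} - Z \<Longrightarrow> level Z t = level ?x t"
    using supported_matching[OF x T sup] by metis
  obtain p where p: "vertex_at 1 Z p" using vertex_exists[OF Z(2)] Z(3) \<alpha>(2) by auto
  have "conformal {1..n} Z \<alpha>"
    unfolding conformal_def
  proof
    fix t assume t: "t \<in> {1..n} - Z"
    have "(- 1 :: real) ^ level ?x t * (- 1) ^ level ?x t = 1" by (simp flip: power_mult_distrib)
    then show "0 \<le> (- 1) ^ level Z t * \<alpha> t" using Z(4)[OF t] sign_at[OF \<alpha>(1), of t] t by simp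
  qed
  then have pa: "p \<in> region n V \<eta> \<alpha>" by (rule vertex_in_region[OF p \<alpha>(1)])
  have pz: "p t = 0" if "t \<in> ?T" for t using p that Z(1) by (auto simp: vertex_at_def)
  have "\<beta> t * p t \<ge> 0" if t: "t \<in> {1..n}" for t
  proof (cases "\<alpha> t = \<beta> t")
    case True
    have "\<alpha> t * p t \<ge> 0" using pa t by (simp add: region_def)
    then show ?thesis using True by simp
  next
    case False
    then show ?thesis using pz[of t] t by simp
  qed
  then have "p \<in> region n V \<eta> \<beta>" using pa by (simp add: region_def)
  moreover have "p \<in> flat V \<eta> S" using pa pz by (simp add: flat_def region_def)
  ultimately show "region n V \<eta> \<alpha> \<inter> region n V \<eta> \<beta> \<inter> flat V \<eta> S \<noteq> {}" using pa by blast
qed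

section \<open>Sign vectors with \<open>k\<close> changes as vertices of the quiver\<close>

lemma sign_changes_bij:
  "bij_betw (sign_changes n) {\<alpha> \<in> sign_vectors n. card (sign_changes n \<alpha>) = k} (verts_l n k)"
proof (rule bij_betwI')
  fix \<alpha> \<beta> assume a: "\<alpha> \<in> {\<alpha> \<in> sign_vectors n. card (sign_changes n \<alpha>) = k}"
    and b: "\<beta> \<in> {\<alpha> \<in> sign_vectors n. card (sign_changes n \<alpha>) = k}"
  show "sign_changes n \<alpha> = sign_changes n \<beta> \<longleftrightarrow> \<alpha> = \<beta>"
  proof
    assume eq: "sign_changes n \<alpha> = sign_changes n \<beta>"
    have "\<alpha> t = \<beta> t" if "t \<in> {1..n}" for t
      using sign_at[of \<alpha> t] sign_at[of \<beta> t] a b eq that sign_vectors_is_sign by auto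
    then show "\<alpha> = \<beta>" using a b by (intro PiE_ext[of \<alpha> "{1..n}" "\<lambda>_. {1, -1}" \<beta>]) (auto simp: sign_vectors_def)
  qed simp
next
  fix \<alpha> assume "\<alpha> \<in> {\<alpha> \<in> sign_vectors n. card (sign_changes n \<alpha>) = k}"
  then show "sign_changes n \<alpha> \<in> verts_l n k" by (auto simp: verts_l_def sign_changes_def)
next
  fix x assume x: "x \<in> verts_l n k"
  define \<alpha> :: "nat \<Rightarrow> real" where "\<alpha> = restrict (\<lambda>t. (- 1) ^ level x t) {1..n}"
  have pm: "(- 1 :: real) ^ l = 1 \<or> (- 1 :: real) ^ l = - 1" for l by (cases "even l") auto
  have sv: "\<alpha> \<in> sign_vectors n" using pm by (auto simp: sign_vectors_def \<alpha>_def)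
  have val: "(\<alpha>(0 := 1)) t = (- 1) ^ level x t" if "t \<le> n" for t
    using that by (cases "t = 0") (auto simp: \<alpha>_def)
  have "sign_changes n \<alpha> = x"
  proof (intro Set.set_eqI)
    fix a
    show "a \<in> sign_changes n \<alpha> \<longleftrightarrow> a \<in> x"
    proof (cases "a < n")
      case True
      have "(- 1 :: real) ^ level x a \<noteq> (- 1) ^ level x (Suc a) \<longleftrightarrow> a \<in> x"
        using pm[of "level x a"] by (auto simp: level_Suc)
      then show ?thesis using True val[of a] val[of "Suc a"] by (simp add: sign_changes_def del: fun_upd_apply)
    next
      case False
      then show ?thesis using x by (auto simp: sign_changes_def verts_l_def)
    qed
  qed
  then show "\<exists>\<alpha>\<in>{\<alpha> \<in> sign_vectors n. card (sign_changes n \<alpha>) = k}. x = sign_changes n \<alpha>"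
    using sv x by (auto simp: verts_l_def intro!: bexI[of _ \<alpha>])
qed

lemma disagreement_eq_odd_edges:
  assumes "is_sign n \<alpha>" "is_sign n \<beta>"
  shows "{i \<in> {1..n}. \<alpha> i \<noteq> \<beta> i} = odd_edges (sign_changes n \<alpha>) (sign_changes n \<beta>)"
proof -
  have "(- 1 :: real) ^ a \<noteq> (- 1) ^ b \<longleftrightarrow> even a \<noteq> even b" for a b
    by (cases "even a"; cases "even b") auto
  then have "\<alpha> i \<noteq> \<beta> i \<longleftrightarrow> even (level (sign_changes n \<alpha>) i) \<noteq> even (level (sign_changes n \<beta>) i)"
    if "i \<in> {1..n}" for i
    unfolding sign_at[OF assms(1) that] sign_at[OF assms(2) that] .
  then show ?thesis unfolding odd_edges_def by blast
qed

end

section \<open>The rings of polynomials and their monomial quotients\<close>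

definition indicator_exp :: "nat set \<Rightarrow> nat \<Rightarrow>\<^sub>0 nat" where
  "indicator_exp S = (\<Sum>i\<in>S. Poly_Mapping.single i 1)"

lemma lookup_indicator_exp:
  assumes "finite S"
  shows "Poly_Mapping.lookup (indicator_exp S) i = (if i \<in> S then 1 else 0)"
proof -
  have "Poly_Mapping.lookup (indicator_exp S) i = (\<Sum>j\<in>S. if j = i then 1 else 0)"
    unfolding indicator_exp_def lookup_sum by (intro sum.cong refl) (simp add: lookup_single when_def)
  then show ?thesis using assms by simp
qed

lemma keys_indicator_exp: "finite S \<Longrightarrow> Poly_Mapping.keys (indicator_exp S) = S"
  by (auto simp: in_keys_iff lookup_indicator_exp split: if_splits)

lemma u_set_eq: "u_set S = Poly_Mapping.single (indicator_exp S) 1"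
  unfolding u_set_def u_var_def indicator_exp_def
  by (induction S rule: infinite_finite_induct) (simp_all add: mult_single)

lemma keys_add_nat: "Poly_Mapping.keys (a + b) = Poly_Mapping.keys a \<union> Poly_Mapping.keys b"
  for a b :: "'a \<Rightarrow>\<^sub>0 nat"
  by (auto simp: in_keys_iff lookup_add)

lemma poly_ring_ops:
  "monoid.mult (poly_ring n) = (*)" "monoid.one (poly_ring n) = 1"
  "ring.zero (poly_ring n) = 0" "ring.add (poly_ring n) = (+)"
  by (simp_all add: poly_ring_def)

lemma poly_ring_carrier: "p \<in> carrier (poly_ring n) \<longleftrightarrow> (\<forall>m\<in>Poly_Mapping.keys p. Poly_Mapping.keys m \<subseteq> {1..n})"
  by (simp add: poly_ring_def)

lemma poly_ring_closed:
  assumes "p \<in> carrier (poly_ring n)" "q \<in> carrier (poly_ring n)"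
  shows "p + q \<in> carrier (poly_ring n)" "p * q \<in> carrier (poly_ring n)" "- p \<in> carrier (poly_ring n)"
    "p - q \<in> carrier (poly_ring n)"
proof -
  show "p + q \<in> carrier (poly_ring n)"
    using assms Poly_Mapping.keys_add[of p q] unfolding poly_ring_carrier by blast
  show "p * q \<in> carrier (poly_ring n)"
    unfolding poly_ring_carrier
  proof
    fix m assume "m \<in> Poly_Mapping.keys (p * q)"
    then obtain a b where "m = a + b" "a \<in> Poly_Mapping.keys p" "b \<in> Poly_Mapping.keys q"
      using keys_mult[of p q] by blast
    then show "Poly_Mapping.keys m \<subseteq> {1..n}" using assms unfolding poly_ring_carrier by (simp add: keys_add_nat)
  qed
  show "- p \<in> carrier (poly_ring n)" using assms(1) unfolding poly_ring_carrier by simp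
  show "p - q \<in> carrier (poly_ring n)"
    using assms keys_diff[of p q] unfolding poly_ring_carrier by blast
qed

lemma poly_ring_0_1: "0 \<in> carrier (poly_ring n)" "1 \<in> carrier (poly_ring n)"
  by (simp_all add: poly_ring_carrier)

lemma poly_ring_sum: "(\<And>i. i \<in> A \<Longrightarrow> f i \<in> carrier (poly_ring n)) \<Longrightarrow> sum f A \<in> carrier (poly_ring n)"
  by (induction A rule: infinite_finite_induct) (simp_all add: poly_ring_0_1 poly_ring_closed)

lemma single_poly_ring: "Poly_Mapping.keys m \<subseteq> {1..n} \<Longrightarrow> Poly_Mapping.single m c \<in> carrier (poly_ring n)"
  by (simp add: poly_ring_carrier)

lemma u_set_poly_ring: "S \<subseteq> {1..n} \<Longrightarrow> u_set S \<in> carrier (poly_ring n)"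
  using finite_subset[of S "{1..n}"] by (simp add: u_set_eq single_poly_ring keys_indicator_exp)

lemma ring_poly_ring: "ring (poly_ring n)"
proof (intro ringI abelian_groupI monoidI, unfold poly_ring_ops)
  fix p assume "p \<in> carrier (poly_ring n)"
  then show "\<exists>q\<in>carrier (poly_ring n). q + p = 0"
    by (intro bexI[of _ "- p"]) (simp_all add: poly_ring_closed)
qed (simp_all add: poly_ring_closed poly_ring_0_1 algebra_simps)

lemma a_inv_poly_ring:
  assumes "p \<in> carrier (poly_ring n)"
  shows "\<ominus>\<^bsub>poly_ring n\<^esub> p = - p"
proof -
  interpret R: ring "poly_ring n" by (rule ring_poly_ring)
  have "- p \<oplus>\<^bsub>poly_ring n\<^esub> p = \<zero>\<^bsub>poly_ring n\<^esub>" by (simp add: poly_ring_ops)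
  then show ?thesis using assms R.minus_equality poly_ring_closed(3) by blast
qed

text \<open>The condition depends on the support of \<open>e\<close> only, as befits an ideal
  generated by squarefree monomials.\<close>

definition good_exp ::
    "nat \<Rightarrow> (nat \<Rightarrow> real) set \<Rightarrow> (nat \<Rightarrow> real) \<Rightarrow> signs \<Rightarrow> signs \<Rightarrow> (nat \<Rightarrow>\<^sub>0 nat) \<Rightarrow> bool" where
  "good_exp n V \<eta> \<alpha> \<beta> e \<longleftrightarrow>
     region n V \<eta> \<alpha> \<inter> region n V \<eta> \<beta> \<inter> flat V \<eta> (Poly_Mapping.keys e) \<noteq> {}"

lemma good_exp_add: "good_exp n V \<eta> \<alpha> \<beta> (a + b) \<Longrightarrow> good_exp n V \<eta> \<alpha> \<beta> a"
  by (auto simp: good_exp_def flat_def keys_add_nat)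

definition bad_polys :: "nat \<Rightarrow> (nat \<Rightarrow> real) set \<Rightarrow> (nat \<Rightarrow> real) \<Rightarrow> signs \<Rightarrow> signs \<Rightarrow> mpoly_int set" where
  "bad_polys n V \<eta> \<alpha> \<beta> =
     {p \<in> carrier (poly_ring n). \<forall>e\<in>Poly_Mapping.keys p. \<not> good_exp n V \<eta> \<alpha> \<beta> e}"

lemma bad_polys_add: "p \<in> bad_polys n V \<eta> \<alpha> \<beta> \<Longrightarrow> q \<in> bad_polys n V \<eta> \<alpha> \<beta> \<Longrightarrow> p + q \<in> bad_polys n V \<eta> \<alpha> \<beta>"
  using Poly_Mapping.keys_add[of p q] by (auto simp: bad_polys_def poly_ring_closed)

lemma bad_polys_mult:
  assumes "p \<in> bad_polys n V \<eta> \<alpha> \<beta>" "q \<in> carrier (poly_ring n)"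
  shows "p * q \<in> bad_polys n V \<eta> \<alpha> \<beta>"
proof -
  have "\<not> good_exp n V \<eta> \<alpha> \<beta> e" if e: "e \<in> Poly_Mapping.keys (p * q)" for e
  proof -
    obtain a b where "e = a + b" "a \<in> Poly_Mapping.keys p" using keys_mult[of p q] e by blast
    then show ?thesis using assms(1) good_exp_add[of n V \<eta> \<alpha> \<beta> a b] by (auto simp: bad_polys_def)
  qed
  then show ?thesis using assms by (auto simp: bad_polys_def poly_ring_closed)
qed

text \<open>A monomial whose support fails to meet the regions is a multiple of the squarefree
  generator on that support. Conversely, enlarging a support only shrinks the flat, so the bad
  monomials span an ideal.\<close>

lemma R_ideal_eq: "R_ideal n V \<eta> \<alpha> \<beta> = bad_polys n V \<eta> \<alpha> \<beta>"
proof
  interpret R: ring "poly_ring n" by (rule ring_poly_ring)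
  let ?G = "{u_set S | S. S \<subseteq> {1..n} \<and> region n V \<eta> \<alpha> \<inter> region n V \<eta> \<beta> \<inter> flat V \<eta> S = {}}"
  have G: "?G \<subseteq> carrier (poly_ring n)" using u_set_poly_ring by blast
  have "ideal (bad_polys n V \<eta> \<alpha> \<beta>) (poly_ring n)"
  proof (rule idealI_uminus[OF _ ring_poly_ring], unfold poly_ring_ops)
    show "bad_polys n V \<eta> \<alpha> \<beta> \<subseteq> carrier (poly_ring n)" by (auto simp: bad_polys_def)
    show "0 \<in> bad_polys n V \<eta> \<alpha> \<beta>" by (simp add: bad_polys_def poly_ring_0_1)
    show "\<ominus>\<^bsub>poly_ring n\<^esub> p \<in> bad_polys n V \<eta> \<alpha> \<beta>" if "p \<in> bad_polys n V \<eta> \<alpha> \<beta>" for p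
      using that a_inv_poly_ring[of p n] poly_ring_closed(3)[of p n p] unfolding bad_polys_def by simp
    show "p * q \<in> bad_polys n V \<eta> \<alpha> \<beta>" "q * p \<in> bad_polys n V \<eta> \<alpha> \<beta>"
      if "p \<in> bad_polys n V \<eta> \<alpha> \<beta>" "q \<in> carrier (poly_ring n)" for p q
      using bad_polys_mult[OF that] by (simp_all add: mult.commute)
  qed (rule bad_polys_add)
  moreover have "?G \<subseteq> bad_polys n V \<eta> \<alpha> \<beta>"
  proof
    fix p assume "p \<in> ?G"
    then obtain S where S: "p = u_set S" "S \<subseteq> {1..n}" "region n V \<eta> \<alpha> \<inter> region n V \<eta> \<beta> \<inter> flat V \<eta> S = {}" by auto
    then have "finite S" using finite_subset by auto
    then have "\<not> good_exp n V \<eta> \<alpha> \<beta> (indicator_exp S)" using S by (simp add: good_exp_def keys_indicator_exp)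
    then show "p \<in> bad_polys n V \<eta> \<alpha> \<beta>"
      using S u_set_poly_ring[of S n] by (simp add: bad_polys_def u_set_eq)
  qed
  ultimately show "R_ideal n V \<eta> \<alpha> \<beta> \<subseteq> bad_polys n V \<eta> \<alpha> \<beta>"
    unfolding R_ideal_def by (rule R.genideal_minimal)
  interpret I: ideal "R_ideal n V \<eta> \<alpha> \<beta>" "poly_ring n"
    unfolding R_ideal_def by (rule R.genideal_ideal[OF G])
  show "bad_polys n V \<eta> \<alpha> \<beta> \<subseteq> R_ideal n V \<eta> \<alpha> \<beta>"
  proof
    fix p assume p: "p \<in> bad_polys n V \<eta> \<alpha> \<beta>"
    have mono: "Poly_Mapping.single e c \<in> R_ideal n V \<eta> \<alpha> \<beta>" if e: "e \<in> Poly_Mapping.keys p" for e and c :: int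
    proof -
      let ?S = "Poly_Mapping.keys e"
      have S: "?S \<subseteq> {1..n}" "\<not> good_exp n V \<eta> \<alpha> \<beta> e" using p e unfolding bad_polys_def poly_ring_carrier by blast+
      then have "u_set ?S \<in> ?G" by (auto simp: good_exp_def)
      then have gen: "u_set ?S \<in> R_ideal n V \<eta> \<alpha> \<beta>" unfolding R_ideal_def using R.genideal_self[OF G] by blast
      have "Poly_Mapping.keys (e - indicator_exp ?S) \<subseteq> ?S" by (auto simp: in_keys_iff lookup_minus)
      then have "Poly_Mapping.single (e - indicator_exp ?S) c \<in> carrier (poly_ring n)"
        using S(1) by (intro single_poly_ring) blast
      from I.I_l_closed[OF gen this]
      have "Poly_Mapping.single (e - indicator_exp ?S) c * u_set ?S \<in> R_ideal n V \<eta> \<alpha> \<beta>" by (simp add: poly_ring_ops)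
      moreover have "e - indicator_exp ?S + indicator_exp ?S = e"
        by (rule poly_mapping_eqI) (auto simp: lookup_add lookup_minus lookup_indicator_exp in_keys_iff)
      ultimately show ?thesis by (simp add: u_set_eq mult_single)
    qed
    have "(\<Sum>e\<in>E. Poly_Mapping.single e (Poly_Mapping.lookup p e)) \<in> R_ideal n V \<eta> \<alpha> \<beta>"
      if "E \<subseteq> Poly_Mapping.keys p" for E
      using that
    proof (induction E rule: infinite_finite_induct)
      case (insert e E)
      then show ?case using I.a_closed[of "Poly_Mapping.single e (Poly_Mapping.lookup p e)"] mono[of e]
        by (simp add: poly_ring_ops)
    qed (use I.zero_closed in \<open>simp_all add: poly_ring_ops\<close>)
    moreover have "p = (\<Sum>e\<in>Poly_Mapping.keys p. Poly_Mapping.single e (Poly_Mapping.lookup p e))"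
      by (rule poly_mapping_expand)
    ultimately show "p \<in> R_ideal n V \<eta> \<alpha> \<beta>" by (metis order_refl)
  qed
qed

lemma ideal_R_ideal: "ideal (R_ideal n V \<eta> \<alpha> \<beta>) (poly_ring n)"
  unfolding R_ideal_def
  by (rule ring.genideal_ideal[OF ring_poly_ring]) (use u_set_poly_ring in blast)

lemma ring_R_tilde: "ring (R_tilde n V \<eta> \<alpha> \<beta>)"
  unfolding R_tilde_def by (rule ideal.quotient_is_ring[OF ideal_R_ideal])

lemma R_class_hom: "R_class n V \<eta> \<alpha> \<beta> \<in> Ring.ring_hom (poly_ring n) (R_tilde n V \<eta> \<alpha> \<beta>)"
  using ideal.rcos_ring_hom[OF ideal_R_ideal] unfolding R_class_def R_tilde_def .

lemma R_class_closed: "p \<in> carrier (poly_ring n) \<Longrightarrow> R_class n V \<eta> \<alpha> \<beta> p \<in> carrier (R_tilde n V \<eta> \<alpha> \<beta>)"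
  by (rule Ring.ring_hom_closed[OF R_class_hom])

lemma R_class_add:
  assumes "p \<in> carrier (poly_ring n)" "q \<in> carrier (poly_ring n)"
  shows "R_class n V \<eta> \<alpha> \<beta> p \<oplus>\<^bsub>R_tilde n V \<eta> \<alpha> \<beta>\<^esub> R_class n V \<eta> \<alpha> \<beta> q = R_class n V \<eta> \<alpha> \<beta> (p + q)"
  using Ring.ring_hom_add[OF R_class_hom assms] by (simp add: poly_ring_ops)

lemma R_class_0: "R_class n V \<eta> \<alpha> \<beta> 0 = \<zero>\<^bsub>R_tilde n V \<eta> \<alpha> \<beta>\<^esub>"
  using Ring.ring_hom_zero[OF R_class_hom ring_poly_ring ring_R_tilde] by (simp add: poly_ring_ops)

lemma R_class_1: "R_class n V \<eta> \<alpha> \<beta> 1 = \<one>\<^bsub>R_tilde n V \<eta> \<alpha> \<beta>\<^esub>"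
  using Ring.ring_hom_one[OF R_class_hom] by (simp add: poly_ring_ops)

lemma R_tilde_cases:
  assumes "A \<in> carrier (R_tilde n V \<eta> \<alpha> \<beta>)"
  obtains p where "p \<in> carrier (poly_ring n)" "A = R_class n V \<eta> \<alpha> \<beta> p"
  using assms unfolding R_tilde_def R_class_def FactRing_def A_RCOSETS_def' by auto

text \<open>Equivalently, the good monomials form an integral basis of the quotient.\<close>

lemma R_class_eq_iff:
  assumes p: "p \<in> carrier (poly_ring n)" and q: "q \<in> carrier (poly_ring n)"
  shows "R_class n V \<eta> \<alpha> \<beta> p = R_class n V \<eta> \<alpha> \<beta> q \<longleftrightarrow>
    (\<forall>e. good_exp n V \<eta> \<alpha> \<beta> e \<longrightarrow> Poly_Mapping.lookup p e = Poly_Mapping.lookup q e)"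
proof -
  interpret I: ideal "R_ideal n V \<eta> \<alpha> \<beta>" "poly_ring n" by (rule ideal_R_ideal)
  have "R_class n V \<eta> \<alpha> \<beta> p = R_class n V \<eta> \<alpha> \<beta> q \<longleftrightarrow> p - q \<in> R_ideal n V \<eta> \<alpha> \<beta>"
  proof
    assume "R_class n V \<eta> \<alpha> \<beta> p = R_class n V \<eta> \<alpha> \<beta> q"
    then have "p \<in> R_ideal n V \<eta> \<alpha> \<beta> +>\<^bsub>poly_ring n\<^esub> q" using I.a_rcos_self[OF p] by (simp add: R_class_def)
    then obtain h where "h \<in> R_ideal n V \<eta> \<alpha> \<beta>" "p = h + q" by (auto simp: a_r_coset_def' poly_ring_ops)
    then show "p - q \<in> R_ideal n V \<eta> \<alpha> \<beta>" by simp
  next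
    assume d: "p - q \<in> R_ideal n V \<eta> \<alpha> \<beta>"
    have "p \<in> R_ideal n V \<eta> \<alpha> \<beta> +>\<^bsub>poly_ring n\<^esub> q"
      unfolding a_r_coset_def' poly_ring_ops by (rule UN_I[OF d]) simp
    then show "R_class n V \<eta> \<alpha> \<beta> p = R_class n V \<eta> \<alpha> \<beta> q"
      using I.a_repr_independence'[OF _ q] by (simp add: R_class_def)
  qed
  also have "\<dots> \<longleftrightarrow> (\<forall>e. good_exp n V \<eta> \<alpha> \<beta> e \<longrightarrow> Poly_Mapping.lookup p e = Poly_Mapping.lookup q e)"
  proof -
    have "Poly_Mapping.lookup (p - q) e + Poly_Mapping.lookup q e = Poly_Mapping.lookup p e" for e
      by (simp flip: lookup_add)
    then have "e \<in> Poly_Mapping.keys (p - q) \<longleftrightarrow> Poly_Mapping.lookup p e \<noteq> Poly_Mapping.lookup q e" for e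
      unfolding in_keys_iff by (metis add_0 add_right_cancel)
    then show ?thesis using poly_ring_closed(4)[OF p q] unfolding R_ideal_eq bad_polys_def by blast
  qed
  finally show ?thesis .
qed

lemma R_class_self:
  assumes "p \<in> carrier (poly_ring n)"
  shows "p \<in> R_class n V \<eta> \<alpha> \<beta> p"
proof -
  interpret I: ideal "R_ideal n V \<eta> \<alpha> \<beta>" "poly_ring n" by (rule ideal_R_ideal)
  show ?thesis using I.a_rcos_self[OF assms] by (simp add: R_class_def)
qed

lemma R_class_sum:
  assumes "finite Q" "\<And>i. i \<in> Q \<Longrightarrow> f i \<in> carrier (poly_ring n)"
  shows "finsum (R_tilde n V \<eta> \<alpha> \<beta>) (\<lambda>i. R_class n V \<eta> \<alpha> \<beta> (f i)) Q = R_class n V \<eta> \<alpha> \<beta> (sum f Q)"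
  using assms
proof (induction Q rule: finite_induct)
  case empty
  interpret R: ring "R_tilde n V \<eta> \<alpha> \<beta>" by (rule ring_R_tilde)
  show ?case by (simp add: R_class_0)
next
  case (insert i Q)
  interpret R: ring "R_tilde n V \<eta> \<alpha> \<beta>" by (rule ring_R_tilde)
  have "finsum (R_tilde n V \<eta> \<alpha> \<beta>) (\<lambda>i. R_class n V \<eta> \<alpha> \<beta> (f i)) (insert i Q) =
      R_class n V \<eta> \<alpha> \<beta> (f i) \<oplus>\<^bsub>R_tilde n V \<eta> \<alpha> \<beta>\<^esub> finsum (R_tilde n V \<eta> \<alpha> \<beta>) (\<lambda>i. R_class n V \<eta> \<alpha> \<beta> (f i)) Q"
    using insert by (intro R.finsum_insert) (auto simp: R_class_closed)
  then show ?case using insert by (simp add: R_class_add poly_ring_sum)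
qed

lemma sign_vectors_cases: "\<alpha> \<in> sign_vectors n \<Longrightarrow> i \<in> {1..n} \<Longrightarrow> \<alpha> i = 1 \<or> \<alpha> i = -1"
  by (auto simp: sign_vectors_def PiE_def Pi_def)

text \<open>There are only two signs, so outside the switch set \<beta> agrees with \<alpha> or with
  \<gamma> at each coordinate.\<close>

lemma region_through:
  assumes \<alpha>: "\<alpha> \<in> sign_vectors n" "\<beta> \<in> sign_vectors n" "\<gamma> \<in> sign_vectors n"
    and x: "x \<in> region n V \<eta> \<alpha>" "x \<in> region n V \<eta> \<gamma>" "\<And>i. i \<in> switch_set n \<alpha> \<beta> \<gamma> \<Longrightarrow> x i = 0"
  shows "x \<in> region n V \<eta> \<beta>"
proof -
  have "\<beta> i * x i \<ge> 0" if i: "i \<in> {1..n}" for i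
  proof -
    consider "\<beta> i = \<alpha> i" | "\<beta> i = \<gamma> i" | "i \<in> switch_set n \<alpha> \<beta> \<gamma>"
      using sign_vectors_cases[OF \<alpha>(1) i] sign_vectors_cases[OF \<alpha>(2) i] sign_vectors_cases[OF \<alpha>(3) i] i
      by (auto simp: switch_set_def)
    then show ?thesis using x i by cases (simp_all add: region_def)
  qed
  then show ?thesis using x(1) by (simp add: region_def)
qed

text \<open>Well-definedness of the product: by \<open>region_through\<close>, multiplication by
  \<open>u_S\<close> maps the ideals for \<open>\<alpha>, \<beta>\<close> and for
  \<open>\<beta>, \<gamma>\<close> into the one for \<open>\<alpha>, \<gamma>\<close>. The union
  over representatives therefore collapses to one class.\<close>

lemma R_prod_class:
  assumes \<alpha>: "\<alpha> \<in> sign_vectors n" "\<beta> \<in> sign_vectors n" "\<gamma> \<in> sign_vectors n"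
    and p: "p \<in> carrier (poly_ring n)" and q: "q \<in> carrier (poly_ring n)"
  shows "R_prod n V \<eta> \<alpha> \<beta> \<gamma> (R_class n V \<eta> \<alpha> \<beta> p) (R_class n V \<eta> \<beta> \<gamma> q) =
    R_class n V \<eta> \<alpha> \<gamma> (u_set (switch_set n \<alpha> \<beta> \<gamma>) * p * q)"
proof -
  let ?S = "switch_set n \<alpha> \<beta> \<gamma>"
  let ?u = "u_set ?S"
  have S: "?S \<subseteq> {1..n}" "finite ?S" by (auto simp: switch_set_def)
  have u: "?u \<in> carrier (poly_ring n)" by (rule u_set_poly_ring[OF S(1)])
  have keys_u: "\<exists>e'. e = indicator_exp ?S + e' \<and> e' \<in> Poly_Mapping.keys r" if "e \<in> Poly_Mapping.keys (?u * r)" for e r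
    using keys_mult[of ?u r] that by (auto simp: u_set_eq split: if_splits)
  have zero_on: "x i = 0" if "x \<in> flat V \<eta> (Poly_Mapping.keys (indicator_exp ?S + e))" "i \<in> ?S" for x i e
    using that S(2) by (simp add: flat_def keys_add_nat keys_indicator_exp)
  have left: "?u * r \<in> bad_polys n V \<eta> \<alpha> \<gamma>" if r: "r \<in> bad_polys n V \<eta> \<alpha> \<beta>" for r
  proof -
    have "\<not> good_exp n V \<eta> \<alpha> \<gamma> e" if e: "e \<in> Poly_Mapping.keys (?u * r)" for e
    proof
      assume g: "good_exp n V \<eta> \<alpha> \<gamma> e"
      obtain e' where e': "e = indicator_exp ?S + e'" "e' \<in> Poly_Mapping.keys r" using keys_u[OF e] by blast
      obtain x where x: "x \<in> region n V \<eta> \<alpha>" "x \<in> region n V \<eta> \<gamma>" "x \<in> flat V \<eta> (Poly_Mapping.keys e)"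
        using g by (auto simp: good_exp_def)
      then have "x \<in> region n V \<eta> \<beta>" using region_through[OF \<alpha> x(1,2)] zero_on e'(1) by blast
      moreover have "x \<in> flat V \<eta> (Poly_Mapping.keys e')" using x(3) by (simp add: e'(1) flat_def keys_add_nat)
      ultimately have "good_exp n V \<eta> \<alpha> \<beta> e'" using x by (auto simp: good_exp_def)
      then show False using r e'(2) by (simp add: bad_polys_def)
    qed
    then show ?thesis using r u by (auto simp: bad_polys_def poly_ring_closed)
  qed
  have right: "?u * r \<in> bad_polys n V \<eta> \<alpha> \<gamma>" if r: "r \<in> bad_polys n V \<eta> \<beta> \<gamma>" for r
  proof -
    have "\<not> good_exp n V \<eta> \<alpha> \<gamma> e" if e: "e \<in> Poly_Mapping.keys (?u * r)" for e
    proof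
      assume g: "good_exp n V \<eta> \<alpha> \<gamma> e"
      obtain e' where e': "e = indicator_exp ?S + e'" "e' \<in> Poly_Mapping.keys r" using keys_u[OF e] by blast
      obtain x where x: "x \<in> region n V \<eta> \<alpha>" "x \<in> region n V \<eta> \<gamma>" "x \<in> flat V \<eta> (Poly_Mapping.keys e)"
        using g by (auto simp: good_exp_def)
      then have "x \<in> region n V \<eta> \<beta>" using region_through[OF \<alpha> x(1,2)] zero_on e'(1) by blast
      moreover have "x \<in> flat V \<eta> (Poly_Mapping.keys e')" using x(3) by (simp add: e'(1) flat_def keys_add_nat)
      ultimately have "good_exp n V \<eta> \<beta> \<gamma> e'" using x by (auto simp: good_exp_def)
      then show False using r e'(2) by (simp add: bad_polys_def)
    qed
    then show ?thesis using r u by (auto simp: bad_polys_def poly_ring_closed)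
  qed
  have const: "R_class n V \<eta> \<alpha> \<gamma> (?u * p' * q') = R_class n V \<eta> \<alpha> \<gamma> (?u * p * q)"
    if p': "p' \<in> R_class n V \<eta> \<alpha> \<beta> p" and q': "q' \<in> R_class n V \<eta> \<beta> \<gamma> q" for p' q'
  proof -
    obtain a where a: "a \<in> bad_polys n V \<eta> \<alpha> \<beta>" "p' = a + p"
      using p' by (auto simp: R_class_def R_ideal_eq a_r_coset_def' poly_ring_ops)
    obtain b where b: "b \<in> bad_polys n V \<eta> \<beta> \<gamma>" "q' = b + q"
      using q' by (auto simp: R_class_def R_ideal_eq a_r_coset_def' poly_ring_ops)
    have ab: "a \<in> carrier (poly_ring n)" "b \<in> carrier (poly_ring n)" using a(1) b(1) by (auto simp: bad_polys_def)
    have c: "?u * p' * q' \<in> carrier (poly_ring n)" "?u * p * q \<in> carrier (poly_ring n)"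
      using u p q ab a(2) b(2) by (auto intro!: poly_ring_closed)
    have "(?u * a) * q' + (?u * b) * p \<in> bad_polys n V \<eta> \<alpha> \<gamma>"
      using bad_polys_mult[OF left[OF a(1)], of q'] bad_polys_mult[OF right[OF b(1)] p] q ab b(2)
      by (intro bad_polys_add) (simp_all add: poly_ring_closed)
    moreover have "?u * p' * q' = (?u * p * q) + ((?u * a) * q' + (?u * b) * p)"
      by (simp add: a(2) b(2) algebra_simps)
    ultimately show ?thesis
      unfolding R_class_eq_iff[OF c] by (auto simp: lookup_add bad_polys_def in_keys_iff)
  qed
  have "p \<in> R_class n V \<eta> \<alpha> \<beta> p" "q \<in> R_class n V \<eta> \<beta> \<gamma> q"
    using p q by (simp_all add: R_class_self)
  then show ?thesis unfolding R_prod_def using const by blast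
qed

section \<open>From paths to polynomials\<close>

lemma (in ideal) rcos_eq_iff:
  assumes "x \<in> carrier R" "y \<in> carrier R"
  shows "I +> x = I +> y \<longleftrightarrow> x \<ominus> y \<in> I"
proof
  assume "I +> x = I +> y"
  then have "x \<in> I +> y" using a_rcos_self[OF assms(1)] by simp
  then obtain h where h: "h \<in> I" "x = h \<oplus> y" by (auto simp: a_r_coset_def')
  then have "x \<ominus> y = h" using assms a_Hcarr[OF h(1)] by (simp add: a_minus_def a_assoc r_neg)
  then show "x \<ominus> y \<in> I" using h by simp
next
  assume d: "x \<ominus> y \<in> I"
  have "x = (x \<ominus> y) \<oplus> y" using assms by (simp add: a_minus_def a_assoc l_neg)
  then have "x \<in> I +> y" using d by (auto simp: a_r_coset_def')
  then show "I +> x = I +> y" using a_repr_independence'[OF _ assms(2)] by simp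
qed

lemma (in ring) ring_corner:
  assumes e: "e \<in> carrier R" "e \<otimes> e = e"
  shows "ring (corner R e)"
proof -
  have fix_e: "e \<otimes> x = x" "x \<otimes> e = x" "x \<in> carrier R" if x: "x \<in> carrier (corner R e)" for x
  proof -
    obtain a where a: "a \<in> carrier R" "x = e \<otimes> a \<otimes> e" using x by (auto simp: corner_def)
    show "e \<otimes> x = x" using a e by (simp flip: m_assoc)
    show "x \<otimes> e = x" using a e by (simp add: m_assoc)
    show "x \<in> carrier R" using a e by simp
  qed
  have mem: "x \<in> carrier (corner R e)" if "x \<in> carrier R" "e \<otimes> x = x" "x \<otimes> e = x" for x
    using that by (auto simp: corner_def intro!: exI[of _ x])
  have ops: "monoid.mult (corner R e) = monoid.mult R" "ring.add (corner R e) = ring.add R"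
    "monoid.one (corner R e) = e" "ring.zero (corner R e) = \<zero>"
    by (simp_all add: corner_def)
  show ?thesis
  proof (intro ringI abelian_groupI monoidI, unfold ops)
    fix x assume x: "x \<in> carrier (corner R e)"
    show "\<exists>y\<in>carrier (corner R e). y \<oplus> x = \<zero>"
      using fix_e[OF x] e by (intro bexI[of _ "\<ominus> x"] mem) (simp_all add: l_neg r_minus l_minus)
  next
    fix x y assume "x \<in> carrier (corner R e)" "y \<in> carrier (corner R e)"
    note x = fix_e[OF this(1)] and y = fix_e[OF this(2)]
    show "x \<oplus> y \<in> carrier (corner R e)" using x y e by (intro mem) (simp_all add: l_distr r_distr)
    have "e \<otimes> (x \<otimes> y) = x \<otimes> y" using x y e by (simp flip: m_assoc)
    moreover have "x \<otimes> y \<otimes> e = x \<otimes> y" using x y e by (simp add: m_assoc)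
    ultimately show "x \<otimes> y \<in> carrier (corner R e)" using x y by (intro mem) simp_all
    show "x \<oplus> y = y \<oplus> x" using x y by (simp add: a_comm)
  next
    show "\<zero> \<in> carrier (corner R e)" "e \<in> carrier (corner R e)" using e by (auto intro!: mem)
  qed (use fix_e in \<open>auto simp: a_assoc m_assoc l_distr r_distr\<close>)
qed

text \<open>The rounding forgets the parities of the weights, which the endpoints of the path
  determine. In particular a single move gets exponent zero and a loop \<open>ArrU i\<close> the
  variable \<open>u_i\<close>.\<close>

definition exponent :: "label list \<Rightarrow> nat \<Rightarrow>\<^sub>0 nat" where
  "exponent w = (\<Sum>i\<in>edge ` set w. Poly_Mapping.single i (weight w i div 2))"

lemma lookup_exponent: "Poly_Mapping.lookup (exponent w) i = weight w i div 2"
proof -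
  have "Poly_Mapping.lookup (exponent w) i = (\<Sum>j\<in>edge ` set w. if j = i then weight w i div 2 else 0)"
    unfolding exponent_def lookup_sum by (intro sum.cong refl) (auto simp: lookup_single when_def)
  also have "\<dots> = weight w i div 2" using weight_pos_iff[of w i] by auto
  finally show ?thesis .
qed

definition path_poly :: "vertex \<Rightarrow> vertex \<Rightarrow> path_sum \<Rightarrow> mpoly_int" where
  "path_poly x y a = (\<Sum>p\<in>Poly_Mapping.keys a. if fst p = x \<and> snd (snd p) = y
     then Poly_Mapping.single (exponent (fst (snd p))) (Poly_Mapping.lookup a p) else 0)"

lemma path_poly_superset:
  assumes "finite A" "Poly_Mapping.keys a \<subseteq> A"
  shows "path_poly x y a = (\<Sum>p\<in>A. if fst p = x \<and> snd (snd p) = y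
     then Poly_Mapping.single (exponent (fst (snd p))) (Poly_Mapping.lookup a p) else 0)"
  unfolding path_poly_def using assms by (intro sum.mono_neutral_left) (auto simp: in_keys_iff)

lemma path_poly_0 [simp]: "path_poly x y 0 = 0"
  by (simp add: path_poly_def)

lemma path_poly_add: "path_poly x y (a + b) = path_poly x y a + path_poly x y b"
proof -
  let ?A = "Poly_Mapping.keys a \<union> Poly_Mapping.keys b"
  have "Poly_Mapping.keys (a + b) \<subseteq> ?A" by (rule Poly_Mapping.keys_add)
  then show ?thesis
    by (simp only: path_poly_superset[of ?A] finite_UnI finite_keys Un_upper1 Un_upper2 sum.distrib[symmetric])
      (intro sum.cong refl, simp add: lookup_add single_add)
qed

lemma path_poly_single:
  "path_poly x y (Poly_Mapping.single (x', w, y') c) =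
     (if x' = x \<and> y' = y then Poly_Mapping.single (exponent w) c else 0)"
  by (simp add: path_poly_superset[of "{(x', w, y')}"])

lemma path_poly_sum: "path_poly x y (sum f A) = (\<Sum>i\<in>A. path_poly x y (f i))"
  by (induction A rule: infinite_finite_induct) (simp_all add: path_poly_add)

context osz
begin

lemma path_edges: "pathw x w \<Longrightarrow> edge ` set w \<subseteq> {1..n}"
  by (induction w arbitrary: x) (auto simp: applicable_def)

lemma path_weight_parity:
  assumes "pathw x w"
  shows "odd (weight w i) \<longleftrightarrow> i \<in> odd_edges x (run x w)"
proof (cases "i \<in> {1..n}")
  case True
  then show ?thesis using parity_level[OF assms, of i] by (auto simp: odd_edges_def)
next
  case False
  then have "weight w i = 0" using path_edges[OF assms] weight_pos_iff[of w i] by auto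
  then show ?thesis using False by (auto simp: odd_edges_def)
qed

text \<open>Rounded halving carries exactly where both weights are odd. For vertices coming from
  sign vectors these edges form the switch set, so the carry is the factor
  \<open>u_S\<close>.\<close>

lemma exponent_append:
  assumes "pathw x v" "pathw (run x v) w"
  shows "exponent (v @ w) = indicator_exp (odd_edges x (run x v) \<inter> odd_edges (run x v) (run (run x v) w))
    + exponent v + exponent w"
proof (rule poly_mapping_eqI)
  fix i
  have fin: "finite (odd_edges x y)" for x y by (simp add: odd_edges_def)
  have "(a + b) div 2 = (if odd a \<and> odd b then 1 else 0) + a div 2 + b div 2" for a b :: nat
    by presburger
  then show "Poly_Mapping.lookup (exponent (v @ w)) i =
    Poly_Mapping.lookup (indicator_exp (odd_edges x (run x v) \<inter> odd_edges (run x v) (run (run x v) w))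
      + exponent v + exponent w) i"
    using path_weight_parity[OF assms(1), of i] path_weight_parity[OF assms(2), of i] fin
    by (simp add: lookup_add lookup_exponent lookup_indicator_exp)
qed

text \<open>Undoes the halving, given the endpoints: twice the exponent, plus one on the edges of
  odd weight.\<close>

definition exp_weight :: "vertex \<Rightarrow> vertex \<Rightarrow> (nat \<Rightarrow>\<^sub>0 nat) \<Rightarrow> nat \<Rightarrow> nat" where
  "exp_weight x y e i = 2 * Poly_Mapping.lookup e i + (if i \<in> odd_edges x y then 1 else 0)"

lemma exponent_eq_iff:
  assumes "pathw x w"
  shows "exponent w = e \<longleftrightarrow> weight w = exp_weight x (run x w) e"
proof -
  have "weight w i div 2 = m \<longleftrightarrow> weight w i = 2 * m + (if i \<in> odd_edges x (run x w) then 1 else 0)" for i m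
    using path_weight_parity[OF assms, of i] by (cases "odd (weight w i)") (auto elim: oddE evenE)
  then show ?thesis by (simp add: poly_mapping_eq_iff fun_eq_iff lookup_exponent exp_weight_def)
qed

lemma exp_weight_support: "{i. 0 < exp_weight x y e i} = Poly_Mapping.keys e \<union> odd_edges x y"
  by (auto simp: exp_weight_def in_keys_iff)

lemma lookup_path_poly:
  assumes a: "a \<in> carrier (path_algebra n k)"
  shows "Poly_Mapping.lookup (path_poly x y a) e = type_coeff a (x, exp_weight x y e, y)"
  unfolding path_poly_def type_coeff_def lookup_sum
proof (intro sum.cong refl)
  fix p assume p: "p \<in> Poly_Mapping.keys a"
  obtain x' w y' where p_eq: "p = (x', w, y')" by (metis prod.exhaust)
  have path: "pathw x' w" "y' = run x' w" using a p by (auto simp: path_algebra_def p_eq is_path_iff)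
  have "exponent w = e \<longleftrightarrow> weight w = exp_weight x' y' e" using exponent_eq_iff[OF path(1)] path(2) by simp
  then show "Poly_Mapping.lookup (if fst p = x \<and> snd (snd p) = y
      then Poly_Mapping.single (exponent (fst (snd p))) (Poly_Mapping.lookup a p) else 0) e =
    (if path_type p = (x, exp_weight x y e, y) then Poly_Mapping.lookup a p else 0)"
    by (cases "x' = x"; cases "y' = y") (simp_all add: p_eq path_type_def lookup_single when_def)
qed

lemma exponent_keys:
  assumes "pathw x w"
  shows "Poly_Mapping.keys (exponent w) \<subseteq> {1..n}"
proof
  fix i assume "i \<in> Poly_Mapping.keys (exponent w)"
  then have "0 < weight w i" by (auto simp: in_keys_iff lookup_exponent intro: gr0I)
  then show "i \<in> {1..n}" using weight_pos_iff[of w i] path_edges[OF assms] by blast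
qed

lemma path_poly_carrier:
  assumes a: "a \<in> carrier (path_algebra n k)"
  shows "path_poly x y a \<in> carrier (poly_ring n)"
  unfolding path_poly_def
proof (rule poly_ring_sum)
  fix p assume p: "p \<in> Poly_Mapping.keys a"
  obtain x' w y' where p_eq: "p = (x', w, y')" by (metis prod.exhaust)
  have "pathw x' w" using a p by (auto simp: path_algebra_def p_eq is_path_iff)
  then show "(if fst p = x \<and> snd (snd p) = y then Poly_Mapping.single (exponent (fst (snd p))) (Poly_Mapping.lookup a p) else 0)
      \<in> carrier (poly_ring n)"
    using exponent_keys by (simp add: p_eq single_poly_ring poly_ring_0_1)
qed

definition between :: "vertex set \<Rightarrow> path_sum set" where
  "between X = {a \<in> carrier (path_algebra n k). \<forall>p\<in>Poly_Mapping.keys a. fst p \<in> X \<and> snd (snd p) \<in> X}"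

lemma path_poly_mult:
  assumes X: "finite X" and a: "a \<in> between X" and b: "b \<in> between X"
  shows "path_poly x z (path_sum_mult a b) =
    (\<Sum>y\<in>X. u_set (odd_edges x y \<inter> odd_edges y z) * path_poly x y a * path_poly y z b)"
proof -
  have single: "path_poly x z (path_comp p q (c * d)) =
      (\<Sum>y\<in>X. u_set (odd_edges x y \<inter> odd_edges y z) * path_poly x y (Poly_Mapping.single p c)
        * path_poly y z (Poly_Mapping.single q d))"
    if p: "p \<in> Poly_Mapping.keys a" and q: "q \<in> Poly_Mapping.keys b" for p q c d
  proof -
    obtain x1 v y1 where p_eq: "p = (x1, v, y1)" by (metis prod.exhaust)
    obtain y2 w z2 where q_eq: "q = (y2, w, z2)" by (metis prod.exhaust)
    have pv: "pathw x1 v" "y1 = run x1 v" "y1 \<in> X" using a p by (auto simp: between_def path_algebra_def p_eq is_path_iff)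
    have pw: "pathw y2 w" "z2 = run y2 w" using b q by (auto simp: between_def path_algebra_def q_eq is_path_iff)
    show ?thesis
    proof (cases "x1 = x \<and> y1 = y2 \<and> z2 = z")
      case True
      have "(\<Sum>y\<in>X. u_set (odd_edges x y \<inter> odd_edges y z) * path_poly x y (Poly_Mapping.single p c)
          * path_poly y z (Poly_Mapping.single q d)) =
        (\<Sum>y\<in>X. if y = y1 then u_set (odd_edges x y1 \<inter> odd_edges y1 z) * path_poly x y1 (Poly_Mapping.single p c)
          * path_poly y1 z (Poly_Mapping.single q d) else 0)"
        by (intro sum.cong refl) (auto simp: p_eq path_poly_single)
      also have "\<dots> = u_set (odd_edges x y1 \<inter> odd_edges y1 z) * path_poly x y1 (Poly_Mapping.single p c)
          * path_poly y1 z (Poly_Mapping.single q d)"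
        using X pv(3) by simp
      also have "\<dots> = Poly_Mapping.single (exponent (v @ w)) (c * d)"
        using exponent_append[OF pv(1), of w] pw pv(2) True
        by (simp add: p_eq q_eq path_poly_single u_set_eq mult_single)
      finally show ?thesis using True by (simp add: p_eq q_eq path_comp_def path_poly_single)
    next
      case False
      then have "path_poly x z (path_comp p q (c * d)) = 0"
        by (auto simp: p_eq q_eq path_comp_def path_poly_single)
      moreover have "path_poly x y (Poly_Mapping.single p c) * path_poly y z (Poly_Mapping.single q d) = 0" for y
        using False by (auto simp: p_eq q_eq path_poly_single)
      ultimately show ?thesis by (simp only: mult.assoc mult_zero_right sum.neutral_const)
    qed
  qed
  have expand: "path_poly x y a = (\<Sum>p\<in>Poly_Mapping.keys a. path_poly x y (Poly_Mapping.single p (Poly_Mapping.lookup a p)))" for x y a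
    by (subst poly_mapping_expand) (rule path_poly_sum)
  have "path_poly x z (path_sum_mult a b) = (\<Sum>p\<in>Poly_Mapping.keys a. \<Sum>q\<in>Poly_Mapping.keys b.
      path_poly x z (path_comp p q (Poly_Mapping.lookup a p * Poly_Mapping.lookup b q)))"
    by (subst path_sum_mult_superset[of "Poly_Mapping.keys a" "Poly_Mapping.keys b"]) (simp_all add: path_poly_sum)
  also have "\<dots> = (\<Sum>p\<in>Poly_Mapping.keys a. \<Sum>q\<in>Poly_Mapping.keys b. \<Sum>y\<in>X.
      u_set (odd_edges x y \<inter> odd_edges y z) * path_poly x y (Poly_Mapping.single p (Poly_Mapping.lookup a p))
        * path_poly y z (Poly_Mapping.single q (Poly_Mapping.lookup b q)))"
    by (intro sum.cong refl single)
  also have "\<dots> = (\<Sum>p\<in>Poly_Mapping.keys a. \<Sum>y\<in>X. \<Sum>q\<in>Poly_Mapping.keys b.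
      u_set (odd_edges x y \<inter> odd_edges y z) * path_poly x y (Poly_Mapping.single p (Poly_Mapping.lookup a p))
        * path_poly y z (Poly_Mapping.single q (Poly_Mapping.lookup b q)))"
    by (intro sum.cong refl sum.swap)
  also have "\<dots> = (\<Sum>y\<in>X. \<Sum>p\<in>Poly_Mapping.keys a. \<Sum>q\<in>Poly_Mapping.keys b.
      u_set (odd_edges x y \<inter> odd_edges y z) * path_poly x y (Poly_Mapping.single p (Poly_Mapping.lookup a p))
        * path_poly y z (Poly_Mapping.single q (Poly_Mapping.lookup b q)))"
    by (rule sum.swap)
  also have "\<dots> = (\<Sum>y\<in>X. u_set (odd_edges x y \<inter> odd_edges y z) * path_poly x y a * path_poly y z b)"
    unfolding expand[of _ _ a] expand[of _ _ b]
    by (simp add: sum_distrib_left sum_distrib_right mult.assoc) (intro sum.cong refl sum.swap)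
  finally show ?thesis .
qed

section \<open>Corners of the path algebra modulo the relations\<close>

lemma OSz_class_hom: "OSz_class n k \<in> Ring.ring_hom (path_algebra n k) (OSz n k)"
  using ideal.rcos_ring_hom[OF ideal_OSz_ideal] unfolding OSz_class_def[abs_def] OSz_def .

lemma ring_OSz: "ring (OSz n k)"
  unfolding OSz_def by (rule ideal.quotient_is_ring[OF ideal_OSz_ideal])

lemma OSz_carrier: "carrier (OSz n k) = OSz_class n k ` carrier (path_algebra n k)"
  unfolding OSz_def FactRing_def A_RCOSETS_def' OSz_class_def by auto

lemma OSz_class_eq_iff:
  assumes "a \<in> carrier (path_algebra n k)" "b \<in> carrier (path_algebra n k)"
  shows "OSz_class n k a = OSz_class n k b \<longleftrightarrow> a - b \<in> OSz_ideal n k"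
  using ideal.rcos_eq_iff[OF ideal_OSz_ideal assms] a_inv_path_algebra[OF assms(2)]
  by (simp add: OSz_class_def a_minus_def path_algebra_ops)

lemma OSz_class_self:
  assumes "a \<in> carrier (path_algebra n k)"
  shows "a \<in> OSz_class n k a"
proof -
  interpret I: ideal "OSz_ideal n k" "path_algebra n k" by (rule ideal_OSz_ideal)
  show ?thesis using I.a_rcos_self[OF assms] by (simp add: OSz_class_def)
qed

lemma idem_sum_between:
  assumes "X \<subseteq> verts n k"
  shows "idem_sum X \<in> between X"
proof -
  have "Poly_Mapping.keys (idem_sum X) \<subseteq> (\<Union>x\<in>X. {(x, [], x)})"
    unfolding idem_sum_def by (rule order_trans[OF keys_sum]) auto
  then show ?thesis using assms by (fastforce simp: between_def path_algebra_def)
qed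

lemma between_closed:
  assumes "a \<in> between X" "b \<in> between X" "X \<subseteq> verts n k"
  shows "a + b \<in> between X" "path_sum_mult a b \<in> between X" "- a \<in> between X" "a - b \<in> between X"
proof -
  interpret P: ring "path_algebra n k" by (rule ring_path_algebra)
  have ab: "a \<in> carrier (path_algebra n k)" "b \<in> carrier (path_algebra n k)" using assms by (auto simp: between_def)
  have fin: "finite X" by (rule finite_subset[OF assms(3) finite_verts])
  have "a + b \<in> carrier (path_algebra n k)" using P.a_closed[OF ab] by (simp only: path_algebra_ops)
  then show "a + b \<in> between X"
    using assms Poly_Mapping.keys_add[of a b] unfolding between_def by blast
  have neg: "- b \<in> between X" if "b \<in> between X" for b
    using that by (simp add: between_def path_algebra_def)
  then show "- a \<in> between X" using assms(1) by blast
  have "a + - b \<in> carrier (path_algebra n k)"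
    using P.a_closed[OF ab(1), of "- b"] neg[OF assms(2)] by (simp only: path_algebra_ops between_def mem_Collect_eq)
  then show "a - b \<in> between X"
    using assms keys_diff[of a b] unfolding between_def by auto
  have "path_sum_mult a b = restrict_paths X X (path_sum_mult a b)"
  proof -
    have "a = path_sum_mult (idem_sum X) a" "b = path_sum_mult b (idem_sum X)"
      using assms unfolding idem_sum_mult_left[OF fin] idem_sum_mult_right[OF fin]
      by (auto simp: between_def restrict_paths_id)
    then have "path_sum_mult a b = path_sum_mult (path_sum_mult (idem_sum X) (path_sum_mult a b)) (idem_sum X)"
      by (metis path_sum_mult_assoc)
    then show ?thesis
      by (simp add: idem_sum_mult_left[OF fin] idem_sum_mult_right[OF fin] restrict_paths_restrict_paths)
  qed
  then have "Poly_Mapping.keys (path_sum_mult a b) = {p \<in> Poly_Mapping.keys (path_sum_mult a b). fst p \<in> X \<and> snd (snd p) \<in> X}"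
    using keys_restrict_paths[of X X "path_sum_mult a b"] by simp
  moreover have "path_sum_mult a b \<in> carrier (path_algebra n k)" using P.m_closed[OF ab] by (simp only: path_algebra_ops)
  ultimately show "path_sum_mult a b \<in> between X" unfolding between_def by blast
qed

lemma corner_ops:
  "monoid.mult (corner (OSz n k) e) = monoid.mult (OSz n k)" "ring.add (corner (OSz n k) e) = ring.add (OSz n k)"
  "monoid.one (corner (OSz n k) e) = e" "ring.zero (corner (OSz n k) e) = \<zero>\<^bsub>OSz n k\<^esub>"
  by (simp_all add: corner_def)

lemma corner_carrier:
  assumes X: "X \<subseteq> verts n k"
  shows "carrier (corner (OSz n k) (OSz_class n k (idem_sum X))) = OSz_class n k ` between X"
proof -
  have fin: "finite X" by (rule finite_subset[OF X finite_verts])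
  have e: "idem_sum X \<in> carrier (path_algebra n k)" using idem_sum_between[OF X] by (simp add: between_def)
  interpret P: ring "path_algebra n k" by (rule ring_path_algebra)
  have prod: "OSz_class n k (idem_sum X) \<otimes>\<^bsub>OSz n k\<^esub> OSz_class n k a \<otimes>\<^bsub>OSz n k\<^esub> OSz_class n k (idem_sum X)
      = OSz_class n k (restrict_paths X X a)" if a: "a \<in> carrier (path_algebra n k)" for a
  proof -
    have ea: "path_sum_mult (idem_sum X) a \<in> carrier (path_algebra n k)"
      using P.m_closed[OF e a] by (simp add: path_algebra_ops)
    show ?thesis
      using Ring.ring_hom_mult[OF OSz_class_hom e a] Ring.ring_hom_mult[OF OSz_class_hom ea e]
      by (simp add: path_algebra_ops idem_sum_mult_left[OF fin] idem_sum_mult_right[OF fin] restrict_paths_restrict_paths)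
  qed
  have in_between: "restrict_paths X X a \<in> between X" if "a \<in> carrier (path_algebra n k)" for a
    using that by (auto simp: between_def path_algebra_def keys_restrict_paths)
  show ?thesis
  proof
    show "carrier (corner (OSz n k) (OSz_class n k (idem_sum X))) \<subseteq> OSz_class n k ` between X"
      using prod in_between by (fastforce simp: corner_def OSz_carrier)
    show "OSz_class n k ` between X \<subseteq> carrier (corner (OSz n k) (OSz_class n k (idem_sum X)))"
    proof
      fix A assume "A \<in> OSz_class n k ` between X"
      then obtain a where a: "a \<in> between X" "A = OSz_class n k a" by auto
      then have "restrict_paths X X a = a" by (intro restrict_paths_id) (simp add: between_def)
      then have "A = OSz_class n k (idem_sum X) \<otimes>\<^bsub>OSz n k\<^esub> OSz_class n k a \<otimes>\<^bsub>OSz n k\<^esub> OSz_class n k (idem_sum X)"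
        using prod[of a] a by (simp add: between_def)
      moreover have "OSz_class n k a \<in> carrier (OSz n k)" using a by (auto simp: OSz_carrier between_def)
      ultimately show "A \<in> carrier (corner (OSz n k) (OSz_class n k (idem_sum X)))" by (auto simp: corner_def)
    qed
  qed
qed

lemma ring_OSz_corner:
  assumes X: "X \<subseteq> verts n k"
  shows "ring (corner (OSz n k) (OSz_class n k (idem_sum X)))"
proof (rule ring.ring_corner[OF ring_OSz])
  have fin: "finite X" by (rule finite_subset[OF X finite_verts])
  have e: "idem_sum X \<in> carrier (path_algebra n k)" using idem_sum_between[OF X] by (simp add: between_def)
  then show "OSz_class n k (idem_sum X) \<in> carrier (OSz n k)" by (simp add: OSz_carrier)
  have "path_sum_mult (idem_sum X) (idem_sum X) = idem_sum X"
    unfolding idem_sum_mult_left[OF fin] using idem_sum_between[OF X] by (intro restrict_paths_id) (auto simp: between_def)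
  then show "OSz_class n k (idem_sum X) \<otimes>\<^bsub>OSz n k\<^esub> OSz_class n k (idem_sum X) = OSz_class n k (idem_sum X)"
    using Ring.ring_hom_mult[OF OSz_class_hom e e] by (simp add: path_algebra_ops)
qed

end

lemma (in ring) finsum_cong_closed:
  assumes "\<And>i. i \<in> A \<Longrightarrow> f i = g i" "\<And>i. i \<in> A \<Longrightarrow> g i \<in> carrier R"
  shows "finsum R f A = finsum R g A"
  using assms by (intro finsum_cong') auto

lemma exists_U_word:
  "\<exists>us. (\<forall>a\<in>set us. is_U a) \<and> (\<forall>i. weight us i = 2 * Poly_Mapping.lookup e i)"
proof (induction e rule: poly_mapping_additive_induct)
  case zero
  show ?case by (intro exI[of _ "[]"]) simp
next
  case (single j c)
  have "weight (replicate c (ArrU j)) i = (if i = j then 2 * c else 0)" for i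
    by (induction c) auto
  then show ?case by (intro exI[of _ "replicate c (ArrU j)"]) (auto simp: lookup_single when_def)
next
  case (add a b)
  then obtain us vs where "\<forall>a\<in>set us. is_U a" "\<forall>i. weight us i = 2 * Poly_Mapping.lookup a i"
    "\<forall>a\<in>set vs. is_U a" "\<forall>i. weight vs i = 2 * Poly_Mapping.lookup b i" by blast
  then show ?case by (intro exI[of _ "us @ vs"]) (auto simp: lookup_add)
qed

lemma (in osz) pathw_U:
  "\<forall>a\<in>set us. is_U a \<Longrightarrow> edge ` set us \<subseteq> {1..n} \<Longrightarrow> pathw x us"
  by (induction us) (auto simp: applicable_def act_def)

section \<open>The comparison isomorphism over a set of sign vectors\<close>

context cyclic
begin

text \<open>By \<open>bounded_feasible_eq\<close> this is \<P> for every left cyclic \<xi>. Working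
  with a set that does not mention \<xi> makes the independence of \<xi> visible in the end.\<close>

definition full_signs :: "signs set" where
  "full_signs = {\<alpha> \<in> sign_vectors n. card (sign_changes n \<alpha>) = k}"

abbreviation "sc \<equiv> sign_changes n"
abbreviation "\<H> Q \<equiv> hypertoric_ring n V \<eta> Q"

lemma full_signsD:
  assumes "\<alpha> \<in> full_signs"
  shows "\<alpha> \<in> sign_vectors n" "is_sign n \<alpha>" "card (sc \<alpha>) = k" "sc \<alpha> \<in> verts_l n k" "sc \<alpha> \<in> verts n k"
proof -
  show "\<alpha> \<in> sign_vectors n" "card (sc \<alpha>) = k" using assms by (simp_all add: full_signs_def)
  then show "is_sign n \<alpha>" "sc \<alpha> \<in> verts_l n k"
    using sign_vectors_is_sign by (auto simp: verts_l_def sign_changes_def)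
  then show "sc \<alpha> \<in> verts n k" using verts_l_subset by blast
qed

lemma bij_sc: "bij_betw sc full_signs (verts_l n k)"
  using sign_changes_bij by (simp add: full_signs_def)

lemma inj_sc: "Q \<subseteq> full_signs \<Longrightarrow> inj_on sc Q"
  using bij_sc by (auto simp: bij_betw_def intro: inj_on_subset)

lemma finite_full_signs: "finite full_signs"
  unfolding full_signs_def sign_vectors_def by (intro finite_subset[OF _ finite_PiE[of "{1..n}" "\<lambda>_. {1, -1}"]]) auto

text \<open>The bridge between both sides: the right-hand set is the support of
  \<open>exp_weight\<close> for \<open>e\<close>, so a monomial survives in the hypertoric algebra
  exactly if the corresponding weight survives among paths.\<close>

lemma good_exp_iff:
  assumes "\<alpha> \<in> full_signs" "\<beta> \<in> full_signs" "Poly_Mapping.keys e \<subseteq> {1..n}"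
  shows "good_exp n V \<eta> \<alpha> \<beta> e \<longleftrightarrow> supported (sc \<alpha>) (Poly_Mapping.keys e \<union> odd_edges (sc \<alpha>) (sc \<beta>))"
  using region_inter_iff[OF full_signsD(2,3)[OF assms(1)] full_signsD(2)[OF assms(2)] assms(3)]
    disagreement_eq_odd_edges[OF full_signsD(2)[OF assms(1)] full_signsD(2)[OF assms(2)]]
  by (simp add: good_exp_def)

lemma good_exp_sym: "good_exp n V \<eta> \<alpha> \<beta> e \<longleftrightarrow> good_exp n V \<eta> \<beta> \<alpha> e"
  by (simp add: good_exp_def Int_commute)

lemma odd_edges_sym: "odd_edges x y = odd_edges y x"
  by (auto simp: odd_edges_def)

lemma switch_set_eq:
  assumes "\<alpha> \<in> full_signs" "\<beta> \<in> full_signs" "\<gamma> \<in> full_signs"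
  shows "switch_set n \<alpha> \<beta> \<gamma> = odd_edges (sc \<alpha>) (sc \<beta>) \<inter> odd_edges (sc \<beta>) (sc \<gamma>)"
proof -
  have "\<alpha> i = \<gamma> i \<and> \<alpha> i \<noteq> \<beta> i \<longleftrightarrow> \<alpha> i \<noteq> \<beta> i \<and> \<beta> i \<noteq> \<gamma> i" if i: "i \<in> {1..n}" for i
    using sign_vectors_cases[OF full_signsD(1)[OF assms(1)] i] sign_vectors_cases[OF full_signsD(1)[OF assms(2)] i]
      sign_vectors_cases[OF full_signsD(1)[OF assms(3)] i] by auto
  then have "switch_set n \<alpha> \<beta> \<gamma> = {i \<in> {1..n}. \<alpha> i \<noteq> \<beta> i} \<inter> {i \<in> {1..n}. \<beta> i \<noteq> \<gamma> i}"
    unfolding switch_set_def by blast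
  then show ?thesis
    using disagreement_eq_odd_edges full_signsD(2)[OF assms(1)] full_signsD(2)[OF assms(2)] full_signsD(2)[OF assms(3)]
    by simp
qed

definition poly_components :: "signs set \<Rightarrow> path_sum \<Rightarrow> family" where
  "poly_components Q a = (\<lambda>\<alpha> \<beta>. if \<alpha> \<in> Q \<and> \<beta> \<in> Q then R_class n V \<eta> \<alpha> \<beta> (path_poly (sc \<alpha>) (sc \<beta>) a)
     else \<zero>\<^bsub>R_tilde n V \<eta> \<alpha> \<beta>\<^esub>)"

lemma sc_image_subset: "Q \<subseteq> full_signs \<Longrightarrow> sc ` Q \<subseteq> verts n k"
  using full_signsD(5) by blast

lemma poly_components_closed:
  assumes "a \<in> carrier (path_algebra n k)"
  shows "poly_components Q a \<in> carrier (\<H> Q)"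
  using assms by (auto simp: hypertoric_ring_def poly_components_def R_class_closed path_poly_carrier)

lemma poly_components_cong:
  assumes Q: "Q \<subseteq> full_signs" and a: "a \<in> carrier (path_algebra n k)" and b: "b \<in> carrier (path_algebra n k)"
    and d: "a - b \<in> OSz_ideal n k"
  shows "poly_components Q a = poly_components Q b"
proof -
  have "R_class n V \<eta> \<alpha> \<beta> (path_poly (sc \<alpha>) (sc \<beta>) a) = R_class n V \<eta> \<alpha> \<beta> (path_poly (sc \<alpha>) (sc \<beta>) b)"
    if \<alpha>: "\<alpha> \<in> Q" and \<beta>: "\<beta> \<in> Q" for \<alpha> \<beta>
    unfolding R_class_eq_iff[OF path_poly_carrier[OF a] path_poly_carrier[OF b]]
  proof (intro allI impI)
    fix e assume g: "good_exp n V \<eta> \<alpha> \<beta> e"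
    show "Poly_Mapping.lookup (path_poly (sc \<alpha>) (sc \<beta>) a) e = Poly_Mapping.lookup (path_poly (sc \<alpha>) (sc \<beta>) b) e"
    proof (cases "Poly_Mapping.keys e \<subseteq> {1..n}")
      case True
      have "supported (sc \<alpha>) {i. 0 < exp_weight (sc \<alpha>) (sc \<beta>) e i}"
        using good_exp_iff[of \<alpha> \<beta> e] g True \<alpha> \<beta> Q by (auto simp: exp_weight_support)
      moreover have "a - b \<in> vanishing" using d by (simp add: OSz_ideal_eq_vanishing)
      ultimately have "type_coeff (a - b) (sc \<alpha>, exp_weight (sc \<alpha>) (sc \<beta>) e, sc \<beta>) = 0"
        unfolding vanishing_def by blast
      then show ?thesis by (simp add: lookup_path_poly a b type_coeff_diff)
    next
      case False
      then have "e \<notin> Poly_Mapping.keys (path_poly (sc \<alpha>) (sc \<beta>) a)" "e \<notin> Poly_Mapping.keys (path_poly (sc \<alpha>) (sc \<beta>) b)"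
        using path_poly_carrier[OF a] path_poly_carrier[OF b] unfolding poly_ring_carrier by blast+
      then show ?thesis by (simp add: in_keys_iff)
    qed
  qed
  then show ?thesis unfolding poly_components_def by (intro ext) simp
qed

text \<open>A type not occurring in \<open>a - b\<close> has coefficient zero anyway. One that
  occurs is the \<open>exp_weight\<close> of its exponent, which is good if the weight is supported,
  so its coefficient can be read off from the class of the path polynomial.\<close>

lemma poly_components_inj:
  assumes Q: "Q \<subseteq> full_signs" and a: "a \<in> between (sc ` Q)" and b: "b \<in> between (sc ` Q)"
    and eq: "poly_components Q a = poly_components Q b"
  shows "a - b \<in> OSz_ideal n k"
proof -
  have ac: "a \<in> carrier (path_algebra n k)" "b \<in> carrier (path_algebra n k)" using a b by (auto simp: between_def)
  have ab: "a - b \<in> between (sc ` Q)" using between_closed(4)[OF a b sc_image_subset[OF Q]] .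
  have "type_coeff (a - b) (x, m, y) = 0" if sup: "supported x {i. 0 < m i}" for x m y
  proof (cases "\<exists>p\<in>Poly_Mapping.keys (a - b). path_type p = (x, m, y)")
    case False
    then show ?thesis unfolding type_coeff_def by (intro sum.neutral) auto
  next
    case True
    then obtain w where p: "(x, w, y) \<in> Poly_Mapping.keys (a - b)" "weight w = m"
      by (auto simp: path_type_def)
    have path: "pathw x w" "y = run x w" and xy: "x \<in> sc ` Q" "y \<in> sc ` Q"
      using ab p(1) by (auto simp: between_def path_algebra_def is_path_iff)
    obtain \<alpha> \<beta> where \<alpha>: "\<alpha> \<in> Q" "x = sc \<alpha>" and \<beta>: "\<beta> \<in> Q" "y = sc \<beta>" using xy by auto
    define e where "e = exponent w"
    have m: "m = exp_weight x y e" using exponent_eq_iff[OF path(1), of e] p(2) path(2) by (simp add: e_def)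
    have keys: "Poly_Mapping.keys e \<subseteq> {1..n}" unfolding e_def by (rule exponent_keys[OF path(1)])
    have "good_exp n V \<eta> \<alpha> \<beta> e"
      using good_exp_iff[of \<alpha> \<beta> e] \<alpha> \<beta> Q keys sup by (auto simp: m exp_weight_support)
    moreover have "R_class n V \<eta> \<alpha> \<beta> (path_poly x y a) = R_class n V \<eta> \<alpha> \<beta> (path_poly x y b)"
      using fun_cong[OF fun_cong[OF eq], of \<alpha> \<beta>] \<alpha> \<beta> by (simp add: poly_components_def)
    ultimately have "Poly_Mapping.lookup (path_poly x y a) e = Poly_Mapping.lookup (path_poly x y b) e"
      using R_class_eq_iff[OF path_poly_carrier[OF ac(1)] path_poly_carrier[OF ac(2)]] by blast
    then show ?thesis by (simp add: lookup_path_poly ac m type_coeff_diff)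
  qed
  then show ?thesis using ab by (simp add: OSz_ideal_eq_vanishing vanishing_def between_def)
qed

lemma poly_components_add:
  assumes "a \<in> carrier (path_algebra n k)" "b \<in> carrier (path_algebra n k)"
  shows "poly_components Q (a + b) = poly_components Q a \<oplus>\<^bsub>\<H> Q\<^esub> poly_components Q b"
proof (intro ext)
  fix \<alpha> \<beta>
  interpret R: ring "R_tilde n V \<eta> \<alpha> \<beta>" by (rule ring_R_tilde)
  show "poly_components Q (a + b) \<alpha> \<beta> = (poly_components Q a \<oplus>\<^bsub>\<H> Q\<^esub> poly_components Q b) \<alpha> \<beta>"
    by (simp add: poly_components_def hypertoric_ring_def path_poly_add R_class_add path_poly_carrier assms)
qed

lemma poly_components_mult:
  assumes Q: "Q \<subseteq> full_signs" and a: "a \<in> between (sc ` Q)" and b: "b \<in> between (sc ` Q)"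
  shows "poly_components Q (path_sum_mult a b) = poly_components Q a \<otimes>\<^bsub>\<H> Q\<^esub> poly_components Q b"
proof (intro ext)
  fix \<alpha> \<gamma>
  have fin: "finite Q" using finite_subset[OF Q finite_full_signs] .
  have ac: "a \<in> carrier (path_algebra n k)" "b \<in> carrier (path_algebra n k)" using a b by (auto simp: between_def)
  interpret R: ring "R_tilde n V \<eta> \<alpha> \<gamma>" by (rule ring_R_tilde)
  show "poly_components Q (path_sum_mult a b) \<alpha> \<gamma> = (poly_components Q a \<otimes>\<^bsub>\<H> Q\<^esub> poly_components Q b) \<alpha> \<gamma>"
  proof (cases "\<alpha> \<in> Q \<and> \<gamma> \<in> Q")
    case True
    define f where "f \<beta> = u_set (switch_set n \<alpha> \<beta> \<gamma>) * path_poly (sc \<alpha>) (sc \<beta>) a * path_poly (sc \<beta>) (sc \<gamma>) b" for \<beta>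
    have f: "f \<beta> \<in> carrier (poly_ring n)" for \<beta>
      unfolding f_def by (intro poly_ring_closed u_set_poly_ring path_poly_carrier ac) (auto simp: switch_set_def)
    have "(poly_components Q a \<otimes>\<^bsub>\<H> Q\<^esub> poly_components Q b) \<alpha> \<gamma> =
        finsum (R_tilde n V \<eta> \<alpha> \<gamma>) (\<lambda>\<beta>. R_prod n V \<eta> \<alpha> \<beta> \<gamma> (poly_components Q a \<alpha> \<beta>) (poly_components Q b \<beta> \<gamma>)) Q"
      using True by (simp add: hypertoric_ring_def)
    also have "\<dots> = finsum (R_tilde n V \<eta> \<alpha> \<gamma>) (\<lambda>\<beta>. R_class n V \<eta> \<alpha> \<gamma> (f \<beta>)) Q"
    proof (rule R.finsum_cong_closed)
      fix \<beta> assume \<beta>: "\<beta> \<in> Q"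
      then have "poly_components Q a \<alpha> \<beta> = R_class n V \<eta> \<alpha> \<beta> (path_poly (sc \<alpha>) (sc \<beta>) a)"
        "poly_components Q b \<beta> \<gamma> = R_class n V \<eta> \<beta> \<gamma> (path_poly (sc \<beta>) (sc \<gamma>) b)"
        using True by (simp_all add: poly_components_def)
      moreover have "\<alpha> \<in> sign_vectors n" "\<beta> \<in> sign_vectors n" "\<gamma> \<in> sign_vectors n"
        using True \<beta> Q full_signsD(1) by blast+
      ultimately show "R_prod n V \<eta> \<alpha> \<beta> \<gamma> (poly_components Q a \<alpha> \<beta>) (poly_components Q b \<beta> \<gamma>) = R_class n V \<eta> \<alpha> \<gamma> (f \<beta>)"
        by (simp add: R_prod_class path_poly_carrier ac f_def)
    qed (rule R_class_closed[OF f])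
    also have "\<dots> = R_class n V \<eta> \<alpha> \<gamma> (\<Sum>\<beta>\<in>Q. f \<beta>)" by (rule R_class_sum[OF fin f])
    also have "(\<Sum>\<beta>\<in>Q. f \<beta>) = (\<Sum>\<beta>\<in>Q. u_set (odd_edges (sc \<alpha>) (sc \<beta>) \<inter> odd_edges (sc \<beta>) (sc \<gamma>))
        * path_poly (sc \<alpha>) (sc \<beta>) a * path_poly (sc \<beta>) (sc \<gamma>) b)"
      unfolding f_def
    proof (intro sum.cong refl)
      fix \<beta> assume "\<beta> \<in> Q"
      then have "switch_set n \<alpha> \<beta> \<gamma> = odd_edges (sc \<alpha>) (sc \<beta>) \<inter> odd_edges (sc \<beta>) (sc \<gamma>)"
        using True Q by (intro switch_set_eq) blast+
      then show "u_set (switch_set n \<alpha> \<beta> \<gamma>) * path_poly (sc \<alpha>) (sc \<beta>) a * path_poly (sc \<beta>) (sc \<gamma>) b =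
          u_set (odd_edges (sc \<alpha>) (sc \<beta>) \<inter> odd_edges (sc \<beta>) (sc \<gamma>)) * path_poly (sc \<alpha>) (sc \<beta>) a
            * path_poly (sc \<beta>) (sc \<gamma>) b" by simp
    qed
    also have "\<dots> = (\<Sum>y\<in>sc ` Q. u_set (odd_edges (sc \<alpha>) y \<inter> odd_edges y (sc \<gamma>))
        * path_poly (sc \<alpha>) y a * path_poly y (sc \<gamma>) b)"
      by (simp add: sum.reindex[OF inj_sc[OF Q]])
    also have "\<dots> = path_poly (sc \<alpha>) (sc \<gamma>) (path_sum_mult a b)"
      using fin by (intro path_poly_mult[symmetric] a b) simp
    finally show ?thesis using True by (simp add: poly_components_def)
  qed (auto simp: poly_components_def hypertoric_ring_def)
qed

lemma poly_components_one:
  assumes Q: "Q \<subseteq> full_signs"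
  shows "poly_components Q (idem_sum (sc ` Q)) = \<one>\<^bsub>\<H> Q\<^esub>"
proof (intro ext)
  fix \<alpha> \<beta>
  have fin: "finite Q" using finite_subset[OF Q finite_full_signs] .
  have ex: "exponent [] = 0" by (simp add: exponent_def)
  have "path_poly (sc \<alpha>) (sc \<beta>) (idem_sum (sc ` Q)) = (\<Sum>x\<in>sc ` Q. if x = sc \<alpha> \<and> x = sc \<beta> then 1 else 0)"
    unfolding idem_sum_def path_poly_sum by (intro sum.cong refl) (auto simp: path_poly_single ex)
  also have "\<dots> = (if \<alpha> = \<beta> then 1 else 0)" if "\<alpha> \<in> Q" "\<beta> \<in> Q"
  proof (cases "\<alpha> = \<beta>")
    case True
    have "(\<Sum>x\<in>sc ` Q. if x = sc \<alpha> \<and> x = sc \<beta> then 1 else 0) = (\<Sum>x\<in>sc ` Q. if x = sc \<alpha> then 1 else (0 :: mpoly_int))"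
      using True by simp
    also have "\<dots> = 1" using fin that by simp
    finally show ?thesis using True by simp
  next
    case False
    then have "sc \<alpha> \<noteq> sc \<beta>" using inj_sc[OF Q] that by (auto dest: inj_onD)
    then have "(\<Sum>x\<in>sc ` Q. if x = sc \<alpha> \<and> x = sc \<beta> then 1 else (0 :: mpoly_int)) = 0" by (intro sum.neutral) auto
    then show ?thesis using False by simp
  qed
  finally show "poly_components Q (idem_sum (sc ` Q)) \<alpha> \<beta> = \<one>\<^bsub>\<H> Q\<^esub> \<alpha> \<beta>"
    by (auto simp: poly_components_def hypertoric_ring_def R_class_0 R_class_1)
qed

text \<open>The condition on regions is symmetric, so Hall's condition for the odd edges holds at
  both ends and gives a path crossing exactly these, each once. Its exponent is zero; loops put in
  front contribute \<open>e\<close>.\<close>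

lemma exists_path_with_exponent:
  assumes \<alpha>: "\<alpha> \<in> full_signs" and \<beta>: "\<beta> \<in> full_signs" and e: "Poly_Mapping.keys e \<subseteq> {1..n}"
    and g: "good_exp n V \<eta> \<alpha> \<beta> e"
  shows "\<exists>w. pathw (sc \<alpha>) w \<and> run (sc \<alpha>) w = sc \<beta> \<and> exponent w = e"
proof -
  have "supported (sc \<alpha>) (odd_edges (sc \<alpha>) (sc \<beta>))"
    using good_exp_iff[OF \<alpha> \<beta> e] g by (auto intro: supported_mono)
  moreover have "supported (sc \<beta>) (odd_edges (sc \<alpha>) (sc \<beta>))"
    using good_exp_iff[OF \<beta> \<alpha> e] g good_exp_sym[of \<alpha> \<beta> e] odd_edges_sym[of "sc \<alpha>" "sc \<beta>"]
    by (auto intro: supported_mono)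
  ultimately obtain w where w: "pathw (sc \<alpha>) w" "moves_distinct w" "run (sc \<alpha>) w = sc \<beta>"
    using exists_distinct_path[OF full_signsD(5)[OF \<alpha>] full_signsD(5)[OF \<beta>]] by blast
  obtain us where us: "\<forall>a\<in>set us. is_U a" "\<And>i. weight us i = 2 * Poly_Mapping.lookup e i"
    using exists_U_word[of e] by blast
  have "edge ` set us \<subseteq> {1..n}"
  proof
    fix i assume "i \<in> edge ` set us"
    then have "i \<in> Poly_Mapping.keys e" using weight_pos_iff[of us i] us(2)[of i] by (simp add: in_keys_iff)
    then show "i \<in> {1..n}" using e by blast
  qed
  then have "pathw (sc \<alpha>) (us @ w)" "run (sc \<alpha>) (us @ w) = sc \<beta>"
    using pathw_U[OF us(1)] run_U[OF us(1)] w by simp_all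
  moreover have "exponent (us @ w) = e"
    by (rule poly_mapping_eqI) (simp add: lookup_exponent us(2) weight_distinct_moves[OF w(2)])
  ultimately show ?thesis by blast
qed

text \<open>Only the good monomials of each entry are lifted to paths. The others need not be
  realised by paths and do not affect the class.\<close>

lemma poly_components_surj:
  assumes Q: "Q \<subseteq> full_signs" and M: "M \<in> carrier (\<H> Q)"
  shows "\<exists>a\<in>between (sc ` Q). poly_components Q a = M"
proof -
  have fin: "finite Q" using finite_subset[OF Q finite_full_signs] .
  have "\<exists>p. p \<in> carrier (poly_ring n) \<and> M \<alpha> \<beta> = R_class n V \<eta> \<alpha> \<beta> p" if "\<alpha> \<in> Q" "\<beta> \<in> Q" for \<alpha> \<beta>
  proof -
    have "\<forall>\<alpha> \<beta>. if \<alpha> \<in> Q \<and> \<beta> \<in> Q then M \<alpha> \<beta> \<in> carrier (R_tilde n V \<eta> \<alpha> \<beta>) else M \<alpha> \<beta> = \<zero>\<^bsub>R_tilde n V \<eta> \<alpha> \<beta>\<^esub>"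
      using M by (simp add: hypertoric_ring_def)
    then have "M \<alpha> \<beta> \<in> carrier (R_tilde n V \<eta> \<alpha> \<beta>)" using that by metis
    then show ?thesis by (rule R_tilde_cases) blast
  qed
  then obtain P where P: "\<And>\<alpha> \<beta>. \<alpha> \<in> Q \<Longrightarrow> \<beta> \<in> Q \<Longrightarrow> P \<alpha> \<beta> \<in> carrier (poly_ring n) \<and> M \<alpha> \<beta> = R_class n V \<eta> \<alpha> \<beta> (P \<alpha> \<beta>)"
    by metis
  define E where "E \<alpha> \<beta> = {e \<in> Poly_Mapping.keys (P \<alpha> \<beta>). good_exp n V \<eta> \<alpha> \<beta> e}" for \<alpha> \<beta>
  have finE: "finite (E \<alpha> \<beta>)" for \<alpha> \<beta> by (simp add: E_def)
  have "\<exists>w. pathw (sc \<alpha>) w \<and> run (sc \<alpha>) w = sc \<beta> \<and> exponent w = e" if "\<alpha> \<in> Q" "\<beta> \<in> Q" "e \<in> E \<alpha> \<beta>" for \<alpha> \<beta> e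
  proof (rule exists_path_with_exponent)
    show "Poly_Mapping.keys e \<subseteq> {1..n}"
      using P[OF that(1,2)] that(3) unfolding poly_ring_carrier E_def by blast
  qed (use that Q in \<open>auto simp: E_def\<close>)
  then obtain w where w: "\<And>\<alpha> \<beta> e. \<alpha> \<in> Q \<Longrightarrow> \<beta> \<in> Q \<Longrightarrow> e \<in> E \<alpha> \<beta> \<Longrightarrow>
      pathw (sc \<alpha>) (w \<alpha> \<beta> e) \<and> run (sc \<alpha>) (w \<alpha> \<beta> e) = sc \<beta> \<and> exponent (w \<alpha> \<beta> e) = e"
    by metis
  define a where "a = (\<Sum>\<alpha>\<in>Q. \<Sum>\<beta>\<in>Q. \<Sum>e\<in>E \<alpha> \<beta>.
    Poly_Mapping.single (sc \<alpha>, w \<alpha> \<beta> e, sc \<beta>) (Poly_Mapping.lookup (P \<alpha> \<beta>) e))"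
  have X: "sc ` Q \<subseteq> verts n k" by (rule sc_image_subset[OF Q])
  have zero: "0 \<in> between (sc ` Q)" by (simp add: between_def path_algebra_def)
  have sum_between: "sum f A \<in> between (sc ` Q)" if "\<And>i. i \<in> A \<Longrightarrow> f i \<in> between (sc ` Q)" for f :: "'z \<Rightarrow> path_sum" and A
    using that by (induction A rule: infinite_finite_induct) (auto simp: zero between_closed(1)[OF _ _ X])
  have "Poly_Mapping.single (sc \<alpha>, w \<alpha> \<beta> e, sc \<beta>) c \<in> between (sc ` Q)"
    if "\<alpha> \<in> Q" "\<beta> \<in> Q" "e \<in> E \<alpha> \<beta>" for \<alpha> \<beta> e c
    using w[OF that] that full_signsD(5)[of \<alpha>] Q by (auto simp: between_def path_algebra_def is_path_iff)
  then have a: "a \<in> between (sc ` Q)" unfolding a_def by (intro sum_between)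
  have pp: "path_poly (sc \<alpha>) (sc \<beta>) a = (\<Sum>e\<in>E \<alpha> \<beta>. Poly_Mapping.single e (Poly_Mapping.lookup (P \<alpha> \<beta>) e))"
    if \<alpha>: "\<alpha> \<in> Q" and \<beta>: "\<beta> \<in> Q" for \<alpha> \<beta>
  proof -
    let ?s = "\<lambda>\<alpha>' \<beta>'. \<Sum>e\<in>E \<alpha>' \<beta>'. Poly_Mapping.single e (Poly_Mapping.lookup (P \<alpha>' \<beta>') e)"
    have eq: "sc \<alpha>' = sc \<beta>' \<longleftrightarrow> \<alpha>' = \<beta>'" if "\<alpha>' \<in> Q" "\<beta>' \<in> Q" for \<alpha>' \<beta>'
      using inj_sc[OF Q] that by (auto dest: inj_onD)
    have "path_poly (sc \<alpha>) (sc \<beta>) a = (\<Sum>\<alpha>'\<in>Q. \<Sum>\<beta>'\<in>Q. if \<alpha>' = \<alpha> then if \<beta>' = \<beta> then ?s \<alpha>' \<beta>' else 0 else 0)"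
      unfolding a_def path_poly_sum
    proof (intro sum.cong refl)
      fix \<alpha>' \<beta>' assume "\<alpha>' \<in> Q" "\<beta>' \<in> Q"
      then show "(\<Sum>e\<in>E \<alpha>' \<beta>'. path_poly (sc \<alpha>) (sc \<beta>) (Poly_Mapping.single (sc \<alpha>', w \<alpha>' \<beta>' e, sc \<beta>') (Poly_Mapping.lookup (P \<alpha>' \<beta>') e)))
          = (if \<alpha>' = \<alpha> then if \<beta>' = \<beta> then ?s \<alpha>' \<beta>' else 0 else 0)"
        using w eq[of \<alpha>' \<alpha>] eq[of \<beta>' \<beta>] \<alpha> \<beta> by (simp add: path_poly_single)
    qed
    also have "\<dots> = ?s \<alpha> \<beta>" using fin \<alpha> \<beta> by (simp add: sum.If_cases if_distrib[of "sum _"] cong: if_cong)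
    finally show ?thesis .
  qed
  have "poly_components Q a = M"
  proof (intro ext)
    fix \<alpha> \<beta>
    show "poly_components Q a \<alpha> \<beta> = M \<alpha> \<beta>"
    proof (cases "\<alpha> \<in> Q \<and> \<beta> \<in> Q")
      case True
      have ac: "a \<in> carrier (path_algebra n k)" using a by (simp add: between_def)
      have "R_class n V \<eta> \<alpha> \<beta> (path_poly (sc \<alpha>) (sc \<beta>) a) = R_class n V \<eta> \<alpha> \<beta> (P \<alpha> \<beta>)"
      proof (subst R_class_eq_iff[OF path_poly_carrier[OF ac]])
        show "P \<alpha> \<beta> \<in> carrier (poly_ring n)" using P True by blast
        show "\<forall>e. good_exp n V \<eta> \<alpha> \<beta> e \<longrightarrow>
            Poly_Mapping.lookup (path_poly (sc \<alpha>) (sc \<beta>) a) e = Poly_Mapping.lookup (P \<alpha> \<beta>) e"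
        proof (intro allI impI)
          fix e assume g: "good_exp n V \<eta> \<alpha> \<beta> e"
          have "Poly_Mapping.lookup (path_poly (sc \<alpha>) (sc \<beta>) a) e = (\<Sum>e'\<in>E \<alpha> \<beta>. if e' = e then Poly_Mapping.lookup (P \<alpha> \<beta>) e else 0)"
            unfolding pp[OF conjunct1[OF True] conjunct2[OF True]] lookup_sum
            by (intro sum.cong refl) (auto simp: lookup_single when_def)
          also have "\<dots> = (if e \<in> E \<alpha> \<beta> then Poly_Mapping.lookup (P \<alpha> \<beta>) e else 0)" using finE by simp
          also have "\<dots> = Poly_Mapping.lookup (P \<alpha> \<beta>) e" using g by (auto simp: E_def in_keys_iff)
          finally show "Poly_Mapping.lookup (path_poly (sc \<alpha>) (sc \<beta>) a) e = Poly_Mapping.lookup (P \<alpha> \<beta>) e" .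
        qed
      qed
      then show ?thesis using P True by (simp add: poly_components_def)
    next
      case False
      have "\<forall>\<alpha> \<beta>. if \<alpha> \<in> Q \<and> \<beta> \<in> Q then M \<alpha> \<beta> \<in> carrier (R_tilde n V \<eta> \<alpha> \<beta>) else M \<alpha> \<beta> = \<zero>\<^bsub>R_tilde n V \<eta> \<alpha> \<beta>\<^esub>"
        using M by (simp add: hypertoric_ring_def)
      then have "M \<alpha> \<beta> = \<zero>\<^bsub>R_tilde n V \<eta> \<alpha> \<beta>\<^esub>" using False by metis
      then show ?thesis using False by (auto simp: poly_components_def)
    qed
  qed
  then show ?thesis using a by blast
qed

abbreviation "\<C> Q \<equiv> corner (OSz n k) (OSz_class n k (idem_sum (sc ` Q)))"

text \<open>The representative may be any member of the coset, even one containing paths with other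
  endpoints, because \<open>poly_components Q\<close> is constant modulo the ideal. Restricting the
  domain makes the map extensional, as the description of \<Phi> demands.\<close>

definition iso_map :: "signs set \<Rightarrow> path_sum set \<Rightarrow> family" where
  "iso_map Q = (\<lambda>A\<in>carrier (\<C> Q). poly_components Q (SOME a. a \<in> A \<and> a \<in> carrier (path_algebra n k)))"

lemma iso_map_class:
  assumes Q: "Q \<subseteq> full_signs" and a: "a \<in> between (sc ` Q)"
  shows "iso_map Q (OSz_class n k a) = poly_components Q a"
proof -
  have ac: "a \<in> carrier (path_algebra n k)" using a by (simp add: between_def)
  define b where "b = (SOME b. b \<in> OSz_class n k a \<and> b \<in> carrier (path_algebra n k))"
  have b: "b \<in> OSz_class n k a" "b \<in> carrier (path_algebra n k)"
    using someI[of "\<lambda>b. b \<in> OSz_class n k a \<and> b \<in> carrier (path_algebra n k)" a] OSz_class_self[OF ac] ac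
    by (auto simp: b_def)
  obtain h where "h \<in> OSz_ideal n k" "b = h + a"
    using b(1) by (auto simp: OSz_class_def a_r_coset_def' path_algebra_ops)
  then have "poly_components Q b = poly_components Q a" using ac b(2) Q by (intro poly_components_cong) auto
  moreover have "OSz_class n k a \<in> carrier (\<C> Q)"
    using a corner_carrier[OF sc_image_subset[OF Q]] by blast
  ultimately show ?thesis by (simp add: iso_map_def b_def)
qed

theorem iso_map_iso:
  assumes Q: "Q \<subseteq> full_signs"
  shows "iso_map Q \<in> ring_iso (\<C> Q) (\<H> Q)"
proof -
  have X: "sc ` Q \<subseteq> verts n k" by (rule sc_image_subset[OF Q])
  note carr = corner_carrier[OF X]
  have bc: "a \<in> carrier (path_algebra n k)" if "a \<in> between (sc ` Q)" for a using that by (simp add: between_def)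
  show ?thesis
  proof (rule ring_iso_memI)
    fix A assume "A \<in> carrier (\<C> Q)"
    then obtain a where a: "a \<in> between (sc ` Q)" "A = OSz_class n k a" using carr by auto
    then show "iso_map Q A \<in> carrier (\<H> Q)" by (simp add: iso_map_class[OF Q] poly_components_closed bc)
    fix B assume "B \<in> carrier (\<C> Q)"
    then obtain b where b: "b \<in> between (sc ` Q)" "B = OSz_class n k b" using carr by auto
    have "A \<otimes>\<^bsub>\<C> Q\<^esub> B = OSz_class n k (path_sum_mult a b)"
      using Ring.ring_hom_mult[OF OSz_class_hom bc[OF a(1)] bc[OF b(1)]] a b by (simp add: corner_ops path_algebra_ops)
    then show "iso_map Q (A \<otimes>\<^bsub>\<C> Q\<^esub> B) = iso_map Q A \<otimes>\<^bsub>\<H> Q\<^esub> iso_map Q B"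
      using a b by (simp add: iso_map_class[OF Q] between_closed[OF _ _ X] poly_components_mult[OF Q])
    have "A \<oplus>\<^bsub>\<C> Q\<^esub> B = OSz_class n k (a + b)"
      using Ring.ring_hom_add[OF OSz_class_hom bc[OF a(1)] bc[OF b(1)]] a b by (simp add: corner_ops path_algebra_ops)
    then show "iso_map Q (A \<oplus>\<^bsub>\<C> Q\<^esub> B) = iso_map Q A \<oplus>\<^bsub>\<H> Q\<^esub> iso_map Q B"
      using a b by (simp add: iso_map_class[OF Q] between_closed[OF _ _ X] poly_components_add bc)
  next
    show "iso_map Q \<one>\<^bsub>\<C> Q\<^esub> = \<one>\<^bsub>\<H> Q\<^esub>"
      by (simp add: corner_ops iso_map_class[OF Q idem_sum_between[OF X]] poly_components_one[OF Q])
    show "bij_betw (iso_map Q) (carrier (\<C> Q)) (carrier (\<H> Q))"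
    proof (rule bij_betwI')
      fix A B assume "A \<in> carrier (\<C> Q)" "B \<in> carrier (\<C> Q)"
      then obtain a b where a: "a \<in> between (sc ` Q)" "A = OSz_class n k a"
        and b: "b \<in> between (sc ` Q)" "B = OSz_class n k b" using carr by auto
      have "iso_map Q A = iso_map Q B \<longleftrightarrow> poly_components Q a = poly_components Q b"
        by (simp add: a b iso_map_class[OF Q])
      also have "\<dots> \<longleftrightarrow> a - b \<in> OSz_ideal n k"
        using poly_components_inj[OF Q a(1) b(1)] poly_components_cong[OF Q bc[OF a(1)] bc[OF b(1)]] by blast
      also have "\<dots> \<longleftrightarrow> A = B" using OSz_class_eq_iff[OF bc[OF a(1)] bc[OF b(1)]] a b by simp
      finally show "iso_map Q A = iso_map Q B \<longleftrightarrow> A = B" .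
    next
      fix A assume "A \<in> carrier (\<C> Q)"
      then obtain a where a: "a \<in> between (sc ` Q)" "A = OSz_class n k a" using carr by auto
      then show "iso_map Q A \<in> carrier (\<H> Q)" by (simp add: iso_map_class[OF Q] poly_components_closed bc)
    next
      fix M assume "M \<in> carrier (\<H> Q)"
      then obtain a where "a \<in> between (sc ` Q)" "poly_components Q a = M" using poly_components_surj[OF Q] by blast
      then show "\<exists>A\<in>carrier (\<C> Q). M = iso_map Q A"
        using carr iso_map_class[OF Q] by (intro bexI[of _ "OSz_class n k a"]) auto
    qed
  qed
qed

end

context osz
begin

section \<open>Uniqueness and restriction\<close>

lemma between_mono: "X \<subseteq> Y \<Longrightarrow> between X \<subseteq> between Y"
  unfolding between_def by blast

lemma reduces_class:
  assumes "reduces x w w'" "x \<in> verts n k" "pathw x w"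
  shows "path_class n k (x, w, run x w) = path_class n k (x, w', run x w)"
proof -
  have "pathw x w'" "run x w' = run x w" "path1 x w - path1 x w' \<in> OSz_ideal n k"
    using assms by (auto simp: reduces_def)
  then show ?thesis
    using assms OSz_class_eq_iff[of "path1 x w" "path1 x w'"] path1_carrier[of x w] path1_carrier[of x w']
    by (simp add: path1_def)
qed

lemma path_class_zero:
  assumes "Poly_Mapping.single p 1 \<in> OSz_ideal n k" "is_path n k p"
  shows "path_class n k p = OSz_class n k 0"
proof -
  have "Poly_Mapping.single p (1::int) \<in> carrier (path_algebra n k)" "0 \<in> carrier (path_algebra n k)"
    using assms(2) by (simp_all add: path_algebra_def)
  then show ?thesis using OSz_class_eq_iff assms(1) by simp
qed

primrec path_in :: "vertex set \<Rightarrow> vertex \<Rightarrow> label list \<Rightarrow> bool" where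
  "path_in X x [] \<longleftrightarrow> x \<in> X"
| "path_in X x (a # w) \<longleftrightarrow> x \<in> X \<and> applicable x a \<and> path_in X (act x a) w"

lemma path_in_verts_l:
  assumes "x \<in> verts_l n k" "pathw x w" "\<forall>a\<in>set w. is_U a \<or> edge a \<noteq> n"
  shows "path_in (verts_l n k) x w"
  using assms by (induction w arbitrary: x) (auto simp: act_verts_l)

text \<open>Paths through vertices containing \<open>n\<close> need not be considered: up to the relations every path
  between vertices of \<open>\<B>\<^sub>l\<close> is zero or stays among them.\<close>

lemma path_class_verts_l:
  assumes x: "x \<in> verts_l n k" and p: "pathw x w" and y: "run x w \<in> verts_l n k"
  shows "path_class n k (x, w, run x w) = OSz_class n k 0 \<or>
    (\<exists>w'. path_in (verts_l n k) x w' \<and> run x w' = run x w \<and>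
      path_class n k (x, w, run x w) = path_class n k (x, w', run x w))"
proof (cases "supported x (edge ` set w)")
  case False
  have xv: "x \<in> verts n k" using x verts_l_subset by auto
  then have "path1 x w \<in> OSz_ideal n k" using zeroes_unsupported[OF False] p by (auto simp: zeroes_def)
  then show ?thesis using path_class_zero[of "(x, w, run x w)"] xv p by (simp add: path1_def is_path_iff)
next
  case True
  have xv: "x \<in> verts n k" using x verts_l_subset by auto
  obtain w' us where w': "reduces x w (w' @ us)" "moves_distinct w'" "\<forall>a\<in>set us. is_U a"
    by (rule normal_form_supported[OF xv p True])
  have pw: "pathw x (w' @ us)" "run x (w' @ us) = run x w" using w'(1) xv p unfolding reduces_def by simp_all
  then have pw': "pathw x w'" "run x w' \<in> verts_l n k" using run_U[OF w'(3)] y by simp_all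
  have "n \<notin> edge ` set w'" by (rule distinct_path_last_edge[OF x pw'(2,1) w'(2)])
  then have "\<forall>a\<in>set (w' @ us). is_U a \<or> edge a \<noteq> n" using w'(3) by (metis Un_iff imageI set_append)
  then have "path_in (verts_l n k) x (w' @ us)" by (rule path_in_verts_l[OF x pw(1)])
  then show ?thesis using reduces_class[OF w'(1) xv p] pw(2) by blast
qed

lemma OSz_class_single_mult:
  assumes "is_path n k (x, v, y)" "is_path n k (y, w, z)"
  shows "path_class n k (x, v @ w, z) = path_class n k (x, v, y) \<otimes>\<^bsub>OSz n k\<^esub> path_class n k (y, w, z)"
  using Ring.ring_hom_mult[OF OSz_class_hom, of "Poly_Mapping.single (x, v, y) 1" "Poly_Mapping.single (y, w, z) 1"] assms
  by (simp add: path_algebra_ops path_sum_mult_single path_comp_def) (simp add: path_algebra_def)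

text \<open>The reason is that \<open>\<B>\<^sub>l\<close> is generated by the arrows between its vertices.\<close>

lemma OSz_l_hom_unique:
  assumes S: "ring S"
    and f: "f \<in> Ring.ring_hom (OSz_l n k) S" and g: "g \<in> Ring.ring_hom (OSz_l n k) S"
    and idem: "\<And>x. x \<in> verts_l n k \<Longrightarrow> f (path_class n k (x, [], x)) = g (path_class n k (x, [], x))"
    and arr: "\<And>x a. x \<in> verts_l n k \<Longrightarrow> applicable x a \<Longrightarrow> act x a \<in> verts_l n k \<Longrightarrow>
      f (path_class n k (x, [a], act x a)) = g (path_class n k (x, [a], act x a))"
    and A: "A \<in> carrier (OSz_l n k)"
  shows "f A = g A"
proof -
  let ?X = "verts_l n k"
  have X: "?X \<subseteq> verts n k" by (rule verts_l_subset)
  have ring_l: "ring (OSz_l n k)" unfolding OSz_l_def by (rule ring_OSz_corner[OF X])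
  interpret F: ring_hom_ring "OSz_l n k" S f by (rule ring_hom_ringI2[OF ring_l S f])
  interpret G: ring_hom_ring "OSz_l n k" S g by (rule ring_hom_ringI2[OF ring_l S g])
  have carr: "carrier (OSz_l n k) = OSz_class n k ` between ?X" unfolding OSz_l_def by (rule corner_carrier[OF X])
  have ops: "monoid.mult (OSz_l n k) = monoid.mult (OSz n k)" "ring.add (OSz_l n k) = ring.add (OSz n k)"
    "ring.zero (OSz_l n k) = \<zero>\<^bsub>OSz n k\<^esub>" unfolding OSz_l_def by (simp_all add: corner_ops)
  have bc: "a \<in> carrier (path_algebra n k)" if "a \<in> between ?X" for a using that by (simp add: between_def)
  have add: "OSz_class n k (a + b) = OSz_class n k a \<oplus>\<^bsub>OSz_l n k\<^esub> OSz_class n k b"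
    if "a \<in> between ?X" "b \<in> between ?X" for a b
    using Ring.ring_hom_add[OF OSz_class_hom bc[OF that(1)] bc[OF that(2)]] by (simp add: ops path_algebra_ops)
  have zero: "OSz_class n k 0 = \<zero>\<^bsub>OSz_l n k\<^esub>"
    using Ring.ring_hom_zero[OF OSz_class_hom ring_path_algebra ring_OSz] by (simp add: ops path_algebra_ops)
  have zb: "0 \<in> between ?X" by (simp add: between_def path_algebra_def)
  define H where "H = {a \<in> between ?X. f (OSz_class n k a) = g (OSz_class n k a)}"
  have H_carr: "OSz_class n k a \<in> carrier (OSz_l n k)" if "a \<in> between ?X" for a using that carr by blast
  have H0: "0 \<in> H" using zb zero by (simp add: H_def)
  have H_add: "a + b \<in> H" if "a \<in> H" "b \<in> H" for a b
    using that H_carr between_closed(1)[OF _ _ X] by (simp add: H_def add)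
  have H_neg: "- a \<in> H" if a: "a \<in> H" for a
  proof -
    have b: "a \<in> between ?X" "- a \<in> between ?X" using a between_closed(3)[OF _ _ X] by (auto simp: H_def)
    have "OSz_class n k (- a) \<oplus>\<^bsub>OSz_l n k\<^esub> OSz_class n k a = \<zero>\<^bsub>OSz_l n k\<^esub>"
      using add[OF b(2,1)] zero by simp
    then have "OSz_class n k (- a) = \<ominus>\<^bsub>OSz_l n k\<^esub> OSz_class n k a"
      using F.R.minus_equality H_carr b by metis
    then show ?thesis using a b H_carr[OF b(1)] by (simp add: H_def)
  qed
  have word: "f (path_class n k (x, w, run x w)) = g (path_class n k (x, w, run x w))"
    if "path_in ?X x w" for x w
    using that
  proof (induction w arbitrary: x)
    case Nil
    then show ?case using idem by simp
  next
    case (Cons a w)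
    have pw: "pathw (act x a) w" "run (act x a) w \<in> ?X" "act x a \<in> ?X"
    proof -
      have "pathw z w \<and> run z w \<in> ?X \<and> z \<in> ?X" if "path_in ?X z w" for z
        using that by (induction w arbitrary: z) auto
      then show "pathw (act x a) w" "run (act x a) w \<in> ?X" "act x a \<in> ?X" using Cons.prems by auto
    qed
    have xX: "x \<in> ?X" "applicable x a" using Cons.prems by auto
    have paths: "is_path n k (x, [a], act x a)" "is_path n k (act x a, w, run (act x a) w)"
      unfolding is_path_iff using xX pw subsetD[OF X xX(1)] subsetD[OF X pw(3)] by simp_all
    have "Poly_Mapping.single (x, [a], act x a) (1::int) \<in> between ?X"
      "Poly_Mapping.single (act x a, w, run (act x a) w) (1::int) \<in> between ?X"
      using paths pw xX by (simp_all add: between_def path_algebra_def)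
    note c = this[THEN H_carr]
    have "path_class n k (x, a # w, run x (a # w)) = path_class n k (x, [a], act x a) \<otimes>\<^bsub>OSz_l n k\<^esub>
        path_class n k (act x a, w, run (act x a) w)"
      using OSz_class_single_mult[OF paths] by (simp add: ops)
    moreover have "f (path_class n k (act x a, w, run (act x a) w)) = g (path_class n k (act x a, w, run (act x a) w))"
      using Cons by simp
    ultimately show ?case using F.hom_mult[OF c] G.hom_mult[OF c] arr[OF xX pw(3)] by simp
  qed
  have one: "Poly_Mapping.single (x, w, y) 1 \<in> H" if p: "is_path n k (x, w, y)" and xy: "x \<in> ?X" "y \<in> ?X" for x w y
  proof -
    have b: "Poly_Mapping.single (x, w, y) (1::int) \<in> between ?X" using p xy by (simp add: between_def path_algebra_def)
    have pw: "pathw x w" "run x w = y" using p unfolding is_path_iff by simp_all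
    have "run x w \<in> ?X" using xy(2) pw(2) by simp
    from path_class_verts_l[OF xy(1) pw(1) this]
    have "f (path_class n k (x, w, y)) = g (path_class n k (x, w, y))"
    proof
      assume "path_class n k (x, w, run x w) = OSz_class n k 0"
      then show ?thesis unfolding pw(2) by (simp only: zero F.hom_zero G.hom_zero)
    next
      assume "\<exists>w'. path_in ?X x w' \<and> run x w' = run x w \<and>
        path_class n k (x, w, run x w) = path_class n k (x, w', run x w)"
      then obtain w' where w': "path_in ?X x w'" "run x w' = y" "path_class n k (x, w, y) = path_class n k (x, w', y)"
        unfolding pw(2) by blast
      show ?thesis using word[OF w'(1)] unfolding w'(2,3) .
    qed
    then show ?thesis using b by (simp add: H_def)
  qed
  \<comment> \<open>Ring homomorphisms respect addition and negation, so integer coefficients are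
    reached from coefficient one in steps of one.\<close>
  have scaled: "Poly_Mapping.single (x, w, y) c \<in> H" if p: "is_path n k (x, w, y)" "x \<in> ?X" "y \<in> ?X" for x w y c
  proof (induction c rule: int_induct[where k = 0])
    case base
    show ?case using H0 by simp
  next
    case (step1 i)
    then show ?case using H_add[OF step1(2) one[OF p]] by (simp add: single_add)
  next
    case (step2 i)
    then show ?case using H_add[OF step2(2) H_neg[OF one[OF p]]] by (simp add: single_diff)
  qed
  obtain a where a: "a \<in> between ?X" "A = OSz_class n k a" using A carr by auto
  have "(\<Sum>p\<in>B. Poly_Mapping.single p (Poly_Mapping.lookup a p)) \<in> H" if "B \<subseteq> Poly_Mapping.keys a" for B
    using that
  proof (induction B rule: infinite_finite_induct)
    case (insert p B)
    obtain x w y where p: "p = (x, w, y)" by (metis prod.exhaust)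
    have "is_path n k (x, w, y)" "x \<in> ?X" "y \<in> ?X" using a(1) insert.prems by (auto simp: between_def path_algebra_def p)
    then have "Poly_Mapping.single p (Poly_Mapping.lookup a p) \<in> H" unfolding p by (rule scaled)
    then show ?case using insert H_add by simp
  qed (simp_all add: H0)
  from this[OF order_refl] have "a \<in> H" by (simp flip: poly_mapping_expand)
  then show ?thesis using a by (simp add: H_def)
qed

end

context cyclic
begin

lemma sc_full_image: "sc ` full_signs = verts_l n k"
  using bij_sc by (simp add: bij_betw_def)

lemma corner_full: "\<C> full_signs = OSz_l n k"
  by (simp add: sc_full_image OSz_l_def)

text \<open>No change at \<open>0\<close> means that the first sign is \<open>+\<close>; by
  \<open>compact_feasible_eq\<close> this is \<K>.\<close>

definition inner_signs :: "signs set" where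
  "inner_signs = {\<alpha> \<in> full_signs. 0 \<notin> sc \<alpha>}"

lemma sc_inner_image: "sc ` inner_signs = verts' n k"
proof -
  have "sc ` inner_signs = {x \<in> sc ` full_signs. 0 \<notin> x}" by (auto simp: inner_signs_def)
  also have "\<dots> = verts' n k"
    unfolding sc_full_image verts_l_def verts'_def by (auto simp: subset_iff Suc_le_eq) (metis gr0I)+
  finally show ?thesis .
qed

lemma corner_inner: "\<C> inner_signs = OSz' n k"
  by (simp add: sc_inner_image OSz'_def)

lemma B_tilde_full: "left_cyclic n k V \<eta> \<xi> \<Longrightarrow> B_tilde n V \<eta> \<xi> = \<H> full_signs"
  by (simp add: B_tilde_def bounded_feasible_eq full_signs_def)

lemma B_tilde'_inner: "B_tilde' n V \<eta> = \<H> inner_signs"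
proof -
  have "compact_feasible n V \<eta> = inner_signs"
    unfolding compact_feasible_eq inner_signs_def full_signs_def by auto
  then show ?thesis by (simp add: B_tilde'_def)
qed

lemma signs_of_eq:
  assumes "left_cyclic n k V \<eta> \<xi>"
  shows "signs_of n V \<eta> \<xi> = inv_into full_signs sc"
  by (simp add: signs_of_def bounded_feasible_eq[OF assms] full_signs_def)

lemma sc_inv: "x \<in> verts_l n k \<Longrightarrow> inv_into full_signs sc x \<in> full_signs \<and> sc (inv_into full_signs sc x) = x"
  using sc_full_image inv_into_into[of x sc full_signs] f_inv_into_f[of x sc full_signs] by simp

lemma iso_map_single:
  assumes x: "x \<in> verts_l n k" and y: "y \<in> verts_l n k" and p: "is_path n k (x, w, y)"
  shows "iso_map full_signs (path_class n k (x, w, y)) =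
    poly_f n V \<eta> (Poly_Mapping.single (exponent w) 1) (inv_into full_signs sc x) (inv_into full_signs sc y)"
proof -
  have "Poly_Mapping.single (x, w, y) (1::int) \<in> between (sc ` full_signs)"
    using x y p by (simp add: sc_full_image between_def path_algebra_def)
  then have "iso_map full_signs (path_class n k (x, w, y)) = poly_components full_signs (Poly_Mapping.single (x, w, y) 1)"
    by (rule iso_map_class[OF order_refl])
  also have "\<dots> = poly_f n V \<eta> (Poly_Mapping.single (exponent w) 1) (inv_into full_signs sc x) (inv_into full_signs sc y)"
  proof (intro ext)
    fix \<alpha> \<beta>
    have "sc \<alpha> = x \<longleftrightarrow> \<alpha> = inv_into full_signs sc x" if "\<alpha> \<in> full_signs"
      using that sc_inv[OF x] inj_sc[OF order_refl] by (metis inv_into_f_f)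
    moreover have "sc \<beta> = y \<longleftrightarrow> \<beta> = inv_into full_signs sc y" if "\<beta> \<in> full_signs"
      using that sc_inv[OF y] inj_sc[OF order_refl] by (metis inv_into_f_f)
    ultimately show "poly_components full_signs (Poly_Mapping.single (x, w, y) 1) \<alpha> \<beta> =
        poly_f n V \<eta> (Poly_Mapping.single (exponent w) 1) (inv_into full_signs sc x) (inv_into full_signs sc y) \<alpha> \<beta>"
      using sc_inv[OF x] sc_inv[OF y]
      by (auto simp: poly_components_def poly_f_def path_poly_single R_class_0)
  qed
  finally show ?thesis .
qed

lemma is_Phi_iso_map:
  assumes lc: "left_cyclic n k V \<eta> \<xi>"
  shows "is_Phi n k V \<eta> \<xi> (iso_map full_signs)"
proof -
  have ex: "exponent [] = 0" "exponent [ArrR i] = 0" "exponent [ArrL i] = 0" "exponent [ArrU i] = Poly_Mapping.single i 1" for i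
    by (simp_all add: exponent_def)
  have one: "Poly_Mapping.single 0 1 = (1 :: mpoly_int)" by (simp add: single_one)
  have iso: "iso_map full_signs \<in> ring_iso (OSz_l n k) (B_tilde n V \<eta> \<xi>)"
    using iso_map_iso[OF order_refl] by (simp add: corner_full B_tilde_full[OF lc])
  have vl: "x \<in> verts n k" if "x \<in> verts_l n k" for x using that verts_l_subset by auto
  show ?thesis
    unfolding is_Phi_def signs_of_eq[OF lc]
  proof (intro conjI ballI allI impI iso)
    fix x assume x: "x \<in> verts_l n k"
    then show "iso_map full_signs (path_class n k (x, [], x)) =
        f_elem n V \<eta> (inv_into full_signs sc x) (inv_into full_signs sc x)"
      using iso_map_single[OF x x, of "[]"] vl by (simp add: ex one)
  next
    fix x y i a assume x: "x \<in> verts_l n k" and y: "y \<in> verts_l n k" and a: "a \<in> {ArrR i, ArrL i}" "arrow n k x a y"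
    have "is_path n k (x, [a], y)" using a(2) unfolding is_path_iff arrow_iff by simp
    from iso_map_single[OF x y this]
    show "iso_map full_signs (path_class n k (x, [a], y)) =
        f_elem n V \<eta> (inv_into full_signs sc x) (inv_into full_signs sc y)"
      using a(1) by (auto simp: ex one)
  next
    fix x i assume x: "x \<in> verts_l n k" and i: "i \<in> {1..n}"
    then have "is_path n k (x, [ArrU i], x)" using vl[OF x] unfolding is_path_iff by (simp add: applicable_def act_def)
    from iso_map_single[OF x x this]
    show "iso_map full_signs (path_class n k (x, [ArrU i], x)) =
        poly_f n V \<eta> (u_var i) (inv_into full_signs sc x) (inv_into full_signs sc x)"
      by (simp add: ex u_var_def)
  qed
qed

text \<open>The ring axioms are transported along \<open>iso_map Q\<close> from the corner, which
  avoids verifying associativity for the product of families. The transported structure has the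
  image of zero as its zero, so that image has to be identified.\<close>

lemma ring_hypertoric:
  assumes "Q \<subseteq> full_signs"
  shows "ring (\<H> Q)"
proof -
  have "ring (\<H> Q \<lparr>zero := iso_map Q \<zero>\<^bsub>\<C> Q\<^esub>\<rparr>)"
    by (rule ring.ring_iso_imp_img_ring[OF ring_OSz_corner[OF sc_image_subset[OF assms]] iso_map_iso[OF assms]])
  moreover have "iso_map Q \<zero>\<^bsub>\<C> Q\<^esub> = \<zero>\<^bsub>\<H> Q\<^esub>"
  proof -
    have "\<zero>\<^bsub>\<C> Q\<^esub> = OSz_class n k 0"
      using Ring.ring_hom_zero[OF OSz_class_hom ring_path_algebra ring_OSz] by (simp add: corner_ops path_algebra_ops)
    moreover have "0 \<in> between (sc ` Q)" by (simp add: between_def path_algebra_def)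
    ultimately have "iso_map Q \<zero>\<^bsub>\<C> Q\<^esub> = poly_components Q 0" by (simp add: iso_map_class[OF assms])
    also have "\<dots> = \<zero>\<^bsub>\<H> Q\<^esub>" by (intro ext) (simp add: poly_components_def hypertoric_ring_def R_class_0)
    finally show ?thesis .
  qed
  ultimately show ?thesis by (simp add: hypertoric_ring_def)
qed

lemma is_Phi_unique:
  assumes lc: "left_cyclic n k V \<eta> \<xi>"
    and \<phi>: "is_Phi n k V \<eta> \<xi> \<phi>" "\<phi> \<in> extensional (carrier (OSz_l n k))"
  shows "\<phi> = iso_map full_signs"
proof (rule extensionalityI[OF \<phi>(2)])
  show "iso_map full_signs \<in> extensional (carrier (OSz_l n k))" by (simp add: iso_map_def corner_full)
  fix A assume A: "A \<in> carrier (OSz_l n k)"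
  have \<psi>: "is_Phi n k V \<eta> \<xi> (iso_map full_signs)" by (rule is_Phi_iso_map[OF lc])
  have homs: "\<phi> \<in> Ring.ring_hom (OSz_l n k) (\<H> full_signs)" "iso_map full_signs \<in> Ring.ring_hom (OSz_l n k) (\<H> full_signs)"
    using \<phi>(1) \<psi> by (auto simp: is_Phi_def ring_iso_def B_tilde_full[OF lc])
  show "\<phi> A = iso_map full_signs A"
  proof (rule OSz_l_hom_unique[OF ring_hypertoric[OF order_refl] homs _ _ A])
    fix x assume "x \<in> verts_l n k"
    then show "\<phi> (path_class n k (x, [], x)) = iso_map full_signs (path_class n k (x, [], x))"
      using \<phi>(1) \<psi> unfolding is_Phi_def by metis
  next
    fix x a assume x: "x \<in> verts_l n k" "applicable x a" "act x a \<in> verts_l n k"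
    then have arrow: "arrow n k x a (act x a)" using verts_l_subset by (auto simp: arrow_iff)
    show "\<phi> (path_class n k (x, [a], act x a)) = iso_map full_signs (path_class n k (x, [a], act x a))"
    proof (cases "is_U a")
      case True
      then have a: "a = ArrU (edge a)" "act x a = x" "edge a \<in> {1..n}"
        using U_eq x(2) by (auto simp: act_def applicable_def)
      have "\<phi> (path_class n k (x, [ArrU (edge a)], x)) = iso_map full_signs (path_class n k (x, [ArrU (edge a)], x))"
        using \<phi>(1) \<psi> x(1) a(3) unfolding is_Phi_def by metis
      then show ?thesis using a by metis
    next
      case False
      then have "a \<in> {ArrR (edge a), ArrL (edge a)}" by (cases a) auto
      then show ?thesis using \<phi>(1) \<psi> x(1,3) arrow unfolding is_Phi_def by metis
    qed
  qed
qed

text \<open>The right-hand side does not involve \<xi>; the independence of \<Phi> and \<Psi> from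
  \<xi> is read off from here.\<close>

lemma Phi_eq:
  assumes "left_cyclic n k V \<eta> \<xi>"
  shows "Phi n k V \<eta> \<xi> = iso_map full_signs"
  unfolding Phi_def
proof (rule the_equality)
  show "iso_map full_signs \<in> extensional (carrier (OSz_l n k)) \<and> is_Phi n k V \<eta> \<xi> (iso_map full_signs)"
    using is_Phi_iso_map[OF assms] by (simp add: iso_map_def corner_full)
qed (use is_Phi_unique[OF assms] in blast)

lemma inner_subset: "inner_signs \<subseteq> full_signs"
  by (auto simp: inner_signs_def)

text \<open>For a sum of paths between vertices without \<open>0\<close>, the path polynomial
  vanishes at every pair of sign vectors one of which starts with \<open>-\<close>. The two families
  therefore agree at all indices, and restricting \<Phi> gives the isomorphism already constructed
  for \<K>.\<close>

lemma iso_map_restrict: "restrict (iso_map full_signs) (carrier (OSz' n k)) = iso_map inner_signs"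
proof (rule extensionalityI[of _ "carrier (OSz' n k)"])
  show "iso_map inner_signs \<in> extensional (carrier (OSz' n k))" by (simp add: iso_map_def corner_inner)
  fix A assume "A \<in> carrier (OSz' n k)"
  then obtain a where a: "a \<in> between (sc ` inner_signs)" "A = OSz_class n k a"
    using corner_carrier[OF sc_image_subset[OF inner_subset]] by (auto simp: corner_inner)
  then have a': "a \<in> between (sc ` full_signs)" using between_mono[OF image_mono[OF inner_subset]] by blast
  have "poly_components full_signs a = poly_components inner_signs a"
  proof (intro ext)
    fix \<alpha> \<beta>
    show "poly_components full_signs a \<alpha> \<beta> = poly_components inner_signs a \<alpha> \<beta>"
    proof (cases "\<alpha> \<in> inner_signs \<and> \<beta> \<in> inner_signs")
      case True
      then show ?thesis using inner_subset by (auto simp: poly_components_def)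
    next
      case out: False
      have "path_poly (sc \<alpha>) (sc \<beta>) a = 0" if full: "\<alpha> \<in> full_signs" "\<beta> \<in> full_signs"
        unfolding path_poly_def
      proof (rule sum.neutral, intro ballI)
        fix p assume "p \<in> Poly_Mapping.keys a"
        then have "fst p \<in> sc ` inner_signs" "snd (snd p) \<in> sc ` inner_signs" using a(1) by (auto simp: between_def)
        then have "0 \<notin> fst p" "0 \<notin> snd (snd p)" by (auto simp: inner_signs_def)
        moreover have "0 \<in> sc \<alpha> \<or> 0 \<in> sc \<beta>" using out full by (auto simp: inner_signs_def)
        ultimately show "(if fst p = sc \<alpha> \<and> snd (snd p) = sc \<beta>
            then Poly_Mapping.single (exponent (fst (snd p))) (Poly_Mapping.lookup a p) else 0) = 0" by auto
      qed
      then show ?thesis using out by (auto simp: poly_components_def R_class_0)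
    qed
  qed
  then show "restrict (iso_map full_signs) (carrier (OSz' n k)) A = iso_map inner_signs A"
    using \<open>A \<in> carrier (OSz' n k)\<close> iso_map_class[OF order_refl a'] iso_map_class[OF inner_subset a(1)] a(2) by simp
qed simp

lemma OSz'_carrier_subset: "carrier (OSz' n k) \<subseteq> carrier (OSz_l n k)"
proof -
  have "between (sc ` inner_signs) \<subseteq> between (sc ` full_signs)"
    by (rule between_mono[OF image_mono[OF inner_subset]])
  then show ?thesis
    using corner_carrier[OF sc_image_subset[OF inner_subset]] corner_carrier[OF sc_image_subset[OF order_refl]]
    by (auto simp: corner_inner corner_full)
qed

lemma hypertoric_carrier_mono: "carrier (\<H> inner_signs) \<subseteq> carrier (\<H> full_signs)"
proof
  fix M assume M: "M \<in> carrier (\<H> inner_signs)"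
  have zero: "\<zero>\<^bsub>R_tilde n V \<eta> \<alpha> \<beta>\<^esub> \<in> carrier (R_tilde n V \<eta> \<alpha> \<beta>)" for \<alpha> \<beta>
    using R_class_closed[of 0 n V \<eta> \<alpha> \<beta>] by (simp add: R_class_0 poly_ring_0_1)
  have M': "if \<alpha> \<in> inner_signs \<and> \<beta> \<in> inner_signs then M \<alpha> \<beta> \<in> carrier (R_tilde n V \<eta> \<alpha> \<beta>)
      else M \<alpha> \<beta> = \<zero>\<^bsub>R_tilde n V \<eta> \<alpha> \<beta>\<^esub>" for \<alpha> \<beta> using M by (simp add: hypertoric_ring_def)
  have "if \<alpha> \<in> full_signs \<and> \<beta> \<in> full_signs then M \<alpha> \<beta> \<in> carrier (R_tilde n V \<eta> \<alpha> \<beta>)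
      else M \<alpha> \<beta> = \<zero>\<^bsub>R_tilde n V \<eta> \<alpha> \<beta>\<^esub>" for \<alpha> \<beta>
    using M'[of \<alpha> \<beta>] zero[of \<alpha> \<beta>] inner_subset by (auto split: if_splits)
  then show "M \<in> carrier (\<H> full_signs)" by (simp add: hypertoric_ring_def)
qed

text \<open>The inverse of the restricted map is the restriction of the inverse: an element of
  \<open>B_tilde'\<close> has a preimage in the smaller corner, and injectivity on the larger one
  makes it the only preimage there.\<close>

lemma Psi_restrict:
  assumes lc: "left_cyclic n k V \<eta> \<xi>"
  shows "restrict (Psi n k V \<eta> \<xi>) (carrier (B_tilde' n V \<eta>)) \<in> ring_iso (B_tilde' n V \<eta>) (OSz' n k)"
    and "b \<in> carrier (OSz_l n k) \<Longrightarrow> Psi n k V \<eta> \<xi> (Phi n k V \<eta> \<xi> b) = b"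
    and "m \<in> carrier (B_tilde n V \<eta> \<xi>) \<Longrightarrow> Phi n k V \<eta> \<xi> (Psi n k V \<eta> \<xi> m) = m"
proof -
  let ?\<Phi> = "iso_map full_signs" and ?\<Phi>' = "iso_map inner_signs"
  have bij: "bij_betw ?\<Phi> (carrier (OSz_l n k)) (carrier (\<H> full_signs))"
    using iso_map_iso[OF order_refl] by (simp add: ring_iso_def corner_full)
  have bij': "bij_betw ?\<Phi>' (carrier (OSz' n k)) (carrier (\<H> inner_signs))"
    using iso_map_iso[OF inner_subset] by (simp add: ring_iso_def corner_inner)
  have Psi: "Psi n k V \<eta> \<xi> = inv_into (carrier (OSz_l n k)) ?\<Phi>" by (simp add: Psi_def Phi_eq[OF lc])
  show "b \<in> carrier (OSz_l n k) \<Longrightarrow> Psi n k V \<eta> \<xi> (Phi n k V \<eta> \<xi> b) = b"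
    using bij by (simp add: Psi Phi_eq[OF lc] bij_betw_def)
  show "m \<in> carrier (B_tilde n V \<eta> \<xi>) \<Longrightarrow> Phi n k V \<eta> \<xi> (Psi n k V \<eta> \<xi> m) = m"
    using bij by (simp add: Psi Phi_eq[OF lc] bij_betw_def f_inv_into_f B_tilde_full[OF lc])
  have ring': "ring (OSz' n k)"
    using ring_OSz_corner[OF sc_image_subset[OF inner_subset]] by (simp add: corner_inner)
  have inv_iso: "inv_into (carrier (OSz' n k)) ?\<Phi>' \<in> ring_iso (\<H> inner_signs) (OSz' n k)"
    using ring_iso_set_sym[OF ring', of ?\<Phi>'] iso_map_iso[OF inner_subset] by (simp add: corner_inner)
  have agree: "inv_into (carrier (OSz' n k)) ?\<Phi>' m = restrict (Psi n k V \<eta> \<xi>) (carrier (\<H> inner_signs)) m"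
    if m: "m \<in> carrier (\<H> inner_signs)" for m
  proof -
    let ?b = "inv_into (carrier (OSz' n k)) ?\<Phi>' m"
    have b: "?b \<in> carrier (OSz' n k)" "?\<Phi>' ?b = m"
      using bij' m by (auto simp: bij_betw_def inv_into_into f_inv_into_f)
    then have "?\<Phi> ?b = m" using fun_cong[OF iso_map_restrict, of ?b] by simp
    then have "Psi n k V \<eta> \<xi> m = ?b"
      unfolding Psi using inv_into_f_f[OF bij_betw_imp_inj_on[OF bij] subsetD[OF OSz'_carrier_subset b(1)]] by simp
    then show ?thesis using m by simp
  qed
  show "restrict (Psi n k V \<eta> \<xi>) (carrier (B_tilde' n V \<eta>)) \<in> ring_iso (B_tilde' n V \<eta>) (OSz' n k)"
    unfolding B_tilde'_inner
    by (rule ring.ring_iso_restrict[OF ring_hypertoric[OF inner_subset] inv_iso agree])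
qed

lemma Phi_restrict:
  assumes lc: "left_cyclic n k V \<eta> \<xi>"
  shows "restrict (Phi n k V \<eta> \<xi>) (carrier (OSz' n k)) \<in> ring_iso (OSz' n k) (B_tilde' n V \<eta>)"
  using iso_map_iso[OF inner_subset] by (simp add: Phi_eq[OF lc] iso_map_restrict corner_inner B_tilde'_inner)

end

theorem corollary4p10:
  fixes n k :: nat and V :: "(nat \<Rightarrow> real) set" and \<eta> :: "nat \<Rightarrow> real"
  assumes "cyclic_arrangement n k V \<eta>"
  shows
    "(\<forall>\<xi>. left_cyclic n k V \<eta> \<xi> \<longrightarrow>
        is_Phi n k V \<eta> \<xi> (Phi n k V \<eta> \<xi>) \<and>
        carrier (OSz' n k) \<subseteq> carrier (OSz_l n k) \<and>
        carrier (B_tilde' n V \<eta>) \<subseteq> carrier (B_tilde n V \<eta> \<xi>) \<and>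
        restrict (Phi n k V \<eta> \<xi>) (carrier (OSz' n k)) \<in> ring_iso (OSz' n k) (B_tilde' n V \<eta>) \<and>
        restrict (Psi n k V \<eta> \<xi>) (carrier (B_tilde' n V \<eta>)) \<in> ring_iso (B_tilde' n V \<eta>) (OSz' n k) \<and>
        (\<forall>b \<in> carrier (OSz' n k). Psi n k V \<eta> \<xi> (Phi n k V \<eta> \<xi> b) = b) \<and>
        (\<forall>m \<in> carrier (B_tilde' n V \<eta>). Phi n k V \<eta> \<xi> (Psi n k V \<eta> \<xi> m) = m)) \<and>
     (\<forall>\<xi> \<xi>'. left_cyclic n k V \<eta> \<xi> \<and> left_cyclic n k V \<eta> \<xi>' \<longrightarrow>
        restrict (Phi n k V \<eta> \<xi>) (carrier (OSz' n k)) =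
          restrict (Phi n k V \<eta> \<xi>') (carrier (OSz' n k)) \<and>
        restrict (Psi n k V \<eta> \<xi>) (carrier (B_tilde' n V \<eta>)) =
          restrict (Psi n k V \<eta> \<xi>') (carrier (B_tilde' n V \<eta>)))"
proof -
  interpret cyclic n k V \<eta> by unfold_locales (rule assms)
  have sub: "carrier (B_tilde' n V \<eta>) \<subseteq> carrier (B_tilde n V \<eta> \<xi>)" if "left_cyclic n k V \<eta> \<xi>" for \<xi>
    using hypertoric_carrier_mono by (simp add: B_tilde'_inner B_tilde_full[OF that])
  have is_Phi: "is_Phi n k V \<eta> \<xi> (Phi n k V \<eta> \<xi>)" if "left_cyclic n k V \<eta> \<xi>" for \<xi>
    unfolding Phi_eq[OF that] by (rule is_Phi_iso_map[OF that])
  have eq: "Phi n k V \<eta> \<xi> = Phi n k V \<eta> \<xi>'" "Psi n k V \<eta> \<xi> = Psi n k V \<eta> \<xi>'"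
    if "left_cyclic n k V \<eta> \<xi>" "left_cyclic n k V \<eta> \<xi>'" for \<xi> \<xi>'
    using Phi_eq[OF that(1)] Phi_eq[OF that(2)] by (simp_all add: Psi_def)
  show ?thesis
  proof (intro conjI allI impI ballI subsetI)
    fix \<xi> assume lc: "left_cyclic n k V \<eta> \<xi>"
    show "Psi n k V \<eta> \<xi> (Phi n k V \<eta> \<xi> b) = b" if "b \<in> carrier (OSz' n k)" for b
      using Psi_restrict(2)[OF lc] OSz'_carrier_subset that by blast
    show "Phi n k V \<eta> \<xi> (Psi n k V \<eta> \<xi> m) = m" if "m \<in> carrier (B_tilde' n V \<eta>)" for m
      using Psi_restrict(3)[OF lc] sub[OF lc] that by blast
    show "is_Phi n k V \<eta> \<xi> (Phi n k V \<eta> \<xi>)" by (rule is_Phi[OF lc])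
    show "A \<in> carrier (OSz_l n k)" if "A \<in> carrier (OSz' n k)" for A using that OSz'_carrier_subset by blast
    show "m \<in> carrier (B_tilde n V \<eta> \<xi>)" if "m \<in> carrier (B_tilde' n V \<eta>)" for m using that sub[OF lc] by blast
    show "restrict (Phi n k V \<eta> \<xi>) (carrier (OSz' n k)) \<in> ring_iso (OSz' n k) (B_tilde' n V \<eta>)"
      by (rule Phi_restrict[OF lc])
    show "restrict (Psi n k V \<eta> \<xi>) (carrier (B_tilde' n V \<eta>)) \<in> ring_iso (B_tilde' n V \<eta>) (OSz' n k)"
      by (rule Psi_restrict(1)[OF lc])
  next
    fix \<xi> \<xi>' assume "left_cyclic n k V \<eta> \<xi> \<and> left_cyclic n k V \<eta> \<xi>'"
    then have lc: "left_cyclic n k V \<eta> \<xi>" "left_cyclic n k V \<eta> \<xi>'" by simp_all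
    show "restrict (Phi n k V \<eta> \<xi>) (carrier (OSz' n k)) = restrict (Phi n k V \<eta> \<xi>') (carrier (OSz' n k))"
      by (simp only: eq(1)[OF lc])
    show "restrict (Psi n k V \<eta> \<xi>) (carrier (B_tilde' n V \<eta>)) = restrict (Psi n k V \<eta> \<xi>') (carrier (B_tilde' n V \<eta>))"
      by (simp only: eq(2)[OF lc])
  qed
qed

end
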